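(* Let $(X,\mathsf d,\mathfrak m)$ be a metric measure space and let $\mathcal V$ be the subspace of $L^\infty(TX)$ made of $C_b(X)$-linear combinations of vector fields in $D(\mathrm{div}^\infty)$. Then for every $f\in\mathrm{BV}(X)$ there exists a unique local vector measure $\mathrm Df$ defined on $\mathcal V$ such that $$\mathrm Df(X)(v)=-\int_Xf\,\mathrm{div}\,v\,\mathrm d\mathfrak m\qquad\text{for every }v\in D(\mathrm{div}^\infty).$$
   Context: **Local vector measures.** A normed $C_b(X)$-module is a normed space $(\mathcal V,\|\cdot\|)$ that is algebraically a module over $C_b(X)$ (bounded continuous functions) with $\|\sum_if_iv_i\|\le\max_i\|f_i\|_\infty\max_i\|v_i\|$ for finitely many $v_i\in\mathcal V$ and $f_i\in C_b(X)$ with pairwise disjoint supports. For $A$ open, $\|v\|_{|A}:=\sup\{\|fv\|:f\in C_b(X),\operatorname{supp}f\subseteq A,\|f\|_\infty\le1\}$. A local vector measure on $\mathcal V$ is a map $\mathsf N$ from the Borel sets of $X$ to the dual $(\mathcal V',\|\cdot\|')$, $\sigma$-additive with respect to norm convergence, with $\mathsf N(A)(v)=0$ whenever $A$ is open and $\|v\|_{|A}=0$. **Metric measure spaces and Sobolev functions.** A metric measure space is a triple $(X,\mathsf d,\mathfrak m)$ with $(X,\mathsf d)$ complete separable and $\mathfrak m$ a nonnegative Borel measure finite on balls with full support. With $\mathrm{lip}(f)(x):=\limsup_{y\to x}|f(y)-f(x)|/\mathsf d(y,x)$ (0 at isolated points), the Cheeger energy of $f\in L^2(\mathfrak m)$ is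 $\mathrm{Ch}(f):=\frac12\inf\{\liminf_k\int\mathrm{lip}(f_k)^2\mathrm d\mathfrak m:f_k\in\mathrm{LIP}_b(X)\cap L^2(\mathfrak m),f_k\to f\text{ in }L^2(\mathfrak m)\}$; $W^{1,2}(X):=\{\mathrm{Ch}<\infty\}$. For $f\in W^{1,2}(X)$, the minimal relaxed slope $|\mathrm df|\in L^2(\mathfrak m)$ satisfies $\mathrm{Ch}(f)=\frac12\int|\mathrm df|^2\mathrm d\mathfrak m$. **(Co)tangent modules** (Gigli). An $L^2$-normed $L^\infty$-module is a Banach space that is a module over $L^\infty(\mathfrak m)$ with a pointwise norm $|\cdot|$ valued in nonnegative $L^2(\mathfrak m)$ functions, $\|v\|=\||v|\|_{L^2}$, $|fv|=|f||v|$. There is a unique couple $(L^2(T^*X),\mathrm d)$ with $L^2(T^*X)$ an $L^2$-normed $L^\infty$-module and $\mathrm d:W^{1,2}(X)\to L^2(T^*X)$ linear such that the pointwise norm of $\mathrm df$ is the minimal relaxed slope and $L^\infty$-linear combinations of differentials are dense. $L^2(TX)$ is its module dual ($L^\infty$-linear continuous maps to $L^1(\mathfrak m)$), $L^0(TX)$ the $L^0$-completion of $L^2(TX)$, and $L^p(TX):=\{v\in L^0(TX):|v|\in L^p(\mathfrak m)\}$. $L^\infty(TX)$ and its subspaces are normed by $\||v|\|_{L^\infty(\mathfrak m)}$, and $\mathcal V$ with this norm is a normed $C_b(X)$-module. **Divergence.** $v\in L^\infty(TX)$ belongs to $D(\mathrm{div}^\infty)$ if there is $g\in L^\infty(\mathfrak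 m)$ with $\int_X\mathrm df(v)\,\mathrm d\mathfrak m=-\int_Xfg\,\mathrm d\mathfrak m$ for every $f\in W^{1,2}(X)$ with bounded support; the unique such $g$ is denoted $\mathrm{div}\,v$. **BV functions.** $f\in L^1(\mathfrak m)$ belongs to $\mathrm{BV}(X)$ if $\inf\{\liminf_k\int_X\mathrm{lip}(f_k)\,\mathrm d\mathfrak m:f_k\in\mathrm{LIP}_{loc}(X)\cap L^1(\mathfrak m),\ f_k\to f\text{ in }L^1(\mathfrak m)\}<\infty$, where $\mathrm{LIP}_{loc}(X)$ is the space of Borel functions that are Lipschitz in a neighbourhood of each point of $X$. *)

theory Defs
  imports "HOL-Analysis.Analysis" "HOL-Probability.Essential_Supremum"
begin

text \<open>
  Elements of \<open>L\<^sup>p(m)\<close> are represented by measurable functions, and equalities or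
  inequalities between them are understood almost everywhere.
\<close>

section \<open>Normed modules over bounded continuous functions, local vector measures\<close>

definition supnorm :: "('a \<Rightarrow> real) \<Rightarrow> real" where
  "supnorm f = (SUP x. \<bar>f x\<bar>)"

definition supp :: "('a::topological_space \<Rightarrow> real) \<Rightarrow> 'a set" where
  "supp f = closure {x. f x \<noteq> 0}"

text \<open>
  The normed space is a linear subspace \<open>V\<close> of an ambient real vector space, with a norm that
  matters only on \<open>V\<close>.  The library constant \<^const>\<open>bcontfun\<close> is the set \<open>C\<^sub>b(X)\<close>.
\<close>

locale normed_Cb_module =
  fixes V :: "'w::real_vector set"
    and nrm :: "'w \<Rightarrow> real"
    and act :: "('a::metric_space \<Rightarrow> real) \<Rightarrow> 'w \<Rightarrow> 'w"
  assumes subspace_V: "subspace V"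
    and nrm_nonneg: "\<And>v. v \<in> V \<Longrightarrow> 0 \<le> nrm v"
    and nrm_eq_0_iff: "\<And>v. v \<in> V \<Longrightarrow> nrm v = 0 \<longleftrightarrow> v = 0"
    and nrm_triangle: "\<And>v w. v \<in> V \<Longrightarrow> w \<in> V \<Longrightarrow> nrm (v + w) \<le> nrm v + nrm w"
    and nrm_scaleR: "\<And>c v. v \<in> V \<Longrightarrow> nrm (c *\<^sub>R v) = \<bar>c\<bar> * nrm v"
    and act_closed: "\<And>f v. f \<in> bcontfun \<Longrightarrow> v \<in> V \<Longrightarrow> act f v \<in> V"
    and act_add_right: "\<And>f v w. f \<in> bcontfun \<Longrightarrow> v \<in> V \<Longrightarrow> w \<in> V \<Longrightarrow>
          act f (v + w) = act f v + act f w"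
    and act_add_left: "\<And>f g v. f \<in> bcontfun \<Longrightarrow> g \<in> bcontfun \<Longrightarrow> v \<in> V \<Longrightarrow>
          act (\<lambda>x. f x + g x) v = act f v + act g v"
    and act_mult: "\<And>f g v. f \<in> bcontfun \<Longrightarrow> g \<in> bcontfun \<Longrightarrow> v \<in> V \<Longrightarrow>
          act (\<lambda>x. f x * g x) v = act f (act g v)"
    and act_const: "\<And>c v. v \<in> V \<Longrightarrow> act (\<lambda>_. c) v = c *\<^sub>R v"
    and nrm_sum_disjoint: "\<And>I (f :: nat \<Rightarrow> 'a \<Rightarrow> real) (v :: nat \<Rightarrow> 'w).
          finite I \<Longrightarrow> I \<noteq> {} \<Longrightarrow> (\<And>i. i \<in> I \<Longrightarrow> f i \<in> bcontfun) \<Longrightarrow>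
          (\<And>i. i \<in> I \<Longrightarrow> v i \<in> V) \<Longrightarrow> disjoint_family_on (\<lambda>i. supp (f i)) I \<Longrightarrow>
          nrm (\<Sum>i\<in>I. act (f i) (v i)) \<le>
            Max ((\<lambda>i. supnorm (f i)) ` I) * Max ((\<lambda>i. nrm (v i)) ` I)"
begin

definition dual_space :: "('w \<Rightarrow> real) set" where
  "dual_space = {L \<in> extensional V.
     (\<forall>v\<in>V. \<forall>w\<in>V. L (v + w) = L v + L w) \<and>
     (\<forall>c. \<forall>v\<in>V. L (c *\<^sub>R v) = c * L v) \<and>
     (\<exists>C. \<forall>v\<in>V. \<bar>L v\<bar> \<le> C * nrm v)}"

definition dual_norm :: "('w \<Rightarrow> real) \<Rightarrow> real" where
  "dual_norm L = (SUP v\<in>{v\<in>V. nrm v \<le> 1}. \<bar>L v\<bar>)"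

definition local_norm :: "'a set \<Rightarrow> 'w \<Rightarrow> real" where
  "local_norm A v = (SUP f\<in>{f\<in>bcontfun. supp f \<subseteq> A \<and> supnorm f \<le> 1}. nrm (act f v))"

end

text \<open>
  Local vector measures are extensional functions of the Borel set and of the vector, so that two
  of them are equal as soon as they agree on Borel sets and on \<open>V\<close>.
\<close>

locale local_vector_measure = normed_Cb_module V nrm act
  for V :: "'w::real_vector set"
    and nrm :: "'w \<Rightarrow> real"
    and act :: "('a::metric_space \<Rightarrow> real) \<Rightarrow> 'w \<Rightarrow> 'w" +
  fixes N :: "'a set \<Rightarrow> 'w \<Rightarrow> real"
  assumes in_dual: "N \<in> sets borel \<rightarrow>\<^sub>E dual_space"
    and sigma_additive: "\<And>A :: nat \<Rightarrow> 'a set.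
          (\<And>i. A i \<in> sets borel) \<Longrightarrow> disjoint_family A \<Longrightarrow>
          (\<lambda>n. dual_norm (\<lambda>v. (\<Sum>i<n. N (A i) v) - N (\<Union>i. A i) v)) \<longlonglongrightarrow> 0"
    and locality: "\<And>A v. open A \<Longrightarrow> v \<in> V \<Longrightarrow> local_norm A v = 0 \<Longrightarrow> N A v = 0"


section \<open>Metric measure spaces and Sobolev functions\<close>

locale metric_measure_space =
  fixes m :: "'a::polish_space measure"
  assumes sets_m: "sets m = sets borel"
    and finite_on_balls: "\<And>x r. emeasure m (ball x r) < \<infinity>"
    and full_support: "\<And>U. open U \<Longrightarrow> U \<noteq> {} \<Longrightarrow> 0 < emeasure m U"

definition L2 :: "'a measure \<Rightarrow> ('a \<Rightarrow> real) set" where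
  "L2 m = {f \<in> borel_measurable m. integrable m (\<lambda>x. (f x)\<^sup>2)}"

definition Linf :: "'a measure \<Rightarrow> ('a \<Rightarrow> real) set" where
  "Linf m = {f \<in> borel_measurable m. \<exists>C. AE x in m. \<bar>f x\<bar> \<le> C}"

definition Linf_norm :: "'a measure \<Rightarrow> ('a \<Rightarrow> real) \<Rightarrow> real" where
  "Linf_norm m f = real_of_ereal (esssup m (\<lambda>x. ereal \<bar>f x\<bar>))"

text \<open>At an isolated point the filter is trivial and the upper limit in \<^typ>\<open>ennreal\<close> is \<open>0\<close>.\<close>

definition lip :: "('a::metric_space \<Rightarrow> real) \<Rightarrow> 'a \<Rightarrow> ennreal" where
  "lip f x = Limsup (at x) (\<lambda>y. ennreal (\<bar>f y - f x\<bar> / dist y x))"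

definition LIPb :: "('a::metric_space \<Rightarrow> real) set" where
  "LIPb = {f. bounded (range f) \<and> (\<exists>L. L-lipschitz_on UNIV f)}"

definition LIPloc :: "('a::metric_space \<Rightarrow> real) set" where
  "LIPloc = {f \<in> borel_measurable borel. \<forall>x. \<exists>r>0. \<exists>L. L-lipschitz_on (ball x r) f}"

definition cheeger_approx ::
    "'a::metric_space measure \<Rightarrow> ('a \<Rightarrow> real) \<Rightarrow> (nat \<Rightarrow> 'a \<Rightarrow> real) \<Rightarrow> bool" where
  "cheeger_approx m f F \<longleftrightarrow>
     (\<forall>k. F k \<in> LIPb \<inter> L2 m) \<and> (\<lambda>k. \<integral>x. (F k x - f x)\<^sup>2 \<partial>m) \<longlonglongrightarrow> 0"

definition Ch :: "'a::metric_space measure \<Rightarrow> ('a \<Rightarrow> real) \<Rightarrow> ennreal" where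
  "Ch m f = (INF F\<in>{F. cheeger_approx m f F}. liminf (\<lambda>k. \<integral>\<^sup>+x. (lip (F k) x)\<^sup>2 \<partial>m)) / 2"

definition W12 :: "'a::metric_space measure \<Rightarrow> ('a \<Rightarrow> real) set" where
  "W12 m = {f \<in> L2 m. Ch m f < \<infinity>}"

text \<open>
  Relaxed slopes in the sense of Ambrosio, Gigli and Savare: functions above weak \<open>L\<^sup>2\<close> limits of
  the local Lipschitz constants of approximating functions.  The minimal one has least \<open>L\<^sup>2\<close> norm.
\<close>

definition relaxed_slope ::
    "'a::metric_space measure \<Rightarrow> ('a \<Rightarrow> real) \<Rightarrow> ('a \<Rightarrow> real) \<Rightarrow> bool" where
  "relaxed_slope m f g \<longleftrightarrow> g \<in> L2 m \<and>
     (\<exists>F G. cheeger_approx m f F \<and> G \<in> L2 m \<and>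
        (\<forall>k. (\<lambda>x. enn2real (lip (F k) x)) \<in> L2 m) \<and>
        (\<forall>h\<in>L2 m. (\<lambda>k. \<integral>x. h x * enn2real (lip (F k) x) \<partial>m) \<longlonglongrightarrow> (\<integral>x. h x * G x \<partial>m)) \<and>
        (AE x in m. G x \<le> g x))"

definition minimal_relaxed_slope ::
    "'a::metric_space measure \<Rightarrow> ('a \<Rightarrow> real) \<Rightarrow> ('a \<Rightarrow> real) \<Rightarrow> bool" where
  "minimal_relaxed_slope m f g \<longleftrightarrow> relaxed_slope m f g \<and>
     (\<forall>h. relaxed_slope m f h \<longrightarrow> (\<integral>x. (g x)\<^sup>2 \<partial>m) \<le> (\<integral>x. (h x)\<^sup>2 \<partial>m))"


section \<open>The cotangent module\<close>

record ('a, 'v) module_ops =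
  scal :: "('a \<Rightarrow> real) \<Rightarrow> 'v \<Rightarrow> 'v"
  pnorm :: "'v \<Rightarrow> 'a \<Rightarrow> real"

text \<open>\<open>pnorm M v\<close> is a representative of the pointwise norm of \<open>v\<close>.\<close>

locale L2_normed_module =
  fixes m :: "'a measure" and M :: "('a, 'v::banach) module_ops"
  assumes scal_cong: "\<And>f g v. f \<in> Linf m \<Longrightarrow> g \<in> Linf m \<Longrightarrow> (AE x in m. f x = g x) \<Longrightarrow>
          scal M f v = scal M g v"
    and scal_add_right: "\<And>f v w. f \<in> Linf m \<Longrightarrow> scal M f (v + w) = scal M f v + scal M f w"
    and scal_add_left: "\<And>f g v. f \<in> Linf m \<Longrightarrow> g \<in> Linf m \<Longrightarrow>
          scal M (\<lambda>x. f x + g x) v = scal M f v + scal M g v"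
    and scal_mult: "\<And>f g v. f \<in> Linf m \<Longrightarrow> g \<in> Linf m \<Longrightarrow>
          scal M (\<lambda>x. f x * g x) v = scal M f (scal M g v)"
    and scal_const: "\<And>c v. scal M (\<lambda>_. c) v = c *\<^sub>R v"
    and pnorm_L2: "\<And>v. pnorm M v \<in> L2 m"
    and pnorm_nonneg: "\<And>v. AE x in m. 0 \<le> pnorm M v x"
    and norm_eq: "\<And>v. norm v = sqrt (\<integral>x. (pnorm M v x)\<^sup>2 \<partial>m)"
    and pnorm_scal: "\<And>f v. f \<in> Linf m \<Longrightarrow> AE x in m. pnorm M (scal M f v) x = \<bar>f x\<bar> * pnorm M v x"

text \<open>
  The pair consisting of the module of \<open>L\<^sup>2\<close> one-forms and the differential is determined by the
  following axioms up to unique isomorphism.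
\<close>

locale cotangent_module = metric_measure_space m + L2_normed_module m C
  for m :: "'a::polish_space measure" and C :: "('a, 'v::banach) module_ops" +
  fixes d :: "('a \<Rightarrow> real) \<Rightarrow> 'v"
  assumes d_linear: "\<And>a b f g. f \<in> W12 m \<Longrightarrow> g \<in> W12 m \<Longrightarrow>
          d (\<lambda>x. a * f x + b * g x) = a *\<^sub>R d f + b *\<^sub>R d g"
    and pnorm_d: "\<And>f. f \<in> W12 m \<Longrightarrow> minimal_relaxed_slope m f (pnorm C (d f))"
    and dense_d: "closure {\<Sum>i<n. scal C (g i) (d (f i)) | (n :: nat) g f.
          \<forall>i<n. g i \<in> Linf m \<and> f i \<in> W12 m} = UNIV"


section \<open>The tangent module and its \<open>L\<^sup>0\<close>-completion\<close>

definition L2TX :: "'a measure \<Rightarrow> ('a, 'v::real_normed_vector) module_ops \<Rightarrow> ('v \<Rightarrow> 'a \<Rightarrow> real) set" where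
  "L2TX m C = {T.
     (\<forall>w. integrable m (T w)) \<and>
     (\<forall>w w'. AE x in m. T (w + w') x = T w x + T w' x) \<and>
     (\<forall>f\<in>Linf m. \<forall>w. AE x in m. T (scal C f w) x = f x * T w x) \<and>
     (\<exists>K. \<forall>w. (\<integral>x. \<bar>T w x\<bar> \<partial>m) \<le> K * norm w)}"

text \<open>The pointwise norm of \<open>T\<close> is the essential supremum of the family of all
  \<open>|T w|\<close> with \<open>|w| \<le> 1\<close>, i.e. its least upper bound in the almost everywhere order.\<close>

definition dual_pnorm ::
    "'a measure \<Rightarrow> ('a, 'v) module_ops \<Rightarrow> ('v \<Rightarrow> 'a \<Rightarrow> real) \<Rightarrow> ('a \<Rightarrow> real) \<Rightarrow> bool" where
  "dual_pnorm m C T g \<longleftrightarrow>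
     (let ub = (\<lambda>h. h \<in> borel_measurable m \<and>
        (\<forall>w. (AE x in m. pnorm C w x \<le> 1) \<longrightarrow> (AE x in m. \<bar>T w x\<bar> \<le> h x)))
      in ub g \<and> (\<forall>h. ub h \<longrightarrow> (AE x in m. g x \<le> h x)))"

text \<open>The topology of \<open>L\<^sup>0(m)\<close> is convergence in measure on sets of finite measure.\<close>

definition L0_size :: "'a measure \<Rightarrow> 'a set \<Rightarrow> ('a \<Rightarrow> real) \<Rightarrow> real" where
  "L0_size m A h = (LINT x:A|m. min 1 \<bar>h x\<bar>)"

definition fin_sets :: "'a measure \<Rightarrow> 'a set set" where
  "fin_sets m = {A \<in> sets m. emeasure m A < \<infinity>}"

definition L0_tendsto :: "'a measure \<Rightarrow> (nat \<Rightarrow> 'a \<Rightarrow> real) \<Rightarrow> ('a \<Rightarrow> real) \<Rightarrow> bool" where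
  "L0_tendsto m F f \<longleftrightarrow> (\<forall>A\<in>fin_sets m. (\<lambda>n. L0_size m A (\<lambda>x. F n x - f x)) \<longlonglongrightarrow> 0)"

definition L0mod_tendsto ::
    "'a measure \<Rightarrow> ('a, 'w::real_vector) module_ops \<Rightarrow> (nat \<Rightarrow> 'w) \<Rightarrow> 'w \<Rightarrow> bool" where
  "L0mod_tendsto m E u v \<longleftrightarrow>
     (\<forall>A\<in>fin_sets m. (\<lambda>n. L0_size m A (pnorm E (u n - v))) \<longlonglongrightarrow> 0)"

definition L0mod_Cauchy ::
    "'a measure \<Rightarrow> ('a, 'w::real_vector) module_ops \<Rightarrow> (nat \<Rightarrow> 'w) \<Rightarrow> bool" where
  "L0mod_Cauchy m E u \<longleftrightarrow> (\<forall>A\<in>fin_sets m. \<forall>e>0. \<exists>n0. \<forall>i\<ge>n0. \<forall>j\<ge>n0.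
     L0_size m A (pnorm E (u i - u j)) < e)"

locale L0_normed_module =
  fixes m :: "'a measure" and E :: "('a, 'w::real_vector) module_ops"
  assumes scal_cong: "\<And>f g v. f \<in> borel_measurable m \<Longrightarrow> g \<in> borel_measurable m \<Longrightarrow>
          (AE x in m. f x = g x) \<Longrightarrow> scal E f v = scal E g v"
    and scal_add_right: "\<And>f v w. f \<in> borel_measurable m \<Longrightarrow>
          scal E f (v + w) = scal E f v + scal E f w"
    and scal_add_left: "\<And>f g v. f \<in> borel_measurable m \<Longrightarrow> g \<in> borel_measurable m \<Longrightarrow>
          scal E (\<lambda>x. f x + g x) v = scal E f v + scal E g v"
    and scal_mult: "\<And>f g v. f \<in> borel_measurable m \<Longrightarrow> g \<in> borel_measurable m \<Longrightarrow>
          scal E (\<lambda>x. f x * g x) v = scal E f (scal E g v)"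
    and scal_const: "\<And>c v. scal E (\<lambda>_. c) v = c *\<^sub>R v"
    and pnorm_measurable: "\<And>v. pnorm E v \<in> borel_measurable m"
    and pnorm_nonneg: "\<And>v. AE x in m. 0 \<le> pnorm E v x"
    and pnorm_definite: "\<And>v. (AE x in m. pnorm E v x = 0) \<Longrightarrow> v = 0"
    and pnorm_triangle: "\<And>v w. AE x in m. pnorm E (v + w) x \<le> pnorm E v x + pnorm E w x"
    and pnorm_scal: "\<And>f v. f \<in> borel_measurable m \<Longrightarrow>
          AE x in m. pnorm E (scal E f v) x = \<bar>f x\<bar> * pnorm E v x"
    and complete: "\<And>u. L0mod_Cauchy m E u \<Longrightarrow> \<exists>v. L0mod_tendsto m E u v"

text \<open>
  \<open>E\<close> together with the embedding \<open>\<iota>\<close> of the tangent module is the \<open>L\<^sup>0\<close>-completion, again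
  determined up to unique isomorphism: \<open>\<iota>\<close> is linear, preserves the pointwise norm and has dense
  image.
\<close>

locale tangent_L0 = cotangent_module m C d + L0: L0_normed_module m E
  for m :: "'a::polish_space measure" and C :: "('a, 'v::banach) module_ops"
    and d :: "('a \<Rightarrow> real) \<Rightarrow> 'v" and E :: "('a, 'w::real_vector) module_ops" +
  fixes \<iota> :: "('v \<Rightarrow> 'a \<Rightarrow> real) \<Rightarrow> 'w"
  assumes \<iota>_add: "\<And>S T. S \<in> L2TX m C \<Longrightarrow> T \<in> L2TX m C \<Longrightarrow>
          \<iota> (\<lambda>w x. S w x + T w x) = \<iota> S + \<iota> T"
    and \<iota>_scal: "\<And>f T. f \<in> Linf m \<Longrightarrow> T \<in> L2TX m C \<Longrightarrow>
          \<iota> (\<lambda>w x. f x * T w x) = scal E f (\<iota> T)"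
    and \<iota>_pnorm: "\<And>T. T \<in> L2TX m C \<Longrightarrow> dual_pnorm m C T (pnorm E (\<iota> T))"
    and \<iota>_dense: "\<And>v. \<exists>T. (\<forall>n. T n \<in> L2TX m C) \<and> L0mod_tendsto m E (\<lambda>n. \<iota> (T n)) v"

text \<open>
  The pairing \<open>w(v)\<close> of a one-form with \<open>v\<close> in the \<open>L\<^sup>0\<close>-completion is the extension by continuity
  of the evaluation \<open>T \<mapsto> T w\<close>; it is unique almost everywhere.
\<close>

definition pairing ::
    "'a measure \<Rightarrow> ('a, 'v::real_normed_vector) module_ops \<Rightarrow> ('a, 'w::real_vector) module_ops \<Rightarrow>
     (('v \<Rightarrow> 'a \<Rightarrow> real) \<Rightarrow> 'w) \<Rightarrow> 'v \<Rightarrow> 'w \<Rightarrow> 'a \<Rightarrow> real" where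
  "pairing m C E \<iota> w v = (SOME g. g \<in> borel_measurable m \<and>
     (\<exists>T. (\<forall>n. T n \<in> L2TX m C) \<and> L0mod_tendsto m E (\<lambda>n. \<iota> (T n)) v \<and>
          L0_tendsto m (\<lambda>n. T n w) g))"

definition LinfTX :: "'a measure \<Rightarrow> ('a, 'w) module_ops \<Rightarrow> 'w set" where
  "LinfTX m E = {v. pnorm E v \<in> Linf m}"

definition LinfTX_norm :: "'a measure \<Rightarrow> ('a, 'w) module_ops \<Rightarrow> 'w \<Rightarrow> real" where
  "LinfTX_norm m E v = Linf_norm m (pnorm E v)"


section \<open>Divergence and functions of bounded variation\<close>

definition is_div where
  "is_div m C d E \<iota> v g \<longleftrightarrow> g \<in> Linf m \<and>
     (\<forall>f\<in>W12 m. (\<exists>B. bounded B \<and> (AE x in m. x \<notin> B \<longrightarrow> f x = 0)) \<longrightarrow>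
        (\<integral>x. pairing m C E \<iota> (d f) v x \<partial>m) = - (\<integral>x. f x * g x \<partial>m))"

definition D_div where
  "D_div m C d E \<iota> = {v \<in> LinfTX m E. \<exists>g. is_div m C d E \<iota> v g}"

definition divergence where
  "divergence m C d E \<iota> v = (SOME g. is_div m C d E \<iota> v g)"

definition test_fields where
  "test_fields m C d E \<iota> = {\<Sum>i<n. scal E (g i) (v i) | (n :: nat) g v.
     \<forall>i<n. g i \<in> bcontfun \<and> v i \<in> D_div m C d E \<iota>}"

definition BV :: "'a::metric_space measure \<Rightarrow> ('a \<Rightarrow> real) set" where
  "BV m = {f. integrable m f \<and>
     (INF F\<in>{F. (\<forall>k. F k \<in> LIPloc \<and> integrable m (F k)) \<and>
                (\<lambda>k. \<integral>x. \<bar>F k x - f x\<bar> \<partial>m) \<longlonglongrightarrow> 0}.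
        liminf (\<lambda>k. \<integral>\<^sup>+x. lip (F k) x \<partial>m)) < \<infinity>}"

end

theory Submission imports Defs begin

text \<open>
  The functional \<open>F v = - \<integral> f div v\<close> is a limit of the functionals \<open>v \<mapsto> \<integral> df\<^sub>k(v)\<close>, where the \<open>f\<^sub>k\<close> are
  Lipschitz functions with bounded support, \<open>f\<^sub>k \<longlonglongrightarrow> f\<close> in \<open>L\<^sup>1\<close> and \<open>\<integral> lip f\<^sub>k \<le> M\<close>. Since divergence fields are
  stable under multiplication with bounded Lipschitz functions, \<open>\<Lambda> s = Sup {F w | |w| \<le> s}\<close> is
  additive on nonnegative Lipschitz functions \<open>s\<close>. Convergence of \<open>F (\<phi>\<^sub>n v)\<close> to \<open>0\<close> for equi-Lipschitz
  \<open>\<phi>\<^sub>n \<longlonglongrightarrow> 0\<close> yields tightness, hence Daniell continuity of \<open>\<Lambda>\<close>, and the outer measure of \<open>\<Lambda>\<close> restricts to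
  a finite Borel measure \<open>\<mu>\<close> with \<open>F w \<le> \<integral> s d\<mu>\<close> whenever \<open>|w| \<le> s\<close>. This estimate extends \<open>F\<close> to \<open>C\<^sub>b\<close>-combinations of
  divergence fields and allows one to localise it to Borel sets by approximating their indicators in
  \<open>L\<^sup>1(\<mu>)\<close> by Lipschitz functions.

  For uniqueness, the difference \<open>P\<close> of two solutions vanishes on \<open>UNIV\<close>. Cutting off at dyadic levels of the distance
  to the complement of an open set and using that the remaining shells are disjoint, locality shows
  that \<open>P\<close> vanishes on open sets, hence on Borel sets, for divergence fields; continuous coefficients are
  increasing limits of Lipschitz ones.
\<close>

section \<open>Bounded Lipschitz functions\<close>

text \<open>Two obstacles shape the proof. The space may fail to be locally compact, so the Riesz
  theorem for compactly supported functions does not apply, and Daniell continuity has to be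
  extracted from tightness. The only source of continuity is the product rule: the divergence of
  \<open>scal E \<phi> v\<close> is bounded by sup |\<phi>| times the bound for the divergence of
  \<open>v\<close> plus Lip(\<phi>) times the bound for \<open>v\<close>. Limits may therefore be
  exchanged only along equi-Lipschitz sequences, which excludes cutoffs that steepen towards an
  indicator. Secondly, the differential is given only through minimal relaxed slopes, which are
  defined by weak limits. Locality, the product estimate and the Leibniz rule are derived from
  pointwise calculus with slopes of Lipschitz functions, after weak limits have been replaced by
  strong ones. Bounded supports matter because a divergence is tested only against Sobolev functions
  with bounded support, while the functions approximating a BV function are merely locally Lipschitz
  and integrable.\<close>

lemma LIPbI:
  fixes f :: "'a::metric_space \<Rightarrow> real"
  assumes "\<And>x. \<bar>f x\<bar> \<le> B" and "\<And>x y. \<bar>f x - f y\<bar> \<le> L * dist x y"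
  shows "f \<in> LIPb"
proof -
  \<comment> \<open>On a one-point space \<open>L\<close> may be negative, whereas
    \<open>lipschitz_on\<close> demands a nonnegative constant.\<close>
  have "\<bar>L\<bar>-lipschitz_on UNIV f"
  proof (rule lipschitz_onI)
    fix x y :: 'a
    have "L * dist x y \<le> \<bar>L\<bar> * dist x y" by (intro mult_right_mono) auto
    with assms(2)[of x y] show "dist (f x) (f y) \<le> \<bar>L\<bar> * dist x y" by (simp add: dist_real_def)
  qed simp
  moreover have "bounded (range f)" using assms(1) by (auto simp: bounded_iff)
  ultimately show ?thesis by (auto simp: LIPb_def)
qed

lemma LIPbE:
  assumes "f \<in> LIPb"
  obtains B L where "0 \<le> B" "0 \<le> L" "\<And>x. \<bar>f x\<bar> \<le> B" "\<And>x y. \<bar>f x - f y\<bar> \<le> L * dist x y"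
proof -
  obtain B where B: "\<And>x. \<bar>f x\<bar> \<le> B" using assms by (auto simp: LIPb_def bounded_iff)
  obtain L where "L-lipschitz_on UNIV f" using assms by (auto simp: LIPb_def)
  then have "0 \<le> L" "\<And>x y. \<bar>f x - f y\<bar> \<le> L * dist x y"
    by (auto simp: lipschitz_on_def dist_real_def)
  with B show ?thesis using that[of B L] abs_ge_zero[of "f undefined"] order_trans by blast
qed

lemma LIPb_const [intro, simp]: "(\<lambda>_. c) \<in> LIPb"
  by (rule LIPbI[of _ "\<bar>c\<bar>" 0]) auto

lemma LIPb_add [intro]:
  assumes "f \<in> LIPb" "g \<in> LIPb" shows "(\<lambda>x. f x + g x) \<in> LIPb"
proof -
  obtain B L where f: "\<And>x. \<bar>f x\<bar> \<le> B" "\<And>x y. \<bar>f x - f y\<bar> \<le> L * dist x y" using assms LIPbE by metis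
  obtain B' L' where g: "\<And>x. \<bar>g x\<bar> \<le> B'" "\<And>x y. \<bar>g x - g y\<bar> \<le> L' * dist x y" using assms LIPbE by metis
  show ?thesis
  proof (rule LIPbI[of _ "B + B'" "L + L'"])
    fix x y show "\<bar>f x + g x\<bar> \<le> B + B'" using f(1)[of x] g(1)[of x] by linarith
    show "\<bar>f x + g x - (f y + g y)\<bar> \<le> (L + L') * dist x y"
      using f(2)[of x y] g(2)[of x y] unfolding distrib_right by linarith
  qed
qed

lemma LIPb_mult [intro]:
  assumes "f \<in> LIPb" "g \<in> LIPb" shows "(\<lambda>x. f x * g x) \<in> LIPb"
proof -
  obtain B L where f: "0 \<le> B" "0 \<le> L" "\<And>x. \<bar>f x\<bar> \<le> B" "\<And>x y. \<bar>f x - f y\<bar> \<le> L * dist x y"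
    using assms LIPbE by metis
  obtain B' L' where g: "0 \<le> B'" "0 \<le> L'" "\<And>x. \<bar>g x\<bar> \<le> B'" "\<And>x y. \<bar>g x - g y\<bar> \<le> L' * dist x y"
    using assms LIPbE by metis
  show ?thesis
  proof (rule LIPbI[of _ "B * B'" "B * L' + B' * L"])
    fix x y show "\<bar>f x * g x\<bar> \<le> B * B'" unfolding abs_mult by (intro mult_mono f g) auto
    have "f x * g x - f y * g y = f x * (g x - g y) + g y * (f x - f y)" by algebra
    then have "\<bar>f x * g x - f y * g y\<bar> \<le> \<bar>f x\<bar> * \<bar>g x - g y\<bar> + \<bar>g y\<bar> * \<bar>f x - f y\<bar>"
      by (metis abs_mult abs_triangle_ineq)
    also have "\<dots> \<le> B * (L' * dist x y) + B' * (L * dist x y)"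
      by (intro add_mono mult_mono f g) auto
    finally show "\<bar>f x * g x - f y * g y\<bar> \<le> (B * L' + B' * L) * dist x y" by (simp add: algebra_simps)
  qed
qed

lemma LIPb_cmult [intro]: "f \<in> LIPb \<Longrightarrow> (\<lambda>x. c * f x) \<in> LIPb"
  by (rule LIPb_mult) auto

lemma LIPb_uminus [intro]: "f \<in> LIPb \<Longrightarrow> (\<lambda>x. - f x) \<in> LIPb"
  using LIPb_cmult[of f "-1"] by simp

lemma LIPb_diff [intro]: "f \<in> LIPb \<Longrightarrow> g \<in> LIPb \<Longrightarrow> (\<lambda>x. f x - g x) \<in> LIPb"
  using LIPb_add[OF _ LIPb_uminus, of f g] by simp

lemma LIPb_abs [intro]:
  assumes "f \<in> LIPb" shows "(\<lambda>x. \<bar>f x\<bar>) \<in> LIPb"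
proof -
  obtain B L where f: "\<And>x. \<bar>f x\<bar> \<le> B" "\<And>x y. \<bar>f x - f y\<bar> \<le> L * dist x y" using assms LIPbE by metis
  show ?thesis
  proof (rule LIPbI)
    show "\<bar>\<bar>f x\<bar>\<bar> \<le> B" for x using f(1)[of x] by simp
    show "\<bar>\<bar>f x\<bar> - \<bar>f y\<bar>\<bar> \<le> L * dist x y" for x y using f(2)[of x y] by linarith
  qed
qed

lemma LIPb_max [intro]:
  assumes "f \<in> LIPb" "g \<in> LIPb" shows "(\<lambda>x. max (f x) (g x)) \<in> LIPb"
proof -
  have *: "(\<lambda>x. max (f x) (g x)) = (\<lambda>x. (1/2) * (f x + g x + \<bar>f x - g x\<bar>))" by (auto simp: fun_eq_iff)
  show ?thesis unfolding * using assms by (intro LIPb_cmult LIPb_add LIPb_abs LIPb_diff)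
qed

lemma LIPb_min [intro]:
  assumes "f \<in> LIPb" "g \<in> LIPb" shows "(\<lambda>x. min (f x) (g x)) \<in> LIPb"
proof -
  have *: "(\<lambda>x. min (f x) (g x)) = (\<lambda>x. (1/2) * (f x + g x - \<bar>f x - g x\<bar>))" by (auto simp: fun_eq_iff)
  show ?thesis unfolding * using assms by (intro LIPb_cmult LIPb_add LIPb_abs LIPb_diff)
qed

lemma LIPb_sum [intro]:
  "(\<And>i. i \<in> I \<Longrightarrow> f i \<in> LIPb) \<Longrightarrow> (\<lambda>x. \<Sum>i\<in>I. f i x) \<in> LIPb"
  by (induction I rule: infinite_finite_induct) auto

text \<open>Serves to split a field by weights such as s / (s + t + \<eta>): the lower bound \<eta>
  keeps the quotients Lipschitz, so that they may multiply divergence fields.\<close>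

lemma LIPb_divide:
  assumes "f \<in> LIPb" "g \<in> LIPb" "0 < \<eta>" "\<And>x. \<eta> \<le> g x"
  shows "(\<lambda>x. f x / g x) \<in> LIPb"
proof -
  obtain B L where g: "0 \<le> L" "\<And>x. \<bar>g x\<bar> \<le> B" "\<And>x y. \<bar>g x - g y\<bar> \<le> L * dist x y"
    using assms LIPbE by metis
  have pos: "0 < g x" for x using assms(3) assms(4)[of x] by linarith
  have "(\<lambda>x. 1 / g x) \<in> LIPb"
  proof (rule LIPbI[of _ "1 / \<eta>" "L / (\<eta> * \<eta>)"])
    fix x y
    show "\<bar>1 / g x\<bar> \<le> 1 / \<eta>" using assms(3) assms(4)[of x] by (simp add: frac_le)
    have "\<bar>1 / g x - 1 / g y\<bar> = \<bar>g x - g y\<bar> / (g x * g y)"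
      using pos[of x] pos[of y] by (simp add: divide_simps abs_mult abs_minus_commute)
    also have "\<dots> \<le> (L * dist x y) / (\<eta> * \<eta>)"
      using assms(3,4) g by (intro frac_le mult_mono) (auto intro: less_imp_le[OF pos])
    finally show "\<bar>1 / g x - 1 / g y\<bar> \<le> L / (\<eta> * \<eta>) * dist x y" by simp
  qed
  from LIPb_mult[OF assms(1) this] show ?thesis by simp
qed

lemma LIPb_continuous: "f \<in> LIPb \<Longrightarrow> continuous_on UNIV f"
  by (auto simp: LIPb_def intro: lipschitz_on_continuous_on)

lemma LIPb_bcontfun: "f \<in> LIPb \<Longrightarrow> f \<in> bcontfun"
  using LIPb_continuous[of f] by (auto simp: bcontfun_def LIPb_def)

lemma LIPb_borel: "f \<in> LIPb \<Longrightarrow> f \<in> borel_measurable borel"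
  by (intro borel_measurable_continuous_onI LIPb_continuous)

text \<open>The distance to the complement is not used directly because \<^const>\<open>infdist\<close> to the empty
  set is \<open>0\<close>.\<close>

lemma open_gauge:
  fixes U :: "'a::metric_space set"
  assumes "open U"
  obtains g where "\<And>x. 0 \<le> g x" "\<And>x. g x \<le> 1" "\<And>x y. \<bar>g x - g y\<bar> \<le> dist x y" "U = {x. 0 < g x}"
proof (cases "U = UNIV")
  case True
  then show ?thesis by (intro that[of "\<lambda>_. 1"]) auto
next
  case False
  then have ne: "- U \<noteq> {}" by auto
  have cl: "closed (- U)" using assms by auto
  show ?thesis
  proof (rule that[of "\<lambda>x. min 1 (infdist x (- U))"])
    fix x y
    show "0 \<le> min 1 (infdist x (- U))" by (simp add: infdist_nonneg)
    show "\<bar>min 1 (infdist x (- U)) - min 1 (infdist y (- U))\<bar> \<le> dist x y"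
      using infdist_triangle_abs[of x "- U" y] by linarith
    have "0 < infdist x (- U) \<longleftrightarrow> x \<in> U" for x
      using in_closed_iff_infdist_zero[OF cl ne, of x] infdist_nonneg[of x "- U"] by auto
    then show "U = {x. 0 < min 1 (infdist x (- U))}" by auto
  qed simp
qed

lemma gauge_LIPb:
  assumes "\<And>x. 0 \<le> g x" "\<And>x. g x \<le> 1" "\<And>x y. \<bar>g x - g y\<bar> \<le> dist x y"
  shows "g \<in> LIPb"
  using assms by (intro LIPbI[of _ 1 1]) auto

text \<open>Lipschitz regularisation by infimal convolution.\<close>

lemma bcontfun_Lipschitz_minorants:
  fixes g :: "'a::metric_space \<Rightarrow> real"
  assumes "g \<in> bcontfun"
  obtains h where "\<And>n. h n \<in> LIPb" "\<And>n x. h n x \<le> g x" "\<And>n x. h n x \<le> h (Suc n) x"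
    "\<And>x. (\<lambda>n. h n x) \<longlonglongrightarrow> g x" "\<And>n x. \<bar>h n x\<bar> \<le> (SUP y. \<bar>g y\<bar>)"
proof -
  define B where "B = (SUP y. \<bar>g y\<bar>)"
  have bdd: "bounded (range g)" and cont: "continuous_on UNIV g" using assms by (auto simp: bcontfun_def)
  then obtain b where b: "\<And>x. \<bar>g x\<bar> \<le> b" by (auto simp: bounded_iff)
  have "bdd_above (range (\<lambda>y. \<bar>g y\<bar>))" using b by (auto intro!: bdd_aboveI)
  then have gB: "\<bar>g x\<bar> \<le> B" for x unfolding B_def by (intro cSUP_upper) auto
  define h where "h n x = (INF y. g y + real n * dist x y)" for n x
  have lower: "- B \<le> g y + real n * dist x y" for n x y
  proof -
    have "0 \<le> real n * dist x y" by simp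
    with gB[of y] show ?thesis by linarith
  qed
  have bb: "bdd_below (range (\<lambda>y. g y + real n * dist x y))" for n x
    using lower by (intro bdd_belowI[of _ "-B"]) auto
  have h_le: "h n x \<le> g y + real n * dist x y" for n x y unfolding h_def by (intro cINF_lower bb) auto
  have h_ge: "(\<And>y. c \<le> g y + real n * dist x y) \<Longrightarrow> c \<le> h n x" for n x c
    unfolding h_def by (rule cINF_greatest) auto
  have hg: "h n x \<le> g x" for n x using h_le[of n x x] by simp
  have hB: "\<bar>h n x\<bar> \<le> B" for n x
  proof -
    have "- B \<le> h n x" by (rule h_ge[OF lower])
    with hg[of n x] gB[of x] show ?thesis by linarith
  qed
  have lip: "h n x - h n y \<le> real n * dist x y" for n x y
  proof -
    have "h n x - real n * dist x y \<le> h n y"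
    proof (rule h_ge)
      fix z
      have "real n * dist x z \<le> real n * (dist x y + dist y z)" by (intro mult_left_mono dist_triangle) auto
      then show "h n x - real n * dist x y \<le> g z + real n * dist y z"
        using h_le[of n x z] by (simp add: distrib_left)
    qed
    then show ?thesis by simp
  qed
  have mem: "h n \<in> LIPb" for n
  proof (rule LIPbI[OF hB])
    show "\<bar>h n x - h n y\<bar> \<le> real n * dist x y" for x y
      using lip[of n x y] lip[of n y x] by (simp add: abs_le_iff dist_commute)
  qed
  have mono: "h n x \<le> h (Suc n) x" for n x
  proof (rule h_ge)
    fix y
    have "real n * dist x y \<le> real (Suc n) * dist x y" by (intro mult_right_mono) auto
    with h_le[of n x y] show "h n x \<le> g y + real (Suc n) * dist x y" by linarith
  qed
  have lim: "(\<lambda>n. h n x) \<longlonglongrightarrow> g x" for x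
  proof (rule LIMSEQ_I)
    fix e :: real assume e: "0 < e"
    obtain d where d: "0 < d" "\<And>y. dist y x < d \<Longrightarrow> dist (g y) (g x) < e/2"
      using cont e unfolding continuous_on_iff by (metis UNIV_I half_gt_zero)
    \<comment> \<open>With this \<open>N\<close> the penalty at distance at least \<open>d\<close>
      is at least \<open>2 * B\<close>, which covers any difference of two values of
      \<open>g\<close>.\<close>
    obtain N :: nat where N: "2 * B / d \<le> real N" using real_arch_simple by blast
    have "g x - e/2 \<le> h n x" if n: "n \<ge> N" for n
    proof (rule h_ge)
      fix y
      show "g x - e/2 \<le> g y + real n * dist x y"
      proof (cases "dist y x < d")
        case True
        then have "\<bar>g y - g x\<bar> < e/2" using d(2) by (simp add: dist_real_def)
        moreover have "0 \<le> real n * dist x y" by simp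
        ultimately show ?thesis by linarith
      next
        case False
        have "2 * B \<le> real N * d" using N d(1) by (simp add: divide_simps)
        also have "\<dots> \<le> real n * dist x y" using n False d(1) by (intro mult_mono) (auto simp: dist_commute)
        finally show ?thesis using gB[of x] gB[of y] e by linarith
      qed
    qed
    then have "norm (h n x - g x) < e" if "n \<ge> N" for n using hg[of n x] that e by fastforce
    then show "\<exists>no. \<forall>n\<ge>no. norm (h n x - g x) < e" by blast
  qed
  show ?thesis using that[of h] mem hg mono lim hB unfolding B_def by blast
qed

section \<open>The local Lipschitz constant\<close>

text \<open>Real-valued form of \<open>lip\<close>, for use under Bochner integrals. An infinite
  \<open>lip\<close> becomes 0 here, which is why rules such as \<open>slope_add\<close> assume
  finiteness.\<close>

definition slope :: "('a::metric_space \<Rightarrow> real) \<Rightarrow> 'a \<Rightarrow> real" where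
  "slope f x = enn2real (lip f x)"

lemma slope_nonneg [simp]: "0 \<le> slope f x"
  by (simp add: slope_def)

text \<open>Clearing the denominators turns the upper limit into inequalities that can be added and
  multiplied; the slope rules rest on this form. At an isolated point both sides hold
  trivially.\<close>

lemma lip_le_iff:
  assumes "0 \<le> c"
  shows "lip f x \<le> ennreal c \<longleftrightarrow> (\<forall>e>0. \<forall>\<^sub>F y in at x. \<bar>f y - f x\<bar> \<le> (c + e) * dist y x)"
proof -
  have *: "(ennreal (\<bar>f y - f x\<bar> / dist y x) < ennreal (c + e)) = (\<bar>f y - f x\<bar> < (c + e) * dist y x)"
    if "y \<noteq> x" "0 < e" for y e
    using that assms by (subst ennreal_less_iff) (auto simp: pos_divide_less_eq)
  show ?thesis
  proof
    assume l: "lip f x \<le> ennreal c"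
    show "\<forall>e>0. \<forall>\<^sub>F y in at x. \<bar>f y - f x\<bar> \<le> (c + e) * dist y x"
    proof (intro allI impI)
      fix e :: real assume e: "0 < e"
      have "ennreal c < ennreal (c + e)" using e assms by (simp add: ennreal_less_iff)
      then have "\<forall>\<^sub>F y in at x. ennreal (\<bar>f y - f x\<bar> / dist y x) < ennreal (c + e)"
        using l unfolding lip_def Limsup_le_iff by blast
      moreover have "\<forall>\<^sub>F y in at x. y \<noteq> x" by (simp add: eventually_at_filter)
      ultimately show "\<forall>\<^sub>F y in at x. \<bar>f y - f x\<bar> \<le> (c + e) * dist y x"
        by eventually_elim (use * e in auto)
    qed
  next
    assume r: "\<forall>e>0. \<forall>\<^sub>F y in at x. \<bar>f y - f x\<bar> \<le> (c + e) * dist y x"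
    show "lip f x \<le> ennreal c"
      unfolding lip_def Limsup_le_iff
    proof (intro allI impI)
      fix z assume z: "ennreal c < z"
      obtain e where e: "0 < e" "ennreal (c + e) < z"
      proof -
        obtain w where w: "ennreal c < w" "w < z" using dense[OF z] by blast
        then obtain w' where w': "w = ennreal w'" "0 \<le> w'" by (cases w) auto
        then have "c < w'" using w(1) assms by (simp add: ennreal_less_iff)
        then show ?thesis using that[of "w' - c"] w w' by simp
      qed
      have "\<forall>\<^sub>F y in at x. y \<noteq> x" by (simp add: eventually_at_filter)
      with r[rule_format, OF e(1)]
      show "\<forall>\<^sub>F y in at x. ennreal (\<bar>f y - f x\<bar> / dist y x) < z"
      proof eventually_elim
        case (elim y)
        have "\<bar>f y - f x\<bar> / dist y x \<le> c + e" using elim by (simp add: pos_divide_le_eq)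
        then have "ennreal (\<bar>f y - f x\<bar> / dist y x) \<le> ennreal (c + e)" by (rule ennreal_leI)
        then show ?case using e(2) by simp
      qed
    qed
  qed
qed

lemma lip_le_Lipschitz_on:
  assumes "L-lipschitz_on (ball x r) f" "0 < r"
  shows "lip f x \<le> ennreal L"
proof -
  have L: "0 \<le> L" using assms(1) by (rule lipschitz_on_nonneg)
  have "\<forall>\<^sub>F y in at x. \<bar>f y - f x\<bar> \<le> (L + e) * dist y x" if "0 < e" for e
  proof -
    have "\<forall>\<^sub>F y in at x. dist y x < r" using assms(2) eventually_at by blast
    then show ?thesis
    proof eventually_elim
      case (elim y)
      have "dist (f y) (f x) \<le> L * dist y x"
        using elim assms by (intro lipschitz_onD[OF assms(1)]) (auto simp: dist_commute)
      moreover have "L * dist y x \<le> (L + e) * dist y x" using that by (intro mult_right_mono) auto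
      ultimately show ?case by (simp add: dist_real_def)
    qed
  qed
  then show ?thesis unfolding lip_le_iff[OF L] by blast
qed

lemma lip_le_Lipschitz:
  assumes "\<And>x y. \<bar>f x - f y\<bar> \<le> L * dist x y" "0 \<le> L"
  shows "lip f x \<le> ennreal L"
  by (rule lip_le_Lipschitz_on[of _ _ 1]) (use assms in \<open>auto simp: lipschitz_on_def dist_real_def\<close>)

lemma LIPb_lip_finite: "f \<in> LIPb \<Longrightarrow> lip f x < \<infinity>"
  by (metis LIPbE lip_le_Lipschitz ennreal_less_top infinity_ennreal_def le_less_trans)

lemma LIPloc_lip_finite:
  assumes "f \<in> LIPloc" shows "lip f x < \<infinity>"
proof -
  obtain r L where "0 < r" "L-lipschitz_on (ball x r) f" using assms unfolding LIPloc_def by blast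
  then show ?thesis
    by (metis lip_le_Lipschitz_on ennreal_less_top infinity_ennreal_def le_less_trans)
qed

lemma LIPloc_continuous:
  assumes "f \<in> LIPloc" shows "continuous_on UNIV f"
proof -
  have "isCont f x" for x
  proof -
    obtain r L where "0 < r" "L-lipschitz_on (ball x r) f" using assms unfolding LIPloc_def by blast
    then show ?thesis
      by (meson centre_in_ball continuous_on_eq_continuous_at lipschitz_on_continuous_on open_ball)
  qed
  then show ?thesis by (simp add: continuous_at_imp_continuous_on)
qed

lemma ennreal_slope: "lip f x < \<infinity> \<Longrightarrow> ennreal (slope f x) = lip f x"
  by (simp add: slope_def)

lemma slope_le_Lipschitz:
  assumes "\<And>x y. \<bar>f x - f y\<bar> \<le> L * dist x y" "0 \<le> L"
  shows "slope f x \<le> L"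
  using lip_le_Lipschitz[of f L x, OF assms] assms(2) by (simp add: slope_def enn2real_leI)

lemma slope_leI:
  assumes "0 \<le> c" "\<And>e. 0 < e \<Longrightarrow> \<forall>\<^sub>F y in at x. \<bar>f y - f x\<bar> \<le> (c + e) * dist y x"
  shows "slope f x \<le> c"
  using assms lip_le_iff[OF assms(1), of f x] by (simp add: slope_def enn2real_leI)

lemma eventually_slope:
  assumes "lip f x < \<infinity>" "0 < e"
  shows "\<forall>\<^sub>F y in at x. \<bar>f y - f x\<bar> \<le> (slope f x + e) * dist y x"
  using lip_le_iff[OF slope_nonneg, of f x f x] ennreal_slope[OF assms(1)] assms(2) by auto

lemma slope_const [simp]: "slope (\<lambda>_. c) x = 0"
  using slope_le_Lipschitz[of "\<lambda>_. c" 0 x] slope_nonneg[of "\<lambda>_. c" x] by simp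

lemma slope_add:
  assumes "lip f x < \<infinity>" "lip g x < \<infinity>"
  shows "slope (\<lambda>y. f y + g y) x \<le> slope f x + slope g x"
proof (rule slope_leI)
  fix e :: real assume "0 < e"
  then have "\<forall>\<^sub>F y in at x. \<bar>f y - f x\<bar> \<le> (slope f x + e/2) * dist y x"
    "\<forall>\<^sub>F y in at x. \<bar>g y - g x\<bar> \<le> (slope g x + e/2) * dist y x"
    using eventually_slope assms by (metis half_gt_zero)+
  then show "\<forall>\<^sub>F y in at x. \<bar>f y + g y - (f x + g x)\<bar> \<le> (slope f x + slope g x + e) * dist y x"
  proof eventually_elim
    case (elim y)
    have "(slope f x + slope g x + e) * dist y x
        = (slope f x + e/2) * dist y x + (slope g x + e/2) * dist y x" by (simp add: algebra_simps)
    with elim show ?case by linarith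
  qed
qed simp

lemma eventually_near:
  assumes "isCont f x" "0 < e" shows "\<forall>\<^sub>F y in at x. \<bar>f y - f x\<bar> \<le> (e::real)"
proof -
  have "\<forall>\<^sub>F y in at x. dist (f y) (f x) < e" using assms unfolding isCont_def tendsto_iff by blast
  then show ?thesis by eventually_elim (simp add: dist_real_def)
qed

lemma slope_mult:
  assumes fin: "lip f x < \<infinity>" "lip g x < \<infinity>" and cont: "isCont f x"
  shows "slope (\<lambda>y. f y * g y) x \<le> \<bar>f x\<bar> * slope g x + \<bar>g x\<bar> * slope f x"
proof (rule slope_leI)
  fix e :: real assume e: "0 < e"
  \<comment> \<open>\<open>K\<close> bounds the factor of \<open>d\<close> in the error once the
    inner \<open>d\<close> is estimated by 1; this dictates the choice of \<open>d\<close>.\<close>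
  define K where "K = \<bar>f x\<bar> + slope g x + 1 + \<bar>g x\<bar>"
  define d where "d = min 1 (e / K)"
  have K: "K \<ge> 1" by (simp add: K_def)
  have d: "0 < d" "d \<le> 1" "d * K \<le> e" using e K by (auto simp: d_def min_def field_simps)
  have "\<forall>\<^sub>F y in at x. \<bar>f y - f x\<bar> \<le> (slope f x + d) * dist y x"
    "\<forall>\<^sub>F y in at x. \<bar>g y - g x\<bar> \<le> (slope g x + d) * dist y x"
    using eventually_slope fin d(1) by auto
  with eventually_near[OF cont d(1)]
  show "\<forall>\<^sub>F y in at x. \<bar>f y * g y - f x * g x\<bar> \<le> (\<bar>f x\<bar> * slope g x + \<bar>g x\<bar> * slope f x + e) * dist y x"
  proof eventually_elim
    case (elim y)
    have "f y * g y - f x * g x = f y * (g y - g x) + g x * (f y - f x)" by algebra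
    then have "\<bar>f y * g y - f x * g x\<bar> \<le> \<bar>f y\<bar> * \<bar>g y - g x\<bar> + \<bar>g x\<bar> * \<bar>f y - f x\<bar>"
      by (metis abs_mult abs_triangle_ineq)
    also have "\<dots> \<le> (\<bar>f x\<bar> + d) * ((slope g x + d) * dist y x) + \<bar>g x\<bar> * ((slope f x + d) * dist y x)"
      using elim d by (intro add_mono mult_mono) auto
    also have "\<dots> = (\<bar>f x\<bar> * slope g x + \<bar>g x\<bar> * slope f x + d * (\<bar>f x\<bar> + slope g x + d + \<bar>g x\<bar>)) * dist y x"
      by (simp add: algebra_simps)
    also have "\<dots> \<le> (\<bar>f x\<bar> * slope g x + \<bar>g x\<bar> * slope f x + e) * dist y x"
    proof (intro mult_right_mono add_left_mono)
      have "d * (\<bar>f x\<bar> + slope g x + d + \<bar>g x\<bar>) \<le> d * K"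
        using d by (intro mult_left_mono) (auto simp: K_def)
      then show "d * (\<bar>f x\<bar> + slope g x + d + \<bar>g x\<bar>) \<le> e" using d(3) by linarith
    qed simp
    finally show ?case .
  qed
qed simp

lemma slope_cmult: "lip f x < \<infinity> \<Longrightarrow> slope (\<lambda>y. c * f y) x \<le> \<bar>c\<bar> * slope f x"
  using slope_mult[of "\<lambda>_. c" x f] LIPb_lip_finite[OF LIPb_const, of c x] by simp

text \<open>The increment is grouped so that the variation of \<theta> multiplies only f - g. When f
  and g approximate the same function this term disappears in the limit, and a genuine convex
  combination of the two slopes remains.\<close>

lemma slope_interpolate:
  assumes fin: "lip f x < \<infinity>" "lip g x < \<infinity>" and chi: "\<And>y. 0 \<le> \<theta> y" "\<And>y. \<theta> y \<le> 1"
    and L: "0 \<le> L" "\<And>y z. \<bar>\<theta> y - \<theta> z\<bar> \<le> L * dist y z"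
  shows "slope (\<lambda>y. \<theta> y * f y + (1 - \<theta> y) * g y) x
    \<le> \<theta> x * slope f x + (1 - \<theta> x) * slope g x + L * \<bar>f x - g x\<bar>"
proof (rule slope_leI)
  show "0 \<le> \<theta> x * slope f x + (1 - \<theta> x) * slope g x + L * \<bar>f x - g x\<bar>"
    using chi L by simp
  fix e :: real assume e: "0 < e"
  define K where "K = slope f x + slope g x + 2"
  define d where "d = min 1 (e / K)"
  have K: "K \<ge> 1" by (simp add: K_def)
  have d: "0 < d" "d \<le> 1" "d * K \<le> e" using e K by (auto simp: d_def min_def field_simps)
  have "isCont \<theta> x"
    using L by (intro continuous_on_interior[of UNIV] lipschitz_on_continuous_on[of L])
      (auto simp: lipschitz_on_def dist_real_def)
  from eventually_near[OF this d(1)] eventually_slope[OF fin(1) d(1)] eventually_slope[OF fin(2) d(1)]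
  show "\<forall>\<^sub>F y in at x. \<bar>\<theta> y * f y + (1 - \<theta> y) * g y - (\<theta> x * f x + (1 - \<theta> x) * g x)\<bar>
    \<le> (\<theta> x * slope f x + (1 - \<theta> x) * slope g x + L * \<bar>f x - g x\<bar> + e) * dist y x"
  proof eventually_elim
    case (elim y)
    define D where "D = dist y x"
    have D: "0 \<le> D" by (simp add: D_def)
    have "\<theta> y * f y + (1 - \<theta> y) * g y - (\<theta> x * f x + (1 - \<theta> x) * g x)
      = \<theta> y * (f y - f x) + (1 - \<theta> y) * (g y - g x) + (\<theta> y - \<theta> x) * (f x - g x)" by algebra
    then have "\<bar>\<theta> y * f y + (1 - \<theta> y) * g y - (\<theta> x * f x + (1 - \<theta> x) * g x)\<bar>
      \<le> \<bar>\<theta> y * (f y - f x)\<bar> + \<bar>(1 - \<theta> y) * (g y - g x)\<bar> + \<bar>(\<theta> y - \<theta> x) * (f x - g x)\<bar>"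
      by linarith
    also have "\<dots> = \<theta> y * \<bar>f y - f x\<bar> + (1 - \<theta> y) * \<bar>g y - g x\<bar> + \<bar>\<theta> y - \<theta> x\<bar> * \<bar>f x - g x\<bar>"
      using chi by (simp add: abs_mult)
    also have "\<dots> \<le> \<theta> y * ((slope f x + d) * D) + (1 - \<theta> y) * ((slope g x + d) * D) + (L * D) * \<bar>f x - g x\<bar>"
      unfolding D_def using elim chi L(2)[of y x] by (intro add_mono mult_left_mono mult_right_mono) auto
    also have "\<dots> = (\<theta> y * slope f x + (1 - \<theta> y) * slope g x + d + L * \<bar>f x - g x\<bar>) * D"
      by (simp add: algebra_simps)
    also have "\<dots> \<le> ((\<theta> x + d) * slope f x + (1 - \<theta> x + d) * slope g x + d + L * \<bar>f x - g x\<bar>) * D"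
    proof (intro mult_right_mono add_mono D order_refl)
      show "\<theta> y \<le> \<theta> x + d" "1 - \<theta> y \<le> 1 - \<theta> x + d" using elim(1) by linarith+
    qed simp_all
    also have "\<dots> = (\<theta> x * slope f x + (1 - \<theta> x) * slope g x + L * \<bar>f x - g x\<bar> + d * (slope f x + slope g x + 1)) * D"
      by (simp add: algebra_simps)
    also have "\<dots> \<le> (\<theta> x * slope f x + (1 - \<theta> x) * slope g x + L * \<bar>f x - g x\<bar> + e) * D"
    proof (intro mult_right_mono add_left_mono D)
      have "d * (slope f x + slope g x + 1) \<le> d * K"
        using d by (intro mult_left_mono) (auto simp: K_def)
      then show "d * (slope f x + slope g x + 1) \<le> e" using d(3) by linarith
    qed
    finally show ?case unfolding D_def .
  qed
qed

text \<open>For a fixed radius the supremum over the punctured ball has open superlevel sets: each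
  \<open>y\<close> contributes an open set of points \<open>x\<close>, and arbitrary unions of open
  sets are open. Countably many radii suffice for the upper limit.\<close>

lemma lip_borel_measurable:
  assumes "continuous_on UNIV f" shows "lip f \<in> borel_measurable borel"
proof -
  define q where "q y x = ennreal (\<bar>f y - f x\<bar> / dist y x)" for y x
  define h where "h n x = (SUP y\<in>ball x (1 / real (Suc n)) - {x}. q y x)" for n x
  have eq: "lip f x = (INF n. h n x)" for x
    unfolding lip_def Limsup_at q_def[symmetric]
  proof (rule INF_eq)
    fix e :: real assume "e \<in> {0<..}"
    then obtain n where "inverse (real (Suc n)) < e" using reals_Archimedean by auto
    then have "ball x (1 / real (Suc n)) \<subseteq> ball x e" by (intro subset_ball) (simp add: field_simps)
    then show "\<exists>n\<in>UNIV. h n x \<le> (SUP y\<in>ball x e - {x}. q y x)"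
      unfolding h_def by (intro bexI[of _ n] SUP_subset_mono) auto
  next
    fix n :: nat
    show "\<exists>e\<in>{0<..}. (SUP y\<in>ball x e - {x}. q y x) \<le> h n x"
      unfolding h_def by (intro bexI[of _ "1 / real (Suc n)"]) auto
  qed
  have "h n \<in> borel_measurable borel" for n
  proof (rule borel_measurableI_greater)
    fix c :: ennreal
    have "{x. c < h n x} = (\<Union>y. {x. x \<in> ball y (1 / real (Suc n)) - {y} \<and> c < q y x})"
      unfolding h_def less_SUP_iff by (auto simp: dist_commute)
    moreover have "open {x. x \<in> ball y (1 / real (Suc n)) - {y} \<and> c < q y x}" for y
    proof -
      have "continuous_on (ball y (1 / real (Suc n)) - {y}) (q y)"
        unfolding q_def
        by (intro continuous_on_ennreal continuous_intros continuous_on_subset[OF assms]) auto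
      then have "open ((ball y (1 / real (Suc n)) - {y}) \<inter> q y -` {c<..})"
        by (intro continuous_open_preimage) auto
      moreover have "(ball y (1 / real (Suc n)) - {y}) \<inter> q y -` {c<..}
          = {x. x \<in> ball y (1 / real (Suc n)) - {y} \<and> c < q y x}" by auto
      ultimately show ?thesis by simp
    qed
    ultimately have "open {x. c < h n x}" by (auto intro!: open_UN)
    then show "{x \<in> space borel. c < h n x} \<in> sets borel" by simp
  qed
  then have "(\<lambda>x. INF n. h n x) \<in> borel_measurable borel" by (intro borel_measurable_INF) auto
  then show ?thesis using eq by (simp add: fun_eq_iff[symmetric] cong: measurable_cong)
qed

lemma slope_borel: "f \<in> LIPb \<Longrightarrow> slope f \<in> borel_measurable borel"
  using borel_measurable_enn2real[OF lip_borel_measurable[OF LIPb_continuous]]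
  by (simp add: slope_def[abs_def])

section \<open>Asymptotically totally bounded sequences\<close>

text \<open>The net \<open>P j\<close> has to catch only the terms from index \<open>j\<close> on.
  Adding the finitely many earlier terms turns it into a net of the whole range, which is thus
  totally bounded.\<close>

lemma convergent_subseq_of_finite_nets:
  fixes x :: "nat \<Rightarrow> 'a::complete_space"
  assumes fin: "\<And>j. finite (P j)"
    and near: "\<And>j i. j \<le> i \<Longrightarrow> \<exists>p\<in>P j. dist (x i) p < r j" and r: "r \<longlonglongrightarrow> (0::real)"
  obtains l s where "strict_mono (s :: nat \<Rightarrow> nat)" "(x \<circ> s) \<longlonglongrightarrow> l"
proof -
  have "compact (closure (range x))"
    unfolding compact_eq_totally_bounded
  proof (intro conjI allI impI)
    show "complete (closure (range x))" by (simp add: complete_eq_closed)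
    fix e :: real assume e: "0 < e"
    have "\<forall>\<^sub>F j in sequentially. r j < e/2" using order_tendstoD(2)[OF r, of "e/2"] e by simp
    then obtain j where j: "r j < e/2" using eventually_happens'[OF sequentially_bot] by blast
    let ?k = "P j \<union> x ` {..<j}"
    show "\<exists>k. finite k \<and> closure (range x) \<subseteq> (\<Union>x\<in>k. ball x e)"
    proof (intro exI[of _ ?k] conjI subsetI)
      show "finite ?k" using fin by auto
      fix y assume "y \<in> closure (range x)"
      then obtain i where i: "dist (x i) y < e/2" using e unfolding closure_approachable by (metis half_gt_zero rangeE)
      show "y \<in> (\<Union>x\<in>?k. ball x e)"
      proof (cases "j \<le> i")
        case True
        then obtain p where "p \<in> P j" "dist (x i) p < e/2" using near j by (meson order_less_trans)
        moreover have "dist p y \<le> dist (x i) p + dist (x i) y" by (rule dist_triangle3)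
        ultimately show ?thesis using i by (auto intro!: bexI[of _ p])
      next
        case False
        then have "x i \<in> ?k" by auto
        moreover have "y \<in> ball (x i) e" using i e by simp
        ultimately show ?thesis by (rule UN_I)
      qed
    qed
  qed
  then have "seq_compact (closure (range x))" by (simp add: compact_eq_seq_compact_metric)
  moreover have "x n \<in> closure (range x)" for n by (rule subsetD[OF closure_subset]) simp
  ultimately obtain l s where "strict_mono s" "(x \<circ> s) \<longlonglongrightarrow> l" by (metis seq_compactE)
  then show ?thesis by (rule that)
qed

section \<open>Square integrable functions\<close>

lemma L2_measurable: "f \<in> L2 m \<Longrightarrow> f \<in> borel_measurable m"
  and L2_integrable_square: "f \<in> L2 m \<Longrightarrow> integrable m (\<lambda>x. (f x)\<^sup>2)"
  by (auto simp: L2_def)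

lemma L2_dominated:
  assumes "f \<in> L2 m" "g \<in> borel_measurable m" "AE x in m. \<bar>g x\<bar> \<le> f x"
  shows "g \<in> L2 m" "(\<integral>x. (g x)\<^sup>2 \<partial>m) \<le> (\<integral>x. (f x)\<^sup>2 \<partial>m)"
proof -
  have le: "AE x in m. (g x)\<^sup>2 \<le> (f x)\<^sup>2"
    using assms(3) by eventually_elim (metis abs_ge_zero power2_abs power_mono)
  have int: "integrable m (\<lambda>x. (g x)\<^sup>2)"
    using assms le by (intro Bochner_Integration.integrable_bound[OF L2_integrable_square[OF assms(1)]]) auto
  then show "g \<in> L2 m" using assms by (simp add: L2_def)
  show "(\<integral>x. (g x)\<^sup>2 \<partial>m) \<le> (\<integral>x. (f x)\<^sup>2 \<partial>m)"
    using int L2_integrable_square[OF assms(1)] le by (intro integral_mono_AE)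
qed

lemma L2_cmult [intro]: "f \<in> L2 m \<Longrightarrow> (\<lambda>x. c * f x) \<in> L2 m"
  by (auto simp: L2_def power_mult_distrib)

lemma L2_add [intro]:
  assumes "f \<in> L2 m" "g \<in> L2 m" shows "(\<lambda>x. f x + g x) \<in> L2 m"
proof -
  have "integrable m (\<lambda>x. (f x + g x)\<^sup>2)"
  proof (rule Bochner_Integration.integrable_bound)
    show "integrable m (\<lambda>x. 2 * (f x)\<^sup>2 + 2 * (g x)\<^sup>2)"
      using assms by (intro Bochner_Integration.integrable_add integrable_mult_right L2_integrable_square)
    have "(f x + g x)\<^sup>2 \<le> 2 * (f x)\<^sup>2 + 2 * (g x)\<^sup>2" for x
      using zero_le_power2[of "f x - g x"] by (simp add: power2_sum power2_diff)
    then show "AE x in m. norm ((f x + g x)\<^sup>2) \<le> norm (2 * (f x)\<^sup>2 + 2 * (g x)\<^sup>2)" by auto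
  qed (use assms in \<open>auto simp: L2_def\<close>)
  then show ?thesis using assms by (auto simp: L2_def)
qed

lemma L2_diff [intro]: "f \<in> L2 m \<Longrightarrow> g \<in> L2 m \<Longrightarrow> (\<lambda>x. f x - g x) \<in> L2 m"
  using L2_add[of f m "\<lambda>x. -1 * g x"] L2_cmult[of g m "-1"] by simp

lemma L2_abs [intro]: "f \<in> L2 m \<Longrightarrow> (\<lambda>x. \<bar>f x\<bar>) \<in> L2 m"
  by (auto simp: L2_def)

lemma L2_bounded_mult:
  assumes "f \<in> L2 m" "g \<in> borel_measurable m" "\<And>x. \<bar>g x\<bar> \<le> B"
  shows "(\<lambda>x. g x * f x) \<in> L2 m"
proof (rule L2_dominated(1)[of "\<lambda>x. \<bar>B\<bar> * \<bar>f x\<bar>"])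
  show "AE x in m. \<bar>g x * f x\<bar> \<le> \<bar>B\<bar> * \<bar>f x\<bar>"
    unfolding abs_mult using order_trans[OF assms(3) abs_ge_self[of B]]
    by (intro always_eventually allI mult_right_mono) auto
qed (use assms L2_cmult[OF L2_abs[OF assms(1)]] in \<open>auto dest: L2_measurable\<close>)

lemma L2_mult_integrable:
  assumes "f \<in> L2 m" "g \<in> L2 m" shows "integrable m (\<lambda>x. f x * g x)"
proof -
  have "(\<lambda>x. f x * g x) = (\<lambda>x. (1/2) * ((f x + g x)\<^sup>2 - (f x)\<^sup>2 - (g x)\<^sup>2))"
    by (auto simp: fun_eq_iff power2_sum)
  then show ?thesis
    using L2_integrable_square[OF L2_add[OF assms]] L2_integrable_square[OF assms(1)]
      L2_integrable_square[OF assms(2)] by auto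
qed

lemma L2_integral_square_add:
  assumes "f \<in> L2 m" "g \<in> L2 m"
  shows "(\<integral>x. (a * f x + b * g x)\<^sup>2 \<partial>m) = a\<^sup>2 * (\<integral>x. (f x)\<^sup>2 \<partial>m) + 2 * a * b * (\<integral>x. f x * g x \<partial>m) + b\<^sup>2 * (\<integral>x. (g x)\<^sup>2 \<partial>m)"
proof -
  have "(\<integral>x. (a * f x + b * g x)\<^sup>2 \<partial>m) = (\<integral>x. a\<^sup>2 * (f x)\<^sup>2 + 2 * a * b * (f x * g x) + b\<^sup>2 * (g x)\<^sup>2 \<partial>m)"
    by (intro Bochner_Integration.integral_cong) (auto simp: power2_sum power_mult_distrib)
  also have "\<dots> = a\<^sup>2 * (\<integral>x. (f x)\<^sup>2 \<partial>m) + 2 * a * b * (\<integral>x. f x * g x \<partial>m) + b\<^sup>2 * (\<integral>x. (g x)\<^sup>2 \<partial>m)"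
    using L2_integrable_square[OF assms(1)] L2_integrable_square[OF assms(2)] L2_mult_integrable[OF assms]
    by simp
  finally show ?thesis .
qed

lemma L2_square_add_le:
  assumes "f \<in> L2 m" "g \<in> L2 m"
  shows "(\<integral>x. (f x + g x)\<^sup>2 \<partial>m) \<le> 2 * (\<integral>x. (f x)\<^sup>2 \<partial>m) + 2 * (\<integral>x. (g x)\<^sup>2 \<partial>m)"
proof -
  have "0 \<le> 1\<^sup>2 * (\<integral>x. (f x)\<^sup>2 \<partial>m) + 2 * 1 * (-1) * (\<integral>x. f x * g x \<partial>m) + (-1)\<^sup>2 * (\<integral>x. (g x)\<^sup>2 \<partial>m)"
    unfolding L2_integral_square_add[OF assms, symmetric] by simp
  then show ?thesis
    using L2_integral_square_add[OF assms, of 1 1] by simp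
qed

lemma L2_square_convex:
  assumes "f \<in> L2 m" "g \<in> L2 m" "0 \<le> t" "t \<le> 1"
  shows "(\<integral>x. ((1 - t) * f x + t * g x)\<^sup>2 \<partial>m) \<le> (1 - t) * (\<integral>x. (f x)\<^sup>2 \<partial>m) + t * (\<integral>x. (g x)\<^sup>2 \<partial>m)"
proof -
  have "(\<integral>x. ((1 - t) * f x + t * g x)\<^sup>2 \<partial>m) \<le> (\<integral>x. (1 - t) * (f x)\<^sup>2 + t * (g x)\<^sup>2 \<partial>m)"
  proof (rule integral_mono)
    show "integrable m (\<lambda>x. ((1 - t) * f x + t * g x)\<^sup>2)"
      by (intro L2_integrable_square L2_add L2_cmult assms)
    show "integrable m (\<lambda>x. (1 - t) * (f x)\<^sup>2 + t * (g x)\<^sup>2)"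
      using assms by (intro Bochner_Integration.integrable_add integrable_mult_right L2_integrable_square)
    fix x
    have "(1 - t) * (f x)\<^sup>2 + t * (g x)\<^sup>2 - ((1 - t) * f x + t * g x)\<^sup>2 = t * (1 - t) * (f x - g x)\<^sup>2"
      by algebra
    moreover have "0 \<le> t * (1 - t) * (f x - g x)\<^sup>2" using assms by simp
    ultimately show "((1 - t) * f x + t * g x)\<^sup>2 \<le> (1 - t) * (f x)\<^sup>2 + t * (g x)\<^sup>2" by linarith
  qed
  then show ?thesis using assms by (simp add: L2_integrable_square)
qed

lemma L2_Cauchy_Schwarz:
  assumes "f \<in> L2 m" "g \<in> L2 m"
  shows "(\<integral>x. f x * g x \<partial>m)\<^sup>2 \<le> (\<integral>x. (f x)\<^sup>2 \<partial>m) * (\<integral>x. (g x)\<^sup>2 \<partial>m)"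
proof -
  define A where "A = (\<integral>x. (f x)\<^sup>2 \<partial>m)"
  define B where "B = (\<integral>x. f x * g x \<partial>m)"
  define C where "C = (\<integral>x. (g x)\<^sup>2 \<partial>m)"
  have pos: "0 \<le> A + 2 * t * B + t\<^sup>2 * C" for t
  proof -
    have "0 \<le> 1\<^sup>2 * A + 2 * 1 * t * B + t\<^sup>2 * C"
      unfolding A_def B_def C_def L2_integral_square_add[OF assms, symmetric] by simp
    then show ?thesis by simp
  qed
  have C0: "0 \<le> C" and A0: "0 \<le> A" by (simp_all add: A_def C_def)
  have "B\<^sup>2 \<le> A * C"
  proof (cases "C = 0")
    case True
    have "B = 0"
    proof (rule ccontr)
      assume "B \<noteq> 0"
      \<comment> \<open>With \<open>C = 0\<close> the polynomial is affine in \<open>t\<close>, and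
        this \<open>t\<close> would give it the value -1. For \<open>C > 0\<close> below, its
        minimiser -B / C is inserted.\<close>
      then have "0 \<le> A + 2 * (-(A + 1) / (2 * B)) * B" using pos[of "-(A + 1) / (2 * B)"] True by simp
      moreover have "2 * (-(A + 1) / (2 * B)) * B = - (A + 1)" using \<open>B \<noteq> 0\<close> by simp
      ultimately show False using A0 by linarith
    qed
    then show ?thesis using True by simp
  next
    case False
    then have "0 < C" using C0 by simp
    moreover have "0 \<le> C * (A + 2 * (-B / C) * B + (-B / C)\<^sup>2 * C)" using pos[of "-B / C"] C0 by simp
    moreover have "C * (A + 2 * (-B / C) * B + (-B / C)\<^sup>2 * C) = A * C - B\<^sup>2"
      using False by (simp add: field_simps power2_eq_square)
    ultimately show ?thesis by simp
  qed
  then show ?thesis by (simp add: A_def B_def C_def)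
qed

lemma L2_inner_tendsto:
  assumes "\<And>n. s n \<in> L2 m" "G \<in> L2 m" "h \<in> L2 m" "(\<lambda>n. \<integral>x. (s n x - G x)\<^sup>2 \<partial>m) \<longlonglongrightarrow> 0"
  shows "(\<lambda>n. \<integral>x. h x * s n x \<partial>m) \<longlonglongrightarrow> (\<integral>x. h x * G x \<partial>m)"
proof -
  have "(\<lambda>n. \<integral>x. h x * (s n x - G x) \<partial>m) \<longlonglongrightarrow> 0"
  proof (rule Lim_null_comparison)
    show "\<forall>\<^sub>F n in sequentially. norm (\<integral>x. h x * (s n x - G x) \<partial>m)
        \<le> sqrt ((\<integral>x. (h x)\<^sup>2 \<partial>m) * (\<integral>x. (s n x - G x)\<^sup>2 \<partial>m))"
      using L2_Cauchy_Schwarz[OF assms(3) L2_diff[OF assms(1,2)]]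
      by (intro always_eventually allI) (simp add: real_le_rsqrt)
    show "(\<lambda>n. sqrt ((\<integral>x. (h x)\<^sup>2 \<partial>m) * (\<integral>x. (s n x - G x)\<^sup>2 \<partial>m))) \<longlonglongrightarrow> 0"
      using tendsto_real_sqrt[OF tendsto_mult_left[OF assms(4), of "\<integral>x. (h x)\<^sup>2 \<partial>m"]] by simp
  qed
  moreover have "(\<integral>x. h x * (s n x - G x) \<partial>m) = (\<integral>x. h x * s n x \<partial>m) - (\<integral>x. h x * G x \<partial>m)" for n
    using L2_mult_integrable[OF assms(3) assms(1)] L2_mult_integrable[OF assms(3) assms(2)]
    by (simp add: right_diff_distrib)
  ultimately show ?thesis by (simp add: LIM_zero_iff)
qed

lemma L2_square_tendsto:
  assumes "\<And>n. s n \<in> L2 m" "G \<in> L2 m" "(\<lambda>n. \<integral>x. (s n x - G x)\<^sup>2 \<partial>m) \<longlonglongrightarrow> 0"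
  shows "(\<lambda>n. \<integral>x. (s n x)\<^sup>2 \<partial>m) \<longlonglongrightarrow> (\<integral>x. (G x)\<^sup>2 \<partial>m)"
proof -
  have "(\<integral>x. (s n x)\<^sup>2 \<partial>m) = (\<integral>x. (s n x - G x)\<^sup>2 \<partial>m) + 2 * (\<integral>x. G x * s n x \<partial>m) - (\<integral>x. (G x)\<^sup>2 \<partial>m)" for n
    using L2_integral_square_add[OF assms(1)[of n] assms(2), of 1 "-1"] by (simp add: mult.commute)
  moreover have "(\<lambda>n. (\<integral>x. (s n x - G x)\<^sup>2 \<partial>m) + 2 * (\<integral>x. G x * s n x \<partial>m) - (\<integral>x. (G x)\<^sup>2 \<partial>m))
      \<longlonglongrightarrow> 0 + 2 * (\<integral>x. G x * G x \<partial>m) - (\<integral>x. (G x)\<^sup>2 \<partial>m)"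
    by (intro tendsto_intros L2_inner_tendsto assms)
  ultimately show ?thesis by (simp add: power2_eq_square)
qed

context sigma_finite_measure
begin

text \<open>Reduction to the L1 case: sigma-finiteness supplies a strictly positive weight
  \<open>w\<close> that lies in L1 and L2. By Cauchy-Schwarz the weighted sequence is Cauchy in L1,
  so a subsequence converges almost everywhere, and Fatou's lemma upgrades this to L2 convergence of
  the whole sequence.\<close>

lemma L2_complete:
  assumes s: "\<And>n. s n \<in> L2 M"
    and Cauchy: "\<And>e. 0 < e \<Longrightarrow> \<exists>N. \<forall>i\<ge>N. \<forall>j\<ge>N. (\<integral>x. (s i x - s j x)\<^sup>2 \<partial>M) < e"
  obtains G where "G \<in> L2 M" "(\<lambda>n. \<integral>x. (s n x - G x)\<^sup>2 \<partial>M) \<longlonglongrightarrow> 0"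
proof -
  obtain w :: "'a \<Rightarrow> real" where w: "w \<in> borel_measurable M" "\<And>x. 0 < w x" "\<And>x. w x \<le> 1" "integrable M w"
    using obtain_positive_integrable_function by metis
  have [measurable]: "s n \<in> borel_measurable M" for n using s L2_measurable by blast
  have w2: "w \<in> L2 M"
    unfolding L2_def
  proof (intro CollectI conjI w Bochner_Integration.integrable_bound[OF w(4)])
    have "(w x)\<^sup>2 \<le> w x" for x
      using w(2)[of x] w(3)[of x] by (simp add: power2_eq_square mult_left_le less_imp_le)
    then show "AE x in M. norm ((w x)\<^sup>2) \<le> norm (w x)" using w(2) by (simp add: less_imp_le)
  qed (use w in measurable)
  define W where "W = (\<integral>x. (w x)\<^sup>2 \<partial>M)"
  obtain r where r: "strict_mono r" "AE x in M. Cauchy (\<lambda>i. w x * s (r i) x)"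
  proof (rule cauchy_L1_AE_cauchy_subseq[of M "\<lambda>n x. w x * s n x"])
    show "integrable M (\<lambda>x. w x * s n x)" for n by (rule L2_mult_integrable[OF w2 s])
    fix e :: real assume e: "0 < e"
    obtain N where N: "\<forall>i\<ge>N. \<forall>j\<ge>N. (\<integral>x. (s i x - s j x)\<^sup>2 \<partial>M) < e\<^sup>2 / (W + 1)"
      using Cauchy[of "e\<^sup>2 / (W + 1)"] e by (auto simp: W_def add_nonneg_pos)
    have "(LINT x|M. norm (w x * s i x - w x * s j x)) < e" if "i \<ge> N" "j \<ge> N" for i j
    proof -
      have W: "0 \<le> W" by (simp add: W_def)
      have "(LINT x|M. norm (w x * s i x - w x * s j x)) = (LINT x|M. w x * \<bar>s i x - s j x\<bar>)"
        by (intro Bochner_Integration.integral_cong)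
          (auto simp: abs_mult right_diff_distrib[symmetric] less_imp_le[OF w(2)])
      moreover have "(LINT x|M. w x * \<bar>s i x - s j x\<bar>)\<^sup>2 \<le> W * (\<integral>x. (s i x - s j x)\<^sup>2 \<partial>M)"
        using L2_Cauchy_Schwarz[OF w2 L2_abs[OF L2_diff[OF s s]], of i j] by (simp add: W_def)
      moreover have "W * (\<integral>x. (s i x - s j x)\<^sup>2 \<partial>M) \<le> (W + 1) * (\<integral>x. (s i x - s j x)\<^sup>2 \<partial>M)"
        by (intro mult_right_mono) auto
      moreover have "(W + 1) * (\<integral>x. (s i x - s j x)\<^sup>2 \<partial>M) < e\<^sup>2"
        using N that W by (simp add: pos_less_divide_eq mult.commute)
      ultimately have "(LINT x|M. norm (w x * s i x - w x * s j x))\<^sup>2 < e\<^sup>2" by simp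
      then show ?thesis using e by (simp add: power_less_imp_less_base)
    qed
    then show "\<exists>N. \<forall>i\<ge>N. \<forall>j\<ge>N. (LINT x|M. norm (w x * s i x - w x * s j x)) < e" by blast
  qed
  define G where "G x = lim (\<lambda>i. s (r i) x)" for x
  have [measurable]: "G \<in> borel_measurable M" unfolding G_def by measurable
  have conv: "AE x in M. (\<lambda>i. s (r i) x) \<longlonglongrightarrow> G x"
    using r(2)
  proof eventually_elim
    case (elim x)
    have "convergent (\<lambda>i. w x * s (r i) x)" using elim by (simp add: Cauchy_convergent_iff)
    then have "convergent (\<lambda>i. (1 / w x) * (w x * s (r i) x))" by (rule convergent_mult[OF convergent_const])
    moreover have "(\<lambda>i. (1 / w x) * (w x * s (r i) x)) = (\<lambda>i. s (r i) x)" using w(2)[of x] by (auto simp: fun_eq_iff)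
    ultimately have "convergent (\<lambda>i. s (r i) x)" by metis
    then show ?case by (simp add: G_def convergent_LIMSEQ_iff)
  qed
  have Fatou: "(\<integral>\<^sup>+x. ennreal ((s n x - G x)\<^sup>2) \<partial>M) \<le> ennreal e"
    if N: "\<forall>i\<ge>N. \<forall>j\<ge>N. (\<integral>x. (s i x - s j x)\<^sup>2 \<partial>M) < e" and n: "N \<le> n" for n N e
  proof -
    have "(\<integral>\<^sup>+x. ennreal ((s n x - G x)\<^sup>2) \<partial>M) = (\<integral>\<^sup>+x. liminf (\<lambda>i. ennreal ((s n x - s (r i) x)\<^sup>2)) \<partial>M)"
    proof (intro nn_integral_cong_AE)
      show "AE x in M. ennreal ((s n x - G x)\<^sup>2) = liminf (\<lambda>i. ennreal ((s n x - s (r i) x)\<^sup>2))"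
        using conv
      proof eventually_elim
        case (elim x)
        have "(\<lambda>i. ennreal ((s n x - s (r i) x)\<^sup>2)) \<longlonglongrightarrow> ennreal ((s n x - G x)\<^sup>2)"
          by (intro tendsto_intros elim tendsto_ennrealI)
        then show ?case by (rule lim_imp_Liminf[symmetric, rotated]) simp
      qed
    qed
    also have "\<dots> \<le> liminf (\<lambda>i. \<integral>\<^sup>+x. ennreal ((s n x - s (r i) x)\<^sup>2) \<partial>M)"
      by (intro nn_integral_liminf) measurable
    also have "\<dots> \<le> ennreal e"
    proof (rule Liminf_le)
      have "\<forall>\<^sub>F i in sequentially. r i \<ge> N"
        using r(1) filterlim_subseq unfolding filterlim_at_top by blast
      then show "\<forall>\<^sub>F i in sequentially. (\<integral>\<^sup>+x. ennreal ((s n x - s (r i) x)\<^sup>2) \<partial>M) \<le> ennreal e"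
      proof eventually_elim
        case (elim i)
        have "(\<integral>\<^sup>+x. ennreal ((s n x - s (r i) x)\<^sup>2) \<partial>M) = ennreal (\<integral>x. (s n x - s (r i) x)\<^sup>2 \<partial>M)"
          by (intro nn_integral_eq_integral L2_integrable_square L2_diff s) auto
        then show ?case using N n elim by (simp add: ennreal_leI less_imp_le)
      qed
    qed simp
    finally show ?thesis .
  qed
  obtain N1 where N1: "\<forall>i\<ge>N1. \<forall>j\<ge>N1. (\<integral>x. (s i x - s j x)\<^sup>2 \<partial>M) < 1" using Cauchy[of 1] by auto
  have diff: "(\<lambda>x. s N1 x - G x) \<in> L2 M"
    unfolding L2_def
  proof (intro CollectI conjI)
    have "(\<integral>\<^sup>+x. ennreal ((s N1 x - G x)\<^sup>2) \<partial>M) < \<infinity>"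
      using Fatou[OF N1 order_refl] by (auto simp: le_less_trans)
    then show "integrable M (\<lambda>x. (s N1 x - G x)\<^sup>2)" by (intro integrableI_bounded) auto
  qed measurable
  have G: "G \<in> L2 M" using L2_diff[OF s[of N1] diff] by simp
  moreover have "(\<lambda>n. \<integral>x. (s n x - G x)\<^sup>2 \<partial>M) \<longlonglongrightarrow> 0"
  proof (rule LIMSEQ_I)
    fix e :: real assume e: "0 < e"
    then obtain N where N: "\<forall>i\<ge>N. \<forall>j\<ge>N. (\<integral>x. (s i x - s j x)\<^sup>2 \<partial>M) < e/2" using Cauchy[of "e/2"] by auto
    have "norm ((\<integral>x. (s n x - G x)\<^sup>2 \<partial>M) - 0) < e" if "N \<le> n" for n
    proof -
      have "ennreal (\<integral>x. (s n x - G x)\<^sup>2 \<partial>M) = (\<integral>\<^sup>+x. ennreal ((s n x - G x)\<^sup>2) \<partial>M)"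
        by (intro nn_integral_eq_integral[symmetric] L2_integrable_square L2_diff s G) auto
      also have "\<dots> \<le> ennreal (e/2)" by (rule Fatou[OF N that])
      finally show ?thesis using e by (simp add: ennreal_le_iff)
    qed
    then show "\<exists>no. \<forall>n\<ge>no. norm ((\<integral>x. (s n x - G x)\<^sup>2 \<partial>M) - 0) < e" by blast
  qed
  ultimately show ?thesis by (rule that)
qed

text \<open>By the parallelogram identity a sequence whose midpoints are not much shorter than its members
  is a Cauchy sequence.\<close>

lemma L2_minimizing_converges:
  assumes s: "\<And>n. s n \<in> L2 M" and a: "a \<longlonglongrightarrow> \<alpha>"
    and up: "\<And>n. (\<integral>x. (s n x)\<^sup>2 \<partial>M) \<le> a n + 1 / real (Suc n)"
    and low: "\<And>i j. i \<le> j \<Longrightarrow> a i \<le> (\<integral>x. ((1 - 1/2) * s i x + 1/2 * s j x)\<^sup>2 \<partial>M)"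
  obtains G where "G \<in> L2 M" "(\<lambda>n. \<integral>x. (s n x - G x)\<^sup>2 \<partial>M) \<longlonglongrightarrow> 0"
proof -
  \<comment> \<open>The parallelogram identity, with \<open>up\<close> at both indices and
    \<open>low\<close> for the midpoint: 2 (a i + a j) - 4 (a i) leaves 2 (a j - a i).\<close>
  have bound: "(\<integral>x. (s i x - s j x)\<^sup>2 \<partial>M) \<le> 2 * (a j - a i) + 2 / real (Suc i) + 2 / real (Suc j)"
    if "i \<le> j" for i j
    using low[OF that] up[of i] up[of j] L2_integral_square_add[OF s[of i] s[of j], of 1 "-1"]
      L2_integral_square_add[OF s[of i] s[of j], of "1/2" "1/2"]
    by (simp add: power2_eq_square algebra_simps)
  have Cauchy: "\<exists>N. \<forall>i\<ge>N. \<forall>j\<ge>N. (\<integral>x. (s i x - s j x)\<^sup>2 \<partial>M) < e" if e: "0 < e" for e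
  proof -
    obtain N1 where N1: "\<And>i j. i \<ge> N1 \<Longrightarrow> j \<ge> N1 \<Longrightarrow> dist (a i) (a j) < e / 8"
      using LIMSEQ_imp_Cauchy[OF a] e unfolding Cauchy_def by (metis divide_pos_pos zero_less_numeral)
    obtain N2 where N2: "inverse (real (Suc N2)) < e / 8" using reals_Archimedean[of "e/8"] e by auto
    have small: "1 / real (Suc i) < e / 8" if "i \<ge> N2" for i
    proof -
      have "1 / real (Suc i) \<le> inverse (real (Suc N2))" using that by (simp add: divide_simps)
      then show ?thesis using N2 by linarith
    qed
    have le: "(\<integral>x. (s i x - s j x)\<^sup>2 \<partial>M) < e" if "i \<ge> max N1 N2" "i \<le> j" for i j
    proof -
      define u v where uv: "u = 1 / real (Suc i)" "v = 1 / real (Suc j)"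
      have "dist (a i) (a j) < e / 8" using N1[of i j] that by simp
      then have "2 * (a j - a i) < e / 4" unfolding dist_real_def abs_less_iff by simp
      moreover have "u < e / 8" "v < e / 8" using small that uv by auto
      moreover have "(\<integral>x. (s i x - s j x)\<^sup>2 \<partial>M) \<le> 2 * (a j - a i) + 2 * u + 2 * v"
        using bound[OF that(2)] by (simp add: uv)
      ultimately have "(\<integral>x. (s i x - s j x)\<^sup>2 \<partial>M) < e / 4 + 2 * (e / 8) + 2 * (e / 8)" by linarith
      then show ?thesis using e by simp
    qed
    have "(\<integral>x. (s i x - s j x)\<^sup>2 \<partial>M) < e" if "i \<ge> max N1 N2" "j \<ge> max N1 N2" for i j
    proof (cases "i \<le> j")
      case False
      then have "(\<integral>x. (s j x - s i x)\<^sup>2 \<partial>M) < e" using le[of j i] that by simp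
      then show ?thesis by (simp add: power2_commute)
    qed (use le that in blast)
    then show ?thesis by blast
  qed
  show ?thesis using L2_complete[OF s Cauchy] that by blast
qed

text \<open>A form of Mazur's lemma: weak and strong closures of convex sets agree at \<open>0\<close>.\<close>

lemma L2_convex_weakly_null:
  assumes KL2: "K \<subseteq> L2 M" and ne: "K \<noteq> {}"
    and conv: "\<And>k k' t. k \<in> K \<Longrightarrow> k' \<in> K \<Longrightarrow> 0 \<le> t \<Longrightarrow> t \<le> 1 \<Longrightarrow> (\<lambda>x. (1 - t) * k x + t * k' x) \<in> K"
    and weak: "\<And>h e. h \<in> L2 M \<Longrightarrow> 0 < e \<Longrightarrow> \<exists>k\<in>K. (\<integral>x. h x * k x \<partial>M) \<le> e"
    and e: "0 < e"
  shows "\<exists>k\<in>K. (\<integral>x. (k x)\<^sup>2 \<partial>M) < e"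
proof -
  define Q where "Q k = (\<integral>x. (k x)\<^sup>2 \<partial>M)" for k :: "'a \<Rightarrow> real"
  define \<alpha> where "\<alpha> = Inf (Q ` K)"
  have bdd: "bdd_below (Q ` K)" by (intro bdd_belowI[of _ 0]) (auto simp: Q_def)
  have low: "\<alpha> \<le> Q k" if "k \<in> K" for k unfolding \<alpha>_def using that bdd by (intro cInf_lower) auto
  have "\<exists>k\<in>K. Q k < \<alpha> + d" if "0 < d" for d
    using cInf_lessD[of "Q ` K" "\<alpha> + d"] ne that by (auto simp: \<alpha>_def)
  then have "\<forall>n. \<exists>k\<in>K. Q k < \<alpha> + 1 / real (Suc n)" by simp
  then obtain s where s: "\<And>n. s n \<in> K" "\<And>n. Q (s n) < \<alpha> + 1 / real (Suc n)" by metis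
  have sL2: "s n \<in> L2 M" for n using s(1) KL2 by auto
  obtain p where p: "p \<in> L2 M" "(\<lambda>n. \<integral>x. (s n x - p x)\<^sup>2 \<partial>M) \<longlonglongrightarrow> 0"
  proof (rule L2_minimizing_converges[OF sL2 tendsto_const[of \<alpha>]])
    show "(\<integral>x. (s n x)\<^sup>2 \<partial>M) \<le> \<alpha> + 1 / real (Suc n)" for n using s(2)[of n] by (simp add: Q_def)
    show "\<alpha> \<le> (\<integral>x. ((1 - 1/2) * s i x + 1/2 * s j x)\<^sup>2 \<partial>M)" for i j
      using low[OF conv[OF s(1)[of i] s(1)[of j], of "1/2"]] by (simp add: Q_def)
  qed blast
  have Qp: "Q p \<le> \<alpha>"
  proof (rule LIMSEQ_le)
    show "(\<lambda>n. Q (s n)) \<longlonglongrightarrow> Q p" unfolding Q_def by (rule L2_square_tendsto[OF sL2 p])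
    show "(\<lambda>n. \<alpha> + 1 / real (Suc n)) \<longlonglongrightarrow> \<alpha>"
      using tendsto_add[OF tendsto_const LIMSEQ_inverse_real_of_nat, of \<alpha>] by (simp add: inverse_eq_divide)
    show "\<exists>N. \<forall>n\<ge>N. Q (s n) \<le> \<alpha> + 1 / real (Suc n)" using s(2) less_imp_le by blast
  qed
  \<comment> \<open>First variation at the minimiser: a step of length \<open>t\<close> towards
    \<open>k\<close> cannot bring the square norm below \<alpha>, and the terms of first order in
    \<open>t\<close> yield the claim. The limit \<open>p\<close> may lie outside \<open>K\<close>,
    so the step starts from \<open>s n\<close> and the limit is taken afterwards.\<close>
  have var: "\<alpha> \<le> (\<integral>x. p x * k x \<partial>M)" if k: "k \<in> K" for k
  proof (rule ccontr)
    assume "\<not> \<alpha> \<le> (\<integral>x. p x * k x \<partial>M)"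
    define b where "b = (\<integral>x. p x * k x \<partial>M)"
    have b: "b < \<alpha>" using \<open>\<not> \<alpha> \<le> _\<close> by (simp add: b_def)
    have kL2: "k \<in> L2 M" using k KL2 by auto
    have ineq: "\<alpha> \<le> (1 - t)\<^sup>2 * \<alpha> + 2 * (1 - t) * t * b + t\<^sup>2 * Q k" if t: "0 \<le> t" "t \<le> 1" for t
    proof (rule LIMSEQ_le_const)
      have "(\<lambda>n. (1 - t)\<^sup>2 * Q (s n) + 2 * (1 - t) * t * (\<integral>x. k x * s n x \<partial>M) + t\<^sup>2 * Q k)
          \<longlonglongrightarrow> (1 - t)\<^sup>2 * Q p + 2 * (1 - t) * t * (\<integral>x. k x * p x \<partial>M) + t\<^sup>2 * Q k"
        unfolding Q_def by (intro tendsto_intros L2_square_tendsto L2_inner_tendsto sL2 p kL2)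
      moreover have "\<alpha> \<le> (1 - t)\<^sup>2 * Q (s n) + 2 * (1 - t) * t * (\<integral>x. k x * s n x \<partial>M) + t\<^sup>2 * Q k" for n
        using low[OF conv[OF s(1)[of n] k t]] L2_integral_square_add[OF sL2[of n] kL2, of "1 - t" t]
        by (simp add: Q_def mult.commute)
      ultimately have "\<alpha> \<le> (1 - t)\<^sup>2 * Q p + 2 * (1 - t) * t * (\<integral>x. k x * p x \<partial>M) + t\<^sup>2 * Q k"
        by (intro LIMSEQ_le_const) blast+
      also have "\<dots> \<le> (1 - t)\<^sup>2 * \<alpha> + 2 * (1 - t) * t * b + t\<^sup>2 * Q k"
        using Qp t by (intro add_mono mult_left_mono) (auto simp: b_def mult.commute)
      finally have "\<alpha> \<le> (1 - t)\<^sup>2 * \<alpha> + 2 * (1 - t) * t * b + t\<^sup>2 * Q k" .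
      then show "\<exists>N. \<forall>n\<ge>N. \<alpha> \<le> (1 - t)\<^sup>2 * \<alpha> + 2 * (1 - t) * t * b + t\<^sup>2 * Q k" by blast
    qed (rule tendsto_const)
    define D where "D = \<bar>\<alpha> - 2 * b + Q k\<bar> + 1"
    \<comment> \<open>This \<open>t\<close> makes the quadratic term at most t (\<alpha> - b), half
      of the linear gain 2 t (\<alpha> - b).\<close>
    define t where "t = min 1 ((\<alpha> - b) / D)"
    have D: "1 \<le> D" by (simp add: D_def)
    have t: "0 < t" "t \<le> 1" "t * D \<le> \<alpha> - b" using b D by (auto simp: t_def min_def field_simps)
    have "(1 - t)\<^sup>2 * \<alpha> + 2 * (1 - t) * t * b + t\<^sup>2 * Q k = \<alpha> - 2 * t * (\<alpha> - b) + t * (t * (\<alpha> - 2 * b + Q k))"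
      by algebra
    moreover have "t * (\<alpha> - 2 * b + Q k) \<le> t * D" using t by (intro mult_left_mono) (auto simp: D_def)
    then have "t * (\<alpha> - 2 * b + Q k) \<le> \<alpha> - b" using t(3) by linarith
    then have "t * (t * (\<alpha> - 2 * b + Q k)) \<le> t * (\<alpha> - b)" using t(1) by (intro mult_left_mono) auto
    moreover have "0 < t * (\<alpha> - b)" using t b by simp
    moreover have "\<alpha> \<le> (1 - t)\<^sup>2 * \<alpha> + 2 * (1 - t) * t * b + t\<^sup>2 * Q k" using ineq[of t] t by simp
    ultimately show False by linarith
  qed
  \<comment> \<open>The weak hypothesis is tested on the minimiser \<open>p\<close> itself.\<close>
  have "\<alpha> \<le> d" if "0 < d" for d using weak[OF p(1) that] var by fastforce
  then have "\<alpha> \<le> 0" using field_le_epsilon[of \<alpha> 0] by simp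
  obtain n where "inverse (real (Suc n)) < e" using reals_Archimedean e by blast
  then have "Q (s n) < e" using s(2)[of n] \<open>\<alpha> \<le> 0\<close> by (simp add: inverse_eq_divide)
  then show ?thesis using s(1) unfolding Q_def by blast
qed

end

section \<open>Lipschitz approximation of Borel sets\<close>

lemma tendsto_integral_bounded:
  fixes u :: "nat \<Rightarrow> 'a \<Rightarrow> real"
  assumes "finite_measure \<nu>" "\<And>n. u n \<in> borel_measurable \<nu>" "g \<in> borel_measurable \<nu>" "\<And>n x. \<bar>u n x\<bar> \<le> B"
    and "\<And>x. (\<lambda>n. u n x) \<longlonglongrightarrow> g x"
  shows "(\<lambda>n. \<integral>x. u n x \<partial>\<nu>) \<longlonglongrightarrow> (\<integral>x. g x \<partial>\<nu>)"
proof (rule integral_dominated_convergence[where w="\<lambda>_. B"])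
  show "integrable \<nu> (\<lambda>_. B)" using finite_measure.integrable_const[OF assms(1)] .
qed (use assms in auto)

lemma open_cutoffs:
  fixes U :: "'a::metric_space set"
  assumes "open U"
  obtains h where "\<And>n::nat. h n \<in> LIPb" "\<And>n x. 0 \<le> h n x" "\<And>n x. h n x \<le> 1"
    "\<And>x. (\<lambda>n. h n x) \<longlonglongrightarrow> indicator U x" "\<And>n. closure {x. h n x \<noteq> 0} \<subseteq> U"
proof -
  obtain g where g: "\<And>x. 0 \<le> g x" "\<And>x. g x \<le> 1" "\<And>x y. \<bar>g x - g y\<bar> \<le> dist x y" "U = {x. 0 < g x}"
    using open_gauge[OF assms] by blast
  have gL: "g \<in> LIPb" by (rule gauge_LIPb[OF g(1-3)])
  \<comment> \<open>Subtracting 1 makes \<open>h n\<close> vanish where g is at most 1 / n, so that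
    even the closure of the set where \<open>h n\<close> is nonzero stays inside
    \<open>U\<close>.\<close>
  define h where "h n x = min (max (real n * g x - 1) 0) 1" for n x
  show ?thesis
  proof (rule that[of h])
    show "h n \<in> LIPb" for n
      unfolding h_def[abs_def] by (intro LIPb_min LIPb_max LIPb_diff LIPb_cmult gL LIPb_const)
    show "(\<lambda>n. h n x) \<longlonglongrightarrow> indicator U x" for x
    proof (cases "x \<in> U")
      case True
      then have "0 < g x" using g(4) by auto
      obtain N :: nat where N: "2 / g x \<le> real N" using real_arch_simple by blast
      have "h n x = 1" if "N \<le> n" for n
      proof -
        have "2 / g x \<le> real n" using N that by linarith
        then have "2 \<le> real n * g x" using \<open>0 < g x\<close> by (simp add: pos_divide_le_eq)
        then show ?thesis by (simp add: h_def)
      qed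
      then show ?thesis using True by (intro tendsto_eventually) (auto simp: eventually_sequentially)
    next
      case False
      then have "g x = 0" using g(1)[of x] g(4) by fastforce
      then show ?thesis using False by (simp add: h_def)
    qed
    show "closure {x. h n x \<noteq> 0} \<subseteq> U" for n
    proof (cases "n = 0")
      case True then show ?thesis by (simp add: h_def)
    next
      case False
      have "closed {x. 1 / real n \<le> g x}" by (intro closed_Collect_le continuous_intros LIPb_continuous gL)
      moreover have "{x. h n x \<noteq> 0} \<subseteq> {x. 1 / real n \<le> g x}"
        using False by (auto simp: h_def min_def max_def field_simps split: if_splits)
      ultimately have "closure {x. h n x \<noteq> 0} \<subseteq> {x. 1 / real n \<le> g x}" by (intro closure_minimal)
      also have "\<dots> \<subseteq> U" using False g(4) by (auto intro: less_le_trans[of 0 "1 / real n"])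
      finally show ?thesis .
    qed
  qed (auto simp: h_def)
qed

text \<open>Outer regularity of finite Borel measures on Polish spaces replaces \<open>A\<close> by
  an open superset of almost the same mass, and the cutoffs of an open set converge boundedly to its
  indicator.\<close>

lemma Lipschitz_approx_indicator:
  fixes A :: "'a::polish_space set"
  assumes sets: "sets \<nu> = sets borel" and fin: "finite_measure \<nu>" and A: "A \<in> sets borel" and e: "0 < e"
  obtains h where "h \<in> LIPb" "\<And>x. 0 \<le> h x" "\<And>x. h x \<le> 1" "(\<integral>x. \<bar>h x - indicator A x\<bar> \<partial>\<nu>) < e"
proof -
  interpret finite_measure \<nu> by (rule fin)
  have space: "space \<nu> = UNIV" using sets by (metis sets_eq_imp_space_eq space_borel)
  have meas: "borel_measurable \<nu> = borel_measurable borel" by (rule measurable_cong_sets[OF sets refl])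
  have "emeasure \<nu> A = (INF U\<in>{U. A \<subseteq> U \<and> open U}. emeasure \<nu> U)"
    by (rule outer_regular[OF sets]) (use A emeasure_finite in auto)
  moreover have "emeasure \<nu> A < emeasure \<nu> A + ennreal (e/2)"
    using e emeasure_finite[of A] by (simp add: ennreal_add_left_cancel_less[of _ 0, simplified])
  ultimately obtain U where U: "A \<subseteq> U" "open U" "emeasure \<nu> U < emeasure \<nu> A + ennreal (e/2)"
    using INF_less_iff[of "emeasure \<nu>" "{U. A \<subseteq> U \<and> open U}" "emeasure \<nu> A + ennreal (e/2)"] by auto
  have [measurable]: "A \<in> sets \<nu>" "U \<in> sets \<nu>" using A U(2) sets by auto
  have mU: "measure \<nu> U < measure \<nu> A + e/2"
    using U(3) e by (simp add: emeasure_eq_measure ennreal_plus[symmetric] ennreal_less_iff del: ennreal_plus)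
  obtain h where h: "\<And>n::nat. h n \<in> LIPb" "\<And>n x. 0 \<le> h n x" "\<And>n x. h n x \<le> 1"
    "\<And>x. (\<lambda>n. h n x) \<longlonglongrightarrow> indicator U x" using open_cutoffs[OF U(2)] by metis
  have [measurable]: "h n \<in> borel_measurable \<nu>" for n using LIPb_borel[OF h(1)] meas by auto
  have hU: "\<bar>h n x - indicator U x\<bar> \<le> 1" for n x
    using h(2)[of n x] h(3)[of n x] by (auto simp: indicator_def)
  have "(\<lambda>n. \<integral>x. \<bar>h n x - indicator U x\<bar> \<partial>\<nu>) \<longlonglongrightarrow> (\<integral>x. 0 \<partial>\<nu>)"
  proof (rule tendsto_integral_bounded[OF fin, where B=1])
    show "(\<lambda>n. \<bar>h n x - indicator U x\<bar>) \<longlonglongrightarrow> 0" for x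
      using tendsto_rabs[OF tendsto_diff[OF h(4)[of x] tendsto_const[of "indicator U x"]]] by simp
    show "\<bar>\<bar>h n x - indicator U x\<bar>\<bar> \<le> 1" for n x using hU by simp
  qed auto
  then have "\<forall>\<^sub>F n in sequentially. (\<integral>x. \<bar>h n x - indicator U x\<bar> \<partial>\<nu>) < e/2"
    using order_tendstoD(2)[of _ _ _ "e/2"] e by fastforce
  then obtain n where n: "(\<integral>x. \<bar>h n x - indicator U x\<bar> \<partial>\<nu>) < e/2"
    using eventually_happens'[OF sequentially_bot] by blast
  have int: "integrable \<nu> (\<lambda>x. \<bar>h n x - indicator U x\<bar>)"
    using hU by (intro integrable_const_bound[of _ 1]) auto
  have "(\<integral>x. \<bar>h n x - indicator A x\<bar> \<partial>\<nu>) \<le> (\<integral>x. \<bar>h n x - indicator U x\<bar> + indicator (U - A) x \<partial>\<nu>)"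
  proof (rule integral_mono')
    show "integrable \<nu> (\<lambda>x. \<bar>h n x - indicator U x\<bar> + indicator (U - A) x)"
      by (intro Bochner_Integration.integrable_add int) (auto simp: emeasure_finite less_top[symmetric])
    show "\<bar>h n x - indicator A x\<bar> \<le> \<bar>h n x - indicator U x\<bar> + indicator (U - A) x" for x
      using U(1) by (auto simp: indicator_def)
  qed simp
  also have "\<dots> = (\<integral>x. \<bar>h n x - indicator U x\<bar> \<partial>\<nu>) + measure \<nu> (U - A)"
    using int by (subst Bochner_Integration.integral_add) (auto simp: emeasure_finite less_top[symmetric] space)
  also have "measure \<nu> (U - A) = measure \<nu> U - measure \<nu> A"
    using U(1) by (intro finite_measure_Diff) auto
  finally have "(\<integral>x. \<bar>h n x - indicator A x\<bar> \<partial>\<nu>) < e" using n mU by linarith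
  then show ?thesis using that[of "h n"] h by blast
qed

section \<open>Relaxed slopes\<close>

text \<open>Membership in \<open>L2 m\<close> is part of the notion because the integral of a
  non-integrable function is 0 by default, so that the limit alone could hold vacuously.\<close>

definition L2_tendsto :: "'a measure \<Rightarrow> (nat \<Rightarrow> 'a \<Rightarrow> real) \<Rightarrow> ('a \<Rightarrow> real) \<Rightarrow> bool" where
  "L2_tendsto m u U \<longleftrightarrow> (\<forall>n. u n \<in> L2 m) \<and> U \<in> L2 m \<and> (\<lambda>n. \<integral>x. (u n x - U x)\<^sup>2 \<partial>m) \<longlonglongrightarrow> 0"

lemma L2_tendstoD:
  assumes "L2_tendsto m u U"
  shows "u n \<in> L2 m" "U \<in> L2 m" "(\<lambda>n. \<integral>x. (u n x - U x)\<^sup>2 \<partial>m) \<longlonglongrightarrow> 0"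
  using assms by (auto simp: L2_tendsto_def)

lemma L2_tendstoI:
  assumes "\<And>n. u n \<in> L2 m" "U \<in> L2 m" "\<And>n. (\<integral>x. (u n x - U x)\<^sup>2 \<partial>m) \<le> b n" "b \<longlonglongrightarrow> 0"
  shows "L2_tendsto m u U"
  unfolding L2_tendsto_def
proof (intro conjI allI assms)
  show "(\<lambda>n. \<integral>x. (u n x - U x)\<^sup>2 \<partial>m) \<longlonglongrightarrow> 0"
    by (rule tendsto_sandwich[OF _ _ tendsto_const assms(4)]) (use assms(3) in auto)
qed

lemma L2_tendsto_const: "U \<in> L2 m \<Longrightarrow> L2_tendsto m (\<lambda>_. U) U"
  by (simp add: L2_tendsto_def)

lemma L2_tendsto_add:
  assumes "L2_tendsto m u U" "L2_tendsto m v V"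
  shows "L2_tendsto m (\<lambda>n x. u n x + v n x) (\<lambda>x. U x + V x)"
proof (rule L2_tendstoI)
  note u = L2_tendstoD[OF assms(1)] and v = L2_tendstoD[OF assms(2)]
  show "(\<integral>x. (u n x + v n x - (U x + V x))\<^sup>2 \<partial>m)
      \<le> 2 * (\<integral>x. (u n x - U x)\<^sup>2 \<partial>m) + 2 * (\<integral>x. (v n x - V x)\<^sup>2 \<partial>m)" for n
    using L2_square_add_le[OF L2_diff[OF u(1,2)] L2_diff[OF v(1,2)], of n n] by (simp add: algebra_simps)
  show "(\<lambda>n. 2 * (\<integral>x. (u n x - U x)\<^sup>2 \<partial>m) + 2 * (\<integral>x. (v n x - V x)\<^sup>2 \<partial>m)) \<longlonglongrightarrow> 0"
    using tendsto_add[OF tendsto_mult_right_zero[OF u(3), of 2] tendsto_mult_right_zero[OF v(3), of 2]] by simp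
qed (use L2_tendstoD(1,2)[OF assms(1)] L2_tendstoD(1,2)[OF assms(2)] in auto)

lemma L2_tendsto_dominated:
  assumes u: "L2_tendsto m u U" and v: "\<And>n. v n \<in> L2 m" "V \<in> L2 m"
    and le: "\<And>n. AE x in m. \<bar>v n x - V x\<bar> \<le> B * \<bar>u n x - U x\<bar>"
  shows "L2_tendsto m v V"
proof (rule L2_tendstoI[OF v])
  note u = L2_tendstoD[OF u]
  show "(\<integral>x. (v n x - V x)\<^sup>2 \<partial>m) \<le> B\<^sup>2 * (\<integral>x. (u n x - U x)\<^sup>2 \<partial>m)" for n
    using L2_dominated(2)[OF L2_cmult[OF L2_abs[OF L2_diff[OF u(1,2)]], of B], of "\<lambda>x. v n x - V x" n]
      le L2_measurable[OF L2_diff[OF v]] by (simp add: power_mult_distrib)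
  show "(\<lambda>n. B\<^sup>2 * (\<integral>x. (u n x - U x)\<^sup>2 \<partial>m)) \<longlonglongrightarrow> 0" by (intro tendsto_mult_right_zero u)
qed

lemma L2_tendsto_bounded_mult:
  assumes u: "L2_tendsto m u U" and g: "g \<in> borel_measurable m" "\<And>x. \<bar>g x\<bar> \<le> B"
  shows "L2_tendsto m (\<lambda>n x. g x * u n x) (\<lambda>x. g x * U x)"
proof (rule L2_tendsto_dominated[OF u])
  show "(\<lambda>x. g x * u n x) \<in> L2 m" "(\<lambda>x. g x * U x) \<in> L2 m" for n
    using L2_bounded_mult[OF _ g] L2_tendstoD[OF u] by auto
  show "AE x in m. \<bar>g x * u n x - g x * U x\<bar> \<le> B * \<bar>u n x - U x\<bar>" for n
    using g(2) by (auto simp: right_diff_distrib[symmetric] abs_mult intro!: mult_right_mono)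
qed

lemma L2_tendsto_abs: "L2_tendsto m u U \<Longrightarrow> L2_tendsto m (\<lambda>n x. \<bar>u n x\<bar>) (\<lambda>x. \<bar>U x\<bar>)"
  by (rule L2_tendsto_dominated[of m u U _ _ 1]) (auto dest: L2_tendstoD)

lemma L2_tendsto_cmult: "L2_tendsto m u U \<Longrightarrow> L2_tendsto m (\<lambda>n x. c * u n x) (\<lambda>x. c * U x)"
  by (rule L2_tendsto_bounded_mult[where B = "\<bar>c\<bar>"]) auto

lemma L2_tendsto_diff:
  "L2_tendsto m u U \<Longrightarrow> L2_tendsto m v V \<Longrightarrow> L2_tendsto m (\<lambda>n x. u n x - v n x) (\<lambda>x. U x - V x)"
  using L2_tendsto_add[of m u U "\<lambda>n x. (-1) * v n x" "\<lambda>x. (-1) * V x"] L2_tendsto_cmult[of m v V "-1"] by simp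

text \<open>Where \<open>u n\<close> is nonnegative, the negative part of \<open>U\<close> is at
  most |u n - U|, so its L2 norm is bounded by a null sequence.\<close>

lemma L2_tendsto_nonneg:
  assumes u: "L2_tendsto m u U" and nonneg: "\<And>n. AE x in m. 0 \<le> u n x"
  shows "AE x in m. 0 \<le> U x"
proof -
  note uD = L2_tendstoD[OF u]
  have [measurable]: "U \<in> borel_measurable m" using uD(2) L2_measurable by blast
  have le: "(\<integral>x. (max (- U x) 0)\<^sup>2 \<partial>m) \<le> (\<integral>x. (u n x - U x)\<^sup>2 \<partial>m)"
    and mem: "(\<lambda>x. max (- U x) 0) \<in> L2 m" for n
  proof -
    have "AE x in m. \<bar>max (- U x) 0\<bar> \<le> \<bar>u n x - U x\<bar>" using nonneg[of n] by eventually_elim auto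
    from L2_dominated[OF L2_abs[OF L2_diff[OF uD(1,2)]] _ this]
    show "(\<integral>x. (max (- U x) 0)\<^sup>2 \<partial>m) \<le> (\<integral>x. (u n x - U x)\<^sup>2 \<partial>m)" "(\<lambda>x. max (- U x) 0) \<in> L2 m"
      by simp_all
  qed
  have "(\<integral>x. (max (- U x) 0)\<^sup>2 \<partial>m) \<le> 0" using LIMSEQ_le_const[OF uD(3)] le by blast
  then have "(\<integral>x. (max (- U x) 0)\<^sup>2 \<partial>m) = 0" by (intro antisym) auto
  then have "AE x in m. (max (- U x) 0)\<^sup>2 = 0"
    using integral_nonneg_eq_0_iff_AE[OF L2_integrable_square[OF mem]] by simp
  then show ?thesis by eventually_elim auto
qed

text \<open>Strong approximation is stable under the constructions below, while weak limits, as in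
  \<^const>\<open>relaxed_slope\<close>, would need weak compactness at every step.\<close>

definition strong_slope :: "'a::metric_space measure \<Rightarrow> ('a \<Rightarrow> real) \<Rightarrow> ('a \<Rightarrow> real) \<Rightarrow> bool" where
  "strong_slope m f r \<longleftrightarrow> (\<exists>F R. (\<forall>n. F n \<in> LIPb) \<and> (\<forall>n x. slope (F n) x \<le> R n x) \<and>
     L2_tendsto m F f \<and> L2_tendsto m R r)"

lemma strong_slopeE:
  assumes "strong_slope m f r"
  obtains F R where "\<And>n. F n \<in> LIPb" "\<And>n x. slope (F n) x \<le> R n x" "L2_tendsto m F f" "L2_tendsto m R r"
  using assms unfolding strong_slope_def by blast

lemma strong_slopeI:
  assumes "\<And>n. F n \<in> LIPb" "\<And>n x. slope (F n) x \<le> R n x" "L2_tendsto m F f" "L2_tendsto m R r"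
  shows "strong_slope m f r"
  using assms unfolding strong_slope_def by blast

lemma strong_slope_L2: "strong_slope m f r \<Longrightarrow> f \<in> L2 m" "strong_slope m f r \<Longrightarrow> r \<in> L2 m"
  unfolding strong_slope_def L2_tendsto_def by blast+

lemma strong_slope_nonneg: "strong_slope m f r \<Longrightarrow> AE x in m. 0 \<le> r x"
  by (erule strong_slopeE, rule L2_tendsto_nonneg) (auto intro!: always_eventually intro: order_trans[OF slope_nonneg])

text \<open>Adding the positive part of r' - r to every \<open>R n\<close> preserves the domination
  of the slopes at every point, although \<open>r\<close> is below r' only almost
  everywhere.\<close>

lemma strong_slope_mono:
  assumes S: "strong_slope m f r" and r': "r' \<in> L2 m" and le: "AE x in m. r x \<le> r' x"
  shows "strong_slope m f r'"
proof -
  obtain F R where F: "\<And>n. F n \<in> LIPb" "\<And>n x. slope (F n) x \<le> R n x" "L2_tendsto m F f" "L2_tendsto m R r"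
    using strong_slopeE[OF S] by blast
  have r: "r \<in> L2 m" using strong_slope_L2[OF S] by simp
  have mx: "(\<lambda>x. max (r' x - r x) 0) \<in> L2 m"
    by (rule L2_dominated(1)[OF L2_abs[OF L2_diff[OF r' r]]])
      (use L2_measurable[OF r] L2_measurable[OF r'] in auto)
  have mem: "(\<lambda>x. R n x + max (r' x - r x) 0) \<in> L2 m" for n
    using L2_tendstoD(1)[OF F(4)] mx by auto
  have "L2_tendsto m (\<lambda>n x. R n x + max (r' x - r x) 0) r'"
  proof (rule L2_tendsto_dominated[OF F(4) mem r'])
    show "AE x in m. \<bar>R n x + max (r' x - r x) 0 - r' x\<bar> \<le> 1 * \<bar>R n x - r x\<bar>" for n
      using le by eventually_elim auto
  qed
  then show ?thesis
    using F by (intro strong_slopeI[of F "\<lambda>n x. R n x + max (r' x - r x) 0"]) (auto intro: add_increasing2)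
qed

lemma slope_convex:
  assumes "F \<in> LIPb" "G \<in> LIPb" "0 \<le> t" "t \<le> 1"
  shows "slope (\<lambda>x. (1 - t) * F x + t * G x) x \<le> (1 - t) * slope F x + t * slope G x"
proof -
  have "slope (\<lambda>x. (1 - t) * F x + t * G x) x \<le> slope (\<lambda>x. (1 - t) * F x) x + slope (\<lambda>x. t * G x) x"
    using assms by (intro slope_add LIPb_lip_finite LIPb_cmult)
  also have "\<dots> \<le> \<bar>1 - t\<bar> * slope F x + \<bar>t\<bar> * slope G x"
    using assms by (intro add_mono slope_cmult LIPb_lip_finite)
  finally show ?thesis using assms by simp
qed

section \<open>Agreement of strong and relaxed slopes, and operations on slopes\<close>

context metric_measure_space
begin

lemma space_m: "space m = UNIV"
  using sets_m by (metis sets_eq_imp_space_eq space_borel)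

lemma borel_measurable_m: "borel_measurable m = borel_measurable borel"
  by (rule measurable_cong_sets[OF sets_m refl])

lemma LIPb_measurable_m: "f \<in> LIPb \<Longrightarrow> f \<in> borel_measurable m"
  using LIPb_borel borel_measurable_m by auto

lemma slope_measurable_m: "f \<in> LIPb \<Longrightarrow> slope f \<in> borel_measurable m"
  using slope_borel borel_measurable_m by auto

lemma sigma_finite: "sigma_finite_measure m"
proof
  let ?A = "range (\<lambda>n::nat. ball undefined (real n)) :: 'a set set"
  show "\<exists>A. countable A \<and> A \<subseteq> sets m \<and> \<Union> A = space m \<and> (\<forall>a\<in>A. emeasure m a \<noteq> \<infinity>)"
  proof (intro exI[of _ ?A] conjI ballI)
    show "\<Union> ?A = space m" using reals_Archimedean2 by (auto simp: space_m)
    show "emeasure m a \<noteq> \<infinity>" if "a \<in> ?A" for a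
      using that finite_on_balls by (auto simp: less_top[symmetric])
  qed (auto simp: sets_m)
qed

text \<open>Mazur's argument for pairs of a function and a bound of its slope. The errors R - G of
  all pairs whose function is close to \<open>f\<close> form a convex set, because slopes are convex
  and balls in L2 are convex. The weak convergence of the slopes says that this set approaches 0
  weakly, hence also in norm.\<close>

lemma relaxed_slope_imp_strong_slope:
  assumes f: "f \<in> L2 m" and rel: "relaxed_slope m f g"
  shows "strong_slope m f g"
proof -
  interpret sigma_finite_measure m by (rule sigma_finite)
  obtain F G where g: "g \<in> L2 m" and F: "cheeger_approx m f F" and G: "G \<in> L2 m"
    and sF: "\<And>k. slope (F k) \<in> L2 m"
    and weak: "\<And>h. h \<in> L2 m \<Longrightarrow> (\<lambda>k. \<integral>x. h x * slope (F k) x \<partial>m) \<longlonglongrightarrow> (\<integral>x. h x * G x \<partial>m)"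
    and le: "AE x in m. G x \<le> g x"
    using rel unfolding relaxed_slope_def slope_def[abs_def] by blast
  have FL: "F k \<in> LIPb" "F k \<in> L2 m" for k using F by (auto simp: cheeger_approx_def)
  have Fto: "(\<lambda>k. \<integral>x. (F k x - f x)\<^sup>2 \<partial>m) \<longlonglongrightarrow> 0" using F by (simp add: cheeger_approx_def)
  have ex: "\<exists>F' R. F' \<in> LIPb \<and> F' \<in> L2 m \<and> R \<in> L2 m \<and> (\<forall>x. slope F' x \<le> R x) \<and>
      (\<integral>x. (F' x - f x)\<^sup>2 \<partial>m) < e \<and> (\<integral>x. (R x - G x)\<^sup>2 \<partial>m) < e" if e: "0 < e" for e
  proof -
    define ok where "ok F' R \<longleftrightarrow> F' \<in> LIPb \<and> F' \<in> L2 m \<and> R \<in> L2 m \<and> (\<forall>x. slope F' x \<le> R x) \<and>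
      (\<integral>x. (F' x - f x)\<^sup>2 \<partial>m) < e" for F' R
    define K where "K = {(\<lambda>x. R x - G x) | F' R. ok F' R}"
    have okF: "ok (F k) (slope (F k))" if "(\<integral>x. (F k x - f x)\<^sup>2 \<partial>m) < e" for k
      using that FL sF by (simp add: ok_def)
    have small: "\<forall>\<^sub>F k in sequentially. (\<integral>x. (F k x - f x)\<^sup>2 \<partial>m) < e"
      using order_tendstoD(2)[OF Fto e] .
    have "\<exists>k\<in>K. (\<integral>x. (k x)\<^sup>2 \<partial>m) < e"
    proof (rule L2_convex_weakly_null[OF _ _ _ _ e])
      show "K \<subseteq> L2 m" using G by (auto simp: K_def ok_def)
      obtain k where "(\<integral>x. (F k x - f x)\<^sup>2 \<partial>m) < e"
        using eventually_happens'[OF sequentially_bot small] by blast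
      then show "K \<noteq> {}" using okF by (auto simp: K_def)
    next
      fix k k' :: "'a \<Rightarrow> real" and t :: real assume k: "k \<in> K" "k' \<in> K" and t: "0 \<le> t" "t \<le> 1"
      obtain F1 R1 where 1: "ok F1 R1" "k = (\<lambda>x. R1 x - G x)" using k by (auto simp: K_def)
      obtain F2 R2 where 2: "ok F2 R2" "k' = (\<lambda>x. R2 x - G x)" using k by (auto simp: K_def)
      have "ok (\<lambda>x. (1 - t) * F1 x + t * F2 x) (\<lambda>x. (1 - t) * R1 x + t * R2 x)"
        unfolding ok_def
      proof (intro conjI allI)
        fix x
        have "(1 - t) * slope F1 x + t * slope F2 x \<le> (1 - t) * R1 x + t * R2 x"
          using 1 2 t by (intro add_mono mult_left_mono) (auto simp: ok_def)
        then show "slope (\<lambda>x. (1 - t) * F1 x + t * F2 x) x \<le> (1 - t) * R1 x + t * R2 x"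
          using slope_convex[of F1 F2 t x] 1 2 t by (auto simp: ok_def)
      next
        have "(\<integral>x. ((1 - t) * (F1 x - f x) + t * (F2 x - f x))\<^sup>2 \<partial>m)
            \<le> (1 - t) * (\<integral>x. (F1 x - f x)\<^sup>2 \<partial>m) + t * (\<integral>x. (F2 x - f x)\<^sup>2 \<partial>m)"
          using 1 2 t f by (intro L2_square_convex) (auto simp: ok_def)
        also have "\<dots> < e"
          using 1 2 t by (intro convex_bound_lt) (auto simp: ok_def)
        finally show "(\<integral>x. ((1 - t) * F1 x + t * F2 x - f x)\<^sup>2 \<partial>m) < e" by (simp add: algebra_simps)
      qed (use 1 2 in \<open>auto simp: ok_def\<close>)
      moreover have "(\<lambda>x. (1 - t) * k x + t * k' x) = (\<lambda>x. ((1 - t) * R1 x + t * R2 x) - G x)"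
        unfolding 1 2 by (auto simp: algebra_simps)
      ultimately show "(\<lambda>x. (1 - t) * k x + t * k' x) \<in> K"
        unfolding K_def by (intro CollectI exI[of _ "\<lambda>x. (1 - t) * F1 x + t * F2 x"] exI[of _ "\<lambda>x. (1 - t) * R1 x + t * R2 x"]) simp
    next
      fix h :: "'a \<Rightarrow> real" and d :: real assume h: "h \<in> L2 m" and d: "0 < d"
      have "\<forall>\<^sub>F k in sequentially. (\<integral>x. h x * slope (F k) x \<partial>m) < (\<integral>x. h x * G x \<partial>m) + d"
        using order_tendstoD(2)[OF weak[OF h]] d by simp
      from eventually_happens'[OF sequentially_bot eventually_conj[OF this small]]
      obtain k where k: "(\<integral>x. h x * slope (F k) x \<partial>m) < (\<integral>x. h x * G x \<partial>m) + d" "(\<integral>x. (F k x - f x)\<^sup>2 \<partial>m) < e"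
        by blast
      have "(\<integral>x. h x * (slope (F k) x - G x) \<partial>m) = (\<integral>x. h x * slope (F k) x \<partial>m) - (\<integral>x. h x * G x \<partial>m)"
        using L2_mult_integrable[OF h sF] L2_mult_integrable[OF h G] by (simp add: right_diff_distrib)
      then have "(\<integral>x. h x * (slope (F k) x - G x) \<partial>m) \<le> d" using k(1) by simp
      then show "\<exists>k\<in>K. (\<integral>x. h x * k x \<partial>m) \<le> d"
        using okF[OF k(2)] by (intro bexI[of _ "\<lambda>x. slope (F k) x - G x"]) (auto simp: K_def)
    qed
    then show ?thesis by (auto simp: K_def ok_def)
  qed
  define good where "good n F' R \<longleftrightarrow> F' \<in> LIPb \<and> F' \<in> L2 m \<and> R \<in> L2 m \<and> (\<forall>x. slope F' x \<le> R x) \<and>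
      (\<integral>x. (F' x - f x)\<^sup>2 \<partial>m) < inverse (real (Suc n)) \<and> (\<integral>x. (R x - G x)\<^sup>2 \<partial>m) < inverse (real (Suc n))"
    for n F' R
  have "\<exists>F' R. good n F' R" for n unfolding good_def by (intro ex) simp
  then obtain F' R where "\<And>n. good n (F' n) (R n)" by metis
  then have FR: "\<And>n. F' n \<in> LIPb" "\<And>n. F' n \<in> L2 m" "\<And>n. R n \<in> L2 m" "\<And>n x. slope (F' n) x \<le> R n x"
      "\<And>n. (\<integral>x. (F' n x - f x)\<^sup>2 \<partial>m) < inverse (real (Suc n))" "\<And>n. (\<integral>x. (R n x - G x)\<^sup>2 \<partial>m) < inverse (real (Suc n))"
    unfolding good_def by blast+
  have "L2_tendsto m F' f" "L2_tendsto m R G"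
    using FR(5,6) by (auto intro!: L2_tendstoI[OF _ _ _ LIMSEQ_inverse_real_of_nat] FR f G less_imp_le)
  then have "strong_slope m f G" using FR by (intro strong_slopeI)
  then show ?thesis by (rule strong_slope_mono[OF _ g le])
qed

text \<open>Almost minimisers of the energy among approximations with controlled slope have strongly
  convergent slopes.\<close>

lemma strong_slope_imp_relaxed_slope:
  assumes S: "strong_slope m f r"
  shows "relaxed_slope m f r"
proof -
  interpret sigma_finite_measure m by (rule sigma_finite)
  obtain F0 R0 where F0: "\<And>n. F0 n \<in> LIPb" "\<And>n x. slope (F0 n) x \<le> R0 n x" "L2_tendsto m F0 f" "L2_tendsto m R0 r"
    using strong_slopeE[OF S] by blast
  have f: "f \<in> L2 m" and r: "r \<in> L2 m" using strong_slope_L2[OF S] by auto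
  define \<epsilon> where "\<epsilon> n = 1 / real (Suc n)" for n
  have \<epsilon>: "0 < \<epsilon> n" "\<epsilon> n \<le> 1" for n by (auto simp: \<epsilon>_def)
  have \<epsilon>mono: "\<epsilon> j \<le> \<epsilon> i" if "i \<le> j" for i j using that by (simp add: \<epsilon>_def frac_le)
  define ok where "ok n F R \<longleftrightarrow> F \<in> LIPb \<and> F \<in> L2 m \<and> R \<in> L2 m \<and> (\<forall>x. slope F x \<le> R x) \<and>
      (\<integral>x. (F x - f x)\<^sup>2 \<partial>m) < \<epsilon> n \<and> (\<integral>x. (R x - r x)\<^sup>2 \<partial>m) < \<epsilon> n" for n F R
  have okmono: "ok i F R" if "ok j F R" "i \<le> j" for i j F R
    using that \<epsilon>mono[OF that(2)] by (auto simp: ok_def)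
  have sL2: "slope F \<in> L2 m" "(\<integral>x. (slope F x)\<^sup>2 \<partial>m) \<le> 2 + 2 * (\<integral>x. (r x)\<^sup>2 \<partial>m)" if "ok n F R" for n F R
  proof -
    have R: "R \<in> L2 m" and F: "F \<in> LIPb" using that by (auto simp: ok_def)
    have dom: "AE x in m. \<bar>slope F x\<bar> \<le> R x" using that by (auto simp: ok_def)
    show "slope F \<in> L2 m" by (rule L2_dominated(1)[OF R slope_measurable_m[OF F] dom])
    have "(\<integral>x. (slope F x)\<^sup>2 \<partial>m) \<le> (\<integral>x. (R x)\<^sup>2 \<partial>m)" by (rule L2_dominated(2)[OF R slope_measurable_m[OF F] dom])
    also have "\<dots> \<le> 2 * (\<integral>x. (R x - r x)\<^sup>2 \<partial>m) + 2 * (\<integral>x. (r x)\<^sup>2 \<partial>m)"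
      using L2_square_add_le[OF L2_diff[OF R r] r] by simp
    also have "(\<integral>x. (R x - r x)\<^sup>2 \<partial>m) \<le> 1" using that \<epsilon>(2)[of n] by (simp add: ok_def)
    finally show "(\<integral>x. (slope F x)\<^sup>2 \<partial>m) \<le> 2 + 2 * (\<integral>x. (r x)\<^sup>2 \<partial>m)" by simp
  qed
  define Q where "Q n = {(\<integral>x. (slope F x)\<^sup>2 \<partial>m) | F R. ok n F R}" for n
  define a where "a n = Inf (Q n)" for n
  have Qne: "Q n \<noteq> {}" for n
  proof -
    have "\<forall>\<^sub>F k in sequentially. (\<integral>x. (F0 k x - f x)\<^sup>2 \<partial>m) < \<epsilon> n" "\<forall>\<^sub>F k in sequentially. (\<integral>x. (R0 k x - r x)\<^sup>2 \<partial>m) < \<epsilon> n"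
      using order_tendstoD(2)[OF L2_tendstoD(3)[OF F0(3)] \<epsilon>(1)] order_tendstoD(2)[OF L2_tendstoD(3)[OF F0(4)] \<epsilon>(1)] by auto
    from eventually_happens'[OF sequentially_bot eventually_conj[OF this]]
    obtain k where "(\<integral>x. (F0 k x - f x)\<^sup>2 \<partial>m) < \<epsilon> n" "(\<integral>x. (R0 k x - r x)\<^sup>2 \<partial>m) < \<epsilon> n" by blast
    then have "ok n (F0 k) (R0 k)" using F0 L2_tendstoD(1)[OF F0(3)] L2_tendstoD(1)[OF F0(4)] by (simp add: ok_def)
    then show ?thesis by (auto simp: Q_def)
  qed
  have Qbdd: "bdd_below (Q n)" for n by (intro bdd_belowI[of _ 0]) (auto simp: Q_def)
  have alow: "a n \<le> (\<integral>x. (slope F x)\<^sup>2 \<partial>m)" if "ok n F R" for n F R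
    unfolding a_def using that Qbdd by (intro cInf_lower) (auto simp: Q_def)
  have "\<exists>F R. ok n F R \<and> (\<integral>x. (slope F x)\<^sup>2 \<partial>m) < a n + \<epsilon> n" for n
    using cInf_lessD[OF Qne, of n "a n + \<epsilon> n"] \<epsilon>(1)[of n] by (auto simp: a_def Q_def)
  then obtain F R where FR: "\<And>n. ok n (F n) (R n)" "\<And>n. (\<integral>x. (slope (F n) x)\<^sup>2 \<partial>m) < a n + \<epsilon> n" by metis
  \<comment> \<open>Admissible pairs get scarcer as \<open>n\<close> grows, so the infima increase;
    being bounded, they converge, which the midpoint argument requires.\<close>
  have "Q (Suc n) \<subseteq> Q n" for n using okmono[of "Suc n" _ _ n] unfolding Q_def by auto
  then have "incseq a"
    unfolding a_def by (intro incseq_SucI cInf_superset_mono Qne Qbdd)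
  moreover have "\<forall>n. a n \<le> 2 + 2 * (\<integral>x. (r x)\<^sup>2 \<partial>m)"
    using alow[OF FR(1)] sL2(2)[OF FR(1)] order_trans by blast
  ultimately obtain \<alpha> where \<alpha>: "a \<longlonglongrightarrow> \<alpha>" using incseq_convergent by blast
  obtain G where G: "G \<in> L2 m" "(\<lambda>n. \<integral>x. (slope (F n) x - G x)\<^sup>2 \<partial>m) \<longlonglongrightarrow> 0"
  proof (rule L2_minimizing_converges[OF sL2(1)[OF FR(1)] \<alpha>])
    show "(\<integral>x. (slope (F n) x)\<^sup>2 \<partial>m) \<le> a n + 1 / real (Suc n)" for n using FR(2)[of n] by (simp add: \<epsilon>_def)
    fix i j :: nat assume ij: "i \<le> j"
    let ?F = "\<lambda>x. (1 - 1/2) * F i x + 1/2 * F j x" and ?R = "\<lambda>x. (1 - 1/2) * R i x + 1/2 * R j x"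
    note oi = FR(1)[of i, unfolded ok_def] and oj = okmono[OF FR(1)[of j] ij, unfolded ok_def]
    have slope: "slope ?F x \<le> (1 - 1/2) * slope (F i) x + 1/2 * slope (F j) x" for x
      using oi oj by (intro slope_convex) auto
    have "ok i ?F ?R"
      unfolding ok_def
    proof (intro conjI allI)
      fix x
      have "slope (F i) x \<le> R i x" "slope (F j) x \<le> R j x" using oi oj by auto
      then show "slope ?F x \<le> ?R x" using slope[of x] by simp
    next
      have "(\<integral>x. ((1 - 1/2) * (F i x - f x) + 1/2 * (F j x - f x))\<^sup>2 \<partial>m)
            \<le> (1 - 1/2) * (\<integral>x. (F i x - f x)\<^sup>2 \<partial>m) + 1/2 * (\<integral>x. (F j x - f x)\<^sup>2 \<partial>m)"
        using oi oj f by (intro L2_square_convex) auto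
      also have "\<dots> < \<epsilon> i" using oi oj by simp
      finally show "(\<integral>x. (?F x - f x)\<^sup>2 \<partial>m) < \<epsilon> i" by (simp add: algebra_simps)
      have "(\<integral>x. ((1 - 1/2) * (R i x - r x) + 1/2 * (R j x - r x))\<^sup>2 \<partial>m)
            \<le> (1 - 1/2) * (\<integral>x. (R i x - r x)\<^sup>2 \<partial>m) + 1/2 * (\<integral>x. (R j x - r x)\<^sup>2 \<partial>m)"
        using oi oj r by (intro L2_square_convex) auto
      also have "\<dots> < \<epsilon> i" using oi oj by simp
      finally show "(\<integral>x. (?R x - r x)\<^sup>2 \<partial>m) < \<epsilon> i" by (simp add: algebra_simps)
    qed (intro LIPb_add LIPb_cmult L2_add L2_cmult; use oi oj in simp)+
    then have "a i \<le> (\<integral>x. (slope ?F x)\<^sup>2 \<partial>m)" by (rule alow)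
    also have "\<dots> \<le> (\<integral>x. ((1 - 1/2) * slope (F i) x + 1/2 * slope (F j) x)\<^sup>2 \<partial>m)"
    proof (rule L2_dominated(2))
      show "(\<lambda>x. (1 - 1/2) * slope (F i) x + 1/2 * slope (F j) x) \<in> L2 m"
        by (intro L2_add L2_cmult sL2(1)[OF FR(1)])
      have "?F \<in> LIPb" using oi oj by (intro LIPb_add LIPb_cmult) auto
      then show "slope ?F \<in> borel_measurable m" by (rule slope_measurable_m)
    qed (use slope in auto)
    finally show "a i \<le> (\<integral>x. ((1 - 1/2) * slope (F i) x + 1/2 * slope (F j) x)\<^sup>2 \<partial>m)" .
  qed blast
  have \<epsilon>0: "\<epsilon> \<longlonglongrightarrow> 0" using LIMSEQ_inverse_real_of_nat by (simp add: \<epsilon>_def[abs_def] inverse_eq_divide)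
  have Fto: "L2_tendsto m F f" and Rto: "L2_tendsto m R r"
    using FR(1) by (auto intro!: L2_tendstoI[OF _ _ _ \<epsilon>0] f r less_imp_le simp: ok_def)
  have Gto: "L2_tendsto m (\<lambda>n. slope (F n)) G"
    using sL2(1)[OF FR(1)] G by (simp add: L2_tendsto_def)
  have "AE x in m. 0 \<le> r x - G x"
    by (rule L2_tendsto_nonneg[OF L2_tendsto_diff[OF Rto Gto]]) (use FR(1) in \<open>auto simp: ok_def\<close>)
  then have le: "AE x in m. G x \<le> r x" by eventually_elim simp
  show ?thesis
    unfolding relaxed_slope_def slope_def[symmetric]
  proof (intro conjI exI[of _ F] exI[of _ G] r G(1) le allI ballI)
    show "cheeger_approx m f F" using Fto FR(1) by (auto simp: cheeger_approx_def L2_tendsto_def ok_def)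
    show "slope (F k) \<in> L2 m" for k by (rule sL2(1)[OF FR(1)])
    show "(\<lambda>k. \<integral>x. h x * slope (F k) x \<partial>m) \<longlonglongrightarrow> (\<integral>x. h x * G x \<partial>m)" if "h \<in> L2 m" for h
      by (rule L2_inner_tendsto[OF sL2(1)[OF FR(1)] G(1) that G(2)])
  qed
qed

lemma strong_slope_interpolate:
  assumes S: "strong_slope m f r" "strong_slope m f r'"
    and h: "h \<in> LIPb" "\<And>x. 0 \<le> h x" "\<And>x. h x \<le> 1"
  shows "strong_slope m f (\<lambda>x. h x * r x + (1 - h x) * r' x)"
proof -
  obtain F R where F: "\<And>n. F n \<in> LIPb" "\<And>n x. slope (F n) x \<le> R n x" "L2_tendsto m F f" "L2_tendsto m R r"
    using strong_slopeE[OF S(1)] by blast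
  obtain F' R' where F': "\<And>n. F' n \<in> LIPb" "\<And>n x. slope (F' n) x \<le> R' n x" "L2_tendsto m F' f" "L2_tendsto m R' r'"
    using strong_slopeE[OF S(2)] by blast
  obtain L where L: "0 \<le> L" "\<And>x y. \<bar>h x - h y\<bar> \<le> L * dist x y" using LIPbE[OF h(1)] by metis
  have hm: "h \<in> borel_measurable m" "(\<lambda>x. 1 - h x) \<in> borel_measurable m" "\<And>x. \<bar>h x\<bar> \<le> 1" "\<And>x. \<bar>1 - h x\<bar> \<le> 1"
    using LIPb_measurable_m[OF h(1)] h by (auto simp: abs_le_iff intro: order_trans[of _ 0])
  define G where "G n x = h x * F n x + (1 - h x) * F' n x" for n x
  \<comment> \<open>The last term is the price of the varying cutoff. It tends to 0 because
    \<open>F\<close> and F' have the same limit \<open>f\<close>.\<close>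
  define T where "T n x = h x * R n x + (1 - h x) * R' n x + L * \<bar>F n x - F' n x\<bar>" for n x
  show ?thesis
  proof (rule strong_slopeI[of G T])
    show "G n \<in> LIPb" for n unfolding G_def[abs_def] by (intro LIPb_add LIPb_mult LIPb_diff h F F' LIPb_const)
    fix n x
    have "slope (G n) x \<le> h x * slope (F n) x + (1 - h x) * slope (F' n) x + L * \<bar>F n x - F' n x\<bar>"
      unfolding G_def[abs_def] by (intro slope_interpolate LIPb_lip_finite F F' h L)
    also have "\<dots> \<le> T n x"
      unfolding T_def using h by (intro add_mono mult_left_mono order_refl F F') auto
    finally show "slope (G n) x \<le> T n x" .
  next
    have "L2_tendsto m G (\<lambda>x. h x * f x + (1 - h x) * f x)"
      unfolding G_def[abs_def] by (intro L2_tendsto_add L2_tendsto_bounded_mult[where B=1] F F' hm)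
    then show "L2_tendsto m G f" by (simp add: algebra_simps)
    have "L2_tendsto m T (\<lambda>x. h x * r x + (1 - h x) * r' x + L * \<bar>f x - f x\<bar>)"
      unfolding T_def[abs_def]
      by (intro L2_tendsto_add L2_tendsto_bounded_mult[where B=1] L2_tendsto_cmult L2_tendsto_abs L2_tendsto_diff F F' hm)
    then show "L2_tendsto m T (\<lambda>x. h x * r x + (1 - h x) * r' x)" by simp
  qed
qed

lemma strong_slope_mult:
  assumes S: "strong_slope m f r" and h: "h \<in> LIPb" "\<And>x y. \<bar>h x - h y\<bar> \<le> L * dist x y" "0 \<le> L"
  shows "strong_slope m (\<lambda>x. h x * f x) (\<lambda>x. \<bar>h x\<bar> * r x + L * \<bar>f x\<bar>)"
proof -
  obtain F R where F: "\<And>n. F n \<in> LIPb" "\<And>n x. slope (F n) x \<le> R n x" "L2_tendsto m F f" "L2_tendsto m R r"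
    using strong_slopeE[OF S] by blast
  obtain B where B: "\<And>x. \<bar>h x\<bar> \<le> B" using LIPbE[OF h(1)] by metis
  have hm: "h \<in> borel_measurable m" "(\<lambda>x. \<bar>h x\<bar>) \<in> borel_measurable m" "\<And>x. \<bar>\<bar>h x\<bar>\<bar> \<le> B"
    using LIPb_measurable_m[OF h(1)] B by auto
  show ?thesis
  proof (rule strong_slopeI[of "\<lambda>n x. h x * F n x" "\<lambda>n x. \<bar>h x\<bar> * R n x + L * \<bar>F n x\<bar>"])
    show "(\<lambda>x. h x * F n x) \<in> LIPb" for n by (intro LIPb_mult h F)
    fix n x
    have "isCont h x" using LIPb_continuous[OF h(1)] by (simp add: continuous_on_eq_continuous_at)
    then have "slope (\<lambda>x. h x * F n x) x \<le> \<bar>h x\<bar> * slope (F n) x + \<bar>F n x\<bar> * slope h x"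
      by (intro slope_mult LIPb_lip_finite h F)
    also have "\<dots> \<le> \<bar>h x\<bar> * R n x + \<bar>F n x\<bar> * L"
      by (intro add_mono mult_left_mono F slope_le_Lipschitz h) auto
    finally show "slope (\<lambda>x. h x * F n x) x \<le> \<bar>h x\<bar> * R n x + L * \<bar>F n x\<bar>" by (simp add: mult.commute)
  next
    show "L2_tendsto m (\<lambda>n x. h x * F n x) (\<lambda>x. h x * f x)"
      by (intro L2_tendsto_bounded_mult[where B=B] F hm B)
    show "L2_tendsto m (\<lambda>n x. \<bar>h x\<bar> * R n x + L * \<bar>F n x\<bar>) (\<lambda>x. \<bar>h x\<bar> * r x + L * \<bar>f x\<bar>)"
      by (intro L2_tendsto_add L2_tendsto_cmult L2_tendsto_abs L2_tendsto_bounded_mult[where B=B] F hm)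
  qed
qed

text \<open>Mixing two slopes along a Lipschitz cutoff close to the indicator of \<open>{r < g}\<close> shows that a slope
  of minimal norm is minimal almost everywhere.\<close>

lemma minimal_relaxed_slope_le:
  assumes f: "f \<in> L2 m" and min: "minimal_relaxed_slope m f g" and S: "strong_slope m f r"
  shows "AE x in m. g x \<le> r x"
proof -
  have Sg: "strong_slope m f g"
    using min by (intro relaxed_slope_imp_strong_slope[OF f]) (simp add: minimal_relaxed_slope_def)
  have g: "g \<in> L2 m" and r: "r \<in> L2 m" using strong_slope_L2[OF Sg] strong_slope_L2[OF S] by auto
  have [measurable]: "g \<in> borel_measurable m" "r \<in> borel_measurable m" using g r L2_measurable by auto
  note int = L2_integrable_square[OF g] L2_integrable_square[OF r]
  define B where "B = {x. r x < g x}"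
  have "{x \<in> space m. r x < g x} \<in> sets m" by measurable
  then have Bm[measurable]: "B \<in> sets m" by (simp add: B_def space_m)
  define w where "w x = (g x)\<^sup>2 + (r x)\<^sup>2" for x
  have w: "integrable m w" "\<And>x. 0 \<le> w x" unfolding w_def using int by auto
  have [measurable]: "w \<in> borel_measurable m" using w by auto
  have mono: "(\<integral>x. (g x)\<^sup>2 \<partial>m) \<le> (\<integral>x. indicator (- B) x * (g x)\<^sup>2 + indicator B x * (r x)\<^sup>2 \<partial>m) + e" if e: "0 < e" for e
  proof -
    \<comment> \<open>With this density the L1 distance from \<open>h\<close> to the indicator is
      exactly the error that \<open>h\<close> causes in the mixed square integral. The measure is
      finite because g and r are square integrable.\<close>
    define \<nu> where "\<nu> = density m (\<lambda>x. ennreal (w x))"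
    have sn: "sets \<nu> = sets borel" by (simp add: \<nu>_def sets_m)
    have fin: "finite_measure \<nu>"
    proof
      have "emeasure \<nu> (space \<nu>) = (\<integral>\<^sup>+x. ennreal (w x) \<partial>m)" by (simp add: \<nu>_def emeasure_density cong: nn_integral_cong)
      also have "\<dots> = ennreal (\<integral>x. w x \<partial>m)" using w by (intro nn_integral_eq_integral) auto
      finally show "emeasure \<nu> (space \<nu>) \<noteq> \<infinity>" by simp
    qed
    have "- B \<in> sets borel" using Bm unfolding sets_m by (rule borel_comp)
    then obtain h where h: "h \<in> LIPb" "\<And>x. 0 \<le> h x" "\<And>x. h x \<le> 1" "(\<integral>x. \<bar>h x - indicator (- B) x\<bar> \<partial>\<nu>) < e"
      using Lipschitz_approx_indicator[OF sn fin _ e] by blast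
    have [measurable]: "h \<in> borel_measurable m" by (rule LIPb_measurable_m[OF h(1)])
    have [measurable]: "- B \<in> sets m" using Bm sets.compl_sets[OF Bm] space_m by (simp add: Compl_eq_Diff_UNIV)
    have dens: "(\<integral>x. \<bar>h x - indicator (- B) x\<bar> \<partial>\<nu>) = (\<integral>x. w x * \<bar>h x - indicator (- B) x\<bar> \<partial>m)"
      unfolding \<nu>_def using w(2) by (subst integral_density) auto
    have bd: "\<bar>h x - indicator (- B) x\<bar> \<le> 1" for x using h(2)[of x] h(3)[of x] by (auto simp: indicator_def)
    have iw: "integrable m (\<lambda>x. w x * \<bar>h x - indicator (- B) x\<bar>)"
    proof (rule Bochner_Integration.integrable_bound[OF w(1)])
      show "AE x in m. norm (w x * \<bar>h x - indicator (- B) x\<bar>) \<le> norm (w x)"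
        using w(2) bd by (auto simp: abs_mult intro!: mult_left_le)
    qed measurable
    have i1: "integrable m (\<lambda>x. indicator (- B) x * (g x)\<^sup>2 + indicator B x * (r x)\<^sup>2)"
    proof (rule Bochner_Integration.integrable_bound[OF w(1)])
      show "AE x in m. norm (indicator (- B) x * (g x)\<^sup>2 + indicator B x * (r x)\<^sup>2) \<le> norm (w x)"
        by (auto simp: w_def indicator_def)
    qed measurable
    have "minimal_relaxed_slope m f g" by (rule min)
    then have "(\<integral>x. (g x)\<^sup>2 \<partial>m) \<le> (\<integral>x. (h x * g x + (1 - h x) * r x)\<^sup>2 \<partial>m)"
      using strong_slope_imp_relaxed_slope[OF strong_slope_interpolate[OF Sg S h(1-3)]]
      by (simp add: minimal_relaxed_slope_def)
    also have "\<dots> \<le> (\<integral>x. (indicator (- B) x * (g x)\<^sup>2 + indicator B x * (r x)\<^sup>2) + w x * \<bar>h x - indicator (- B) x\<bar> \<partial>m)"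
    proof (rule integral_mono')
      show "integrable m (\<lambda>x. (indicator (- B) x * (g x)\<^sup>2 + indicator B x * (r x)\<^sup>2) + w x * \<bar>h x - indicator (- B) x\<bar>)"
        using i1 iw by simp
      fix x
      define t where "t = h x"
      have t: "0 \<le> t" "t \<le> 1" using h by (auto simp: t_def)
      have "t * (g x)\<^sup>2 + (1 - t) * (r x)\<^sup>2 - (t * g x + (1 - t) * r x)\<^sup>2 = t * (1 - t) * (g x - r x)\<^sup>2" by algebra
      moreover have "0 \<le> t * (1 - t) * (g x - r x)\<^sup>2" using t by simp
      ultimately have 1: "(t * g x + (1 - t) * r x)\<^sup>2 \<le> t * (g x)\<^sup>2 + (1 - t) * (r x)\<^sup>2" by linarith
      have 2: "t * (g x)\<^sup>2 + (1 - t) * (r x)\<^sup>2 \<le>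
          (indicator (- B) x * (g x)\<^sup>2 + indicator B x * (r x)\<^sup>2) + w x * \<bar>t - indicator (- B) x\<bar>"
      proof (cases "x \<in> B")
        case True
        have "0 \<le> t * (r x)\<^sup>2 + t * (r x)\<^sup>2" using t by simp
        then show ?thesis using True t by (simp add: w_def algebra_simps)
      next
        case False
        have "0 \<le> (1 - t) * (g x)\<^sup>2 + (1 - t) * (g x)\<^sup>2" using t by simp
        then show ?thesis using False t by (simp add: w_def algebra_simps)
      qed
      show "(h x * g x + (1 - h x) * r x)\<^sup>2 \<le> (indicator (- B) x * (g x)\<^sup>2 + indicator B x * (r x)\<^sup>2) + w x * \<bar>h x - indicator (- B) x\<bar>"
        using 1 2 unfolding t_def by linarith
    qed (auto simp: w_def indicator_def)
    also have "\<dots> = (\<integral>x. indicator (- B) x * (g x)\<^sup>2 + indicator B x * (r x)\<^sup>2 \<partial>m) + (\<integral>x. w x * \<bar>h x - indicator (- B) x\<bar> \<partial>m)"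
      using i1 iw by simp
    finally show ?thesis using h(4) dens by linarith
  qed
  have i1: "integrable m (\<lambda>x. indicator (- B) x * (g x)\<^sup>2 + indicator B x * (r x)\<^sup>2)"
  proof (rule Bochner_Integration.integrable_bound[OF w(1)])
    show "AE x in m. norm (indicator (- B) x * (g x)\<^sup>2 + indicator B x * (r x)\<^sup>2) \<le> norm (w x)"
      by (auto simp: w_def indicator_def)
    have "- B \<in> sets m" using Bm sets.compl_sets[OF Bm] space_m by (simp add: Compl_eq_Diff_UNIV)
    then show "(\<lambda>x. indicator (- B) x * (g x)\<^sup>2 + indicator B x * (r x)\<^sup>2) \<in> borel_measurable m" by measurable
  qed
  have eq: "indicator B x * ((g x)\<^sup>2 - (r x)\<^sup>2) = (g x)\<^sup>2 - (indicator (- B) x * (g x)\<^sup>2 + indicator B x * (r x)\<^sup>2)" for x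
    by (auto simp: indicator_def)
  have "(\<integral>x. (g x)\<^sup>2 \<partial>m) \<le> (\<integral>x. indicator (- B) x * (g x)\<^sup>2 + indicator B x * (r x)\<^sup>2 \<partial>m)"
    using mono field_le_epsilon by blast
  then have "(\<integral>x. indicator B x * ((g x)\<^sup>2 - (r x)\<^sup>2) \<partial>m) \<le> 0"
    unfolding eq using i1 int by simp
  moreover have nn: "AE x in m. 0 \<le> indicator B x * ((g x)\<^sup>2 - (r x)\<^sup>2)"
    using strong_slope_nonneg[OF S] by eventually_elim (auto simp: B_def indicator_def intro!: power_mono)
  ultimately have "(\<integral>x. indicator B x * ((g x)\<^sup>2 - (r x)\<^sup>2) \<partial>m) = 0"
    using integral_nonneg_AE by force
  moreover have "integrable m (\<lambda>x. indicator B x * ((g x)\<^sup>2 - (r x)\<^sup>2))"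
    unfolding eq using i1 int by simp
  ultimately have "AE x in m. indicator B x * ((g x)\<^sup>2 - (r x)\<^sup>2) = 0"
    using integral_nonneg_eq_0_iff_AE[OF _ nn] by simp
  then show ?thesis
    using strong_slope_nonneg[OF S]
  proof eventually_elim
    case (elim x)
    show ?case
    proof (rule ccontr)
      assume "\<not> g x \<le> r x"
      then have "x \<in> B" "(r x)\<^sup>2 < (g x)\<^sup>2" using elim(2) by (auto simp: B_def intro!: power_strict_mono)
      then show False using elim(1) by simp
    qed
  qed
qed

lemma strong_slope_imp_W12:
  assumes S: "strong_slope m f r" shows "f \<in> W12 m"
proof -
  obtain F R where F: "\<And>n. F n \<in> LIPb" "\<And>n x. slope (F n) x \<le> R n x" "L2_tendsto m F f" "L2_tendsto m R r"
    using strong_slopeE[OF S] by blast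
  have R: "R n \<in> L2 m" for n using L2_tendstoD(1)[OF F(4)] .
  have "(\<lambda>n. \<integral>x. (R n x)\<^sup>2 \<partial>m) \<longlonglongrightarrow> (\<integral>x. (r x)\<^sup>2 \<partial>m)"
    by (rule L2_square_tendsto) (use L2_tendstoD[OF F(4)] in auto)
  then have "Bseq (\<lambda>n. \<integral>x. (R n x)\<^sup>2 \<partial>m)" by (intro convergent_imp_Bseq convergentI)
  then obtain K where "\<And>n. norm (\<integral>x. (R n x)\<^sup>2 \<partial>m) \<le> K" by (auto simp: Bseq_def)
  then have K: "(\<integral>x. (R n x)\<^sup>2 \<partial>m) \<le> K" for n by (simp add: abs_le_iff)
  have app: "cheeger_approx m f F" using F L2_tendstoD[OF F(3)] by (auto simp: cheeger_approx_def)
  have le: "(\<integral>\<^sup>+x. (lip (F k) x)\<^sup>2 \<partial>m) \<le> ennreal K" for k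
  proof -
    have "(\<integral>\<^sup>+x. (lip (F k) x)\<^sup>2 \<partial>m) \<le> (\<integral>\<^sup>+x. ennreal ((R k x)\<^sup>2) \<partial>m)"
    proof (rule nn_integral_mono)
      fix x
      have "(lip (F k) x)\<^sup>2 = ennreal ((slope (F k) x)\<^sup>2)"
        unfolding ennreal_slope[OF LIPb_lip_finite[OF F(1)], of k x, symmetric] by (simp add: ennreal_power)
      also have "\<dots> \<le> ennreal ((R k x)\<^sup>2)" using F(2) by (intro ennreal_leI power_mono) auto
      finally show "(lip (F k) x)\<^sup>2 \<le> ennreal ((R k x)\<^sup>2)" .
    qed
    also have "\<dots> = ennreal (\<integral>x. (R k x)\<^sup>2 \<partial>m)"
      by (intro nn_integral_eq_integral L2_integrable_square R) auto
    also have "\<dots> \<le> ennreal K" by (intro ennreal_leI K)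
    finally show ?thesis .
  qed
  have "(INF F\<in>{F. cheeger_approx m f F}. liminf (\<lambda>k. \<integral>\<^sup>+x. (lip (F k) x)\<^sup>2 \<partial>m)) \<le> liminf (\<lambda>k. \<integral>\<^sup>+x. (lip (F k) x)\<^sup>2 \<partial>m)"
    using app by (intro INF_lower) auto
  also have "\<dots> \<le> ennreal K" by (rule Liminf_le) (simp_all add: le)
  finally have "(INF F\<in>{F. cheeger_approx m f F}. liminf (\<lambda>k. \<integral>\<^sup>+x. (lip (F k) x)\<^sup>2 \<partial>m)) < \<infinity>"
    by (auto simp: le_less_trans)
  then have "Ch m f < \<infinity>"
    unfolding Ch_def infinity_ennreal_def less_top[symmetric] by (simp add: ennreal_divide_eq_top_iff)
  then show ?thesis using strong_slope_L2[OF S] by (simp add: W12_def)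
qed

lemma strong_slope_LIPb: "f \<in> LIPb \<Longrightarrow> f \<in> L2 m \<Longrightarrow> slope f \<in> L2 m \<Longrightarrow> strong_slope m f (slope f)"
  by (rule strong_slopeI[of "\<lambda>_. f" "\<lambda>_. slope f"]) (auto intro: L2_tendsto_const)

section \<open>Functions with bounded support\<close>

lemma bounded_support_integrable:
  fixes u :: "'a \<Rightarrow> real"
  assumes "u \<in> borel_measurable m" "AE x in m. \<bar>u x\<bar> \<le> K" "AE x in m. x \<notin> ball x0 \<rho> \<longrightarrow> u x = 0"
  shows "integrable m u"
proof (rule Bochner_Integration.integrable_bound)
  show "integrable m (\<lambda>x. \<bar>K\<bar> * indicator (ball x0 \<rho>) x)"
    using finite_on_balls by (intro integrable_mult_right integrable_real_indicator) (auto simp: sets_m)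
  show "AE x in m. norm (u x) \<le> norm (\<bar>K\<bar> * indicator (ball x0 \<rho>) x)"
    using assms(2,3) by eventually_elim (auto simp: indicator_def)
qed (use assms in auto)

lemma bounded_support_L2:
  assumes "u \<in> borel_measurable m" "\<And>x. \<bar>u x\<bar> \<le> K" "\<And>x. x \<notin> ball x0 \<rho> \<Longrightarrow> u x = 0"
  shows "u \<in> L2 m"
  unfolding L2_def
proof (intro CollectI conjI assms(1) bounded_support_integrable[where K="K\<^sup>2" and ?x0.0=x0 and \<rho>=\<rho>])
  show "AE x in m. \<bar>(u x)\<^sup>2\<bar> \<le> K\<^sup>2" 
  proof (intro always_eventually allI)
    show "\<bar>(u x)\<^sup>2\<bar> \<le> K\<^sup>2" for x using power_mono[OF assms(2)[of x] abs_ge_zero, of 2] by simp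
  qed
qed (use assms in auto)

lemma strong_slope_LIPb_bounded_support:
  assumes f: "f \<in> LIPb" and supp: "\<And>x. x \<notin> ball x0 \<rho> \<Longrightarrow> f x = 0"
  shows "strong_slope m f (slope f)"
proof -
  obtain B L where B: "0 \<le> L" "\<And>x. \<bar>f x\<bar> \<le> B" "\<And>x y. \<bar>f x - f y\<bar> \<le> L * dist x y" using LIPbE[OF f] by metis
  \<comment> \<open>One unit outside the ball \<open>f\<close> vanishes on a whole neighbourhood of
    the point; on the boundary of the original ball the slope may be positive.\<close>
  have "slope f x = 0" if "x \<notin> ball x0 (\<rho> + 1)" for x
  proof -
    have "slope f x \<le> 0"
    proof (rule slope_leI)
      fix e :: real assume "0 < e"
      have "\<forall>\<^sub>F y in at x. dist y x < 1" unfolding eventually_at by (intro exI[of _ 1]) auto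
      then show "\<forall>\<^sub>F y in at x. \<bar>f y - f x\<bar> \<le> (0 + e) * dist y x"
      proof eventually_elim
        case (elim y)
        have "\<rho> + 1 \<le> dist x0 x" using that by simp
        also have "\<dots> \<le> dist x0 y + dist y x" by (rule dist_triangle)
        finally have "y \<notin> ball x0 \<rho>" "x \<notin> ball x0 \<rho>" using elim that by auto
        then show ?case using supp \<open>0 < e\<close> by simp
      qed
    qed simp
    then show ?thesis using slope_nonneg[of f x] by linarith
  qed
  then have "slope f \<in> L2 m"
    using slope_le_Lipschitz[OF B(3) B(1)]
    by (intro bounded_support_L2[where K=L and ?x0.0=x0 and \<rho>="\<rho>+1"] slope_measurable_m f) auto
  moreover have "f \<in> L2 m" by (rule bounded_support_L2[OF LIPb_measurable_m[OF f] B(2) supp])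
  ultimately show ?thesis using f by (intro strong_slope_LIPb)
qed

lemma LIPb_bounded_support_W12: "f \<in> LIPb \<Longrightarrow> (\<And>x. x \<notin> ball x0 \<rho> \<Longrightarrow> f x = 0) \<Longrightarrow> f \<in> W12 m"
  using strong_slope_LIPb_bounded_support strong_slope_imp_W12 by blast

end

section \<open>The differential\<close>

lemma (in metric_measure_space) strong_slope_lincomb:
  assumes S: "strong_slope m f r" "strong_slope m g s"
  shows "strong_slope m (\<lambda>x. a * f x + b * g x) (\<lambda>x. \<bar>a\<bar> * r x + \<bar>b\<bar> * s x)"
proof -
  obtain F R where F: "\<And>n. F n \<in> LIPb" "\<And>n x. slope (F n) x \<le> R n x" "L2_tendsto m F f" "L2_tendsto m R r"
    using strong_slopeE[OF S(1)] by blast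
  obtain G T where G: "\<And>n. G n \<in> LIPb" "\<And>n x. slope (G n) x \<le> T n x" "L2_tendsto m G g" "L2_tendsto m T s"
    using strong_slopeE[OF S(2)] by blast
  show ?thesis
  proof (rule strong_slopeI[of "\<lambda>n x. a * F n x + b * G n x" "\<lambda>n x. \<bar>a\<bar> * R n x + \<bar>b\<bar> * T n x"])
    show "(\<lambda>x. a * F n x + b * G n x) \<in> LIPb" for n by (intro LIPb_add LIPb_cmult F G)
    fix n x
    have "slope (\<lambda>x. a * F n x + b * G n x) x \<le> slope (\<lambda>x. a * F n x) x + slope (\<lambda>x. b * G n x) x"
      by (intro slope_add LIPb_lip_finite LIPb_cmult F G)
    also have "\<dots> \<le> \<bar>a\<bar> * slope (F n) x + \<bar>b\<bar> * slope (G n) x"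
      by (intro add_mono slope_cmult LIPb_lip_finite F G)
    also have "\<dots> \<le> \<bar>a\<bar> * R n x + \<bar>b\<bar> * T n x" by (intro add_mono mult_left_mono F G) auto
    finally show "slope (\<lambda>x. a * F n x + b * G n x) x \<le> \<bar>a\<bar> * R n x + \<bar>b\<bar> * T n x" .
  qed (intro L2_tendsto_add L2_tendsto_cmult F G)+
qed

lemma W12_L2: "f \<in> W12 m \<Longrightarrow> f \<in> L2 m"
  by (simp add: W12_def)

lemma Linf_const [simp]: "(\<lambda>_. c) \<in> Linf m"
  by (auto simp: Linf_def intro!: exI[of _ "\<bar>c\<bar>"])

context cotangent_module
begin

lemma d_le_strong_slope: "strong_slope m f r \<Longrightarrow> AE x in m. pnorm C (d f) x \<le> r x"
  using minimal_relaxed_slope_le strong_slope_L2(1) strong_slope_imp_W12 pnorm_d by blast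

lemma strong_slope_d: "f \<in> W12 m \<Longrightarrow> strong_slope m f (pnorm C (d f))"
  using pnorm_d[of f] by (intro relaxed_slope_imp_strong_slope W12_L2) (simp_all add: minimal_relaxed_slope_def)

lemma W12_lincomb: "f \<in> W12 m \<Longrightarrow> g \<in> W12 m \<Longrightarrow> (\<lambda>x. a * f x + b * g x) \<in> W12 m"
  using strong_slope_lincomb[OF strong_slope_d strong_slope_d] by (rule strong_slope_imp_W12)

lemma
  assumes f: "f \<in> W12 m" and h: "h \<in> LIPb" "\<And>x y. \<bar>h x - h y\<bar> \<le> L * dist x y" "0 \<le> L"
  shows W12_mult: "(\<lambda>x. h x * f x) \<in> W12 m"
    and d_mult_le: "AE x in m. pnorm C (d (\<lambda>x. h x * f x)) x \<le> \<bar>h x\<bar> * pnorm C (d f) x + L * \<bar>f x\<bar>"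
  using strong_slope_mult[OF strong_slope_d[OF f] h] strong_slope_imp_W12 d_le_strong_slope by blast+

lemma pnorm_zero_imp_zero:
  assumes "AE x in m. pnorm C w x = 0" shows "w = 0"
proof -
  have "(\<integral>x. (pnorm C w x)\<^sup>2 \<partial>m) = 0" using assms by (intro integral_eq_zero_AE) auto
  then show ?thesis using norm_eq[of w] by simp
qed

text \<open>Makes \<open>d\<close> a map on classes of functions. If f = g almost everywhere, the
  zero sequence approximates f - g in L2, so 0 is a strong slope of the difference and its
  differential has pointwise norm 0.\<close>

lemma d_cong_AE:
  assumes "f \<in> W12 m" "g \<in> W12 m" "AE x in m. f x = g x"
  shows "d f = d g"
proof -
  let ?u = "\<lambda>x. 1 * f x + (-1) * g x"
  have u: "?u \<in> L2 m" using W12_L2[OF W12_lincomb[OF assms(1,2)]] .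
  have z: "(\<lambda>_. 0) \<in> L2 m" by (simp add: L2_def)
  have "(\<integral>x. (0 - ?u x)\<^sup>2 \<partial>m) = 0" using assms(3) by (intro integral_eq_zero_AE) auto
  then have "L2_tendsto m (\<lambda>_ _. 0) ?u" using u z by (simp add: L2_tendsto_def)
  then have "strong_slope m ?u (\<lambda>_. 0)"
    by (intro strong_slopeI[of "\<lambda>_ _. 0" "\<lambda>_ _. 0"] L2_tendsto_const z) auto
  from d_le_strong_slope[OF this] pnorm_nonneg[of "d ?u"]
  have "AE x in m. pnorm C (d ?u) x = 0" by eventually_elim auto
  then have "d ?u = 0" by (rule pnorm_zero_imp_zero)
  then show ?thesis using d_linear[OF assms(1,2), of 1 "-1"] by simp
qed

lemma pnorm_d_LIPb_le:
  assumes f: "f \<in> LIPb" and supp: "\<And>x. x \<notin> ball x0 \<rho> \<Longrightarrow> f x = 0"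
  shows "AE x in m. pnorm C (d f) x \<le> slope f x"
  using d_le_strong_slope[OF strong_slope_LIPb_bounded_support[OF f supp]] .

end

section \<open>Convergence in measure\<close>

text \<open>One positive integrable weight \<open>w\<close> turns convergence in measure on all sets
  of finite measure into L1 convergence of \<open>w x * min 1 \<bar>h n x\<bar>\<close>: outside a
  large ball the integrand is at most \<open>w\<close>, whose tail is small uniformly in
  \<open>n\<close>. An L1 null sequence has a subsequence that tends to 0 almost everywhere.\<close>

lemma (in metric_measure_space) L0_null_AE_subseq:
  assumes h: "\<And>n. h n \<in> borel_measurable m"
    and lim: "\<And>A. A \<in> fin_sets m \<Longrightarrow> (\<lambda>n. L0_size m A (h n)) \<longlonglongrightarrow> 0"
  obtains r :: "nat \<Rightarrow> nat" where "strict_mono r" "AE x in m. (\<lambda>n. h (r n) x) \<longlonglongrightarrow> 0"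
proof -
  interpret sigma_finite_measure m by (rule sigma_finite)
  obtain w :: "'a \<Rightarrow> real" where w: "w \<in> borel_measurable m" "\<And>x. 0 < w x" "\<And>x. w x \<le> 1" "integrable m w"
    using obtain_positive_integrable_function by metis
  note [measurable] = h w(1)
  define B where "B k = ball (undefined :: 'a) (real k)" for k :: nat
  have Bm [measurable]: "B k \<in> sets m" for k by (simp add: B_def sets_m)
  have Bfin: "B k \<in> fin_sets m" for k using finite_on_balls by (simp add: fin_sets_def B_def sets_m)
  have int: "integrable m (\<lambda>x. w x * min 1 \<bar>h n x\<bar>)" for n
    by (rule Bochner_Integration.integrable_bound[OF w(4)]) (use w(2) in \<open>auto simp: abs_mult less_imp_le mult_left_le\<close>)
  have intB: "integrable m (\<lambda>x. indicator (- B k) x * w x)" for k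
    by (rule Bochner_Integration.integrable_bound[OF w(4)]) (auto simp: indicator_def Compl_eq_Diff_UNIV space_m[symmetric])
  have intA: "integrable m (\<lambda>x. indicator (B k) x * min 1 \<bar>h n x\<bar>)" for k n
  proof (rule Bochner_Integration.integrable_bound)
    show "integrable m (indicator (B k) :: 'a \<Rightarrow> real)" using Bfin[of k] by (simp add: fin_sets_def)
  qed (auto simp: indicator_def)
  have tail: "(\<lambda>k. \<integral>x. indicator (- B k) x * w x \<partial>m) \<longlonglongrightarrow> (\<integral>x. 0 \<partial>m)"
  proof (rule integral_dominated_convergence[where w=w])
    show "AE x in m. (\<lambda>k. indicator (- B k) x * w x) \<longlonglongrightarrow> 0"
    proof (rule AE_I2, rule tendsto_eventually)
      fix x :: 'a
      obtain K :: nat where "dist undefined x < real K" using reals_Archimedean2 by blast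
      then show "\<forall>\<^sub>F k in sequentially. indicator (- B k) x * w x = 0"
        unfolding eventually_sequentially by (intro exI[of _ K]) (auto simp: B_def)
    qed
    show "AE x in m. norm (indicator (- B k) x * w x) \<le> w x" for k
      using w(2) by (auto simp: indicator_def less_imp_le)
  qed (use w intB in auto)
  have "(\<lambda>n. \<integral>x. w x * min 1 \<bar>h n x\<bar> \<partial>m) \<longlonglongrightarrow> 0"
  proof (rule LIMSEQ_I)
    fix e :: real assume e: "0 < e"
    have "\<forall>\<^sub>F k in sequentially. (\<integral>x. indicator (- B k) x * w x \<partial>m) < e/2"
      using order_tendstoD(2)[OF tail, of "e/2"] e by simp
    then obtain k where k: "(\<integral>x. indicator (- B k) x * w x \<partial>m) < e/2"
      using eventually_happens'[OF sequentially_bot] by blast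
    have "\<forall>\<^sub>F n in sequentially. L0_size m (B k) (h n) < e/2"
      using order_tendstoD(2)[OF lim[OF Bfin], of "e/2"] e by simp
    moreover have "norm ((\<integral>x. w x * min 1 \<bar>h n x\<bar> \<partial>m) - 0) < e" if n: "L0_size m (B k) (h n) < e/2" for n
    proof -
      have "(\<integral>x. w x * min 1 \<bar>h n x\<bar> \<partial>m) \<le> (\<integral>x. indicator (B k) x * min 1 \<bar>h n x\<bar> + indicator (- B k) x * w x \<partial>m)"
      proof (rule integral_mono[OF int])
        show "integrable m (\<lambda>x. indicator (B k) x * min 1 \<bar>h n x\<bar> + indicator (- B k) x * w x)"
          using intA intB by simp
        fix x
        have "w x * min 1 \<bar>h n x\<bar> \<le> min 1 \<bar>h n x\<bar>" using w(2,3)[of x] by (intro mult_left_le_one_le) (auto simp: less_imp_le)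
        moreover have "w x * min 1 \<bar>h n x\<bar> \<le> w x" using w(2)[of x] by (intro mult_left_le) (auto simp: less_imp_le)
        ultimately show "w x * min 1 \<bar>h n x\<bar> \<le> indicator (B k) x * min 1 \<bar>h n x\<bar> + indicator (- B k) x * w x"
          by (auto simp: indicator_def)
      qed
      also have "\<dots> = L0_size m (B k) (h n) + (\<integral>x. indicator (- B k) x * w x \<partial>m)"
        using intA intB by (simp add: L0_size_def set_lebesgue_integral_def)
      finally have "(\<integral>x. w x * min 1 \<bar>h n x\<bar> \<partial>m) < e" using n k by linarith
      moreover have "0 \<le> (\<integral>x. w x * min 1 \<bar>h n x\<bar> \<partial>m)"
        using w(2) by (intro Bochner_Integration.integral_nonneg) (auto simp: less_imp_le)
      ultimately show ?thesis by simp
    qed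
    ultimately have "\<forall>\<^sub>F n in sequentially. norm ((\<integral>x. w x * min 1 \<bar>h n x\<bar> \<partial>m) - 0) < e"
      by (auto elim: eventually_mono)
    then show "\<exists>no. \<forall>n\<ge>no. norm ((\<integral>x. w x * min 1 \<bar>h n x\<bar> \<partial>m) - 0) < e" by (simp add: eventually_sequentially)
  qed
  moreover have "(\<integral>x. norm (w x * min 1 \<bar>h n x\<bar>) \<partial>m) = (\<integral>x. w x * min 1 \<bar>h n x\<bar> \<partial>m)" for n
    using w(2) by (intro Bochner_Integration.integral_cong) (auto simp: less_imp_le abs_mult)
  ultimately have "(\<lambda>n. \<integral>x. norm (w x * min 1 \<bar>h n x\<bar>) \<partial>m) \<longlonglongrightarrow> 0" by simp
  from tendsto_L1_AE_subseq[OF int this] obtain r where r: "strict_mono r"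
    "AE x in m. (\<lambda>n. w x * min 1 \<bar>h (r n) x\<bar>) \<longlonglongrightarrow> 0" by blast
  have "AE x in m. (\<lambda>n. h (r n) x) \<longlonglongrightarrow> 0"
    using r(2)
  proof eventually_elim
    case (elim x)
    have "(\<lambda>n. (1 / w x) * (w x * min 1 \<bar>h (r n) x\<bar>)) \<longlonglongrightarrow> (1 / w x) * 0" by (intro tendsto_mult_left elim)
    moreover have "(\<lambda>n. (1 / w x) * (w x * min 1 \<bar>h (r n) x\<bar>)) = (\<lambda>n. min 1 \<bar>h (r n) x\<bar>)"
      using w(2)[of x] by (auto simp: fun_eq_iff)
    ultimately have lim: "(\<lambda>n. min 1 \<bar>h (r n) x\<bar>) \<longlonglongrightarrow> 0" by simp
    have "\<forall>\<^sub>F n in sequentially. min 1 \<bar>h (r n) x\<bar> < 1" using order_tendstoD(2)[OF lim, of 1] by simp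
    then have "\<forall>\<^sub>F n in sequentially. min 1 \<bar>h (r n) x\<bar> = \<bar>h (r n) x\<bar>" by eventually_elim auto
    then have "(\<lambda>n. \<bar>h (r n) x\<bar>) \<longlonglongrightarrow> 0" using lim by (rule Lim_transform_eventually[rotated])
    then show ?case by (rule tendsto_rabs_zero_cancel)
  qed
  with r(1) show ?thesis by (rule that)
qed

lemma (in metric_measure_space) AE_null_imp_L0_null:
  assumes h: "\<And>n. h n \<in> borel_measurable m" and lim: "AE x in m. (\<lambda>n. h n x) \<longlonglongrightarrow> 0"
    and A: "A \<in> fin_sets m"
  shows "(\<lambda>n. L0_size m A (h n)) \<longlonglongrightarrow> 0"
proof -
  note [measurable] = h
  have Am [measurable]: "A \<in> sets m" "emeasure m A < \<infinity>" using A by (auto simp: fin_sets_def)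
  have "(\<lambda>n. \<integral>x. indicator A x * min 1 \<bar>h n x\<bar> \<partial>m) \<longlonglongrightarrow> (\<integral>x. 0 \<partial>m)"
  proof (rule integral_dominated_convergence[where w="indicator A"])
    show "AE x in m. (\<lambda>n. indicator A x * min 1 \<bar>h n x\<bar>) \<longlonglongrightarrow> 0"
      using lim
    proof eventually_elim
      case (elim x)
      have "(\<lambda>n. indicator A x * min 1 \<bar>h n x\<bar>) \<longlonglongrightarrow> indicator A x * min 1 \<bar>0 :: real\<bar>" by (intro tendsto_intros elim)
      then show ?case by simp
    qed
  qed (use Am in \<open>auto simp: indicator_def\<close>)
  then show ?thesis by (simp add: L0_size_def set_lebesgue_integral_def)
qed

section \<open>The pairing of one-forms and vector fields\<close>

context tangent_L0
begin

lemma L2TX_D: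
  assumes "T \<in> L2TX m C"
  shows "integrable m (T w)" "AE x in m. T (w + w') x = T w x + T w' x"
    "f \<in> Linf m \<Longrightarrow> AE x in m. T (scal C f w) x = f x * T w x"
  using assms by (auto simp: L2TX_def)

lemma L2TX_scaleR: "T \<in> L2TX m C \<Longrightarrow> AE x in m. T (c *\<^sub>R w) x = c * T w x"
  using L2TX_D(3)[of T "\<lambda>_. c" w] by (simp add: scal_const)

lemma L2TX_zero: "T \<in> L2TX m C \<Longrightarrow> AE x in m. T 0 x = 0"
  using L2TX_scaleR[of T 0 0] by simp

lemma L2TX_add:
  assumes S: "S \<in> L2TX m C" and T: "T \<in> L2TX m C" shows "(\<lambda>w x. S w x + T w x) \<in> L2TX m C"
proof -
  obtain K1 K2 where K: "\<And>w. (\<integral>x. \<bar>S w x\<bar> \<partial>m) \<le> K1 * norm w" "\<And>w. (\<integral>x. \<bar>T w x\<bar> \<partial>m) \<le> K2 * norm w"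
    using S T by (auto simp: L2TX_def)
  have "(\<integral>x. \<bar>S w x + T w x\<bar> \<partial>m) \<le> (K1 + K2) * norm w" for w
  proof -
    have "(\<integral>x. \<bar>S w x + T w x\<bar> \<partial>m) \<le> (\<integral>x. \<bar>S w x\<bar> + \<bar>T w x\<bar> \<partial>m)"
      using L2TX_D(1)[OF S] L2TX_D(1)[OF T] by (intro integral_mono) auto
    also have "\<dots> = (\<integral>x. \<bar>S w x\<bar> \<partial>m) + (\<integral>x. \<bar>T w x\<bar> \<partial>m)"
      using L2TX_D(1)[OF S] L2TX_D(1)[OF T] by simp
    finally show ?thesis using K[of w] by (simp add: distrib_right)
  qed
  moreover have "AE x in m. S (w + w') x + T (w + w') x = S w x + T w x + (S w' x + T w' x)" for w w'
    using L2TX_D(2)[OF S, of w w'] L2TX_D(2)[OF T, of w w'] by eventually_elim simp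
  moreover have "AE x in m. S (scal C f w) x + T (scal C f w) x = f x * (S w x + T w x)" if "f \<in> Linf m" for f w
    using L2TX_D(3)[OF S that, of w] L2TX_D(3)[OF T that, of w] by eventually_elim (simp add: distrib_left)
  ultimately show ?thesis unfolding L2TX_def using L2TX_D(1)[OF S] L2TX_D(1)[OF T] by auto
qed

lemma Linf_mult_integrable:
  assumes "f \<in> Linf m" "integrable m u" shows "integrable m (\<lambda>x. f x * u x)"
proof -
  obtain K where f: "f \<in> borel_measurable m" "AE x in m. \<bar>f x\<bar> \<le> K" using assms by (auto simp: Linf_def)
  show ?thesis
  proof (rule Bochner_Integration.integrable_bound)
    show "integrable m (\<lambda>x. K * \<bar>u x\<bar>)" using assms by simp
    show "AE x in m. norm (f x * u x) \<le> norm (K * \<bar>u x\<bar>)"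
      using f(2) by eventually_elim (auto simp: abs_mult intro!: mult_right_mono)
  qed (use f assms in auto)
qed

lemma L2TX_scal:
  assumes h: "h \<in> Linf m" and T: "T \<in> L2TX m C" shows "(\<lambda>w x. h x * T w x) \<in> L2TX m C"
proof -
  obtain B where B: "AE x in m. \<bar>h x\<bar> \<le> B" using h by (auto simp: Linf_def)
  obtain K where K: "\<And>w. (\<integral>x. \<bar>T w x\<bar> \<partial>m) \<le> K * norm w" using T by (auto simp: L2TX_def)
  have int: "integrable m (\<lambda>x. h x * T w x)" for w by (rule Linf_mult_integrable[OF h L2TX_D(1)[OF T]])
  have "(\<integral>x. \<bar>h x * T w x\<bar> \<partial>m) \<le> (\<bar>B\<bar> * K) * norm w" for w
  proof -
    have "(\<integral>x. \<bar>h x * T w x\<bar> \<partial>m) \<le> (\<integral>x. \<bar>B\<bar> * \<bar>T w x\<bar> \<partial>m)"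
    proof (rule integral_mono_AE)
      show "AE x in m. \<bar>h x * T w x\<bar> \<le> \<bar>B\<bar> * \<bar>T w x\<bar>"
        using B by eventually_elim (auto simp: abs_mult intro!: mult_right_mono)
    qed (use int L2TX_D(1)[OF T] in auto)
    also have "\<dots> \<le> \<bar>B\<bar> * (K * norm w)" using K[of w] by (auto intro!: mult_left_mono)
    finally show ?thesis by simp
  qed
  moreover have "AE x in m. h x * T (w + w') x = h x * T w x + h x * T w' x" for w w'
    using L2TX_D(2)[OF T, of w w'] by eventually_elim (simp add: distrib_left)
  moreover have "AE x in m. h x * T (scal C f w) x = f x * (h x * T w x)" if "f \<in> Linf m" for f w
    using L2TX_D(3)[OF T that, of w] by eventually_elim simp
  ultimately show ?thesis unfolding L2TX_def using int by auto
qed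

lemma L2TX_diff:
  assumes S: "S \<in> L2TX m C" and T: "T \<in> L2TX m C"
  shows "(\<lambda>w x. S w x - T w x) \<in> L2TX m C" "\<iota> (\<lambda>w x. S w x - T w x) = \<iota> S - \<iota> T"
proof -
  have T': "(\<lambda>w x. -1 * T w x) \<in> L2TX m C" using L2TX_scal[OF Linf_const T] .
  show "(\<lambda>w x. S w x - T w x) \<in> L2TX m C" using L2TX_add[OF S T'] by simp
  show "\<iota> (\<lambda>w x. S w x - T w x) = \<iota> S - \<iota> T"
    using \<iota>_add[OF S T'] \<iota>_scal[OF Linf_const T, of "-1"] by (simp add: L0.scal_const)
qed

text \<open>The definition of the pointwise norm of \<open>T\<close> only tests one-forms of norm at most \<open>1\<close>; a general
  one-form is normalised where it is not small.\<close>

lemma L2TX_bound: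
  assumes T: "T \<in> L2TX m C"
  shows "AE x in m. \<bar>T w x\<bar> \<le> pnorm E (\<iota> T) x * pnorm C w x"
proof -
  define p where "p = pnorm C w"
  have [measurable]: "p \<in> borel_measurable m" using pnorm_L2[of w] L2_measurable by (auto simp: p_def)
  have p0: "AE x in m. 0 \<le> p x" using pnorm_nonneg by (simp add: p_def)
  define f where "f k x = (if p x > 1 / real (Suc k) then 1 / p x else 0)" for k :: nat and x
  have f: "f k \<in> Linf m" for k
    unfolding Linf_def
  proof (intro CollectI conjI exI always_eventually allI)
    show "f k \<in> borel_measurable m" unfolding f_def by measurable
    fix x
    have "1 / p x \<le> real (Suc k)" if "1 / real (Suc k) < p x"
    proof -
      have "0 < p x" using that by (rule less_trans[rotated]) simp
      then show ?thesis using that by (simp add: field_simps)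
    qed
    moreover have "0 < p x" if "1 / real (Suc k) < p x" using that by (rule less_trans[rotated]) simp
    ultimately show "\<bar>f k x\<bar> \<le> real (Suc k)" by (auto simp: f_def)
  qed
  have bound: "AE x in m. \<bar>f k x * T w x\<bar> \<le> pnorm E (\<iota> T) x" for k
  proof -
    have "AE x in m. pnorm C (scal C (f k) w) x \<le> 1"
      using pnorm_scal[OF f[of k], of w] p0
      by eventually_elim (auto simp: f_def p_def[symmetric] abs_mult divide_simps)
    then have "AE x in m. \<bar>T (scal C (f k) w) x\<bar> \<le> pnorm E (\<iota> T) x"
      using \<iota>_pnorm[OF T] by (simp add: dual_pnorm_def Let_def)
    then show ?thesis using L2TX_D(3)[OF T f, of k w] by eventually_elim simp
  qed
  define z where "z x = (if p x = 0 then 1 else 0 :: real)" for x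
  have z: "z \<in> Linf m" unfolding Linf_def z_def by (auto intro!: exI[of _ 1])
  have "AE x in m. pnorm C (scal C z w) x = 0"
    using pnorm_scal[OF z, of w] by eventually_elim (auto simp: z_def p_def)
  then have "scal C z w = 0" by (rule pnorm_zero_imp_zero)
  then have zero: "AE x in m. z x * T w x = 0"
    using L2TX_D(3)[OF T z, of w] L2TX_zero[OF T] by (auto elim: AE_mp)
  have "AE x in m. \<forall>k. \<bar>f k x * T w x\<bar> \<le> pnorm E (\<iota> T) x" using bound by (simp add: AE_all_countable)
  then show ?thesis
    using zero p0
  proof eventually_elim
    case (elim x)
    show ?case
    proof (cases "p x = 0")
      case True
      then show ?thesis using elim(2) by (simp add: z_def p_def)
    next
      case False
      then have pos: "0 < p x" using elim(3) by simp
      then obtain k where "inverse (real (Suc k)) < p x" using reals_Archimedean by blast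
      then have "f k x = 1 / p x" by (simp add: f_def inverse_eq_divide)
      then have "\<bar>T w x\<bar> / p x \<le> pnorm E (\<iota> T) x" using elim(1) pos by (auto dest!: spec[of _ k] simp: abs_mult)
      then show ?thesis using pos by (simp add: p_def pos_divide_le_eq)
    qed
  qed
qed

lemma pnorm_E_uminus: "AE x in m. pnorm E (- v) x = pnorm E v x"
  using L0.pnorm_scal[of "\<lambda>_. -1" v] by (simp add: L0.scal_const)

lemma pnorm_E_zero: "AE x in m. pnorm E 0 x = 0"
  using L0.pnorm_scal[of "\<lambda>_. 0" 0] by (simp add: L0.scal_const)

lemma pnorm_E_diff: "AE x in m. pnorm E (u - v) x \<le> pnorm E (u - z) x + pnorm E (v - z) x"
proof -
  have "AE x in m. pnorm E ((u - z) + (z - v)) x \<le> pnorm E (u - z) x + pnorm E (z - v) x"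
    by (rule L0.pnorm_triangle)
  moreover have "AE x in m. pnorm E (- (v - z)) x = pnorm E (v - z) x" by (rule pnorm_E_uminus)
  ultimately show ?thesis by eventually_elim simp
qed

text \<open>Convergence almost everywhere in place of convergence in measure, so that algebraic
  identities for pairings pass to the limit point by point. A subsequence of any L0 approximation
  provides it.\<close>

definition approx_field :: "(nat \<Rightarrow> 'v \<Rightarrow> 'a \<Rightarrow> real) \<Rightarrow> 'w \<Rightarrow> bool" where
  "approx_field T v \<longleftrightarrow> (\<forall>n. T n \<in> L2TX m C) \<and> (AE x in m. (\<lambda>n. pnorm E (\<iota> (T n) - v) x) \<longlonglongrightarrow> 0)"

lemma approx_fieldD:
  "approx_field T v \<Longrightarrow> T n \<in> L2TX m C"
  "approx_field T v \<Longrightarrow> AE x in m. (\<lambda>n. pnorm E (\<iota> (T n) - v) x) \<longlonglongrightarrow> 0"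
  by (auto simp: approx_field_def)

lemma L0mod_tendsto_approx_field:
  assumes "\<And>n. T n \<in> L2TX m C" "L0mod_tendsto m E (\<lambda>n. \<iota> (T n)) v"
  obtains r :: "nat \<Rightarrow> nat" where "strict_mono r" "approx_field (T \<circ> r) v"
proof -
  obtain r :: "nat \<Rightarrow> nat" where "strict_mono r" "AE x in m. (\<lambda>n. pnorm E (\<iota> (T (r n)) - v) x) \<longlonglongrightarrow> 0"
    using L0_null_AE_subseq[of "\<lambda>n. pnorm E (\<iota> (T n) - v)"] assms(2) L0.pnorm_measurable
    unfolding L0mod_tendsto_def by blast
  then show ?thesis using assms(1) by (intro that[of r]) (auto simp: approx_field_def)
qed

lemma approx_field_exists: obtains T where "approx_field T v"
  using \<iota>_dense[of v] L0mod_tendsto_approx_field by metis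

lemma approx_field_difference:
  assumes S: "approx_field S v" and T: "approx_field T v"
  shows "AE x in m. \<forall>n k. \<bar>S n w x - T k w x\<bar> \<le> (pnorm E (\<iota> (S n) - v) x + pnorm E (\<iota> (T k) - v) x) * pnorm C w x"
proof -
  have "AE x in m. \<bar>S n w x - T k w x\<bar> \<le> (pnorm E (\<iota> (S n) - v) x + pnorm E (\<iota> (T k) - v) x) * pnorm C w x" for n k
    using L2TX_bound[OF L2TX_diff(1)[OF approx_fieldD(1)[OF S, of n] approx_fieldD(1)[OF T, of k]], of w]
      pnorm_E_diff[of "\<iota> (S n)" "\<iota> (T k)" v] pnorm_nonneg[of w]
    unfolding L2TX_diff(2)[OF approx_fieldD(1)[OF S, of n] approx_fieldD(1)[OF T, of k]]
    by eventually_elim (meson mult_right_mono order_trans)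
  then show ?thesis by (simp add: AE_all_countable)
qed

text \<open>\<open>pairing\<close> is a choice made through some approximating sequence
  \<open>S\<close>. The difference of \<open>S k w\<close> and \<open>T n w\<close> is at most the
  sum of the distances of the two fields to \<open>v\<close>, times the norm of \<open>w\<close>.
  Hence every approximation has the same limit, and all later properties can be read off from a
  convenient \<open>T\<close>.\<close>

lemma pairing_limit:
  assumes T: "approx_field T v"
  shows "pairing m C E \<iota> w v \<in> borel_measurable m"
    and "AE x in m. (\<lambda>n. T n w x) \<longlonglongrightarrow> pairing m C E \<iota> w v x"
proof -
  have Tm [measurable]: "T n w \<in> borel_measurable m" for n using L2TX_D(1)[OF approx_fieldD(1)[OF T]] by auto
  define g where "g x = lim (\<lambda>n. T n w x)" for x
  have [measurable]: "g \<in> borel_measurable m" unfolding g_def by measurable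
  have "AE x in m. Cauchy (\<lambda>n. T n w x)"
    using approx_field_difference[OF T T, of w] approx_fieldD(2)[OF T] pnorm_nonneg[of w]
  proof eventually_elim
    case (elim x)
    define q where "q n = pnorm E (\<iota> (T n) - v) x" for n
    have q: "q \<longlonglongrightarrow> 0" using elim(2) by (simp add: q_def[abs_def])
    show ?case
    proof (rule CauchyI)
      fix e :: real assume e: "0 < e"
      define P where "P = pnorm C w x + 1"
      have P: "0 < P" "pnorm C w x \<le> P" using elim(3) by (auto simp: P_def)
      obtain N where N: "\<And>n. n \<ge> N \<Longrightarrow> norm (q n - 0) < e / (2 * P)"
        using LIMSEQ_D[OF q, of "e / (2 * P)"] e P by auto
      have "norm (T i w x - T j w x) < e" if ij: "i \<ge> N" "j \<ge> N" for i j
      proof -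
        have "\<bar>T i w x - T j w x\<bar> \<le> (q i + q j) * pnorm C w x" using elim(1) by (simp add: q_def)
        also have "\<dots> \<le> (\<bar>q i\<bar> + \<bar>q j\<bar>) * P" using P(2) elim(3) by (intro mult_mono) auto
        also have "\<dots> < (e / (2 * P) + e / (2 * P)) * P"
          using N[OF ij(1)] N[OF ij(2)] P by (intro mult_strict_right_mono add_strict_mono) auto
        also have "\<dots> = e" using P by simp
        finally show ?thesis by simp
      qed
      then show "\<exists>M. \<forall>m\<ge>M. \<forall>n\<ge>M. norm (T m w x - T n w x) < e" by blast
    qed
  qed
  then have lim: "AE x in m. (\<lambda>n. T n w x) \<longlonglongrightarrow> g x"
    by eventually_elim (simp add: g_def Cauchy_convergent_iff convergent_LIMSEQ_iff)
  have "L0_tendsto m (\<lambda>n. T n w) g"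
    unfolding L0_tendsto_def
  proof (intro ballI AE_null_imp_L0_null)
    show "AE x in m. (\<lambda>n. T n w x - g x) \<longlonglongrightarrow> 0" using lim by eventually_elim (simp add: LIM_zero_iff)
  qed measurable
  moreover have "L0mod_tendsto m E (\<lambda>n. \<iota> (T n)) v"
    unfolding L0mod_tendsto_def
    by (intro ballI AE_null_imp_L0_null approx_fieldD[OF T] L0.pnorm_measurable)
  ultimately have "\<exists>g. g \<in> borel_measurable m \<and>
     (\<exists>T. (\<forall>n. T n \<in> L2TX m C) \<and> L0mod_tendsto m E (\<lambda>n. \<iota> (T n)) v \<and> L0_tendsto m (\<lambda>n. T n w) g)"
    using approx_fieldD(1)[OF T] by (intro exI[of _ g] conjI exI[of _ T]) auto
  from someI_ex[OF this] obtain S where p: "pairing m C E \<iota> w v \<in> borel_measurable m"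
    and S: "\<And>n. S n \<in> L2TX m C" "L0mod_tendsto m E (\<lambda>n. \<iota> (S n)) v" "L0_tendsto m (\<lambda>n. S n w) (pairing m C E \<iota> w v)"
    unfolding pairing_def[symmetric] by blast
  show "pairing m C E \<iota> w v \<in> borel_measurable m" by (rule p)
  obtain r :: "nat \<Rightarrow> nat" where r: "strict_mono r" "approx_field (S \<circ> r) v"
    using L0mod_tendsto_approx_field[OF S(1,2)] by blast
  have Sm: "S n w \<in> borel_measurable m" for n using L2TX_D(1)[OF S(1)] by auto
  \<comment> \<open>Along \<open>r\<close> the fields converge almost everywhere; the second
    extraction makes their pairings with \<open>w\<close> converge as well.\<close>
  obtain r' :: "nat \<Rightarrow> nat" where r': "strict_mono r'" "AE x in m. (\<lambda>n. S (r (r' n)) w x - pairing m C E \<iota> w v x) \<longlonglongrightarrow> 0"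
  proof (rule L0_null_AE_subseq[of "\<lambda>n x. S (r n) w x - pairing m C E \<iota> w v x"])
    show "(\<lambda>x. S (r n) w x - pairing m C E \<iota> w v x) \<in> borel_measurable m" for n using Sm p by simp
    show "(\<lambda>n. L0_size m A (\<lambda>x. S (r n) w x - pairing m C E \<iota> w v x)) \<longlonglongrightarrow> 0" if "A \<in> fin_sets m" for A
      using LIMSEQ_subseq_LIMSEQ[OF S(3)[unfolded L0_tendsto_def, rule_format, OF that] r(1)] by (simp add: o_def)
  qed blast
  show "AE x in m. (\<lambda>n. T n w x) \<longlonglongrightarrow> pairing m C E \<iota> w v x"
    using approx_field_difference[OF T r(2), of w] approx_fieldD(2)[OF T] approx_fieldD(2)[OF r(2)] r'(2)
  proof eventually_elim
    case (elim x)
    have 1: "(\<lambda>n. pnorm E (\<iota> (S (r (r' n))) - v) x) \<longlonglongrightarrow> 0"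
      using LIMSEQ_subseq_LIMSEQ[OF elim(3) r'(1)] by (simp add: o_def)
    have "(\<lambda>n. T n w x - S (r (r' n)) w x) \<longlonglongrightarrow> 0"
    proof (rule Lim_null_comparison)
      show "\<forall>\<^sub>F n in sequentially. norm (T n w x - S (r (r' n)) w x)
          \<le> (pnorm E (\<iota> (T n) - v) x + pnorm E (\<iota> (S (r (r' n))) - v) x) * pnorm C w x"
        using elim(1) by (auto simp: o_def)
      show "(\<lambda>n. (pnorm E (\<iota> (T n) - v) x + pnorm E (\<iota> (S (r (r' n))) - v) x) * pnorm C w x) \<longlonglongrightarrow> 0"
        using tendsto_mult_right[OF tendsto_add[OF elim(2) 1], of "pnorm C w x"] by simp
    qed
    from tendsto_add[OF this elim(4)] have "(\<lambda>n. T n w x - pairing m C E \<iota> w v x) \<longlonglongrightarrow> 0" by simp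
    then show ?case by (simp add: LIM_zero_iff)
  qed
qed

lemma pairing_measurable [measurable]: "pairing m C E \<iota> w v \<in> borel_measurable m"
  using approx_field_exists pairing_limit(1) by metis

lemma pairing_bound: "AE x in m. \<bar>pairing m C E \<iota> w v x\<bar> \<le> pnorm E v x * pnorm C w x"
proof -
  obtain T where T: "approx_field T v" by (rule approx_field_exists)
  have b: "AE x in m. \<forall>n. \<bar>T n w x\<bar> \<le> (pnorm E v x + pnorm E (\<iota> (T n) - v) x) * pnorm C w x"
    unfolding AE_all_countable
  proof
    fix n
    show "AE x in m. \<bar>T n w x\<bar> \<le> (pnorm E v x + pnorm E (\<iota> (T n) - v) x) * pnorm C w x"
      using L2TX_bound[OF approx_fieldD(1)[OF T, of n], of w] L0.pnorm_triangle[of v "\<iota> (T n) - v"] pnorm_nonneg[of w]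
    proof eventually_elim
      case (elim x)
      have "pnorm E (\<iota> (T n)) x * pnorm C w x \<le> (pnorm E v x + pnorm E (\<iota> (T n) - v) x) * pnorm C w x"
        using elim by (intro mult_right_mono) auto
      then show ?case using elim by linarith
    qed
  qed
  show ?thesis
    using b pairing_limit(2)[OF T, of w] approx_fieldD(2)[OF T]
  proof eventually_elim
    case (elim x)
    have "(\<lambda>n. \<bar>T n w x\<bar>) \<longlonglongrightarrow> \<bar>pairing m C E \<iota> w v x\<bar>" by (intro tendsto_intros elim)
    moreover have "(\<lambda>n. (pnorm E v x + pnorm E (\<iota> (T n) - v) x) * pnorm C w x) \<longlonglongrightarrow> (pnorm E v x + 0) * pnorm C w x"
      by (intro tendsto_intros elim)
    ultimately show ?case using elim(1) by (auto intro: LIMSEQ_le)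
  qed
qed

lemma pairing_add_left: "AE x in m. pairing m C E \<iota> (w + w') v x = pairing m C E \<iota> w v x + pairing m C E \<iota> w' v x"
proof -
  obtain T where T: "approx_field T v" by (rule approx_field_exists)
  have "AE x in m. \<forall>n. T n (w + w') x = T n w x + T n w' x"
    unfolding AE_all_countable using L2TX_D(2)[OF approx_fieldD(1)[OF T]] by blast
  then show ?thesis
    using pairing_limit(2)[OF T, of w] pairing_limit(2)[OF T, of w'] pairing_limit(2)[OF T, of "w + w'"]
  proof eventually_elim
    case (elim x)
    from LIMSEQ_unique[OF elim(4)] tendsto_add[OF elim(2,3)] elim(1) show ?case by simp
  qed
qed

lemma pairing_scaleR_left: "AE x in m. pairing m C E \<iota> (c *\<^sub>R w) v x = c * pairing m C E \<iota> w v x"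
proof -
  obtain T where T: "approx_field T v" by (rule approx_field_exists)
  have "AE x in m. \<forall>n. T n (c *\<^sub>R w) x = c * T n w x"
    unfolding AE_all_countable using L2TX_scaleR[OF approx_fieldD(1)[OF T]] by blast
  then show ?thesis
    using pairing_limit(2)[OF T, of w] pairing_limit(2)[OF T, of "c *\<^sub>R w"]
  proof eventually_elim
    case (elim x)
    from LIMSEQ_unique[OF elim(3)] tendsto_mult_left[OF elim(2), of c] elim(1) show ?case by simp
  qed
qed

lemma pairing_add_right: "AE x in m. pairing m C E \<iota> w (v + v') x = pairing m C E \<iota> w v x + pairing m C E \<iota> w v' x"
proof -
  obtain S where S: "approx_field S v" by (rule approx_field_exists)
  obtain T where T: "approx_field T v'" by (rule approx_field_exists)
  let ?U = "\<lambda>n w x. S n w x + T n w x"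
  have U: "approx_field ?U (v + v')"
    unfolding approx_field_def
  proof (intro conjI allI L2TX_add approx_fieldD(1)[OF S] approx_fieldD(1)[OF T])
    have "AE x in m. \<forall>n. pnorm E (\<iota> (?U n) - (v + v')) x \<le> pnorm E (\<iota> (S n) - v) x + pnorm E (\<iota> (T n) - v') x"
      unfolding AE_all_countable
    proof
      fix n
      have eq: "\<iota> (?U n) - (v + v') = (\<iota> (S n) - v) + (\<iota> (T n) - v')"
        using \<iota>_add[OF approx_fieldD(1)[OF S, of n] approx_fieldD(1)[OF T, of n]] by simp
      show "AE x in m. pnorm E (\<iota> (?U n) - (v + v')) x \<le> pnorm E (\<iota> (S n) - v) x + pnorm E (\<iota> (T n) - v') x"
        unfolding eq by (rule L0.pnorm_triangle)
    qed
    moreover have "AE x in m. \<forall>n. 0 \<le> pnorm E (\<iota> (?U n) - (v + v')) x"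
      unfolding AE_all_countable using L0.pnorm_nonneg by blast
    ultimately show "AE x in m. (\<lambda>n. pnorm E (\<iota> (?U n) - (v + v')) x) \<longlonglongrightarrow> 0"
      using approx_fieldD(2)[OF S] approx_fieldD(2)[OF T]
    proof eventually_elim
      case (elim x)
      show ?case
      proof (rule tendsto_sandwich[OF _ _ tendsto_const])
        show "(\<lambda>n. pnorm E (\<iota> (S n) - v) x + pnorm E (\<iota> (T n) - v') x) \<longlonglongrightarrow> 0"
          using tendsto_add[OF elim(3,4)] by simp
      qed (use elim in auto)
    qed
  qed
  show ?thesis
    using pairing_limit(2)[OF S, of w] pairing_limit(2)[OF T, of w] pairing_limit(2)[OF U, of w]
  proof eventually_elim
    case (elim x)
    from LIMSEQ_unique[OF elim(3) tendsto_add[OF elim(1,2)]] show ?case .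
  qed
qed

lemma pairing_scal_right:
  assumes h: "h \<in> Linf m"
  shows "AE x in m. pairing m C E \<iota> w (scal E h v) x = h x * pairing m C E \<iota> w v x"
proof -
  obtain T where T: "approx_field T v" by (rule approx_field_exists)
  have hm: "h \<in> borel_measurable m" using h by (simp add: Linf_def)
  let ?U = "\<lambda>n w x. h x * T n w x"
  have U: "approx_field ?U (scal E h v)"
    unfolding approx_field_def
  proof (intro conjI allI L2TX_scal h approx_fieldD(1)[OF T])
    have "AE x in m. \<forall>n. pnorm E (\<iota> (?U n) - scal E h v) x = \<bar>h x\<bar> * pnorm E (\<iota> (T n) - v) x"
      unfolding AE_all_countable
    proof
      fix n
      have "scal E h (\<iota> (T n) - v) + scal E h v = scal E h (\<iota> (T n))"
        using L0.scal_add_right[OF hm, of "\<iota> (T n) - v" v] by simp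
      then have "\<iota> (?U n) - scal E h v = scal E h (\<iota> (T n) - v)"
        using \<iota>_scal[OF h approx_fieldD(1)[OF T, of n]] by (simp add: algebra_simps)
      then show "AE x in m. pnorm E (\<iota> (?U n) - scal E h v) x = \<bar>h x\<bar> * pnorm E (\<iota> (T n) - v) x"
        using L0.pnorm_scal[OF hm, of "\<iota> (T n) - v"] by simp
    qed
    then show "AE x in m. (\<lambda>n. pnorm E (\<iota> (?U n) - scal E h v) x) \<longlonglongrightarrow> 0"
      using approx_fieldD(2)[OF T] by eventually_elim (simp add: tendsto_mult_right_zero)
  qed
  show ?thesis
    using pairing_limit(2)[OF T, of w] pairing_limit(2)[OF U, of w]
  proof eventually_elim
    case (elim x)
    from LIMSEQ_unique[OF elim(2) tendsto_mult_left[OF elim(1)]] show ?case .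
  qed
qed

end

section \<open>Bounded vector fields and their divergence\<close>

text \<open>Allows a constant in an almost everywhere inequality to be optimised at each point:
  rational constants cost only countably many null sets, and the value of a function at the point is
  then approximated by them.\<close>

lemma le_of_rat_approx:
  fixes a b c t :: real
  assumes "\<And>q :: rat. a \<le> b + \<bar>t - of_rat q\<bar> * c" shows "a \<le> b"
proof (rule field_le_epsilon)
  fix e :: real assume e: "0 < e"
  define d where "d = e / (\<bar>c\<bar> + 1)"
  have "0 < d" using e by (simp add: d_def)
  then obtain r where r: "r \<in> \<rat>" "t < r" "r < t + d" using Rats_dense_in_real[of t "t + d"] by auto
  then obtain q where q: "r = of_rat q" by (auto simp: Rats_def)
  have "\<bar>t - of_rat q\<bar> * c \<le> \<bar>t - of_rat q\<bar> * (\<bar>c\<bar> + 1)" by (intro mult_left_mono) auto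
  also have "\<dots> \<le> d * (\<bar>c\<bar> + 1)" using r q by (intro mult_right_mono) auto
  also have "\<dots> = e" by (simp add: d_def)
  finally show "a \<le> b + e" using assms[of q] by linarith
qed

text \<open>\<open>undefined\<close> serves as an arbitrary but fixed base point.\<close>

definition ball_cutoff :: "nat \<Rightarrow> 'a::metric_space \<Rightarrow> real" where
  "ball_cutoff n x = min (max (real n + 1 - dist x undefined) 0) 1"

lemma ball_cutoff:
  "0 \<le> ball_cutoff n x" "ball_cutoff n x \<le> 1" "dist x undefined \<le> real n \<Longrightarrow> ball_cutoff n x = 1"
  "x \<notin> ball undefined (real n + 1) \<Longrightarrow> ball_cutoff n x = 0"
  "\<bar>ball_cutoff n x - ball_cutoff n y\<bar> \<le> 1 * dist x y"
proof -
  have "\<bar>dist x undefined - dist y undefined\<bar> \<le> dist x y"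
    using dist_triangle[of x undefined y] dist_triangle[of y undefined x] by (simp add: dist_commute abs_le_iff)
  then show "\<bar>ball_cutoff n x - ball_cutoff n y\<bar> \<le> 1 * dist x y"
    unfolding ball_cutoff_def by (auto simp: min_def max_def abs_le_iff)
qed (auto simp: ball_cutoff_def dist_commute)

lemma ball_cutoff_LIPb: "ball_cutoff n \<in> LIPb"
proof (rule LIPbI[where B=1 and L=1])
  show "\<bar>ball_cutoff n x\<bar> \<le> 1" for x :: 'a using ball_cutoff(1,2)[of n x] by simp
qed (rule ball_cutoff)

definition has_bounded_support :: "'a::metric_space measure \<Rightarrow> ('a \<Rightarrow> real) \<Rightarrow> bool" where
  "has_bounded_support m f \<longleftrightarrow> (\<exists>n :: nat. AE x in m. x \<notin> ball undefined (real n) \<longrightarrow> f x = 0)"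

lemma has_bounded_support_iff:
  "has_bounded_support m f \<longleftrightarrow> (\<exists>B. bounded B \<and> (AE x in m. x \<notin> B \<longrightarrow> f x = 0))"
proof
  assume "has_bounded_support m f"
  then show "\<exists>B. bounded B \<and> (AE x in m. x \<notin> B \<longrightarrow> f x = 0)"
    unfolding has_bounded_support_def using bounded_ball by blast
next
  assume "\<exists>B. bounded B \<and> (AE x in m. x \<notin> B \<longrightarrow> f x = 0)"
  then obtain B where B: "bounded B" "AE x in m. x \<notin> B \<longrightarrow> f x = 0" by blast
  obtain r where r: "B \<subseteq> ball undefined r" using bounded_subset_ballD[OF B(1)] by blast
  obtain n :: nat where "r \<le> real n" using real_arch_simple by blast
  then have "B \<subseteq> ball undefined (real n)" using r by auto
  with B(2) have "AE x in m. x \<notin> ball undefined (real n) \<longrightarrow> f x = 0" by (auto elim!: eventually_mono)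
  then show "has_bounded_support m f" unfolding has_bounded_support_def by blast
qed

lemma has_bounded_support_mult: "has_bounded_support m f \<Longrightarrow> has_bounded_support m (\<lambda>x. h x * f x)"
  unfolding has_bounded_support_def by (elim ex_forward) (auto elim!: eventually_mono)

lemma (in metric_measure_space) L2_bounded_support_integrable:
  assumes "f \<in> L2 m" "has_bounded_support m f" shows "integrable m f"
proof -
  obtain n :: nat where n: "AE x in m. x \<notin> ball undefined (real n) \<longrightarrow> f x = 0"
    using assms(2) by (auto simp: has_bounded_support_def)
  have [measurable]: "f \<in> borel_measurable m" using L2_measurable[OF assms(1)] .
  have [measurable]: "ball undefined (real n) \<in> sets m" by (simp add: sets_m)
  have "(indicator (ball undefined (real n)) :: 'a \<Rightarrow> real) \<in> L2 m"
    by (rule bounded_support_L2[where K=1 and ?x0.0=undefined and \<rho>="real n"]) (auto simp: indicator_def)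
  from L2_mult_integrable[OF this assms(1)]
  show ?thesis
  proof (rule integrable_cong_AE_imp)
    show "AE x in m. indicator (ball undefined (real n)) x * f x = f x"
      using n by eventually_elim (auto simp: indicator_def)
  qed measurable
qed

lemma is_div_iff:
  "is_div m C d E \<iota> v g \<longleftrightarrow> g \<in> Linf m \<and>
     (\<forall>f\<in>W12 m. has_bounded_support m f \<longrightarrow>
        (\<integral>x. pairing m C E \<iota> (d f) v x \<partial>m) = - (\<integral>x. f x * g x \<partial>m))"
  unfolding is_div_def has_bounded_support_iff ..

lemma Linf_add: "f \<in> Linf m \<Longrightarrow> g \<in> Linf m \<Longrightarrow> (\<lambda>x. f x + g x) \<in> Linf m"
proof -
  assume "f \<in> Linf m" "g \<in> Linf m"
  then obtain A B where f: "f \<in> borel_measurable m" "AE x in m. \<bar>f x\<bar> \<le> A" "g \<in> borel_measurable m" "AE x in m. \<bar>g x\<bar> \<le> B"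
    by (auto simp: Linf_def)
  have "AE x in m. \<bar>f x + g x\<bar> \<le> A + B" using f(2,4) by eventually_elim linarith
  then show ?thesis using f unfolding Linf_def by auto
qed

lemma Linf_mult: "f \<in> Linf m \<Longrightarrow> g \<in> Linf m \<Longrightarrow> (\<lambda>x. f x * g x) \<in> Linf m"
proof -
  assume "f \<in> Linf m" "g \<in> Linf m"
  then obtain A B where f: "f \<in> borel_measurable m" "AE x in m. \<bar>f x\<bar> \<le> A" "g \<in> borel_measurable m" "AE x in m. \<bar>g x\<bar> \<le> B"
    by (auto simp: Linf_def)
  have "AE x in m. \<bar>f x * g x\<bar> \<le> A * B"
    using f(2,4) unfolding abs_mult by eventually_elim (auto intro!: mult_mono intro: order_trans[OF abs_ge_zero])
  then show ?thesis using f unfolding Linf_def by auto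
qed

lemma (in metric_measure_space) bcontfun_Linf: "h \<in> bcontfun \<Longrightarrow> h \<in> Linf m"
proof -
  assume h: "h \<in> bcontfun"
  then obtain b where "\<And>x. \<bar>h x\<bar> \<le> b" by (auto simp: bcontfun_def bounded_iff)
  moreover have "h \<in> borel_measurable m"
    using h unfolding borel_measurable_m bcontfun_def by (auto intro: borel_measurable_continuous_onI)
  ultimately show ?thesis unfolding Linf_def by blast
qed

context tangent_L0
begin

abbreviation "pair \<equiv> pairing m C E \<iota>"

lemma LinfTX_iff: "v \<in> LinfTX m E \<longleftrightarrow> (\<exists>K. AE x in m. pnorm E v x \<le> K)"
proof
  assume "v \<in> LinfTX m E"
  then obtain K where "AE x in m. \<bar>pnorm E v x\<bar> \<le> K" by (auto simp: LinfTX_def Linf_def)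
  then have "AE x in m. pnorm E v x \<le> K" by eventually_elim simp
  then show "\<exists>K. AE x in m. pnorm E v x \<le> K" by blast
next
  assume "\<exists>K. AE x in m. pnorm E v x \<le> K"
  then obtain K where "AE x in m. pnorm E v x \<le> K" by blast
  then have "AE x in m. \<bar>pnorm E v x\<bar> \<le> K" using L0.pnorm_nonneg[of v] by eventually_elim simp
  then show "v \<in> LinfTX m E" using L0.pnorm_measurable by (auto simp: LinfTX_def Linf_def)
qed

lemma LinfTX_add: "u \<in> LinfTX m E \<Longrightarrow> v \<in> LinfTX m E \<Longrightarrow> u + v \<in> LinfTX m E"
proof -
  assume "u \<in> LinfTX m E" "v \<in> LinfTX m E"
  then obtain A B where "AE x in m. pnorm E u x \<le> A" "AE x in m. pnorm E v x \<le> B" by (auto simp: LinfTX_iff)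
  with L0.pnorm_triangle[of u v] have "AE x in m. pnorm E (u + v) x \<le> A + B" by eventually_elim linarith
  then show ?thesis by (auto simp: LinfTX_iff)
qed

lemma LinfTX_scal: "h \<in> Linf m \<Longrightarrow> v \<in> LinfTX m E \<Longrightarrow> scal E h v \<in> LinfTX m E"
proof -
  assume h: "h \<in> Linf m" and v: "v \<in> LinfTX m E"
  obtain B where B: "h \<in> borel_measurable m" "AE x in m. \<bar>h x\<bar> \<le> B" using h by (auto simp: Linf_def)
  obtain K where "AE x in m. pnorm E v x \<le> K" using v by (auto simp: LinfTX_iff)
  with B(2) L0.pnorm_scal[OF B(1), of v] L0.pnorm_nonneg[of v]
  have "AE x in m. pnorm E (scal E h v) x \<le> B * K"
    by eventually_elim (auto intro!: mult_mono intro: order_trans[OF abs_ge_zero])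
  then show ?thesis by (auto simp: LinfTX_iff)
qed

text \<open>Locality from the product estimate: \<open>f\<close> agrees almost everywhere with its
  product with a cutoff, so their differentials coincide, and the bound for the differential of the
  product vanishes where both \<open>f\<close> and the cutoff are 0.\<close>

lemma d_bounded_support:
  assumes f: "f \<in> W12 m" and bs: "has_bounded_support m f"
  shows "has_bounded_support m (pnorm C (d f))"
proof -
  obtain n :: nat where n: "AE x in m. x \<notin> ball undefined (real n) \<longrightarrow> f x = 0"
    using bs by (auto simp: has_bounded_support_def)
  note mult = W12_mult[OF f ball_cutoff_LIPb ball_cutoff(5)] d_mult_le[OF f ball_cutoff_LIPb ball_cutoff(5)]
  have "AE x in m. ball_cutoff n x * f x = f x"
    using n
  proof eventually_elim
    case (elim x)
    then show ?case using ball_cutoff(3)[of x n] by (cases "x \<in> ball undefined (real n)") (auto simp: dist_commute)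
  qed
  then have "d (\<lambda>x. ball_cutoff n x * f x) = d f" using mult(1) f by (intro d_cong_AE) auto
  then have "AE x in m. pnorm C (d f) x \<le> \<bar>ball_cutoff n x\<bar> * pnorm C (d f) x + 1 * \<bar>f x\<bar>"
    using mult(2)[of n] by simp
  then have "AE x in m. x \<notin> ball undefined (real (n + 1)) \<longrightarrow> pnorm C (d f) x = 0"
    using n pnorm_nonneg[of "d f"]
  proof eventually_elim
    case (elim x)
    show ?case
    proof
      assume x: "x \<notin> ball undefined (real (n + 1))"
      then have "f x = 0" "ball_cutoff n x = 0" using elim(2) ball_cutoff(4)[of x n] by (auto simp: add.commute)
      then show "pnorm C (d f) x = 0" using elim(1,3) by simp
    qed
  qed
  then show ?thesis unfolding has_bounded_support_def by blast
qed

lemma pair_integrable: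
  assumes f: "f \<in> W12 m" "has_bounded_support m f" and v: "v \<in> LinfTX m E"
  shows "integrable m (pair (d f) v)"
proof -
  obtain K where K: "AE x in m. pnorm E v x \<le> K" using v by (auto simp: LinfTX_iff)
  have int: "integrable m (pnorm C (d f))"
    by (rule L2_bounded_support_integrable[OF pnorm_L2 d_bounded_support[OF f]])
  show ?thesis
  proof (rule Bochner_Integration.integrable_bound)
    show "integrable m (\<lambda>x. K * pnorm C (d f) x)" using int by simp
    show "AE x in m. norm (pair (d f) v x) \<le> norm (K * pnorm C (d f) x)"
      using K pairing_bound[of "d f" v] pnorm_nonneg[of "d f"] L0.pnorm_nonneg[of v]
    proof eventually_elim
      case (elim x)
      have "pnorm E v x * pnorm C (d f) x \<le> K * pnorm C (d f) x" using elim by (intro mult_right_mono) auto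
      then show ?case using elim(2) by simp
    qed
  qed measurable
qed

section \<open>The Leibniz rule for the pairing\<close>

lemma pair_d_lincomb:
  assumes "f \<in> W12 m" "g \<in> W12 m"
  shows "AE x in m. pair (d (\<lambda>x. a * f x + b * g x)) v x = a * pair (d f) v x + b * pair (d g) v x"
  unfolding d_linear[OF assms]
  using pairing_add_left[of "a *\<^sub>R d f" "b *\<^sub>R d g" v] pairing_scaleR_left[of a "d f" v] pairing_scaleR_left[of b "d g" v]
  by eventually_elim simp

text \<open>The Leibniz rule is obtained without a chain rule: subtracting a rational constant from \<open>h\<close>
  leaves \<open>d(h f) - h df\<close> unchanged and makes the coefficient of \<open>df\<close> small.\<close>

lemma Leibniz_remainder_le:
  assumes f: "f \<in> W12 m" and h: "h \<in> LIPb" "\<And>x y. \<bar>h x - h y\<bar> \<le> L * dist x y" "0 \<le> L"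
  shows "AE x in m. \<bar>pair (d (\<lambda>x. h x * f x)) v x - h x * pair (d f) v x\<bar> \<le> L * pnorm E v x * \<bar>f x\<bar>"
proof -
  have "AE x in m. \<bar>pair (d (\<lambda>x. h x * f x)) v x - h x * pair (d f) v x\<bar>
      \<le> L * pnorm E v x * \<bar>f x\<bar> + \<bar>h x - of_rat q\<bar> * (2 * (pnorm E v x * pnorm C (d f) x))" for q :: rat
  proof -
    let ?c = "of_rat q :: real"
    have hc: "(\<lambda>x. h x - ?c) \<in> LIPb" "\<And>x y. \<bar>h x - ?c - (h y - ?c)\<bar> \<le> L * dist x y" using h by auto
    have eq: "(\<lambda>x. 1 * (h x * f x) + (- ?c) * f x) = (\<lambda>x. (h x - ?c) * f x)" by (auto simp: algebra_simps)
    have "AE x in m. pair (d (\<lambda>x. (h x - ?c) * f x)) v x = 1 * pair (d (\<lambda>x. h x * f x)) v x + (- ?c) * pair (d f) v x"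
      using pair_d_lincomb[OF W12_mult[OF f h] f, of 1 "- ?c" v] unfolding eq .
    then show ?thesis
      using pairing_bound[of "d (\<lambda>x. (h x - ?c) * f x)" v] pairing_bound[of "d f" v]
        d_mult_le[OF f hc h(3)] L0.pnorm_nonneg[of v]
    proof eventually_elim
      case (elim x)
      have "pair (d (\<lambda>x. h x * f x)) v x - h x * pair (d f) v x
          = pair (d (\<lambda>x. (h x - ?c) * f x)) v x - (h x - ?c) * pair (d f) v x"
        using elim(1) by (simp add: algebra_simps)
      then have "\<bar>pair (d (\<lambda>x. h x * f x)) v x - h x * pair (d f) v x\<bar>
          \<le> \<bar>pair (d (\<lambda>x. (h x - ?c) * f x)) v x\<bar> + \<bar>h x - ?c\<bar> * \<bar>pair (d f) v x\<bar>"
        by (simp only: abs_mult[symmetric] abs_triangle_ineq4)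
      also have "\<dots> \<le> pnorm E v x * (\<bar>h x - ?c\<bar> * pnorm C (d f) x + L * \<bar>f x\<bar>)
          + \<bar>h x - ?c\<bar> * (pnorm E v x * pnorm C (d f) x)"
      proof (intro add_mono mult_left_mono elim(3))
        show "\<bar>pair (d (\<lambda>x. (h x - ?c) * f x)) v x\<bar> \<le> pnorm E v x * (\<bar>h x - ?c\<bar> * pnorm C (d f) x + L * \<bar>f x\<bar>)"
          by (rule order_trans[OF elim(2) mult_left_mono[OF elim(4,5)]])
      qed simp
      also have "\<dots> = L * pnorm E v x * \<bar>f x\<bar> + \<bar>h x - ?c\<bar> * (2 * (pnorm E v x * pnorm C (d f) x))"
        by (simp add: algebra_simps)
      finally show ?case .
    qed
  qed
  then have "AE x in m. \<forall>q :: rat. \<bar>pair (d (\<lambda>x. h x * f x)) v x - h x * pair (d f) v x\<bar>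
      \<le> L * pnorm E v x * \<bar>f x\<bar> + \<bar>h x - of_rat q\<bar> * (2 * (pnorm E v x * pnorm C (d f) x))"
    by (simp add: AE_all_countable)
  then show ?thesis by eventually_elim (blast intro: le_of_rat_approx)
qed

text \<open>The remainder \<open>r f\<close> is linear in \<open>f\<close> and dominated pointwise
  by a multiple of |f|, hence it is multiplication by a fixed function \<open>k\<close>, which plays
  the role of dh(v). As neither \<open>h\<close> nor the constant 1 has to be square integrable,
  \<open>k\<close> is glued together from the remainders of the cutoffs of balls.\<close>

lemma Leibniz:
  assumes K: "AE x in m. pnorm E v x \<le> K"
    and h: "h \<in> LIPb" "\<And>x y. \<bar>h x - h y\<bar> \<le> L * dist x y" "0 \<le> L"
  obtains k where "k \<in> borel_measurable m" "AE x in m. \<bar>k x\<bar> \<le> L * K"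
    "\<And>f. f \<in> W12 m \<Longrightarrow> AE x in m. pair (d (\<lambda>x. h x * f x)) v x = h x * pair (d f) v x + f x * k x"
proof -
  define r where "r f x = pair (d (\<lambda>x. h x * f x)) v x - h x * pair (d f) v x" for f x
  have [measurable]: "h \<in> borel_measurable m" by (rule LIPb_measurable_m[OF h(1)])
  have r_meas [measurable]: "r f \<in> borel_measurable m" for f unfolding r_def by measurable
  have r_le: "AE x in m. \<bar>r f x\<bar> \<le> L * pnorm E v x * \<bar>f x\<bar>" if "f \<in> W12 m" for f
    using Leibniz_remainder_le[OF that h] by (simp add: r_def)
  have r_lincomb: "AE x in m. r (\<lambda>x. 1 * f x + b * g x) x = r f x + b * r g x" if fg: "f \<in> W12 m" "g \<in> W12 m" for f g b
  proof -
    have eq: "(\<lambda>x. h x * (1 * f x + b * g x)) = (\<lambda>x. 1 * (h x * f x) + b * (h x * g x))" by (auto simp: algebra_simps)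
    show ?thesis
      unfolding r_def eq
      using pair_d_lincomb[OF fg, of 1 b v] pair_d_lincomb[OF W12_mult[OF fg(1) h] W12_mult[OF fg(2) h], of 1 b v]
      by eventually_elim (simp add: algebra_simps)
  qed
  \<comment> \<open>At a point where \<open>g\<close> is 1, a rational \<open>q\<close> near
    \<open>f x\<close> makes f - q g small there, so by domination its remainder is small as
    well.\<close>
  have r_local: "AE x in m. g x = 1 \<longrightarrow> r f x = f x * r g x" if fg: "f \<in> W12 m" "g \<in> W12 m" for f g
  proof -
    have "AE x in m. \<bar>r f x + (- of_rat q) * r g x\<bar> \<le> L * pnorm E v x * \<bar>1 * f x + (- of_rat q) * g x\<bar>" for q :: rat
      using r_lincomb[OF fg, of "- of_rat q"] r_le[OF W12_lincomb[OF fg, of 1 "- of_rat q"]] by eventually_elim simp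
    then have "AE x in m. \<forall>q :: rat. \<bar>r f x + (- of_rat q) * r g x\<bar> \<le> L * pnorm E v x * \<bar>1 * f x + (- of_rat q) * g x\<bar>"
      by (simp add: AE_all_countable)
    then show ?thesis
    proof eventually_elim
      case (elim x)
      show ?case
      proof
        assume g1: "g x = 1"
        have "\<bar>r f x - f x * r g x\<bar> \<le> 0 + \<bar>f x - of_rat q\<bar> * (L * pnorm E v x + \<bar>r g x\<bar>)" for q :: rat
        proof -
          have "r f x - f x * r g x = (r f x + (- of_rat q) * r g x) - (f x - of_rat q) * r g x" by (simp add: algebra_simps)
          then have "\<bar>r f x - f x * r g x\<bar> \<le> \<bar>r f x + (- of_rat q) * r g x\<bar> + \<bar>f x - of_rat q\<bar> * \<bar>r g x\<bar>"
            by (simp only: abs_mult[symmetric] abs_triangle_ineq4)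
          also have "\<bar>r f x + (- of_rat q) * r g x\<bar> \<le> L * pnorm E v x * \<bar>1 * f x + (- of_rat q) * g x\<bar>"
            using elim by blast
          finally show ?thesis using g1 by (simp add: algebra_simps)
        qed
        then have "\<bar>r f x - f x * r g x\<bar> \<le> 0" by (rule le_of_rat_approx)
        then show "r f x = f x * r g x" by simp
      qed
    qed
  qed
  have bc: "ball_cutoff n \<in> W12 m" for n
    using LIPb_bounded_support_W12[OF ball_cutoff_LIPb ball_cutoff(4)] by blast
  \<comment> \<open>An integer radius whose cutoff equals 1 at \<open>x\<close>. Since it takes
    countably many values, the glued function is measurable.\<close>
  define N where "N x = nat \<lceil>dist x undefined\<rceil>" for x :: 'a
  have N1: "ball_cutoff (N x) x = 1" for x :: 'a
    by (rule ball_cutoff(3)) (simp add: N_def real_nat_ceiling_ge)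
  have "N \<in> borel \<rightarrow>\<^sub>M count_space UNIV" unfolding N_def by measurable
  then have [measurable]: "N \<in> m \<rightarrow>\<^sub>M count_space UNIV" by (simp add: measurable_cong_sets[OF sets_m refl])
  define k where "k x = r (ball_cutoff (N x)) x" for x
  show ?thesis
  proof (rule that[of k])
    show "k \<in> borel_measurable m"
      unfolding k_def by (rule measurable_compose_countable[where g=N]) measurable
    have "AE x in m. \<forall>n. \<bar>r (ball_cutoff n) x\<bar> \<le> L * pnorm E v x * \<bar>ball_cutoff n x\<bar>"
      unfolding AE_all_countable using r_le[OF bc] by blast
    then show "AE x in m. \<bar>k x\<bar> \<le> L * K"
      using K
    proof eventually_elim
      case (elim x)
      have "\<bar>k x\<bar> \<le> L * pnorm E v x * \<bar>ball_cutoff (N x) x\<bar>" using elim(1) by (simp add: k_def)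
      also have "\<dots> \<le> L * K" using elim(2) h(3) by (simp add: N1 mult_left_mono)
      finally show ?case .
    qed
    fix f assume f: "f \<in> W12 m"
    have "AE x in m. \<forall>n. ball_cutoff n x = 1 \<longrightarrow> r f x = f x * r (ball_cutoff n) x"
      unfolding AE_all_countable using r_local[OF f bc] by blast
    then show "AE x in m. pair (d (\<lambda>x. h x * f x)) v x = h x * pair (d f) v x + f x * k x"
    proof eventually_elim
      case (elim x)
      then have "r f x = f x * k x" using N1 by (simp add: k_def)
      then show ?case by (simp add: r_def)
    qed
  qed
qed

section \<open>Stability of divergence fields under Lipschitz multipliers\<close>

abbreviation "Ddiv \<equiv> D_div m C d E \<iota>"

lemma D_divD:
  assumes "v \<in> Ddiv" shows "v \<in> LinfTX m E" "\<exists>g. is_div m C d E \<iota> v g"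
  using assms by (auto simp: D_div_def)

lemma is_div_add:
  assumes "u \<in> LinfTX m E" "v \<in> LinfTX m E" "is_div m C d E \<iota> u g" "is_div m C d E \<iota> v g'"
  shows "is_div m C d E \<iota> (u + v) (\<lambda>x. g x + g' x)"
  unfolding is_div_iff
proof (intro conjI ballI impI)
  have g: "g \<in> Linf m" "g' \<in> Linf m" using assms by (auto simp: is_div_iff)
  then show "(\<lambda>x. g x + g' x) \<in> Linf m" by (rule Linf_add)
  fix f assume f: "f \<in> W12 m" and bs: "has_bounded_support m f"
  have int: "integrable m f" using L2_bounded_support_integrable W12_L2 f bs by blast
  have ig: "integrable m (\<lambda>x. f x * g x)" "integrable m (\<lambda>x. f x * g' x)"
    using Linf_mult_integrable[OF g(1) int] Linf_mult_integrable[OF g(2) int] by (simp_all add: mult.commute)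
  have "(\<integral>x. pair (d f) (u + v) x \<partial>m) = (\<integral>x. pair (d f) u x + pair (d f) v x \<partial>m)"
    by (rule integral_cong_AE) (use pairing_add_right in auto)
  also have "\<dots> = (\<integral>x. pair (d f) u x \<partial>m) + (\<integral>x. pair (d f) v x \<partial>m)"
    using pair_integrable[OF f bs] assms by simp
  also have "\<dots> = - (\<integral>x. f x * g x \<partial>m) - (\<integral>x. f x * g' x \<partial>m)" using assms f bs by (simp add: is_div_iff)
  also have "\<dots> = - (\<integral>x. f x * (g x + g' x) \<partial>m)" using ig by (simp add: distrib_left)
  finally show "(\<integral>x. pair (d f) (u + v) x \<partial>m) = - (\<integral>x. f x * (g x + g' x) \<partial>m)" .
qed

text \<open>The divergence of \<open>scal E h v\<close> is h g + k with \<open>k\<close> from the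
  Leibniz rule. The explicit bound is what counts later: it is uniform over multipliers with common
  bounds \<open>B\<close> and \<open>L\<close>.\<close>

lemma is_div_mult:
  assumes v: "v \<in> LinfTX m E" "is_div m C d E \<iota> v g" and K: "AE x in m. pnorm E v x \<le> K"
    and G: "AE x in m. \<bar>g x\<bar> \<le> G"
    and h: "h \<in> LIPb" "\<And>x y. \<bar>h x - h y\<bar> \<le> L * dist x y" "0 \<le> L" "\<And>x. \<bar>h x\<bar> \<le> B"
  obtains g' where "is_div m C d E \<iota> (scal E h v) g'" "AE x in m. \<bar>g' x\<bar> \<le> B * G + L * K"
proof -
  obtain k where k: "k \<in> borel_measurable m" "AE x in m. \<bar>k x\<bar> \<le> L * K"
    "\<And>f. f \<in> W12 m \<Longrightarrow> AE x in m. pair (d (\<lambda>x. h x * f x)) v x = h x * pair (d f) v x + f x * k x"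
    using Leibniz[OF K h(1-3)] by blast
  have kL: "k \<in> Linf m" using k by (auto simp: Linf_def)
  have hL: "h \<in> Linf m" by (rule bcontfun_Linf[OF LIPb_bcontfun[OF h(1)]])
  have g: "g \<in> Linf m" using v by (simp add: is_div_iff)
  have [measurable]: "h \<in> borel_measurable m" by (rule LIPb_measurable_m[OF h(1)])
  note [measurable] = k(1)
  show ?thesis
  proof (rule that[of "\<lambda>x. h x * g x + k x"])
    show "AE x in m. \<bar>h x * g x + k x\<bar> \<le> B * G + L * K"
      using G k(2)
    proof eventually_elim
      case (elim x)
      have "\<bar>h x\<bar> * \<bar>g x\<bar> \<le> B * G" using h(4)[of x] elim(1) by (intro mult_mono) (auto intro: order_trans[OF abs_ge_zero])
      then show ?case using elim(2) abs_triangle_ineq[of "h x * g x" "k x"] by (simp add: abs_mult)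
    qed
    show "is_div m C d E \<iota> (scal E h v) (\<lambda>x. h x * g x + k x)"
      unfolding is_div_iff
    proof (intro conjI ballI impI)
      show "(\<lambda>x. h x * g x + k x) \<in> Linf m" by (intro Linf_add Linf_mult hL g kL)
      fix f assume f: "f \<in> W12 m" and bs: "has_bounded_support m f"
      note hf = W12_mult[OF f h(1-3)] has_bounded_support_mult[OF bs, of h]
      have int: "integrable m f" "integrable m (\<lambda>x. h x * f x)"
        using L2_bounded_support_integrable W12_L2 f bs hf by blast+
      have i1: "integrable m (\<lambda>x. f x * k x)" "integrable m (\<lambda>x. h x * f x * g x)"
        using Linf_mult_integrable[OF kL int(1)] Linf_mult_integrable[OF g int(2)] by (simp_all add: mult.commute)
      have "(\<integral>x. pair (d f) (scal E h v) x \<partial>m) = (\<integral>x. pair (d (\<lambda>x. h x * f x)) v x - f x * k x \<partial>m)"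
      proof (rule integral_cong_AE)
        show "AE x in m. pair (d f) (scal E h v) x = pair (d (\<lambda>x. h x * f x)) v x - f x * k x"
          using pairing_scal_right[OF hL, of "d f" v] k(3)[OF f] by eventually_elim simp
      qed (use i1 in measurable)
      also have "\<dots> = (\<integral>x. pair (d (\<lambda>x. h x * f x)) v x \<partial>m) - (\<integral>x. f x * k x \<partial>m)"
        using pair_integrable[OF hf v(1)] i1 by simp
      also have "\<dots> = - (\<integral>x. h x * f x * g x \<partial>m) - (\<integral>x. f x * k x \<partial>m)"
        using v(2) hf by (simp add: is_div_iff)
      also have "\<dots> = - ((\<integral>x. h x * f x * g x \<partial>m) + (\<integral>x. f x * k x \<partial>m))" by simp
      also have "\<dots> = - (\<integral>x. h x * f x * g x + f x * k x \<partial>m)"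
        by (subst Bochner_Integration.integral_add[OF i1(2,1)]) simp
      also have "(\<lambda>x. h x * f x * g x + f x * k x) = (\<lambda>x. f x * (h x * g x + k x))" by (auto simp: algebra_simps)
      finally show "(\<integral>x. pair (d f) (scal E h v) x \<partial>m) = - (\<integral>x. f x * (h x * g x + k x) \<partial>m)" .
    qed
  qed
qed

lemma D_div_add: "u \<in> Ddiv \<Longrightarrow> v \<in> Ddiv \<Longrightarrow> u + v \<in> Ddiv"
  using is_div_add LinfTX_add unfolding D_div_def by blast

lemma D_div_scal:
  assumes v: "v \<in> Ddiv" and h: "h \<in> LIPb" shows "scal E h v \<in> Ddiv"
proof -
  obtain B L where hL: "0 \<le> L" "\<And>x. \<bar>h x\<bar> \<le> B" "\<And>x y. \<bar>h x - h y\<bar> \<le> L * dist x y" using LIPbE[OF h] by metis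
  have vL: "v \<in> LinfTX m E" using D_divD[OF v] by simp
  obtain g where g: "is_div m C d E \<iota> v g" using D_divD[OF v] by blast
  obtain K where K: "AE x in m. pnorm E v x \<le> K" using vL by (auto simp: LinfTX_iff)
  obtain G where G: "AE x in m. \<bar>g x\<bar> \<le> G" using g by (auto simp: is_div_iff Linf_def)
  have "scal E h v \<in> LinfTX m E" by (intro LinfTX_scal bcontfun_Linf LIPb_bcontfun h vL)
  then show ?thesis using is_div_mult[OF vL g K G h hL(3,1,2)] unfolding D_div_def by blast
qed

lemma D_div_scaleR: "v \<in> Ddiv \<Longrightarrow> c *\<^sub>R v \<in> Ddiv"
  using D_div_scal[OF _ LIPb_const, of v c] by (simp add: L0.scal_const)

lemma D_div_zero: "0 \<in> Ddiv"
proof -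
  have z: "AE x in m. pairing m C E \<iota> w 0 x = 0" for w
    using pairing_bound[of w 0] pnorm_E_zero by eventually_elim simp
  have "is_div m C d E \<iota> 0 (\<lambda>_. 0)"
    unfolding is_div_iff by (auto intro!: integral_eq_zero_AE z)
  moreover have "0 \<in> LinfTX m E" using pnorm_E_zero by (auto simp: LinfTX_iff elim: eventually_mono)
  ultimately show ?thesis unfolding D_div_def by blast
qed

end

section \<open>Lipschitz approximation of functions of bounded variation\<close>

definition dense_sequence :: "(nat \<Rightarrow> 'a::topological_space) \<Rightarrow> bool" where
  "dense_sequence p \<longleftrightarrow> (\<forall>U. open U \<longrightarrow> U \<noteq> {} \<longrightarrow> (\<exists>n. p n \<in> U))"

lemma dense_sequence_exists:
  obtains p :: "nat \<Rightarrow> 'a::polish_space" where "dense_sequence p"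
proof -
  obtain D :: "'a set" where D: "countable D" "\<And>U. open U \<Longrightarrow> U \<noteq> {} \<Longrightarrow> \<exists>d\<in>D. d \<in> U"
    using countable_dense_setE by blast
  have "D \<noteq> {}" using D(2)[of UNIV] by auto
  show ?thesis
  proof (rule that[of "from_nat_into D"])
    show "dense_sequence (from_nat_into D)"
      unfolding dense_sequence_def using D(2) from_nat_into_surj[OF D(1)] by metis
  qed
qed

text \<open>For fixed \<open>j\<close> the functions \<open>net_cutoff p j n\<close> have Lipschitz constant \<open>j + 1\<close> and decrease to \<open>0\<close>
  as \<open>n\<close> grows, while smallness for all \<open>j\<close> forces total boundedness.\<close>

definition net_cutoff :: "(nat \<Rightarrow> 'a::metric_space) \<Rightarrow> nat \<Rightarrow> nat \<Rightarrow> 'a \<Rightarrow> real" where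
  "net_cutoff p j n x = min (max (real (Suc j) * infdist x (p ` {..n}) - 1) 0) 1"

lemma net_cutoff_range: "0 \<le> net_cutoff p j n x" "net_cutoff p j n x \<le> 1"
  by (auto simp: net_cutoff_def)

lemma net_cutoff_Lipschitz: "\<bar>net_cutoff p j n x - net_cutoff p j n y\<bar> \<le> real (Suc j) * dist x y"
proof -
  have "\<bar>real (Suc j) * infdist x (p ` {..n}) - real (Suc j) * infdist y (p ` {..n})\<bar>
      = real (Suc j) * \<bar>infdist x (p ` {..n}) - infdist y (p ` {..n})\<bar>"
    by (simp only: right_diff_distrib[symmetric] abs_mult abs_of_nat)
  also have "\<dots> \<le> real (Suc j) * dist x y" by (intro mult_left_mono infdist_triangle_abs) auto
  finally show ?thesis unfolding net_cutoff_def by (auto simp: min_def max_def abs_le_iff)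
qed

lemma net_cutoff_LIPb: "net_cutoff p j n \<in> LIPb"
proof (rule LIPbI[OF _ net_cutoff_Lipschitz])
  show "\<bar>net_cutoff p j n x\<bar> \<le> 1" for x using net_cutoff_range[of p j n x] by simp
qed

lemma net_cutoff_decreasing: "net_cutoff p j (Suc n) x \<le> net_cutoff p j n x"
proof -
  have "infdist x (p ` {..Suc n}) \<le> infdist x (p ` {..n})" by (intro infdist_mono) auto
  then have "real (Suc j) * infdist x (p ` {..Suc n}) \<le> real (Suc j) * infdist x (p ` {..n})"
    by (intro mult_left_mono) auto
  then show ?thesis unfolding net_cutoff_def by (intro min.mono max.mono) auto
qed

lemma infdist_dense_sequence:
  assumes p: "dense_sequence p"
  shows "(\<lambda>n. infdist x (p ` {..n})) \<longlonglongrightarrow> 0"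
proof (rule LIMSEQ_I)
  fix e :: real assume e: "0 < e"
  then have "ball x e \<noteq> {}" by simp
  then obtain N where N: "p N \<in> ball x e" using p unfolding dense_sequence_def by blast
  have "norm (infdist x (p ` {..n}) - 0) < e" if "N \<le> n" for n
  proof -
    have "infdist x (p ` {..n}) \<le> dist x (p N)" using that by (intro infdist_le) auto
    then show ?thesis using N infdist_nonneg[of x "p ` {..n}"] by simp
  qed
  then show "\<exists>no. \<forall>n\<ge>no. norm (infdist x (p ` {..n}) - 0) < e" by blast
qed

lemma eventually_infdist_small:
  assumes p: "dense_sequence p"
  shows "\<forall>\<^sub>F n in sequentially. real (Suc j) * infdist x (p ` {..n}) < 1"
proof -
  have "\<forall>\<^sub>F n in sequentially. infdist x (p ` {..n}) < 1 / real (Suc j)"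
    using order_tendstoD(2)[OF infdist_dense_sequence[OF p, of x], of "1 / real (Suc j)"] by simp
  then show ?thesis by eventually_elim (simp add: field_simps)
qed

lemma net_cutoff_tendsto_0:
  assumes p: "dense_sequence p"
  shows "(\<lambda>n. net_cutoff p j n x) \<longlonglongrightarrow> 0"
proof (rule tendsto_eventually)
  show "\<forall>\<^sub>F n in sequentially. net_cutoff p j n x = 0"
    using eventually_infdist_small[OF p, of j x] by eventually_elim (auto simp: net_cutoff_def)
qed

lemma net_cutoff_lt_1D:
  assumes "net_cutoff p j n x < 1" shows "\<exists>q\<in>p ` {..n}. dist x q < 2 / real (Suc j)"
proof -
  have "real (Suc j) * infdist x (p ` {..n}) < 2"
    using assms unfolding net_cutoff_def by (auto simp: min_def max_def split: if_splits)
  then have "infdist x (p ` {..n}) < 2 / real (Suc j)" by (simp add: pos_less_divide_eq mult.commute)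
  moreover have ne: "p ` {..n} \<noteq> {}" by auto
  ultimately have "(INF a\<in>p ` {..n}. dist x a) < 2 / real (Suc j)" by (simp add: infdist_notempty)
  then show ?thesis
    using cInf_lessD[of "(dist x) ` (p ` {..n})" "2 / real (Suc j)"] ne by auto
qed

lemma bounded_net_cutoff_lt_1: "bounded {x. net_cutoff p j n x < 1}"
proof (rule bounded_subset)
  show "bounded (\<Union>q\<in>p ` {..n}. ball q (2 / real (Suc j)))" by (intro bounded_UN) auto
  show "{x. net_cutoff p j n x < 1} \<subseteq> (\<Union>q\<in>p ` {..n}. ball q (2 / real (Suc j)))"
    using net_cutoff_lt_1D[of p j n] by (auto simp: dist_commute)
qed

text \<open>A value below 1 at scale \<open>j\<close> places the point within 2 / (j + 1) of a
  finite set; completeness does the rest.\<close>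

lemma convergent_subseq_of_net_cutoffs:
  fixes x :: "nat \<Rightarrow> 'a::polish_space"
  assumes "\<And>j i. j \<le> i \<Longrightarrow> net_cutoff p j (n j) (x i) < 1"
  obtains l s where "strict_mono (s :: nat \<Rightarrow> nat)" "(x \<circ> s) \<longlonglongrightarrow> l"
proof (rule convergent_subseq_of_finite_nets[of "\<lambda>j. p ` {..n j}" x "\<lambda>j. 2 / real (Suc j)"])
  show "\<exists>q\<in>p ` {..n j}. dist (x i) q < 2 / real (Suc j)" if "j \<le> i" for i j
    using net_cutoff_lt_1D[OF assms[OF that]] .
  show "(\<lambda>j. 2 / real (Suc j)) \<longlonglongrightarrow> 0"
    using tendsto_mult_right_zero[OF LIMSEQ_inverse_real_of_nat, of 2] by (simp add: inverse_eq_divide)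
qed (use that in auto)

text \<open>Near the points where \<open>h\<close> is nonzero, \<open>u\<close> has a uniform
  Lipschitz constant at scale \<open>r\<close>. Pairs of points at distance less than
  \<open>r\<close> use this, and for the other pairs boundedness alone gives the constant 2 B /
  r.\<close>

lemma bounded_Lipschitz_product:
  assumes u: "\<And>x. \<bar>u x\<bar> \<le> B" and h: "h \<in> LIPb" "\<And>x. 0 \<le> h x" "\<And>x. h x \<le> 1"
    and loc: "\<And>x. h x \<noteq> 0 \<Longrightarrow> N-lipschitz_on (ball x r) u" and r: "0 < r" and N: "0 \<le> N"
  shows "(\<lambda>x. u x * h x) \<in> LIPb"
proof -
  obtain K where K: "0 \<le> K" "\<And>x y. \<bar>h x - h y\<bar> \<le> K * dist x y" using LIPbE[OF h(1)] by metis
  have B: "0 \<le> B" using u[of undefined] by (meson abs_ge_zero order_trans)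
  have *: "\<bar>u x * h x - u y * h y\<bar> \<le> (N + B * K + 2 * B / r) * dist x y" if hx: "h x \<noteq> 0" for x y
  proof (cases "dist x y < r")
    case True
    have "dist (u x) (u y) \<le> N * dist x y" using loc[OF hx] r True by (intro lipschitz_onD[of N "ball x r"]) auto
    then have 1: "\<bar>u x - u y\<bar> \<le> N * dist x y" by (simp add: dist_real_def)
    have "u x * h x - u y * h y = h x * (u x - u y) + u y * (h x - h y)" by algebra
    then have "\<bar>u x * h x - u y * h y\<bar> \<le> \<bar>h x\<bar> * \<bar>u x - u y\<bar> + \<bar>u y\<bar> * \<bar>h x - h y\<bar>"
      by (simp only: abs_mult[symmetric] abs_triangle_ineq)
    also have "\<dots> \<le> 1 * (N * dist x y) + B * (K * dist x y)"
      using h(2,3)[of x] 1 u[of y] K B by (intro add_mono mult_mono) auto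
    also have "\<dots> \<le> (N + B * K + 2 * B / r) * dist x y" using B r by (simp add: algebra_simps)
    finally show ?thesis .
  next
    case False
    have "\<bar>u z * h z\<bar> \<le> B * 1" for z
      unfolding abs_mult using h(2,3)[of z] u[of z] B by (intro mult_mono) auto
    from this[of x] this[of y] have "\<bar>u x * h x - u y * h y\<bar> \<le> 2 * B" by linarith
    also have "\<dots> \<le> 2 * B / r * dist x y" using False r B by (simp add: field_simps mult_left_mono)
    also have "\<dots> \<le> (N + B * K + 2 * B / r) * dist x y" using B K N by (intro mult_right_mono) auto
    finally show ?thesis .
  qed
  show ?thesis
  proof (rule LIPbI)
    fix x y
    show "\<bar>u x * h x\<bar> \<le> B" using mult_mono[OF u[of x] h(3)[of x] B h(2)] h(2)[of x] by (simp add: abs_mult)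
    show "\<bar>u x * h x - u y * h y\<bar> \<le> (N + B * K + 2 * B / r) * dist x y"
    proof (cases "h x = 0 \<and> h y = 0")
      case True
      then show ?thesis using B K N r by simp
    next
      case False
      then show ?thesis using *[of x y] *[of y x] by (auto simp: dist_commute abs_minus_commute)
    qed
  qed
qed

section \<open>Approximation of locally Lipschitz functions by Lipschitz functions with bounded
  support\<close>

context metric_measure_space
begin

text \<open>Completeness of the space enters here: outside a set of small mass, a locally Lipschitz function
  is cut off to a neighbourhood of a compact set, with cutoffs whose slopes are supported in sets of
  small mass.\<close>

lemma LIPloc_bounded_cutoff:
  assumes u: "u \<in> LIPloc" "integrable m u" "\<And>x. \<bar>u x\<bar> \<le> B" and e: "0 < e"
  obtains w where "w \<in> LIPb" "bounded {x. w x \<noteq> 0}" "(\<integral>x. \<bar>w x - u x\<bar> \<partial>m) \<le> e"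
    "(\<integral>\<^sup>+x. lip w x \<partial>m) \<le> (\<integral>\<^sup>+x. lip u x \<partial>m) + ennreal e"
proof -
  obtain p :: "nat \<Rightarrow> 'a" where p: "dense_sequence p" by (rule dense_sequence_exists)
  have [measurable]: "u \<in> borel_measurable m" using u(2) by simp
  define A where "A j n = {x. 1 \<le> real (Suc j) * infdist x (p ` {..n})}" for j n
  have Acl: "closed (A j n)" for j n unfolding A_def by (intro closed_Collect_le continuous_intros)
  then have [measurable]: "A j n \<in> sets m" for j n by (simp add: sets_m)
  have intA: "integrable m (\<lambda>x. indicator (A j n) x * \<bar>u x\<bar>)" for j n
    by (rule Bochner_Integration.integrable_bound[OF u(2)]) (auto simp: indicator_def)
  \<comment> \<open>Division by j + 2 pays for the Lipschitz constant j + 1 of the cutoff at scale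
    \<open>j\<close>; the powers of 1/2 make the errors summable over all scales.\<close>
  have "\<exists>n. (\<integral>x. indicator (A j n) x * \<bar>u x\<bar> \<partial>m) < e * (1/2) ^ Suc j / (real j + 2)" for j
  proof -
    have "(\<lambda>n. \<integral>x. indicator (A j n) x * \<bar>u x\<bar> \<partial>m) \<longlonglongrightarrow> (\<integral>x. 0 \<partial>m)"
    proof (rule integral_dominated_convergence[where w="\<lambda>x. \<bar>u x\<bar>"])
      show "AE x in m. (\<lambda>n. indicator (A j n) x * \<bar>u x\<bar>) \<longlonglongrightarrow> 0"
      proof (rule AE_I2, rule tendsto_eventually)
        fix x :: 'a
        show "\<forall>\<^sub>F n in sequentially. indicator (A j n) x * \<bar>u x\<bar> = 0"
          using eventually_infdist_small[OF p, of j x] by eventually_elim (auto simp: A_def indicator_def)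
      qed
    qed (use u in \<open>auto simp: indicator_def\<close>)
    then have "\<forall>\<^sub>F n in sequentially. (\<integral>x. indicator (A j n) x * \<bar>u x\<bar> \<partial>m) < e * (1/2) ^ Suc j / (real j + 2)"
      using order_tendstoD(2)[of _ 0 sequentially "e * (1/2) ^ Suc j / (real j + 2)"] e by (simp add: add_nonneg_pos)
    then show ?thesis using eventually_happens'[OF sequentially_bot] by blast
  qed
  then obtain n where n: "\<And>j. (\<integral>x. indicator (A j (n j)) x * \<bar>u x\<bar> \<partial>m) < e * (1/2) ^ Suc j / (real j + 2)" by metis
  define c where "c j = net_cutoff p j (n j)" for j
  define a where "a j x = (indicator (A j (n j)) x :: real)" for j and x :: 'a
  have [measurable]: "a j \<in> borel_measurable m" for j unfolding a_def by measurable
  \<comment> \<open>Subtracting the sum of the \<open>c j\<close> bounds the slope by the sum of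
    their slopes, and still forces every \<open>c j\<close> to be below 1 wherever
    \<open>\<Theta> N\<close> is nonzero.\<close>
  define \<Theta> where "\<Theta> N x = max 0 (1 - (\<Sum>j<N. c j x))" for N :: nat and x
  have c_le_a: "c j x \<le> a j x" for j x
    using net_cutoff_range(2)[of p j "n j" x] by (auto simp: c_def a_def A_def net_cutoff_def indicator_def)
  have c0: "0 \<le> c j x" for j x by (simp add: c_def net_cutoff_range)
  have \<Theta>L: "\<Theta> N \<in> LIPb" for N unfolding \<Theta>_def[abs_def] c_def by (intro LIPb_max LIPb_diff LIPb_sum net_cutoff_LIPb LIPb_const)
  have \<Theta>0: "0 \<le> \<Theta> N x" "\<Theta> N x \<le> 1" for N x using c0 by (auto simp: \<Theta>_def sum_nonneg)
  have \<Theta>1: "\<bar>\<Theta> N x - 1\<bar> \<le> (\<Sum>j<N. a j x)" for N x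
  proof -
    have "0 \<le> (\<Sum>j<N. c j x)" using c0 by (intro sum_nonneg)
    moreover have "(\<Sum>j<N. c j x) \<le> (\<Sum>j<N. a j x)" by (intro sum_mono c_le_a)
    ultimately show ?thesis unfolding \<Theta>_def by linarith
  qed
  have slope\<Theta>: "slope (\<Theta> N) x \<le> (\<Sum>j<N. real (Suc j) * a j x)" for N x
  proof (rule slope_leI)
    show "0 \<le> (\<Sum>j<N. real (Suc j) * a j x)" by (intro sum_nonneg) (auto simp: a_def)
    fix d :: real assume d: "0 < d"
    have "\<forall>\<^sub>F y in at x. \<bar>c j y - c j x\<bar> \<le> real (Suc j) * a j x * dist y x" for j
    proof (cases "x \<in> A j (n j)")
      case True
      then show ?thesis using net_cutoff_Lipschitz[of p j "n j" _ x] by (auto simp: a_def c_def)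
    next
      case False
      have "open (- A j (n j))" using Acl by auto
      then have "\<forall>\<^sub>F y in at x. y \<in> - A j (n j)" using False by (intro eventually_at_topological[THEN iffD2]) auto
      then show ?thesis
      proof eventually_elim
        case (elim y)
        then have "c j y \<le> 0" "c j x \<le> 0" using c_le_a[of j y] c_le_a[of j x] False by (auto simp: a_def)
        then have "c j y = 0" "c j x = 0" using c0[of j y] c0[of j x] by linarith+
        then show ?case by (simp add: a_def)
      qed
    qed
    then have "\<forall>\<^sub>F y in at x. \<forall>j\<in>{..<N}. \<bar>c j y - c j x\<bar> \<le> real (Suc j) * a j x * dist y x"
      by (intro eventually_ball_finite) auto
    then show "\<forall>\<^sub>F y in at x. \<bar>\<Theta> N y - \<Theta> N x\<bar> \<le> ((\<Sum>j<N. real (Suc j) * a j x) + d) * dist y x"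
    proof eventually_elim
      case (elim y)
      have "\<bar>\<Theta> N y - \<Theta> N x\<bar> \<le> \<bar>(\<Sum>j<N. c j y) - (\<Sum>j<N. c j x)\<bar>" unfolding \<Theta>_def by linarith
      also have "\<dots> \<le> (\<Sum>j<N. \<bar>c j y - c j x\<bar>)" unfolding sum_subtractf[symmetric] by (rule sum_abs)
      also have "\<dots> \<le> (\<Sum>j<N. real (Suc j) * a j x * dist y x)" using elim by (intro sum_mono) auto
      also have "\<dots> = (\<Sum>j<N. real (Suc j) * a j x) * dist y x" by (simp add: sum_distrib_right)
      also have "\<dots> \<le> ((\<Sum>j<N. real (Suc j) * a j x) + d) * dist y x" using d by (intro mult_right_mono) auto
      finally show ?case .
    qed
  qed
  have \<Theta>small: "c j x < 1" if "\<Theta> N x \<noteq> 0" "j < N" for N j x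
  proof -
    have "c j x \<le> (\<Sum>j<N. c j x)" using that(2) c0 by (intro member_le_sum) auto
    then show ?thesis using that(1) unfolding \<Theta>_def by linarith
  qed
  \<comment> \<open>Otherwise bad points for every \<open>N\<close> accumulate at some
    \<open>l\<close>, around which \<open>u\<close> has a single Lipschitz constant. With
    \<open>Suc N\<close> cutoffs the point of index \<open>i\<close> is controlled at all scales up
    to and including \<open>i\<close>, as the compactness argument requires.\<close>
  have "\<exists>N. \<forall>x. \<Theta> (Suc N) x \<noteq> 0 \<longrightarrow> (real N)-lipschitz_on (ball x (1 / real (Suc N))) u"
  proof (rule ccontr)
    assume "\<not> ?thesis"
    then have "\<forall>N. \<exists>x. \<Theta> (Suc N) x \<noteq> 0 \<and> \<not> (real N)-lipschitz_on (ball x (1 / real (Suc N))) u" by blast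
    then obtain x where x: "\<And>N. \<Theta> (Suc N) (x N) \<noteq> 0" "\<And>N. \<not> (real N)-lipschitz_on (ball (x N) (1 / real (Suc N))) u"
      by metis
    have "net_cutoff p j (n j) (x i) < 1" if "j \<le> i" for i j
      using \<Theta>small[OF x(1)[of i], of j] that by (simp add: c_def)
    then obtain l s where s: "strict_mono (s :: nat \<Rightarrow> nat)" "(x \<circ> s) \<longlonglongrightarrow> l"
      by (rule convergent_subseq_of_net_cutoffs)
    obtain r L where rL: "0 < r" "L-lipschitz_on (ball l r) u" using u(1) unfolding LIPloc_def by blast
    have "\<forall>\<^sub>F k in sequentially. dist ((x \<circ> s) k) l < r / 2" using tendstoD[OF s(2), of "r/2"] rL(1) by simp
    moreover have "\<forall>\<^sub>F k in sequentially. 1 / real (Suc k) < r / 2"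
      using order_tendstoD(2)[OF LIMSEQ_inverse_real_of_nat, of "r/2"] rL(1) by (simp add: inverse_eq_divide)
    moreover have "\<forall>\<^sub>F k in sequentially. L \<le> real k"
      using filterlim_real_sequentially unfolding filterlim_at_top by blast
    ultimately have "\<forall>\<^sub>F k in sequentially. dist ((x \<circ> s) k) l < r / 2 \<and> 1 / real (Suc k) < r / 2 \<and> L \<le> real k"
      by eventually_elim auto
    then obtain k where k: "dist (x (s k)) l < r / 2" "1 / real (Suc k) < r / 2" "L \<le> real k"
      using eventually_happens'[OF sequentially_bot] by fastforce
    have "k \<le> s k" using s(1) by (rule seq_suble)
    then have "1 / real (Suc (s k)) \<le> 1 / real (Suc k)" "L \<le> real (s k)" using k(3) by (auto simp: frac_le)
    moreover have "ball (x (s k)) (1 / real (Suc (s k))) \<subseteq> ball l r"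
    proof
      fix y assume "y \<in> ball (x (s k)) (1 / real (Suc (s k)))"
      then have "dist (x (s k)) y < r / 2" using k(2) calculation(1) by simp
      then show "y \<in> ball l r" using dist_triangle[of l y "x (s k)"] k(1) by (simp add: dist_commute)
    qed
    ultimately have "(real (s k))-lipschitz_on (ball (x (s k)) (1 / real (Suc (s k)))) u"
      using lipschitz_on_mono[OF rL(2)] by blast
    then show False using x(2) by blast
  qed
  then obtain N where N: "\<And>x. \<Theta> (Suc N) x \<noteq> 0 \<Longrightarrow> (real N)-lipschitz_on (ball x (1 / real (Suc N))) u" by blast
  define w where "w x = u x * \<Theta> (Suc N) x" for x
  have small: "(\<integral>x. \<bar>u x\<bar> * a j x \<partial>m) * (real j + 2) \<le> e * (1/2) ^ Suc j" for j
  proof -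
    have "(\<integral>x. \<bar>u x\<bar> * a j x \<partial>m) \<le> e * (1/2) ^ Suc j / (real j + 2)" using n[of j] by (simp add: a_def mult.commute)
    then show ?thesis by (subst (asm) pos_le_divide_eq) auto
  qed
  have inta: "integrable m (\<lambda>x. \<bar>u x\<bar> * a j x)" for j using intA[of j "n j"] by (simp add: a_def mult.commute)
  have nna: "0 \<le> (\<integral>x. \<bar>u x\<bar> * a j x \<partial>m)" for j by (intro Bochner_Integration.integral_nonneg) (auto simp: a_def)
  have total: "(\<Sum>j<Suc N. \<rho> j * (\<integral>x. \<bar>u x\<bar> * a j x \<partial>m)) \<le> e" if \<rho>: "\<And>j. \<rho> j \<le> real j + 2" for \<rho> :: "nat \<Rightarrow> real"
  proof -
    have "(\<Sum>j<Suc N. \<rho> j * (\<integral>x. \<bar>u x\<bar> * a j x \<partial>m)) \<le> (\<Sum>j<Suc N. e * (1/2) ^ Suc j)"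
    proof (rule sum_mono)
      fix j
      have "\<rho> j * (\<integral>x. \<bar>u x\<bar> * a j x \<partial>m) \<le> (real j + 2) * (\<integral>x. \<bar>u x\<bar> * a j x \<partial>m)"
        by (intro mult_right_mono \<rho> nna)
      then show "\<rho> j * (\<integral>x. \<bar>u x\<bar> * a j x \<partial>m) \<le> e * (1/2) ^ Suc j" using small[of j] by (simp add: mult.commute)
    qed
    also have "\<dots> = e * (1 - (1/2) ^ Suc N)"
    proof -
      have "(\<Sum>j<Suc N. (1/2 :: real) ^ Suc j) = 1 - (1/2) ^ Suc N" by (induction N) (auto simp: field_simps)
      then show ?thesis by (simp only: sum_distrib_left[symmetric])
    qed
    also have "\<dots> \<le> e" using e by (simp add: mult_le_cancel_left1)
    finally show ?thesis .
  qed
  show ?thesis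
  proof (rule that[of w])
    show wL: "w \<in> LIPb"
      unfolding w_def[abs_def] by (rule bounded_Lipschitz_product[OF u(3) \<Theta>L \<Theta>0 N]) auto
    have "{x. w x \<noteq> 0} \<subseteq> {x. net_cutoff p 0 (n 0) x < 1}"
      using \<Theta>small[of "Suc N" _ 0] by (auto simp: w_def c_def)
    then show "bounded {x. w x \<noteq> 0}" by (rule bounded_subset[OF bounded_net_cutoff_lt_1])
    have [measurable]: "w \<in> borel_measurable m" by (rule LIPb_measurable_m[OF wL])
    have "(\<integral>x. \<bar>w x - u x\<bar> \<partial>m) \<le> (\<integral>x. (\<Sum>j<Suc N. \<bar>u x\<bar> * a j x) \<partial>m)"
    proof (rule integral_mono')
      show "integrable m (\<lambda>x. \<Sum>j<Suc N. \<bar>u x\<bar> * a j x)" by (intro Bochner_Integration.integrable_sum inta)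
      fix x
      have "w x - u x = u x * (\<Theta> (Suc N) x - 1)" by (simp add: w_def algebra_simps)
      then have "\<bar>w x - u x\<bar> = \<bar>u x\<bar> * \<bar>\<Theta> (Suc N) x - 1\<bar>" by (simp only: abs_mult)
      also have "\<dots> \<le> \<bar>u x\<bar> * (\<Sum>j<Suc N. a j x)" by (intro mult_left_mono \<Theta>1) auto
      finally show "\<bar>w x - u x\<bar> \<le> (\<Sum>j<Suc N. \<bar>u x\<bar> * a j x)" by (simp only: sum_distrib_left)
    qed (auto simp: a_def intro!: sum_nonneg)
    also have "\<dots> = (\<Sum>j<Suc N. \<integral>x. \<bar>u x\<bar> * a j x \<partial>m)" by (intro Bochner_Integration.integral_sum inta)
    also have "\<dots> \<le> e" using total[of "\<lambda>_. 1"] by simp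
    finally show "(\<integral>x. \<bar>w x - u x\<bar> \<partial>m) \<le> e" .
    have lipw: "lip w x \<le> lip u x + ennreal (\<Sum>j<Suc N. real (Suc j) * (\<bar>u x\<bar> * a j x))" for x
    proof -
      have "isCont u x" using LIPloc_continuous[OF u(1)] by (simp add: continuous_on_eq_continuous_at)
      then have "slope w x \<le> \<bar>u x\<bar> * slope (\<Theta> (Suc N)) x + \<bar>\<Theta> (Suc N) x\<bar> * slope u x"
        unfolding w_def[abs_def] by (intro slope_mult LIPloc_lip_finite u LIPb_lip_finite \<Theta>L)
      also have "\<dots> \<le> \<bar>u x\<bar> * (\<Sum>j<Suc N. real (Suc j) * a j x) + 1 * slope u x"
        using \<Theta>0[of "Suc N" x] by (intro add_mono mult_mono slope\<Theta>) auto
      also have "\<dots> = slope u x + (\<Sum>j<Suc N. real (Suc j) * (\<bar>u x\<bar> * a j x))"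
        by (simp add: sum_distrib_left mult.left_commute del: sum.lessThan_Suc)
      finally have "ennreal (slope w x) \<le> ennreal (slope u x + (\<Sum>j<Suc N. real (Suc j) * (\<bar>u x\<bar> * a j x)))"
        by (rule ennreal_leI)
      also have "\<dots> = ennreal (slope u x) + ennreal (\<Sum>j<Suc N. real (Suc j) * (\<bar>u x\<bar> * a j x))"
        by (intro ennreal_plus sum_nonneg) (auto simp: a_def)
      finally show ?thesis
        by (simp only: ennreal_slope[OF LIPb_lip_finite[OF wL]] ennreal_slope[OF LIPloc_lip_finite[OF u(1)]])
    qed
    have [measurable]: "lip u \<in> borel_measurable m"
      using lip_borel_measurable[OF LIPloc_continuous[OF u(1)]] by (simp add: measurable_cong_sets[OF sets_m refl])
    have intS: "integrable m (\<lambda>x. \<Sum>j<Suc N. real (Suc j) * (\<bar>u x\<bar> * a j x))"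
      by (intro Bochner_Integration.integrable_sum integrable_mult_right inta)
    have "(\<integral>\<^sup>+x. lip w x \<partial>m) \<le> (\<integral>\<^sup>+x. lip u x + ennreal (\<Sum>j<Suc N. real (Suc j) * (\<bar>u x\<bar> * a j x)) \<partial>m)"
      by (intro nn_integral_mono lipw)
    also have "\<dots> = (\<integral>\<^sup>+x. lip u x \<partial>m) + (\<integral>\<^sup>+x. ennreal (\<Sum>j<Suc N. real (Suc j) * (\<bar>u x\<bar> * a j x)) \<partial>m)"
      using intS by (intro nn_integral_add) measurable
    also have "(\<integral>\<^sup>+x. ennreal (\<Sum>j<Suc N. real (Suc j) * (\<bar>u x\<bar> * a j x)) \<partial>m) = ennreal (\<integral>x. (\<Sum>j<Suc N. real (Suc j) * (\<bar>u x\<bar> * a j x)) \<partial>m)"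
      by (intro nn_integral_eq_integral intS) (auto simp: a_def intro!: sum_nonneg simp del: sum.lessThan_Suc)
    also have "(\<integral>x. (\<Sum>j<Suc N. real (Suc j) * (\<bar>u x\<bar> * a j x)) \<partial>m) = (\<Sum>j<Suc N. real (Suc j) * (\<integral>x. \<bar>u x\<bar> * a j x \<partial>m))"
      using inta by (subst Bochner_Integration.integral_sum) (auto simp del: sum.lessThan_Suc)
    also have "ennreal \<dots> \<le> ennreal e" by (intro ennreal_leI total) auto
    finally show "(\<integral>\<^sup>+x. lip w x \<partial>m) \<le> (\<integral>\<^sup>+x. lip u x \<partial>m) + ennreal e" by (simp add: add_left_mono)
  qed
qed

text \<open>Removes the boundedness assumption: truncating the values at -n and n moves the function
  little in L1 for large \<open>n\<close> and does not increase \<open>lip\<close>.\<close>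

lemma LIPloc_cutoff:
  assumes u: "u \<in> LIPloc" "integrable m u" and e: "0 < e"
  obtains w where "w \<in> LIPb" "bounded {x. w x \<noteq> 0}" "(\<integral>x. \<bar>w x - u x\<bar> \<partial>m) \<le> e"
    "(\<integral>\<^sup>+x. lip w x \<partial>m) \<le> (\<integral>\<^sup>+x. lip u x \<partial>m) + ennreal e"
proof -
  define c where "c n x = min (max (u x) (- real n)) (real n)" for n :: nat and x
  have [measurable]: "u \<in> borel_measurable m" using u by simp
  have [measurable]: "c n \<in> borel_measurable m" for n unfolding c_def by measurable
  have c_u: "\<bar>c n y - c n x\<bar> \<le> \<bar>u y - u x\<bar>" for n x y unfolding c_def by linarith
  have cabs: "\<bar>c n x\<bar> \<le> \<bar>u x\<bar>" "\<bar>c n x\<bar> \<le> real n" for n x unfolding c_def by linarith+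
  have "(\<lambda>n. \<integral>x. \<bar>c n x - u x\<bar> \<partial>m) \<longlonglongrightarrow> (\<integral>x. 0 \<partial>m)"
  proof (rule integral_dominated_convergence[where w="\<lambda>x. 2 * \<bar>u x\<bar>"])
    show "AE x in m. (\<lambda>n. \<bar>c n x - u x\<bar>) \<longlonglongrightarrow> 0"
    proof (rule AE_I2, rule tendsto_eventually)
      fix x :: 'a
      have "\<forall>\<^sub>F n in sequentially. \<bar>u x\<bar> \<le> real n"
        using filterlim_real_sequentially unfolding filterlim_at_top by blast
      then show "\<forall>\<^sub>F n in sequentially. \<bar>c n x - u x\<bar> = 0"
        by eventually_elim (auto simp: c_def abs_le_iff min_def max_def)
    qed
    show "AE x in m. norm \<bar>c n x - u x\<bar> \<le> 2 * \<bar>u x\<bar>" for n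
    proof (rule AE_I2)
      show "norm \<bar>c n x - u x\<bar> \<le> 2 * \<bar>u x\<bar>" for x using cabs(1)[of n x] unfolding real_norm_def by linarith
    qed
  qed (use u in auto)
  then have "\<forall>\<^sub>F n in sequentially. (\<integral>x. \<bar>c n x - u x\<bar> \<partial>m) < e/2"
    using order_tendstoD(2)[of _ 0 sequentially "e/2"] e by simp
  then obtain n where n: "(\<integral>x. \<bar>c n x - u x\<bar> \<partial>m) < e/2" using eventually_happens'[OF sequentially_bot] by blast
  have cL: "c n \<in> LIPloc"
    unfolding LIPloc_def
  proof (intro CollectI conjI allI)
    show "c n \<in> borel_measurable borel" using \<open>c n \<in> borel_measurable m\<close> unfolding borel_measurable_m .
    fix x
    obtain r L where "0 < r" "L-lipschitz_on (ball x r) u" using u(1) unfolding LIPloc_def by blast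
    have "L-lipschitz_on (ball x r) (c n)"
    proof (rule lipschitz_onI)
      show "dist (c n y) (c n z) \<le> L * dist y z" if "y \<in> ball x r" "z \<in> ball x r" for y z
        using lipschitz_onD[OF \<open>L-lipschitz_on (ball x r) u\<close> that] c_u[of n y z] by (simp add: dist_real_def)
      show "0 \<le> L" using \<open>L-lipschitz_on (ball x r) u\<close> by (rule lipschitz_on_nonneg)
    qed
    then show "\<exists>r>0. \<exists>L. L-lipschitz_on (ball x r) (c n)" using \<open>0 < r\<close> by blast
  qed
  have ic: "integrable m (c n)"
    by (rule Bochner_Integration.integrable_bound[OF u(2)]) (use cabs(1) in auto)
  have "0 < e/2" using e by simp
  then obtain w where w: "w \<in> LIPb" "bounded {x. w x \<noteq> 0}" "(\<integral>x. \<bar>w x - c n x\<bar> \<partial>m) \<le> e/2"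
      "(\<integral>\<^sup>+x. lip w x \<partial>m) \<le> (\<integral>\<^sup>+x. lip (c n) x \<partial>m) + ennreal (e/2)"
    using LIPloc_bounded_cutoff[OF cL ic cabs(2)] by blast
  show ?thesis
  proof (rule that[OF w(1,2)])
    have "has_bounded_support m w" unfolding has_bounded_support_iff using w(2) by blast
    moreover have "w \<in> L2 m"
    proof -
      obtain B where B: "\<And>x. \<bar>w x\<bar> \<le> B" using LIPbE[OF w(1)] by metis
      obtain r where "{x. w x \<noteq> 0} \<subseteq> ball undefined r" using bounded_subset_ballD[OF w(2)] by blast
      then show ?thesis using B by (intro bounded_support_L2[OF LIPb_measurable_m[OF w(1)]]) auto
    qed
    ultimately have iw: "integrable m w" by (intro L2_bounded_support_integrable)
    have "(\<integral>x. \<bar>w x - u x\<bar> \<partial>m) \<le> (\<integral>x. \<bar>w x - c n x\<bar> + \<bar>c n x - u x\<bar> \<partial>m)"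
      using iw ic u(2) by (intro integral_mono) auto
    also have "\<dots> = (\<integral>x. \<bar>w x - c n x\<bar> \<partial>m) + (\<integral>x. \<bar>c n x - u x\<bar> \<partial>m)" using iw ic u(2) by simp
    finally show "(\<integral>x. \<bar>w x - u x\<bar> \<partial>m) \<le> e" using w(3) n by linarith
    have "lip (c n) x \<le> lip u x" for x
      unfolding lip_def using c_u by (intro Limsup_mono always_eventually allI ennreal_leI divide_right_mono) auto
    then have "(\<integral>\<^sup>+x. lip (c n) x \<partial>m) \<le> (\<integral>\<^sup>+x. lip u x \<partial>m)" by (intro nn_integral_mono)
    moreover have "ennreal (e/2) \<le> ennreal e" using e by (intro ennreal_leI) auto
    ultimately show "(\<integral>\<^sup>+x. lip w x \<partial>m) \<le> (\<integral>\<^sup>+x. lip u x \<partial>m) + ennreal e"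
      using w(4) by (meson add_mono order_trans)
  qed
qed

lemma BV_Lipschitz_approx:
  assumes "f \<in> BV m"
  obtains F M where "0 \<le> M" "\<And>k. F k \<in> LIPb" "\<And>k. bounded {x. F k x \<noteq> 0}" "\<And>k. integrable m (slope (F k))"
    "\<And>k. (\<integral>x. slope (F k) x \<partial>m) \<le> M" "(\<lambda>k. \<integral>x. \<bar>F k x - f x\<bar> \<partial>m) \<longlonglongrightarrow> 0"
proof -
  have f: "integrable m f" using assms by (simp add: BV_def)
  have "(INF F\<in>{F. (\<forall>k. F k \<in> LIPloc \<and> integrable m (F k)) \<and> (\<lambda>k. \<integral>x. \<bar>F k x - f x\<bar> \<partial>m) \<longlonglongrightarrow> 0}.
        liminf (\<lambda>k. \<integral>\<^sup>+x. lip (F k) x \<partial>m)) < \<infinity>"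
    using assms by (simp add: BV_def)
  then obtain G where G: "\<And>k. G k \<in> LIPloc" "\<And>k. integrable m (G k)" "(\<lambda>k. \<integral>x. \<bar>G k x - f x\<bar> \<partial>m) \<longlonglongrightarrow> 0"
    and fin: "liminf (\<lambda>k. \<integral>\<^sup>+x. lip (G k) x \<partial>m) < \<infinity>"
    unfolding INF_less_iff by blast
  obtain M where M: "0 \<le> M" "liminf (\<lambda>k. \<integral>\<^sup>+x. lip (G k) x \<partial>m) < ennreal M"
  proof -
    obtain z where z: "liminf (\<lambda>k. \<integral>\<^sup>+x. lip (G k) x \<partial>m) < z" "z < \<infinity>" using dense[OF fin] by blast
    then show ?thesis using that by (cases z) auto
  qed
  have "\<exists>w. w \<in> LIPb \<and> bounded {x. w x \<noteq> 0} \<and> (\<integral>x. \<bar>w x - f x\<bar> \<partial>m) \<le> 2 * inverse (real (Suc n)) \<and>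
      (\<integral>\<^sup>+x. lip w x \<partial>m) \<le> ennreal (M + 1)" for n
  proof -
    have pos: "0 < inverse (real (Suc n))" by simp
    have "\<forall>\<^sub>F k in sequentially. (\<integral>x. \<bar>G k x - f x\<bar> \<partial>m) < inverse (real (Suc n))"
      using order_tendstoD(2)[OF G(3) pos] .
    \<comment> \<open>A lower limit below \<open>M\<close> bounds the energy only for infinitely
      many \<open>k\<close>; closeness in L1 holds eventually, so some \<open>k\<close> has both
      properties.\<close>
    moreover have "\<exists>\<^sub>F k in sequentially. (\<integral>\<^sup>+x. lip (G k) x \<partial>m) < ennreal M"
    proof (rule ccontr)
      assume "\<not> ?thesis"
      then have "\<forall>\<^sub>F k in sequentially. ennreal M \<le> (\<integral>\<^sup>+x. lip (G k) x \<partial>m)" by (simp add: frequently_def not_less)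
      then have "ennreal M \<le> liminf (\<lambda>k. \<integral>\<^sup>+x. lip (G k) x \<partial>m)" by (rule Liminf_bounded)
      then show False using M(2) by simp
    qed
    ultimately have "\<exists>\<^sub>F k in sequentially. (\<integral>\<^sup>+x. lip (G k) x \<partial>m) < ennreal M \<and> (\<integral>x. \<bar>G k x - f x\<bar> \<partial>m) < inverse (real (Suc n))"
      by (intro frequently_eventually_frequently)
    then obtain k where k: "(\<integral>\<^sup>+x. lip (G k) x \<partial>m) < ennreal M" "(\<integral>x. \<bar>G k x - f x\<bar> \<partial>m) < inverse (real (Suc n))"
      using frequently_ex by blast
    obtain w where w: "w \<in> LIPb" "bounded {x. w x \<noteq> 0}" "(\<integral>x. \<bar>w x - G k x\<bar> \<partial>m) \<le> inverse (real (Suc n))"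
      "(\<integral>\<^sup>+x. lip w x \<partial>m) \<le> (\<integral>\<^sup>+x. lip (G k) x \<partial>m) + ennreal (inverse (real (Suc n)))"
      using LIPloc_cutoff[OF G(1,2) pos] by blast
    have iw: "integrable m w"
    proof -
      obtain B where B: "\<And>x. \<bar>w x\<bar> \<le> B" using LIPbE[OF w(1)] by metis
      obtain r where "{x. w x \<noteq> 0} \<subseteq> ball undefined r" using bounded_subset_ballD[OF w(2)] by blast
      then have "w x = 0" if "x \<notin> ball undefined r" for x using that by blast
      then show ?thesis
        using B by (intro bounded_support_integrable[of w B undefined r] LIPb_measurable_m w) auto
    qed
    have "(\<integral>x. \<bar>w x - f x\<bar> \<partial>m) \<le> (\<integral>x. \<bar>w x - G k x\<bar> + \<bar>G k x - f x\<bar> \<partial>m)"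
      using iw G(2)[of k] f by (intro integral_mono) auto
    also have "\<dots> = (\<integral>x. \<bar>w x - G k x\<bar> \<partial>m) + (\<integral>x. \<bar>G k x - f x\<bar> \<partial>m)" using iw G(2)[of k] f by simp
    finally have "(\<integral>x. \<bar>w x - f x\<bar> \<partial>m) \<le> 2 * inverse (real (Suc n))" using w(3) k(2) by linarith
    moreover have "(\<integral>\<^sup>+x. lip w x \<partial>m) \<le> ennreal M + ennreal 1"
    proof (rule order_trans[OF w(4) add_mono])
      show "ennreal (inverse (real (Suc n))) \<le> ennreal 1" by (intro ennreal_leI) (simp add: inverse_eq_divide)
    qed (use k(1) in auto)
    ultimately show ?thesis
      using w(1,2) M(1) by (intro exI[of _ w] conjI) (simp_all only: ennreal_plus zero_le_one)
  qed
  then obtain F where F: "\<And>n. F n \<in> LIPb" "\<And>n. bounded {x. F n x \<noteq> 0}"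
    "\<And>n. (\<integral>x. \<bar>F n x - f x\<bar> \<partial>m) \<le> 2 * inverse (real (Suc n))" "\<And>n. (\<integral>\<^sup>+x. lip (F n) x \<partial>m) \<le> ennreal (M + 1)"
    by metis
  have nn: "(\<integral>\<^sup>+x. ennreal (slope (F n) x) \<partial>m) \<le> ennreal (M + 1)" for n
    using F(4)[of n] by (simp only: ennreal_slope[OF LIPb_lip_finite[OF F(1)]])
  have int: "integrable m (slope (F n))" for n
  proof (rule integrableI_nonneg)
    show "(\<integral>\<^sup>+x. ennreal (slope (F n) x) \<partial>m) < \<infinity>" using nn[of n] by (simp add: le_less_trans)
  qed (use slope_measurable_m[OF F(1)] in auto)
  show ?thesis
  proof (rule that[of "M + 1" F])
    show "(\<integral>x. slope (F k) x \<partial>m) \<le> M + 1" for k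
    proof -
      have "ennreal (\<integral>x. slope (F k) x \<partial>m) = (\<integral>\<^sup>+x. ennreal (slope (F k) x) \<partial>m)"
        by (intro nn_integral_eq_integral[symmetric] int) simp
      also note nn[of k]
      finally show ?thesis using M(1) by (subst (asm) ennreal_le_iff) auto
    qed
    show "(\<lambda>k. \<integral>x. \<bar>F k x - f x\<bar> \<partial>m) \<longlonglongrightarrow> 0"
    proof (rule tendsto_sandwich[OF _ _ tendsto_const])
      show "(\<lambda>n. 2 * inverse (real (Suc n))) \<longlonglongrightarrow> 0" by (rule tendsto_mult_right_zero[OF LIMSEQ_inverse_real_of_nat])
    qed (use F(3) in auto)
  qed (use M F int in auto)
qed

end

section \<open>The measure dominating a functional on divergence fields\<close>

lemma tendsto_zero_of_antimono:
  fixes a :: "nat \<Rightarrow> real"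
  assumes "\<And>n. a (Suc n) \<le> a n" "\<And>n. 0 \<le> a n" "\<And>e. 0 < e \<Longrightarrow> \<exists>n. a n \<le> e"
  shows "a \<longlonglongrightarrow> 0"
proof (rule LIMSEQ_I)
  fix e :: real assume e: "0 < e"
  have dec: "decseq a" using assms(1) by (rule decseq_SucI)
  obtain n where n: "a n \<le> e/2" using assms(3)[of "e/2"] e by auto
  have "norm (a k - 0) < e" if "n \<le> k" for k
    using decseqD[OF dec that] n assms(2)[of k] e by simp
  then show "\<exists>no. \<forall>k\<ge>no. norm (a k - 0) < e" by blast
qed

definition LIPb_nonneg :: "('a::metric_space \<Rightarrow> real) \<Rightarrow> bool" where
  "LIPb_nonneg s \<longleftrightarrow> s \<in> LIPb \<and> (\<forall>x. 0 \<le> s x)"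

lemma LIPb_nonnegD: "LIPb_nonneg s \<Longrightarrow> s \<in> LIPb" "LIPb_nonneg s \<Longrightarrow> 0 \<le> s x"
  by (auto simp: LIPb_nonneg_def)

lemma LIPb_nonnegI: "s \<in> LIPb \<Longrightarrow> (\<And>x. 0 \<le> s x) \<Longrightarrow> LIPb_nonneg s"
  by (auto simp: LIPb_nonneg_def)

lemma LIPb_nonneg_add: "LIPb_nonneg s \<Longrightarrow> LIPb_nonneg t \<Longrightarrow> LIPb_nonneg (\<lambda>x. s x + t x)"
  by (auto simp: LIPb_nonneg_def)

lemma LIPb_nonneg_sum: "(\<And>i. i \<in> I \<Longrightarrow> LIPb_nonneg (s i)) \<Longrightarrow> LIPb_nonneg (\<lambda>x. \<Sum>i\<in>I. s i x)"
  by (auto simp: LIPb_nonneg_def intro: sum_nonneg)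

lemma LIPb_nonneg_mult: "LIPb_nonneg s \<Longrightarrow> LIPb_nonneg t \<Longrightarrow> LIPb_nonneg (\<lambda>x. s x * t x)"
  by (auto simp: LIPb_nonneg_def)

lemma LIPb_nonneg_const: "0 \<le> c \<Longrightarrow> LIPb_nonneg (\<lambda>_. c)"
  by (auto simp: LIPb_nonneg_def)

lemma LIPb_nonneg_bound:
  assumes "LIPb_nonneg s" obtains B where "0 \<le> B" "\<And>x. s x \<le> B"
  using LIPbE[OF LIPb_nonnegD(1)[OF assms]] by (metis abs_le_D1)

text \<open>Abstracts from the BV function: the construction of the measure and the localisation use
  only linearity, a bound by the sup norm and continuity along equi-Lipschitz multipliers. The
  one-sided bound is two-sided after replacing \<open>v\<close> by its negative.\<close>

locale divergence_functional = tangent_L0 m C d E \<iota>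
  for m :: "'a::polish_space measure" and C :: "('a, 'v::banach) module_ops"
    and d :: "('a \<Rightarrow> real) \<Rightarrow> 'v" and E :: "('a, 'w::real_vector) module_ops"
    and \<iota> :: "('v \<Rightarrow> 'a \<Rightarrow> real) \<Rightarrow> 'w" +
  fixes F :: "'w \<Rightarrow> real" and M :: real
  assumes F_add: "\<And>u v. u \<in> Ddiv \<Longrightarrow> v \<in> Ddiv \<Longrightarrow> F (u + v) = F u + F v"
    and F_scaleR: "\<And>c v. v \<in> Ddiv \<Longrightarrow> F (c *\<^sub>R v) = c * F v"
    and F_bound: "\<And>c v. v \<in> Ddiv \<Longrightarrow> AE x in m. pnorm E v x \<le> c \<Longrightarrow> 0 \<le> c \<Longrightarrow> F v \<le> M * c"
    and M_nonneg: "0 \<le> M"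
    and F_continuous: "\<And>v \<phi> L. v \<in> Ddiv \<Longrightarrow> (\<And>n. \<phi> n \<in> LIPb) \<Longrightarrow> (\<And>n x. \<bar>\<phi> n x\<bar> \<le> 1) \<Longrightarrow> 0 \<le> L \<Longrightarrow>
          (\<And>n x y. \<bar>\<phi> n x - \<phi> n y\<bar> \<le> L * dist x y) \<Longrightarrow> (\<And>x. (\<lambda>n. \<phi> n x) \<longlonglongrightarrow> 0) \<Longrightarrow>
          (\<lambda>n. F (scal E (\<phi> n) v)) \<longlonglongrightarrow> 0"
begin

lemma F_zero: "F 0 = 0"
  using F_scaleR[OF D_div_zero, of 0] by simp

lemma F_uminus: "v \<in> Ddiv \<Longrightarrow> F (- v) = - F v"
  using F_scaleR[of v "-1"] by simp

lemma scal_E_add: "f \<in> LIPb \<Longrightarrow> g \<in> LIPb \<Longrightarrow> scal E (\<lambda>x. f x + g x) v = scal E f v + scal E g v"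
  by (intro L0.scal_add_left LIPb_measurable_m)

lemma pnorm_scal_le:
  assumes "f \<in> LIPb" "AE x in m. pnorm E v x \<le> s x" "\<And>x. \<bar>f x\<bar> * s x \<le> t x"
  shows "AE x in m. pnorm E (scal E f v) x \<le> t x"
  using L0.pnorm_scal[OF LIPb_measurable_m[OF assms(1)], of v] assms(2)
proof eventually_elim
  case (elim x)
  have "\<bar>f x\<bar> * pnorm E v x \<le> \<bar>f x\<bar> * s x" using elim by (intro mult_left_mono) auto
  then show ?case using elim(1) assms(3)[of x] by linarith
qed

text \<open>The integral of \<open>s\<close> against the prospective total variation of
  \<open>F\<close>. For bounded \<open>s\<close> the supremum is finite by \<open>F_bound\<close>,
  and for nonnegative \<open>s\<close> the zero field is admissible.\<close>

definition \<Lambda> :: "('a \<Rightarrow> real) \<Rightarrow> real" where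
  "\<Lambda> s = (SUP w\<in>{w\<in>Ddiv. AE x in m. pnorm E w x \<le> s x}. F w)"

lemma F_le_\<Lambda>:
  assumes s: "LIPb_nonneg s" and w: "w \<in> Ddiv" "AE x in m. pnorm E w x \<le> s x"
  shows "F w \<le> \<Lambda> s"
proof -
  obtain B where B: "0 \<le> B" "\<And>x. s x \<le> B" using LIPb_nonneg_bound[OF s] by blast
  have "F v \<le> M * B" if "v \<in> Ddiv" "AE x in m. pnorm E v x \<le> s x" for v
    using that(2) B by (intro F_bound that(1)) (auto elim!: eventually_mono intro: order_trans)
  then show ?thesis unfolding \<Lambda>_def using w by (intro cSUP_upper bdd_aboveI2[where M="M * B"]) auto
qed

lemma \<Lambda>_le:
  assumes s: "LIPb_nonneg s" and "\<And>w. w \<in> Ddiv \<Longrightarrow> AE x in m. pnorm E w x \<le> s x \<Longrightarrow> F w \<le> c"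
  shows "\<Lambda> s \<le> c"
proof -
  have "AE x in m. pnorm E 0 x \<le> s x" using pnorm_E_zero LIPb_nonnegD(2)[OF s] by (auto elim!: eventually_mono)
  then show ?thesis unfolding \<Lambda>_def using assms(2) D_div_zero by (intro cSUP_least) auto
qed

lemma \<Lambda>_nonneg:
  assumes s: "LIPb_nonneg s" shows "0 \<le> \<Lambda> s"
proof -
  have "AE x in m. pnorm E 0 x \<le> s x"
    using pnorm_E_zero by eventually_elim (simp add: LIPb_nonnegD(2)[OF s])
  then show ?thesis using F_le_\<Lambda>[OF s D_div_zero] F_zero by simp
qed

lemma \<Lambda>_mono: "LIPb_nonneg s \<Longrightarrow> LIPb_nonneg t \<Longrightarrow> (\<And>x. s x \<le> t x) \<Longrightarrow> \<Lambda> s \<le> \<Lambda> t"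
  by (rule \<Lambda>_le, assumption, rule F_le_\<Lambda>) (auto elim!: eventually_mono intro: order_trans)

lemma \<Lambda>_le_const: "LIPb_nonneg s \<Longrightarrow> (\<And>x. s x \<le> c) \<Longrightarrow> 0 \<le> c \<Longrightarrow> \<Lambda> s \<le> M * c"
  by (rule \<Lambda>_le, assumption, rule F_bound) (auto elim!: eventually_mono intro: order_trans)

lemma \<Lambda>_cmult_le:
  assumes s: "LIPb_nonneg s" and c: "0 < c" shows "\<Lambda> (\<lambda>x. c * s x) \<le> c * \<Lambda> s"
proof (rule \<Lambda>_le)
  show "LIPb_nonneg (\<lambda>x. c * s x)" using LIPb_nonneg_mult[OF LIPb_nonneg_const s] c by simp
  fix w assume w: "w \<in> Ddiv" "AE x in m. pnorm E w x \<le> c * s x"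
  have "AE x in m. pnorm E (scal E (\<lambda>_. 1 / c) w) x \<le> s x" by (rule pnorm_scal_le[OF _ w(2)]) (use c in auto)
  then have "F ((1 / c) *\<^sub>R w) \<le> \<Lambda> s" by (intro F_le_\<Lambda> s D_div_scaleR w) (simp add: L0.scal_const)
  then show "F w \<le> c * \<Lambda> s" using c F_scaleR[OF w(1), of "1 / c"] by (simp add: field_simps)
qed

lemma \<Lambda>_add:
  assumes s: "LIPb_nonneg s" and t: "LIPb_nonneg t"
  shows "\<Lambda> (\<lambda>x. s x + t x) = \<Lambda> s + \<Lambda> t"
proof (rule antisym)
  note sL = LIPb_nonnegD[OF s] and tL = LIPb_nonnegD[OF t]
  note st = LIPb_nonneg_add[OF s t]
  show "\<Lambda> (\<lambda>x. s x + t x) \<le> \<Lambda> s + \<Lambda> t"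
  proof (rule \<Lambda>_le[OF st])
    fix w assume w: "w \<in> Ddiv" "AE x in m. pnorm E w x \<le> s x + t x"
    have "F w \<le> \<Lambda> s + \<Lambda> t + M * \<eta>" if \<eta>: "0 < \<eta>" for \<eta>
    proof -
      \<comment> \<open>The fractions s / q and t / q split \<open>w\<close> into admissible fields
        for \<open>s\<close> and \<open>t\<close>. The term \<eta> keeps the denominator away from
        0; the leftover share \<eta> / q costs at most M \<eta>.\<close>
      define q where "q x = s x + t x + \<eta>" for x
      have q: "q \<in> LIPb" "\<And>x. \<eta> \<le> q x" unfolding q_def[abs_def] using sL tL by (auto intro!: LIPb_add)
      have qpos: "0 < q x" for x using q(2)[of x] \<eta> by linarith
      define a b c where "a x = s x / q x" and "b x = t x / q x" and "c x = \<eta> / q x" for x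
      have abc: "a \<in> LIPb" "b \<in> LIPb" "c \<in> LIPb"
        unfolding a_def[abs_def] b_def[abs_def] c_def[abs_def] using sL tL \<eta> q by (auto intro!: LIPb_divide)
      have one: "(\<lambda>x. (a x + b x) + c x) = (\<lambda>_. 1)"
        using qpos by (auto simp: a_def b_def c_def add_divide_distrib[symmetric] q_def[symmetric] fun_eq_iff less_le)
      have "w = scal E (\<lambda>x. (a x + b x) + c x) w" unfolding one by (simp add: L0.scal_const)
      also have "\<dots> = scal E a w + scal E b w + scal E c w" using abc by (simp add: scal_E_add LIPb_add)
      finally have "F w = F (scal E a w) + F (scal E b w) + F (scal E c w)"
        using F_add D_div_add D_div_scal[OF w(1)] abc by metis
      moreover have "F (scal E a w) \<le> \<Lambda> s"
      proof (rule F_le_\<Lambda>[OF s D_div_scal[OF w(1) abc(1)]], rule pnorm_scal_le[OF abc(1) w(2)])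
        show "\<bar>a x\<bar> * (s x + t x) \<le> s x" for x
          using qpos[of x] sL(2)[of x] tL(2)[of x] \<eta> by (simp add: a_def pos_divide_le_eq) (simp add: q_def mult_left_mono)
      qed
      moreover have "F (scal E b w) \<le> \<Lambda> t"
      proof (rule F_le_\<Lambda>[OF t D_div_scal[OF w(1) abc(2)]], rule pnorm_scal_le[OF abc(2) w(2)])
        show "\<bar>b x\<bar> * (s x + t x) \<le> t x" for x
          using qpos[of x] sL(2)[of x] tL(2)[of x] \<eta> by (simp add: b_def pos_divide_le_eq) (simp add: q_def mult_left_mono)
      qed
      moreover have "F (scal E c w) \<le> M * \<eta>"
      proof (rule F_bound[OF D_div_scal[OF w(1) abc(3)]], rule pnorm_scal_le[OF abc(3) w(2)])
        show "\<bar>c x\<bar> * (s x + t x) \<le> \<eta>" for x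
          using qpos[of x] sL(2)[of x] tL(2)[of x] \<eta> by (simp add: c_def pos_divide_le_eq) (simp add: q_def mult_left_mono)
      qed (use \<eta> in simp)
      ultimately show ?thesis by linarith
    qed
    then have "F w \<le> \<Lambda> s + \<Lambda> t + e" if "0 < e" for e
    proof -
      have "M * (e / (M + 1)) \<le> e" using that M_nonneg by (simp add: field_simps)
      then show ?thesis using \<open>\<And>\<eta>. 0 < \<eta> \<Longrightarrow> F w \<le> \<Lambda> s + \<Lambda> t + M * \<eta>\<close>[of "e / (M + 1)"] that M_nonneg by fastforce
    qed
    then show "F w \<le> \<Lambda> s + \<Lambda> t" by (rule field_le_epsilon)
  qed
  have "F u + F w \<le> \<Lambda> (\<lambda>x. s x + t x)"
    if u: "u \<in> Ddiv" "AE x in m. pnorm E u x \<le> s x" and w: "w \<in> Ddiv" "AE x in m. pnorm E w x \<le> t x" for u w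
  proof -
    have "AE x in m. pnorm E (u + w) x \<le> s x + t x"
      using L0.pnorm_triangle[of u w] u(2) w(2) by eventually_elim linarith
    then have "F (u + w) \<le> \<Lambda> (\<lambda>x. s x + t x)" by (intro F_le_\<Lambda> st D_div_add u w)
    then show ?thesis using F_add u w by simp
  qed
  then have "\<Lambda> s \<le> \<Lambda> (\<lambda>x. s x + t x) - F w" if "w \<in> Ddiv" "AE x in m. pnorm E w x \<le> t x" for w
    using that by (intro \<Lambda>_le[OF s]) (simp add: le_diff_eq)
  then have "\<Lambda> t \<le> \<Lambda> (\<lambda>x. s x + t x) - \<Lambda> s"
    by (intro \<Lambda>_le[OF t]) (simp add: le_diff_eq add.commute)
  then show "\<Lambda> s + \<Lambda> t \<le> \<Lambda> (\<lambda>x. s x + t x)" by simp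
qed

lemma \<Lambda>_zero: "\<Lambda> (\<lambda>_. 0) = 0"
  using \<Lambda>_add[of "\<lambda>_. 0" "\<lambda>_. 0"] LIPb_nonneg_const[of 0] by simp

lemma \<Lambda>_sum:
  assumes "finite I" "\<And>i. i \<in> I \<Longrightarrow> LIPb_nonneg (s i)"
  shows "\<Lambda> (\<lambda>x. \<Sum>i\<in>I. s i x) = (\<Sum>i\<in>I. \<Lambda> (s i))"
  using assms
proof (induction I)
  case (insert i I)
  then have "\<Lambda> (\<lambda>x. s i x + (\<Sum>i\<in>I. s i x)) = \<Lambda> (s i) + \<Lambda> (\<lambda>x. \<Sum>i\<in>I. s i x)"
    by (intro \<Lambda>_add LIPb_nonneg_sum) auto
  then show ?case using insert by simp
qed (simp add: \<Lambda>_zero)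

lemma \<Lambda>_diff:
  assumes "LIPb_nonneg s" "LIPb_nonneg t" "\<And>x. s x \<le> t x"
  shows "\<Lambda> (\<lambda>x. t x - s x) = \<Lambda> t - \<Lambda> s"
proof -
  have "LIPb_nonneg (\<lambda>x. t x - s x)" using assms by (auto simp: LIPb_nonneg_def)
  then show ?thesis using \<Lambda>_add[of s "\<lambda>x. t x - s x"] assms by simp
qed

text \<open>A field bounded by \<open>\<phi> n\<close> is, up to a small error, \<open>\<phi> n\<close> times a field bounded by \<open>1\<close>;
  hence the limit of \<open>\<Lambda> (\<phi> n)\<close> can be subtracted from \<open>\<Lambda> (\<phi> n)\<close> without making it smaller.\<close>

lemma \<Lambda>_equi_Lipschitz_tendsto_0:
  assumes \<phi>: "\<And>n. LIPb_nonneg (\<phi> n)" "\<And>n x. \<phi> n x \<le> 1" "\<And>n x. \<phi> (Suc n) x \<le> \<phi> n x"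
    and L: "0 \<le> L" "\<And>n x y. \<bar>\<phi> n x - \<phi> n y\<bar> \<le> L * dist x y" and lim: "\<And>x. (\<lambda>n. \<phi> n x) \<longlonglongrightarrow> 0"
  shows "(\<lambda>n. \<Lambda> (\<phi> n)) \<longlonglongrightarrow> 0"
proof -
  have dec: "decseq (\<lambda>n. \<Lambda> (\<phi> n))" by (intro decseq_SucI \<Lambda>_mono \<phi>)
  have "\<forall>n. 0 \<le> \<Lambda> (\<phi> n)" using \<Lambda>_nonneg \<phi> by blast
  then obtain l where l: "(\<lambda>n. \<Lambda> (\<phi> n)) \<longlonglongrightarrow> l" "\<forall>n. l \<le> \<Lambda> (\<phi> n)" using decseq_convergent[OF dec] by blast
  have "l \<ge> 0" using LIMSEQ_le_const[OF l(1)] \<Lambda>_nonneg \<phi>(1) by blast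
  moreover have "\<Lambda> (\<phi> 0) \<le> \<Lambda> (\<phi> 0) - l"
  proof (rule \<Lambda>_le[OF \<phi>(1)])
    fix w assume w: "w \<in> Ddiv" "AE x in m. pnorm E w x \<le> \<phi> 0 x"
    note p = LIPb_nonnegD[OF \<phi>(1)]
    have main: "F w \<le> \<Lambda> (\<phi> 0) - l + M * \<eta>" if \<eta>: "0 < \<eta>" for \<eta>
    proof -
      define q where "q x = \<phi> 0 x + \<eta>" for x
      have q: "q \<in> LIPb" "\<And>x. \<eta> \<le> q x" unfolding q_def[abs_def] using p by (auto intro!: LIPb_add)
      have qpos: "0 < q x" for x using q(2)[of x] \<eta> by linarith
      define r where "r x = 1 / q x" for x
      define c where "c x = \<eta> / q x" for x
      have rc: "r \<in> LIPb" "c \<in> LIPb" unfolding r_def[abs_def] c_def[abs_def] using q \<eta> by (auto intro!: LIPb_divide)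
      define v where "v = scal E r w"
      have v: "v \<in> Ddiv" unfolding v_def by (rule D_div_scal[OF w(1) rc(1)])
      have v1: "AE x in m. pnorm E v x \<le> 1"
        unfolding v_def
      proof (rule pnorm_scal_le[OF rc(1) w(2)])
        show "\<bar>r x\<bar> * \<phi> 0 x \<le> 1" for x using qpos[of x] \<eta> by (simp add: r_def pos_divide_le_eq) (simp add: q_def)
      qed
      have one: "(\<lambda>x. \<phi> 0 x * r x + c x) = (\<lambda>_. 1)"
        using qpos by (auto simp: r_def c_def add_divide_distrib[symmetric] q_def[symmetric] fun_eq_iff less_le)
      have "w = scal E (\<lambda>x. \<phi> 0 x * r x + c x) w" unfolding one by (simp add: L0.scal_const)
      also have "\<dots> = scal E (\<lambda>x. \<phi> 0 x * r x) w + scal E c w" using rc p(1) by (intro scal_E_add LIPb_mult)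
      also have "scal E (\<lambda>x. \<phi> 0 x * r x) w = scal E (\<phi> 0) v"
        unfolding v_def using rc p(1) by (intro L0.scal_mult LIPb_measurable_m)
      finally have Fw: "F w = F (scal E (\<phi> 0) v) + F (scal E c w)"
        using F_add D_div_scal[OF v p(1)] D_div_scal[OF w(1) rc(2)] by metis
      have Fc: "F (scal E c w) \<le> M * \<eta>"
      proof (rule F_bound[OF D_div_scal[OF w(1) rc(2)]], rule pnorm_scal_le[OF rc(2) w(2)])
        show "\<bar>c x\<bar> * \<phi> 0 x \<le> \<eta>" for x
          using qpos[of x] p(2)[of 0 x] \<eta> by (simp add: c_def pos_divide_le_eq) (simp add: q_def mult_left_mono)
      qed (use \<eta> in simp)
      \<comment> \<open>The part carried by \<phi> 0 - \<phi> k costs at most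
        \<open>\<Lambda> (\<phi> 0) - \<Lambda> (\<phi> k)\<close>, by additivity. The rest is
        \<phi> k times the fixed field \<open>v\<close>, and \<open>F_continuous\<close> removes it
        as \<open>k\<close> grows.\<close>
      have step: "F (scal E (\<phi> 0) v) \<le> \<Lambda> (\<phi> 0) - l + F (scal E (\<phi> k) v)" for k
      proof -
        have le: "\<phi> k x \<le> \<phi> 0 x" for x using \<phi>(3) by (induction k) (auto intro: order_trans)
        have dL: "(\<lambda>x. \<phi> 0 x - \<phi> k x) \<in> LIPb" using p by auto
        have "scal E (\<phi> 0) v = scal E (\<lambda>x. (\<phi> 0 x - \<phi> k x) + \<phi> k x) v" by simp
        also have "\<dots> = scal E (\<lambda>x. \<phi> 0 x - \<phi> k x) v + scal E (\<phi> k) v" by (intro scal_E_add dL p(1))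
        finally have "F (scal E (\<phi> 0) v) = F (scal E (\<lambda>x. \<phi> 0 x - \<phi> k x) v) + F (scal E (\<phi> k) v)"
          using F_add D_div_scal[OF v dL] D_div_scal[OF v p(1)] by metis
        moreover have "F (scal E (\<lambda>x. \<phi> 0 x - \<phi> k x) v) \<le> \<Lambda> (\<lambda>x. \<phi> 0 x - \<phi> k x)"
        proof (rule F_le_\<Lambda>[OF LIPb_nonnegI[OF dL] D_div_scal[OF v dL]], use le in simp)
          show "AE x in m. pnorm E (scal E (\<lambda>x. \<phi> 0 x - \<phi> k x) v) x \<le> \<phi> 0 x - \<phi> k x"
            by (rule pnorm_scal_le[OF dL v1]) (use le in simp)
        qed
        moreover have "\<Lambda> (\<lambda>x. \<phi> 0 x - \<phi> k x) = \<Lambda> (\<phi> 0) - \<Lambda> (\<phi> k)" by (intro \<Lambda>_diff \<phi> le)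
        ultimately show ?thesis using l(2)[rule_format, of k] by linarith
      qed
      have "(\<lambda>k. F (scal E (\<phi> k) v)) \<longlonglongrightarrow> 0"
        by (rule F_continuous[OF v p(1) _ L lim]) (use p(2) \<phi>(2) in simp)
      then have "(\<lambda>k. \<Lambda> (\<phi> 0) - l + F (scal E (\<phi> k) v)) \<longlonglongrightarrow> \<Lambda> (\<phi> 0) - l + 0" by (intro tendsto_intros)
      then have "F (scal E (\<phi> 0) v) \<le> \<Lambda> (\<phi> 0) - l + 0" using step by (intro LIMSEQ_le_const) auto
      then show ?thesis using Fw Fc by linarith
    qed
    show "F w \<le> \<Lambda> (\<phi> 0) - l"
    proof (rule field_le_epsilon)
      fix e :: real assume e: "0 < e"
      have "M * (e / (M + 1)) \<le> e" using e M_nonneg by (simp add: field_simps)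
      then show "F w \<le> \<Lambda> (\<phi> 0) - l + e" using main[of "e / (M + 1)"] e M_nonneg by fastforce
    qed
  qed
  ultimately have "l = 0" by simp
  then show ?thesis using l(1) by simp
qed

text \<open>A Dini argument under tightness. At points that all cutoffs \<open>c j\<close> with j up
  to \<open>k\<close> place near finite nets, \<open>t k\<close> is at most \<delta>; otherwise such
  points would accumulate where the limit is not 0. Elsewhere some \<open>c j\<close> equals 1 and
  the bound \<open>B\<close> is used, so \<open>t k\<close> is at most \<delta> plus the sum of the
  \<open>B * c j\<close>, and the nets are chosen so fine that this sum has small \<Lambda>.\<close>

lemma \<Lambda>_Daniell:
  assumes t: "\<And>n. LIPb_nonneg (t n)" "\<And>n x. t (Suc n) x \<le> t n x" "\<And>x. (\<lambda>n. t n x) \<longlonglongrightarrow> 0"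
  shows "(\<lambda>n. \<Lambda> (t n)) \<longlonglongrightarrow> 0"
proof (rule tendsto_zero_of_antimono)
  fix e :: real assume e: "0 < e"
  have dec: "t k x \<le> t n x" if "n \<le> k" for n k x
    using decseqD[OF decseq_SucI[of "\<lambda>n. t n x", OF t(2)] that] .
  obtain B where B: "0 \<le> B" "\<And>x. t 0 x \<le> B" using LIPb_nonneg_bound[OF t(1)] by blast
  have tB: "t n x \<le> B" for n x using dec[of 0 n x] B(2)[of x] by simp
  \<comment> \<open>Half of \<open>e\<close> goes to the constant \<delta>, the other half to the
    cutoffs. M + 1 here and B + 1 below guard against division by 0.\<close>
  define \<delta> where "\<delta> = e / (2 * (M + 1))"
  have \<delta>: "0 < \<delta>" "M * \<delta> \<le> e / 2" using e M_nonneg by (auto simp: \<delta>_def field_simps)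
  obtain p :: "nat \<Rightarrow> 'a" where p: "dense_sequence p" by (rule dense_sequence_exists)
  have ncL: "LIPb_nonneg (net_cutoff p j n)" for j n by (intro LIPb_nonnegI net_cutoff_LIPb net_cutoff_range)
  have "\<exists>n. \<Lambda> (net_cutoff p j n) < e / (2 * (B + 1)) * (1/2) ^ Suc j" for j
  proof -
    have "(\<lambda>n. \<Lambda> (net_cutoff p j n)) \<longlonglongrightarrow> 0"
      by (rule \<Lambda>_equi_Lipschitz_tendsto_0[OF ncL net_cutoff_range(2) net_cutoff_decreasing _ net_cutoff_Lipschitz net_cutoff_tendsto_0[OF p]]) simp
    then have "\<forall>\<^sub>F n in sequentially. \<Lambda> (net_cutoff p j n) < e / (2 * (B + 1)) * (1/2) ^ Suc j"
      using e B(1) by (intro order_tendstoD(2)) (auto intro!: mult_pos_pos divide_pos_pos)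
    then show ?thesis using eventually_happens'[OF sequentially_bot] by blast
  qed
  then obtain n where n: "\<And>j. \<Lambda> (net_cutoff p j (n j)) < e / (2 * (B + 1)) * (1/2) ^ Suc j" by metis
  define c where "c j = net_cutoff p j (n j)" for j
  have cL: "LIPb_nonneg (c j)" for j unfolding c_def by (rule ncL)
  have c0: "0 \<le> c j x" "c j x \<le> 1" for j x unfolding c_def by (rule net_cutoff_range)+
  have "\<exists>k. \<forall>x. (\<forall>j\<le>k. c j x < 1) \<longrightarrow> t k x \<le> \<delta>"
  proof (rule ccontr)
    assume "\<not> ?thesis"
    then have "\<forall>k. \<exists>x. (\<forall>j\<le>k. c j x < 1) \<and> \<delta> < t k x" by (auto simp: not_le)
    then obtain x where x: "\<And>j k. j \<le> k \<Longrightarrow> c j (x k) < 1" "\<And>k. \<delta> < t k (x k)" by metis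
    obtain l s where s: "strict_mono (s :: nat \<Rightarrow> nat)" "(x \<circ> s) \<longlonglongrightarrow> l"
      by (rule convergent_subseq_of_net_cutoffs[of p n x]) (use x(1) in \<open>auto simp: c_def\<close>)
    have "\<delta> \<le> t N l" for N
    proof (rule LIMSEQ_le_const)
      have "isCont (t N) l" using LIPb_continuous[OF LIPb_nonnegD(1)[OF t(1)]] by (simp add: continuous_on_eq_continuous_at)
      then show "(\<lambda>k. t N ((x \<circ> s) k)) \<longlonglongrightarrow> t N l" using s(2) by (rule isCont_tendsto_compose)
      have "\<delta> \<le> t N ((x \<circ> s) k)" if "N \<le> k" for k
        using x(2)[of "s k"] dec[of N "s k" "x (s k)"] seq_suble[OF s(1), of k] that by simp
      then show "\<exists>K. \<forall>k\<ge>K. \<delta> \<le> t N ((x \<circ> s) k)" by blast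
    qed
    then have "\<delta> \<le> 0" using LIMSEQ_le_const[OF t(3)[of l]] by blast
    then show False using \<delta> by simp
  qed
  then obtain k where k: "\<And>x. (\<And>j. j \<le> k \<Longrightarrow> c j x < 1) \<Longrightarrow> t k x \<le> \<delta>" by blast
  have le: "t k x \<le> \<delta> + (\<Sum>j\<le>k. B * c j x)" for x
  proof (cases "\<forall>j\<le>k. c j x < 1")
    case True
    then show ?thesis using k[of x] c0 B by (auto intro!: add_increasing2 sum_nonneg)
  next
    case False
    then obtain j where j: "j \<le> k" "1 \<le> c j x" by (auto simp: not_less)
    have "B * 1 \<le> B * c j x" using j B by (intro mult_left_mono) auto
    also have "\<dots> \<le> (\<Sum>j\<le>k. B * c j x)" using j(1) c0 B by (intro member_le_sum) auto
    finally show ?thesis using tB[of k x] \<delta>(1) by linarith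
  qed
  have BcL: "LIPb_nonneg (\<lambda>x. B * c j x)" for j using LIPb_nonneg_mult[OF LIPb_nonneg_const[OF B(1)] cL] .
  have "\<Lambda> (t k) \<le> \<Lambda> (\<lambda>x. \<delta> + (\<Sum>j\<le>k. B * c j x))"
    using \<delta> by (intro \<Lambda>_mono t le LIPb_nonneg_add LIPb_nonneg_sum LIPb_nonneg_const BcL) auto
  also have "\<dots> = \<Lambda> (\<lambda>_. \<delta>) + (\<Sum>j\<le>k. \<Lambda> (\<lambda>x. B * c j x))"
  proof -
    have "LIPb_nonneg (\<lambda>x. \<Sum>j\<le>k. B * c j x)" by (intro LIPb_nonneg_sum BcL)
    then show ?thesis
      using \<delta> \<Lambda>_add[OF LIPb_nonneg_const, of \<delta>] \<Lambda>_sum[of "{..k}" "\<lambda>j x. B * c j x"] BcL by simp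
  qed
  also have "\<dots> \<le> M * \<delta> + (\<Sum>j\<le>k. e / 2 * (1/2) ^ Suc j)"
  proof (intro add_mono sum_mono)
    show "\<Lambda> (\<lambda>_. \<delta>) \<le> M * \<delta>" using \<delta> by (intro \<Lambda>_le_const LIPb_nonneg_const) auto
    fix j
    have "\<Lambda> (\<lambda>x. B * c j x) \<le> \<Lambda> (\<lambda>x. (B + 1) * c j x)"
      using B c0 by (intro \<Lambda>_mono BcL LIPb_nonneg_mult LIPb_nonneg_const cL mult_right_mono) auto
    also have "\<dots> \<le> (B + 1) * \<Lambda> (c j)" using B by (intro \<Lambda>_cmult_le cL) auto
    also have "\<dots> \<le> (B + 1) * (e / (2 * (B + 1)) * (1/2) ^ Suc j)"
      using n[of j] B by (intro mult_left_mono) (auto simp: c_def)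
    also have "\<dots> = e / 2 * (1/2) ^ Suc j"
    proof -
      have "b * (e / (2 * b) * r) = e / 2 * r" if "b \<noteq> 0" for b r :: real using that by (simp add: field_simps)
      moreover have "B + 1 \<noteq> 0" using B(1) by simp
      ultimately show ?thesis by blast
    qed
    finally show "\<Lambda> (\<lambda>x. B * c j x) \<le> e / 2 * (1/2) ^ Suc j" .
  qed
  also have "(\<Sum>j\<le>k. e / 2 * (1/2) ^ Suc j) = e / 2 * (1 - (1/2) ^ Suc k)"
  proof -
    have "(\<Sum>j\<le>k. (1/2 :: real) ^ Suc j) = 1 - (1/2) ^ Suc k" by (induction k) (auto simp: field_simps)
    then show ?thesis by (simp only: sum_distrib_left[symmetric])
  qed
  also have "M * \<delta> + e / 2 * (1 - (1/2) ^ Suc k) \<le> e / 2 + e / 2 * 1"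
    using \<delta> e by (intro add_mono mult_left_mono) auto
  finally show "\<exists>k. \<Lambda> (t k) \<le> e" by (auto intro!: exI[of _ k])
qed (use \<Lambda>_mono \<Lambda>_nonneg t in auto)

text \<open>The uncovered remainders, the positive parts of \<open>t\<close> minus partial sums,
  decrease to 0, so Daniell continuity makes their \<Lambda> vanish; finite additivity handles the
  covered part.\<close>

lemma \<Lambda>_countable_cover:
  assumes t: "LIPb_nonneg t" and s: "\<And>n. LIPb_nonneg (s n)" and le: "\<And>x. ennreal (t x) \<le> (\<Sum>n. ennreal (s n x))"
  shows "ennreal (\<Lambda> t) \<le> (\<Sum>n. ennreal (\<Lambda> (s n)))"
proof -
  define r where "r N x = max (t x - (\<Sum>n<N. s n x)) 0" for N :: nat and x
  have sumL: "LIPb_nonneg (\<lambda>x. \<Sum>n<N. s n x)" for N by (intro LIPb_nonneg_sum s)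
  have rL: "LIPb_nonneg (r N)" for N
    unfolding r_def[abs_def] using LIPb_nonnegD(1)[OF t] LIPb_nonnegD(1)[OF sumL[of N]]
    by (intro LIPb_nonnegI LIPb_max LIPb_diff LIPb_const) auto
  have "(\<lambda>N. \<Lambda> (r N)) \<longlonglongrightarrow> 0"
  proof (rule \<Lambda>_Daniell[OF rL])
    show "r (Suc N) x \<le> r N x" for N x using LIPb_nonnegD(2)[OF s, of N x] by (auto simp: r_def)
    fix x
    show "(\<lambda>N. r N x) \<longlonglongrightarrow> 0"
    proof (rule tendsto_zero_of_antimono)
      show "r (Suc N) x \<le> r N x" for N using LIPb_nonnegD(2)[OF s, of N x] by (auto simp: r_def)
      fix e :: real assume e: "0 < e"
      show "\<exists>N. r N x \<le> e"
      proof (cases "t x = 0")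
        case True
        have "0 \<le> (\<Sum>n<0. s n x)" by simp
        then show ?thesis using True e by (auto simp: r_def intro!: exI[of _ 0])
      next
        case False
        then have tx: "0 < t x" using LIPb_nonnegD(2)[OF t, of x] by simp
        have "ennreal (t x - e) < ennreal (t x)" using tx e by (auto simp: ennreal_less_iff ennreal_eq_0_iff ennreal_lessI)
        also have "\<dots> \<le> (SUP N. \<Sum>n<N. ennreal (s n x))" using le[of x] by (simp add: suminf_eq_SUP)
        finally obtain N where "ennreal (t x - e) < (\<Sum>n<N. ennreal (s n x))" by (auto simp: less_SUP_iff)
        also have "\<dots> = ennreal (\<Sum>n<N. s n x)" using LIPb_nonnegD(2)[OF s] by (intro sum_ennreal) auto
        finally have "t x - e < (\<Sum>n<N. s n x)" by (metis ennreal_leI not_le)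
        then show ?thesis using e by (auto simp: r_def intro!: exI[of _ N])
      qed
    qed (simp add: r_def)
  qed
  then have lim: "(\<lambda>N. ennreal (\<Lambda> (r N)) + (\<Sum>n. ennreal (\<Lambda> (s n)))) \<longlonglongrightarrow> ennreal 0 + (\<Sum>n. ennreal (\<Lambda> (s n)))"
    by (intro tendsto_add tendsto_ennrealI tendsto_const)
  have "ennreal (\<Lambda> t) \<le> ennreal (\<Lambda> (r N)) + (\<Sum>n. ennreal (\<Lambda> (s n)))" for N
  proof -
    have "\<Lambda> t \<le> \<Lambda> (\<lambda>x. r N x + (\<Sum>n<N. s n x))" by (intro \<Lambda>_mono t LIPb_nonneg_add rL sumL) (simp add: r_def)
    also have "\<dots> = \<Lambda> (r N) + (\<Sum>n<N. \<Lambda> (s n))" using \<Lambda>_add[OF rL sumL] \<Lambda>_sum[OF _ s, of "{..<N}"] by simp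
    finally have "ennreal (\<Lambda> t) \<le> ennreal (\<Lambda> (r N) + (\<Sum>n<N. \<Lambda> (s n)))" by (rule ennreal_leI)
    also have "\<dots> = ennreal (\<Lambda> (r N)) + (\<Sum>n<N. ennreal (\<Lambda> (s n)))"
      using \<Lambda>_nonneg rL s by (subst ennreal_plus) (auto intro!: sum_nonneg simp: sum_ennreal)
    also have "\<dots> \<le> ennreal (\<Lambda> (r N)) + (\<Sum>n. ennreal (\<Lambda> (s n)))"
      by (intro add_left_mono sum_le_suminf) auto
    finally show ?thesis .
  qed
  then show ?thesis using LIMSEQ_le_const[OF lim] by simp
qed

section \<open>The outer measure of the variation functional and its Borel measure\<close>

definition covers :: "(nat \<Rightarrow> 'a \<Rightarrow> real) \<Rightarrow> 'a set \<Rightarrow> bool" where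
  "covers s A \<longleftrightarrow> (\<forall>n. LIPb_nonneg (s n)) \<and> (\<forall>x\<in>A. 1 \<le> (\<Sum>n. ennreal (s n x)))"

text \<open>Daniell's outer measure: sets are covered by sequences of functions with sum at least 1
  rather than by sets. Such covers can be split by multiplying them with cutoffs, at no cost since
  \<Lambda> is additive.\<close>

definition outer :: "'a set \<Rightarrow> ennreal" where
  "outer A = (INF s\<in>{s. covers s A}. \<Sum>n. ennreal (\<Lambda> (s n)))"

lemma outer_le: "covers s A \<Longrightarrow> outer A \<le> (\<Sum>n. ennreal (\<Lambda> (s n)))"
  unfolding outer_def by (intro INF_lower) auto

lemma outer_geI: "(\<And>s. covers s A \<Longrightarrow> c \<le> (\<Sum>n. ennreal (\<Lambda> (s n)))) \<Longrightarrow> c \<le> outer A"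
  unfolding outer_def by (intro INF_greatest) auto

lemma outer_mono: "A \<subseteq> B \<Longrightarrow> outer A \<le> outer B"
  by (intro outer_geI outer_le) (auto simp: covers_def)

lemma outer_UNIV: "outer UNIV \<le> ennreal M"
proof -
  define s where "s n = (if n = 0 then (\<lambda>_::'a. 1::real) else (\<lambda>_. 0))" for n :: nat
  have "(\<Sum>n. ennreal (s n x)) = (\<Sum>n\<in>{0}. ennreal (s n x))" for x
    by (rule suminf_finite) (auto simp: s_def)
  then have "covers s UNIV" by (auto simp: covers_def s_def intro!: LIPb_nonneg_const)
  then have "outer UNIV \<le> (\<Sum>n. ennreal (\<Lambda> (s n)))" by (rule outer_le)
  also have "\<dots> = (\<Sum>n\<in>{0}. ennreal (\<Lambda> (s n)))" by (rule suminf_finite) (auto simp: s_def \<Lambda>_zero)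
  also have "\<dots> \<le> ennreal M" using \<Lambda>_le_const[of "\<lambda>_. 1" 1] LIPb_nonneg_const[of 1] by (auto simp: s_def intro!: ennreal_leI)
  finally show ?thesis .
qed

lemma outer_empty: "outer {} = 0"
proof -
  have "covers (\<lambda>_ _. 0) {}" by (auto simp: covers_def intro!: LIPb_nonneg_const)
  from outer_le[OF this] show ?thesis by (simp add: \<Lambda>_zero)
qed

lemma outer_countably_subadditive: "outer (\<Union>i. A i) \<le> (\<Sum>i. outer (A i))"
proof (rule ennreal_le_epsilon)
  fix e :: real assume e: "0 < e"
  have "\<exists>s. covers s (A i) \<and> (\<Sum>n. ennreal (\<Lambda> (s n))) < outer (A i) + ennreal (e * (1/2) ^ Suc i)" for i :: nat
  proof -
    have "outer (A i) < top" using outer_mono[of "A i" UNIV] outer_UNIV by (auto simp: less_top[symmetric] top_unique)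
    then have "outer (A i) < outer (A i) + ennreal (e * (1/2) ^ Suc i)"
      using e by (simp add: ennreal_add_left_cancel_less[of _ 0, simplified])
    then show ?thesis unfolding outer_def INF_less_iff by auto
  qed
  then obtain s where s: "\<And>i. covers (s i) (A i)"
    "\<And>i. (\<Sum>n. ennreal (\<Lambda> (s i n))) < outer (A i) + ennreal (e * (1/2) ^ Suc i)" by metis
  define r where "r k = (\<lambda>(i, n). s i n) (prod_decode k)" for k
  have sum_r: "(\<Sum>k. ennreal (r k x)) = (\<Sum>i. \<Sum>n. ennreal (s i n x))" for x
    using suminf_ennreal_2dimen[of "\<lambda>i. \<Sum>n. ennreal (s i n x)" "\<lambda>(i, n). ennreal (s i n x)"]
    by (simp add: r_def case_prod_unfold)
  have "covers r (\<Union>i. A i)"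
    unfolding covers_def
  proof (intro conjI allI ballI)
    show "LIPb_nonneg (r k)" for k using s(1) by (auto simp: r_def covers_def split: prod.split)
    fix x assume "x \<in> (\<Union>i. A i)"
    then obtain i where "x \<in> A i" by blast
    then have "1 \<le> (\<Sum>n. ennreal (s i n x))" using s(1)[of i] by (auto simp: covers_def)
    also have "\<dots> \<le> (\<Sum>i. \<Sum>n. ennreal (s i n x))" using sum_le_suminf[of "\<lambda>i. \<Sum>n. ennreal (s i n x)" "{i}"] by simp
    finally show "1 \<le> (\<Sum>k. ennreal (r k x))" by (simp add: sum_r)
  qed
  then have "outer (\<Union>i. A i) \<le> (\<Sum>k. ennreal (\<Lambda> (r k)))" by (rule outer_le)
  also have "\<dots> = (\<Sum>i. \<Sum>n. ennreal (\<Lambda> (s i n)))"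
    using suminf_ennreal_2dimen[of "\<lambda>i. \<Sum>n. ennreal (\<Lambda> (s i n))" "\<lambda>(i, n). ennreal (\<Lambda> (s i n))"]
    by (simp add: r_def case_prod_unfold)
  also have "\<dots> \<le> (\<Sum>i. outer (A i) + ennreal (e * (1/2) ^ Suc i))" using s(2) by (intro suminf_le) (auto simp: less_imp_le)
  also have "\<dots> = (\<Sum>i. outer (A i)) + (\<Sum>i. ennreal (e * (1/2) ^ Suc i))" by (intro suminf_add[symmetric]) auto
  also have "(\<Sum>i. ennreal (e * (1/2) ^ Suc i)) = ennreal e"
  proof -
    have "(\<lambda>i. e * (1/2) ^ Suc i) sums (e * 1)" using power_half_series by (intro sums_mult)
    then show ?thesis using e by (intro suminf_ennreal_eq) auto
  qed
  finally show "outer (\<Union>i. A i) \<le> (\<Sum>i. outer (A i)) + ennreal e" .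
qed

lemma outer_measure_space_outer: "outer_measure_space (Pow UNIV) outer"
  unfolding outer_measure_space_def positive_def increasing_def countably_subadditive_def
  using outer_empty outer_mono outer_countably_subadditive by auto

lemma outer_subadditive: "outer (A \<union> B) \<le> outer A + outer B"
proof -
  interpret sigma_algebra UNIV "Pow UNIV :: 'a set set" by (rule sigma_algebra_Pow)
  have "subadditive (Pow UNIV) outer"
    using outer_measure_space_outer countably_subadditive_subadditive unfolding outer_measure_space_def by blast
  then have "outer (A \<union> (B - A)) \<le> outer A + outer (B - A)" unfolding subadditive_def by blast
  also have "\<dots> \<le> outer A + outer B" by (intro add_left_mono outer_mono) auto
  finally show ?thesis by simp
qed

text \<open>The telescoping increments of the cutoffs \<open>min 1 (2\<^sup>k g)\<close> control the part of \<open>{0 < g}\<close> where \<open>g\<close>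
  is small, which gives the Caratheodory condition for open sets.\<close>

lemma outer_split_open:
  assumes U: "open U" shows "outer (A \<inter> U) + outer (A - U) = outer A"
proof (rule antisym)
  obtain g where g: "\<And>x. 0 \<le> g x" "\<And>x. g x \<le> 1" "\<And>x y. \<bar>g x - g y\<bar> \<le> dist x y" "U = {x. 0 < g x}"
    using open_gauge[OF U] by blast
  have gL: "g \<in> LIPb" by (rule gauge_LIPb[OF g(1-3)])
  define h where "h k x = min 1 (2 ^ k * g x)" for k :: nat and x
  have hL: "LIPb_nonneg (h k)" for k
    unfolding h_def[abs_def] using g by (intro LIPb_nonnegI LIPb_min LIPb_cmult gL LIPb_const) auto
  have h1: "h k x \<le> 1" for k x by (simp add: h_def)
  have hmono: "h k x \<le> h (Suc k) x" for k x using g(1)[of x] by (auto simp: h_def min_def)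
  have inc: "incseq (\<lambda>k. \<Lambda> (h k))" by (intro incseq_SucI \<Lambda>_mono hL hmono)
  have "\<forall>k. \<Lambda> (h k) \<le> M" using \<Lambda>_le_const[OF hL h1] by simp
  then obtain l where l: "(\<lambda>k. \<Lambda> (h k)) \<longlonglongrightarrow> l" "\<forall>k. \<Lambda> (h k) \<le> l" using incseq_convergent[OF inc] by blast
  define N where "N k = {x. 0 < g x \<and> 2 ^ Suc k * g x < 1}" for k :: nat
  have hit: "\<exists>n. 1 \<le> 2 ^ n * g x" if "0 < g x" for x
  proof -
    obtain n where "1 / g x < 2 ^ n" using real_arch_pow[of 2 "1 / g x"] by auto
    then show ?thesis using that by (intro exI[of _ n]) (simp add: pos_divide_less_eq)
  qed
  have Nle: "outer (N k) \<le> ennreal (2 * (l - \<Lambda> (h k)))" for k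
  proof -
    \<comment> \<open>On \<open>N k\<close> the cutoff \<open>h k\<close> is at most 1/2 while the
      later ones reach 1. The increments thus add up to at least 1/2, and the factor 2 turns them
      into a cover.\<close>
    define s where "s j x = 2 * (h (k + Suc j) x - h (k + j) x)" for j x
    have dL: "LIPb_nonneg (\<lambda>x. h (k + Suc j) x - h (k + j) x)" for j
      using LIPb_nonnegD(1)[OF hL] hmono by (intro LIPb_nonnegI LIPb_diff) auto
    have sL: "LIPb_nonneg (s j)" for j
      unfolding s_def[abs_def] using LIPb_nonneg_mult[OF LIPb_nonneg_const dL, of 2 j] by simp
    have tel: "(\<Sum>j<J. s j x) = 2 * (h (k + J) x - h k x)" for J x
      by (induction J) (auto simp: s_def algebra_simps)
    have "covers s (N k)"
      unfolding covers_def
    proof (intro conjI allI ballI sL)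
      fix x assume x: "x \<in> N k"
      obtain n where n: "1 \<le> 2 ^ n * g x" using hit x by (auto simp: N_def)
      have "2 ^ n * g x \<le> 2 ^ (k + n) * g x" using g(1)[of x] by (intro mult_right_mono power_increasing) auto
      then have hn: "h (k + n) x = 1" using n by (simp add: h_def)
      have "h k x \<le> 1/2" using x by (auto simp: N_def h_def min_def)
      then have "1 \<le> (\<Sum>j<n. s j x)" using hn by (simp add: tel)
      then have "1 \<le> ennreal (\<Sum>j<n. s j x)" by (metis ennreal_1 ennreal_leI)
      also have "\<dots> = (\<Sum>j<n. ennreal (s j x))" using LIPb_nonnegD(2)[OF sL] by (intro sum_ennreal[symmetric]) auto
      also have "\<dots> \<le> (\<Sum>j. ennreal (s j x))" by (intro sum_le_suminf) auto
      finally show "1 \<le> (\<Sum>j. ennreal (s j x))" .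
    qed
    then have "outer (N k) \<le> (\<Sum>j. ennreal (\<Lambda> (s j)))" by (rule outer_le)
    also have "\<dots> \<le> ennreal (2 * (l - \<Lambda> (h k)))"
    proof (rule suminf_le_const)
      fix J
      have "(\<Sum>j<J. ennreal (\<Lambda> (s j))) = ennreal (\<Sum>j<J. \<Lambda> (s j))" using \<Lambda>_nonneg sL by (intro sum_ennreal) auto
      also have "(\<Sum>j<J. \<Lambda> (s j)) \<le> (\<Sum>j<J. 2 * (\<Lambda> (h (k + Suc j)) - \<Lambda> (h (k + j))))"
      proof (rule sum_mono)
        fix j
        have "\<Lambda> (s j) \<le> 2 * \<Lambda> (\<lambda>x. h (k + Suc j) x - h (k + j) x)"
          unfolding s_def[abs_def] by (rule \<Lambda>_cmult_le[OF dL]) simp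
        also have "\<Lambda> (\<lambda>x. h (k + Suc j) x - h (k + j) x) = \<Lambda> (h (k + Suc j)) - \<Lambda> (h (k + j))"
          using hmono by (intro \<Lambda>_diff hL) auto
        finally show "\<Lambda> (s j) \<le> 2 * (\<Lambda> (h (k + Suc j)) - \<Lambda> (h (k + j)))" .
      qed
      also have "(\<Sum>j<J. 2 * (\<Lambda> (h (k + Suc j)) - \<Lambda> (h (k + j)))) = 2 * (\<Lambda> (h (k + J)) - \<Lambda> (h k))"
        by (induction J) (auto simp: algebra_simps)
      also have "\<dots> \<le> 2 * (l - \<Lambda> (h k))" using l(2) by simp
      finally show "(\<Sum>j<J. ennreal (\<Lambda> (s j))) \<le> ennreal (2 * (l - \<Lambda> (h k)))" by (simp add: ennreal_leI)
    qed simp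
    finally show ?thesis .
  qed
  have step: "outer (A \<inter> U) + outer (A - U) \<le> outer A + ennreal (2 * (l - \<Lambda> (h k)))" for k
  proof -
    define V where "V = {x. 1 \<le> 2 ^ Suc k * g x}"
    have "outer (A \<inter> U) \<le> outer ((A \<inter> V) \<union> N k)" using g(4) by (intro outer_mono) (auto simp: V_def N_def)
    also have "\<dots> \<le> outer (A \<inter> V) + outer (N k)" by (rule outer_subadditive)
    finally have 1: "outer (A \<inter> U) \<le> outer (A \<inter> V) + ennreal (2 * (l - \<Lambda> (h k)))"
      using Nle[of k] by (meson add_left_mono order_trans)
    \<comment> \<open>\<open>h (Suc k)\<close> is 1 on \<open>V\<close> and 0 off \<open>U\<close>.
      Multiplying a cover of \<open>A\<close> by it and by its complement to 1 yields covers of both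
      pieces with the same total cost.\<close>
    have 2: "outer (A \<inter> V) + outer (A - U) \<le> outer A"
    proof (rule outer_geI)
      fix s assume s: "covers s A"
      define u v where "u n x = h (Suc k) x * s n x" and "v n x = (1 - h (Suc k) x) * s n x" for n x
      have sL: "LIPb_nonneg (s n)" for n using s by (simp add: covers_def)
      have "LIPb_nonneg (\<lambda>x. 1 - h (Suc k) x)" using LIPb_nonnegD(1)[OF hL] h1 by (intro LIPb_nonnegI LIPb_diff LIPb_const) auto
      then have uvL: "LIPb_nonneg (u n)" "LIPb_nonneg (v n)" for n
        unfolding u_def[abs_def] v_def[abs_def] by (intro LIPb_nonneg_mult hL sL)+
      have "covers u (A \<inter> V)"
        using s uvL by (auto simp: covers_def u_def V_def h_def)
      moreover have "covers v (A - U)"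
      proof -
        have "v n x = s n x" if "x \<in> A - U" for n x
        proof -
          have "g x = 0" using that g(1)[of x] g(4) by fastforce
          then show ?thesis by (simp add: v_def h_def)
        qed
        then show ?thesis using s uvL by (auto simp: covers_def)
      qed
      ultimately have "outer (A \<inter> V) + outer (A - U) \<le> (\<Sum>n. ennreal (\<Lambda> (u n))) + (\<Sum>n. ennreal (\<Lambda> (v n)))"
        by (intro add_mono outer_le)
      also have "\<dots> = (\<Sum>n. ennreal (\<Lambda> (u n)) + ennreal (\<Lambda> (v n)))" by (intro suminf_add) auto
      also have "\<dots> = (\<Sum>n. ennreal (\<Lambda> (s n)))"
      proof (intro suminf_cong)
        fix n
        have "(\<lambda>x. u n x + v n x) = s n" by (auto simp: u_def v_def algebra_simps)
        then have "\<Lambda> (s n) = \<Lambda> (u n) + \<Lambda> (v n)" using \<Lambda>_add[OF uvL] by metis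
        then show "ennreal (\<Lambda> (u n)) + ennreal (\<Lambda> (v n)) = ennreal (\<Lambda> (s n))" using \<Lambda>_nonneg uvL by simp
      qed
      finally show "outer (A \<inter> V) + outer (A - U) \<le> (\<Sum>n. ennreal (\<Lambda> (s n)))" .
    qed
    have "outer (A \<inter> U) + outer (A - U) \<le> (outer (A \<inter> V) + outer (A - U)) + ennreal (2 * (l - \<Lambda> (h k)))"
      using add_right_mono[OF 1, of "outer (A - U)"] by (simp add: ac_simps)
    also have "\<dots> \<le> outer A + ennreal (2 * (l - \<Lambda> (h k)))" by (intro add_right_mono 2)
    finally show ?thesis .
  qed
  have "(\<lambda>k. outer A + ennreal (2 * (l - \<Lambda> (h k)))) \<longlonglongrightarrow> outer A + ennreal (2 * (l - l))"
    by (intro tendsto_intros tendsto_ennrealI l)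
  then show "outer (A \<inter> U) + outer (A - U) \<le> outer A" using step LIMSEQ_le_const by fastforce
  have "A = (A \<inter> U) \<union> (A - U)" by auto
  then show "outer A \<le> outer (A \<inter> U) + outer (A - U)" using outer_subadditive by metis
qed

definition dominating :: "'a measure" where
  "dominating = measure_of UNIV (sets borel) outer"

lemma sets_dominating [measurable_cong]: "sets dominating = sets borel"
  using sets.sets_measure_of_eq[of borel outer] by (simp add: dominating_def)

lemma space_dominating [simp]: "space dominating = UNIV"
  using sets_eq_imp_space_eq[OF sets_dominating] by simp

lemma emeasure_dominating: "A \<in> sets borel \<Longrightarrow> emeasure dominating A = outer A"
proof -
  interpret sigma_algebra UNIV "Pow UNIV :: 'a set set" by (rule sigma_algebra_Pow)
  let ?L = "lambda_system UNIV (Pow UNIV) outer"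
  have ms: "measure_space UNIV ?L outer" by (rule caratheodory_lemma[OF outer_measure_space_outer])
  then have L: "sigma_algebra UNIV ?L" by (simp add: measure_space_def)
  have "U \<in> ?L" if "open U" for U
  proof -
    have "U \<inter> A = A \<inter> U" "(UNIV - U) \<inter> A = A - U" for A by auto
    then show ?thesis using outer_split_open[OF that] by (simp add: lambda_system_def)
  qed
  then have "sigma_sets UNIV {S. open S} \<subseteq> ?L" by (intro sigma_algebra.sigma_sets_subset[OF L]) auto
  then have "sets borel \<subseteq> ?L" by (simp add: borel_def sets_measure_of)
  moreover have "countably_additive ?L outer" using ms by (simp add: measure_space_def)
  ultimately have "countably_additive (sets borel) outer" unfolding countably_additive_def by blast
  moreover have "positive (sets borel) outer" by (simp add: positive_def outer_empty)
  moreover have "sigma_algebra UNIV (sets (borel :: 'a measure))" using sets.sigma_algebra_axioms[of "borel :: 'a measure"] by simp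
  ultimately show "A \<in> sets borel \<Longrightarrow> emeasure dominating A = outer A"
    unfolding dominating_def by (intro emeasure_measure_of_sigma)
qed

lemma finite_dominating: "finite_measure dominating"
proof
  have "emeasure dominating UNIV \<le> ennreal M" using outer_UNIV by (simp add: emeasure_dominating)
  then show "emeasure dominating (space dominating) \<noteq> \<infinity>" by (auto simp: top_unique)
qed

text \<open>Layer cake: \<open>t\<close> is cut into slices \<open>e * l j\<close> with
  \<open>l j\<close> between 0 and 1 and positive exactly on {t > j e}. Every cover of that set
  dominates \<open>l j\<close>, so \<open>unit\<close> bounds its \<Lambda> by the measure of the
  set. The slices start at j = 0, so the resulting step function may exceed \<open>t\<close> by at
  most \<open>e\<close>.\<close>

lemma \<Lambda>_le_integral:
  assumes t: "LIPb_nonneg t" shows "\<Lambda> t \<le> (\<integral>x. t x \<partial>dominating)"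
proof -
  interpret finite_measure dominating by (rule finite_dominating)
  obtain B where B: "0 \<le> B" "\<And>x. t x \<le> B" using LIPb_nonneg_bound[OF t] by blast
  note tL = LIPb_nonnegD[OF t]
  have tm [measurable]: "t \<in> borel_measurable borel" by (rule LIPb_borel[OF tL(1)])
  have unit: "\<Lambda> s \<le> measure dominating {x. 0 < s x}" if s: "LIPb_nonneg s" "\<And>x. s x \<le> 1" for s
  proof -
    have [measurable]: "s \<in> borel_measurable borel" by (rule LIPb_borel[OF LIPb_nonnegD(1)[OF s(1)]])
    have "ennreal (\<Lambda> s) \<le> outer {x. 0 < s x}"
    proof (rule outer_geI, rule \<Lambda>_countable_cover[OF s(1)])
      fix r x assume r: "covers r {x. 0 < s x}"
      show "LIPb_nonneg (r n)" for n using r by (simp add: covers_def)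
      show "ennreal (s x) \<le> (\<Sum>n. ennreal (r n x))"
      proof (cases "0 < s x")
        case True
        have "ennreal (s x) \<le> 1" using s(2)[of x] by (metis ennreal_1 ennreal_leI)
        also have "1 \<le> (\<Sum>n. ennreal (r n x))" using r True by (auto simp: covers_def)
        finally show ?thesis .
      next
        case False
        then show ?thesis by (simp add: ennreal_neg)
      qed
    qed
    also have "\<dots> = ennreal (measure dominating {x. 0 < s x})"
      by (subst emeasure_dominating[symmetric]) (auto simp: emeasure_eq_measure)
    finally show ?thesis by (simp add: ennreal_le_iff)
  qed
  have int: "integrable dominating t" using B tL by (intro integrable_const_bound[where B=B]) auto
  have main: "\<Lambda> t \<le> (\<integral>x. t x \<partial>dominating) + e * measure dominating UNIV" if e: "0 < e" for e
  proof -
    obtain N :: nat where N: "B / e \<le> real N" using real_arch_simple by blast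
    define l where "l j x = min (max (t x - real j * e) 0 / e) 1" for j :: nat and x
    have lL: "LIPb_nonneg (l j)" for j
    proof (rule LIPb_nonnegI)
      have "(\<lambda>x. min (1 / e * max (t x - real j * e) 0) 1) \<in> LIPb"
        by (intro LIPb_min LIPb_cmult LIPb_max LIPb_diff tL LIPb_const)
      then show "l j \<in> LIPb" by (simp add: l_def[abs_def])
      show "0 \<le> l j x" for x using e by (auto simp: l_def)
    qed
    have l1: "l j x \<le> 1" for j x by (simp add: l_def)
    have elj: "e * l j x = min (max (t x - real j * e) 0) e" for j x
      using e by (auto simp: l_def min_def max_def field_simps)
    have part: "(\<Sum>j<n. e * l j x) = min (t x) (real n * e)" for n x
    proof (induction n)
      case (Suc n)
      then show ?case using e tL(2)[of x] unfolding sum.lessThan_Suc Suc elj by (auto simp: min_def max_def algebra_simps)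
    qed (use tL(2)[of x] in simp)
    have full: "(\<lambda>x. \<Sum>j<N. e * l j x) = t"
    proof
      fix x
      have "B \<le> real N * e" using N e by (simp add: pos_divide_le_eq)
      then show "(\<Sum>j<N. e * l j x) = t x" using B(2)[of x] by (simp add: part)
    qed
    have elL: "LIPb_nonneg (\<lambda>x. e * l j x)" for j using LIPb_nonneg_mult[OF LIPb_nonneg_const lL] e by simp
    define S where "S j = {x. real j * e < t x}" for j :: nat
    have [measurable]: "S j \<in> sets borel" for j unfolding S_def by measurable
    have "\<Lambda> t = (\<Sum>j<N. \<Lambda> (\<lambda>x. e * l j x))" using \<Lambda>_sum[of "{..<N}" "\<lambda>j x. e * l j x"] elL full by simp
    also have "\<dots> \<le> (\<Sum>j<N. e * measure dominating (S j))"
    proof (rule sum_mono)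
      fix j
      have "\<Lambda> (\<lambda>x. e * l j x) \<le> e * \<Lambda> (l j)" by (rule \<Lambda>_cmult_le[OF lL e])
      also have "\<dots> \<le> e * measure dominating {x. 0 < l j x}" using e by (intro mult_left_mono unit lL l1) auto
      also have "{x. 0 < l j x} = S j" using e by (auto simp: l_def S_def)
      finally show "\<Lambda> (\<lambda>x. e * l j x) \<le> e * measure dominating (S j)" .
    qed
    also have "\<dots> = (\<integral>x. (\<Sum>j<N. e * indicator (S j) x) \<partial>dominating)"
      by (subst Bochner_Integration.integral_sum) (auto simp: emeasure_eq_measure sets_dominating)
    also have "\<dots> \<le> (\<integral>x. t x + e \<partial>dominating)"
    proof (rule integral_mono')
      show "integrable dominating (\<lambda>x. t x + e)" using int by simp
      fix x
      show "0 \<le> t x + e" using tL(2)[of x] e by simp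
      show "(\<Sum>j<N. e * indicator (S j) x) \<le> t x + e"
      proof (induction N)
        case 0
        then show ?case using tL(2)[of x] e by simp
      next
        case (Suc n)
        show ?case
        proof (cases "real n * e < t x")
          case True
          have "(\<Sum>j<n. e * indicator (S j) x) \<le> (\<Sum>j<n. e)" using e by (intro sum_mono) (auto simp: indicator_def)
          then show ?thesis using True by (simp add: S_def)
        next
          case False
          then show ?thesis using Suc by (simp add: S_def)
        qed
      qed
    qed
    also have "\<dots> = (\<integral>x. t x \<partial>dominating) + e * measure dominating UNIV" using int by simp
    finally show ?thesis .
  qed
  show ?thesis
  proof (rule field_le_epsilon)
    fix e :: real assume e: "0 < e"
    define K where "K = measure dominating UNIV + 1"
    have K: "1 \<le> K" by (simp add: K_def)
    have "e / K * measure dominating UNIV \<le> e / K * K" using e K by (intro mult_left_mono) (auto simp: K_def)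
    then show "\<Lambda> t \<le> (\<integral>x. t x \<partial>dominating) + e" using main[of "e / K"] e K by simp
  qed
qed

text \<open>For Lipschitz \<open>s\<close> the estimate follows from \<Lambda>. A continuous
  \<open>s\<close> is approached from above, by negatives of Lipschitz minorants of -s, so that
  \<open>w\<close> stays admissible for every approximation.\<close>

lemma F_le_integral:
  assumes w: "w \<in> Ddiv" and s: "s \<in> bcontfun" and le: "AE x in m. pnorm E w x \<le> s x" and nonneg: "\<And>x. 0 \<le> s x"
  shows "\<bar>F w\<bar> \<le> (\<integral>x. s x \<partial>dominating)"
proof -
  interpret finite_measure dominating by (rule finite_dominating)
  have "(\<lambda>x. - s x) \<in> bcontfun" using s by (auto simp: bcontfun_def intro: continuous_intros)
  then obtain h where h: "\<And>n. h n \<in> LIPb" "\<And>n x. h n x \<le> - s x" "\<And>x. (\<lambda>n. h n x) \<longlonglongrightarrow> - s x"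
    "\<And>n x. \<bar>h n x\<bar> \<le> (SUP y. \<bar>- s y\<bar>)"
    using bcontfun_Lipschitz_minorants by metis
  have hL: "LIPb_nonneg (\<lambda>x. - h n x)" for n
  proof (rule LIPb_nonnegI)
    show "0 \<le> - h n x" for x using h(2)[of n x] nonneg[of x] by linarith
  qed (intro LIPb_uminus h)
  have sm: "s \<in> borel_measurable dominating"
    using s by (auto simp: bcontfun_def measurable_cong_sets[OF sets_dominating refl] intro: borel_measurable_continuous_onI)
  have lim: "(\<lambda>n. \<integral>x. - h n x \<partial>dominating) \<longlonglongrightarrow> (\<integral>x. s x \<partial>dominating)"
  proof (rule tendsto_integral_bounded[OF finite_dominating _ sm])
    show "(\<lambda>x. - h n x) \<in> borel_measurable dominating" for n
      using LIPb_borel[OF LIPb_uminus[OF h(1)]] by (simp add: measurable_cong_sets[OF sets_dominating refl])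
    show "\<bar>- h n x\<bar> \<le> (SUP y. \<bar>- s y\<bar>)" for n x using h(4)[of n x] by simp
    show "(\<lambda>n. - h n x) \<longlonglongrightarrow> s x" for x using tendsto_minus[OF h(3)[of x]] by simp
  qed
  have main: "F v \<le> (\<integral>x. s x \<partial>dominating)" if v: "v \<in> Ddiv" "AE x in m. pnorm E v x \<le> s x" for v
  proof (rule LIMSEQ_le_const[OF lim])
    have "F v \<le> (\<integral>x. - h n x \<partial>dominating)" for n
    proof -
      have "AE x in m. pnorm E v x \<le> - h n x" using v(2)
      proof eventually_elim
        case (elim x) then show ?case using h(2)[of n x] by linarith
      qed
      then have "F v \<le> \<Lambda> (\<lambda>x. - h n x)" by (rule F_le_\<Lambda>[OF hL v(1)])
      then show ?thesis using \<Lambda>_le_integral[OF hL, of n] by linarith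
    qed
    then show "\<exists>N. \<forall>n\<ge>N. F v \<le> (\<integral>x. - h n x \<partial>dominating)" by blast
  qed
  have "AE x in m. pnorm E (- w) x \<le> s x" using pnorm_E_uminus[of w] le by eventually_elim simp
  moreover have "- w \<in> Ddiv" using D_div_scaleR[OF w, of "-1"] by simp
  ultimately have "F (- w) \<le> (\<integral>x. s x \<partial>dominating)" using main by blast
  then show ?thesis using main[OF w le] F_uminus[OF w] by linarith
qed

end

section \<open>Combinations of divergence fields\<close>

lemma bcontfun_real_iff:
  fixes f :: "'a::topological_space \<Rightarrow> real"
  shows "f \<in> bcontfun \<longleftrightarrow> continuous_on UNIV f \<and> (\<exists>b. \<forall>x. \<bar>f x\<bar> \<le> b)"
  by (auto simp: bcontfun_def bounded_iff)

lemma bcontfun_mult_real: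
  fixes f g :: "'a::topological_space \<Rightarrow> real"
  assumes "f \<in> bcontfun" "g \<in> bcontfun" shows "(\<lambda>x. f x * g x) \<in> bcontfun"
proof -
  obtain a b where ab: "\<And>x. \<bar>f x\<bar> \<le> a" "\<And>x. \<bar>g x\<bar> \<le> b" using assms by (auto simp: bcontfun_real_iff)
  have "\<bar>f x * g x\<bar> \<le> a * b" for x
    unfolding abs_mult using ab[of x] by (intro mult_mono) (auto intro: order_trans[OF abs_ge_zero])
  then show ?thesis using assms by (auto simp: bcontfun_real_iff intro!: continuous_intros)
qed

lemma bcontfun_add_real:
  fixes f g :: "'a::topological_space \<Rightarrow> real"
  assumes "f \<in> bcontfun" "g \<in> bcontfun" shows "(\<lambda>x. f x + g x) \<in> bcontfun"
proof -
  obtain a b where ab: "\<And>x. \<bar>f x\<bar> \<le> a" "\<And>x. \<bar>g x\<bar> \<le> b" using assms by (auto simp: bcontfun_real_iff)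
  have "\<bar>f x + g x\<bar> \<le> a + b" for x using ab[of x] by linarith
  then show ?thesis using assms by (auto simp: bcontfun_real_iff intro!: continuous_intros)
qed

lemma bcontfun_const_real [simp]: "(\<lambda>_. c :: real) \<in> bcontfun"
  by (auto simp: bcontfun_real_iff)

lemma bcontfun_abs_real: "f \<in> bcontfun \<Longrightarrow> (\<lambda>x. \<bar>f x :: real\<bar>) \<in> bcontfun"
  by (auto simp: bcontfun_real_iff intro!: continuous_intros)

lemma bcontfun_cmult_real: "f \<in> bcontfun \<Longrightarrow> (\<lambda>x. c * f x :: real) \<in> bcontfun"
  by (intro bcontfun_mult_real) auto

lemma bcontfun_diff_real: "f \<in> bcontfun \<Longrightarrow> g \<in> bcontfun \<Longrightarrow> (\<lambda>x. f x - g x :: real) \<in> bcontfun"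
  using bcontfun_add_real[OF _ bcontfun_cmult_real[of g "-1"], of f] by simp

lemma abs_le_supnorm:
  assumes "f \<in> bcontfun" shows "\<bar>f x\<bar> \<le> supnorm f"
proof -
  obtain b where "\<And>x. \<bar>f x\<bar> \<le> b" using assms by (auto simp: bcontfun_real_iff)
  then have "bdd_above (range (\<lambda>x. \<bar>f x\<bar>))" by (rule bdd_aboveI2)
  then show ?thesis unfolding supnorm_def by (intro cSUP_upper) auto
qed

context tangent_L0
begin

lemma Linf_norm:
  assumes h: "h \<in> Linf m"
  shows "AE x in m. \<bar>h x\<bar> \<le> Linf_norm m h" "0 \<le> Linf_norm m h"
    "AE x in m. \<bar>h x\<bar> \<le> c \<Longrightarrow> Linf_norm m h \<le> c"
proof -
  let ?h = "\<lambda>x. ereal \<bar>h x\<bar>"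
  have [measurable]: "h \<in> borel_measurable m" using h by (simp add: Linf_def)
  obtain K where K: "AE x in m. \<bar>h x\<bar> \<le> K" using h by (auto simp: Linf_def)
  have le: "esssup m ?h \<le> ereal c" if "AE x in m. \<bar>h x\<bar> \<le> c" for c
    by (rule esssup_I) (use that in auto)
  \<comment> \<open>Full support enters here: for the zero measure the essential supremum would be
    -\<infinity>.\<close>
  have "emeasure m (space m) \<noteq> 0" using full_support[of UNIV] by (simp add: space_m)
  then have "esssup m (\<lambda>_. 0 :: ereal) = 0" by (rule esssup_const)
  then have ge: "0 \<le> esssup m ?h" using esssup_AE_mono[where f="\<lambda>_. 0 :: ereal" and M=m and g="?h"] by simp
  obtain r where r: "esssup m ?h = ereal r" using le[OF K] ge by (cases "esssup m ?h") auto
  have N: "Linf_norm m h = r" by (simp add: Linf_norm_def r)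
  show "AE x in m. \<bar>h x\<bar> \<le> Linf_norm m h" using esssup_AE[where M=m and f="?h"] by (simp add: r N)
  show "0 \<le> Linf_norm m h" using ge by (simp add: r N)
  show "AE x in m. \<bar>h x\<bar> \<le> c \<Longrightarrow> Linf_norm m h \<le> c" using le[of c] by (simp add: r N)
qed

abbreviation "nrm \<equiv> LinfTX_norm m E"
abbreviation "TF \<equiv> test_fields m C d E \<iota>"

lemma nrm:
  assumes "v \<in> LinfTX m E"
  shows nrm_AE: "AE x in m. pnorm E v x \<le> nrm v" and nrm_nonneg: "0 \<le> nrm v"
    and nrm_leI: "AE x in m. pnorm E v x \<le> c \<Longrightarrow> nrm v \<le> c"
proof -
  have p: "pnorm E v \<in> Linf m" using assms by (simp add: LinfTX_def)
  show "AE x in m. pnorm E v x \<le> nrm v"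
    using Linf_norm(1)[OF p] unfolding LinfTX_norm_def by eventually_elim simp
  show "0 \<le> nrm v" using Linf_norm(2)[OF p] by (simp add: LinfTX_norm_def)
  assume "AE x in m. pnorm E v x \<le> c"
  then have "AE x in m. \<bar>pnorm E v x\<bar> \<le> c" using L0.pnorm_nonneg[of v] by eventually_elim simp
  then show "nrm v \<le> c" using Linf_norm(3)[OF p] by (simp add: LinfTX_norm_def)
qed

lemma bcontfun_measurable_m: "(f :: 'a \<Rightarrow> real) \<in> bcontfun \<Longrightarrow> f \<in> borel_measurable m"
  using bcontfun_Linf[of f] by (simp add: Linf_def)

lemma TF_zero: "0 \<in> TF"
  unfolding test_fields_def by (auto intro!: exI[of _ 0])

lemma TF_add_term:
  assumes "u \<in> TF" "g \<in> bcontfun" "v \<in> Ddiv" shows "u + scal E g v \<in> TF"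
proof -
  obtain n :: nat and h w where u: "u = (\<Sum>i<n. scal E (h i) (w i))" "\<forall>i<n. h i \<in> bcontfun \<and> w i \<in> Ddiv"
    using assms(1) unfolding test_fields_def by blast
  let ?h = "h(n := g)" and ?w = "w(n := v)"
  have "u + scal E g v = (\<Sum>i<Suc n. scal E (?h i) (?w i))" by (simp add: u(1))
  moreover have "\<forall>i<Suc n. ?h i \<in> bcontfun \<and> ?w i \<in> Ddiv" using u(2) assms by (auto simp: less_Suc_eq)
  ultimately show ?thesis unfolding test_fields_def by blast
qed

lemma TF_induct [consumes 1, case_names zero add]:
  assumes "u \<in> TF" and "P 0"
    and step: "\<And>u g v. u \<in> TF \<Longrightarrow> P u \<Longrightarrow> g \<in> bcontfun \<Longrightarrow> v \<in> Ddiv \<Longrightarrow> P (u + scal E g v)"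
  shows "P u"
proof -
  obtain n :: nat and h w where u: "u = (\<Sum>i<n. scal E (h i) (w i))" "\<forall>i<n. h i \<in> bcontfun \<and> w i \<in> Ddiv"
    using assms(1) unfolding test_fields_def by blast
  have "k \<le> n \<Longrightarrow> (\<Sum>i<k. scal E (h i) (w i)) \<in> TF \<and> P (\<Sum>i<k. scal E (h i) (w i))" for k
  proof (induction k)
    case (Suc k)
    then show ?case using step TF_add_term u(2) by simp
  qed (use assms(2) TF_zero in simp)
  then show ?thesis using u(1) by blast
qed

lemma TF_term: "g \<in> bcontfun \<Longrightarrow> v \<in> Ddiv \<Longrightarrow> scal E g v \<in> TF"
  using TF_add_term[OF TF_zero] by simp

lemma Ddiv_TF: "v \<in> Ddiv \<Longrightarrow> v \<in> TF"
  using TF_term[of "\<lambda>_. 1" v] by (simp add: L0.scal_const)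

lemma TF_add: "v \<in> TF \<Longrightarrow> u \<in> TF \<Longrightarrow> u + v \<in> TF"
  by (induction rule: TF_induct) (auto simp: add.assoc[symmetric] intro: TF_add_term)

lemma scal_zero: "f \<in> borel_measurable m \<Longrightarrow> scal E f 0 = 0"
  using L0.scal_add_right[of f 0 0] by simp

lemma TF_scal: "u \<in> TF \<Longrightarrow> f \<in> bcontfun \<Longrightarrow> scal E f u \<in> TF"
proof (induction rule: TF_induct)
  case zero
  then show ?case by (simp add: scal_zero bcontfun_measurable_m TF_zero)
next
  case (add u g v)
  have "scal E f (u + scal E g v) = scal E f u + scal E (\<lambda>x. f x * g x) v"
    using add by (simp add: L0.scal_add_right L0.scal_mult bcontfun_measurable_m)
  then show ?case using add by (simp add: TF_add_term bcontfun_mult_real)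
qed

lemma TF_scaleR: "u \<in> TF \<Longrightarrow> c *\<^sub>R u \<in> TF"
  using TF_scal[of u "\<lambda>_. c"] by (simp add: L0.scal_const)

lemma TF_LinfTX: "u \<in> TF \<Longrightarrow> u \<in> LinfTX m E"
proof (induction rule: TF_induct)
  case zero
  have "0 \<in> Ddiv" by (rule D_div_zero)
  then show ?case by (rule D_divD)
next
  case (add u g v)
  then show ?case using LinfTX_scal[OF bcontfun_Linf D_divD(1)] by (intro LinfTX_add)
qed

lemma pnorm_E_sum: "finite I \<Longrightarrow> AE x in m. pnorm E (\<Sum>i\<in>I. u i) x \<le> (\<Sum>i\<in>I. pnorm E (u i) x)"
proof (induction I rule: finite_induct)
  case empty
  then show ?case using pnorm_E_zero by (auto elim: eventually_mono)
next
  case (insert i I)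
  then show ?case using insert.IH L0.pnorm_triangle[of "u i" "\<Sum>i\<in>I. u i"]
    by (auto elim: eventually_elim2)
qed

lemma normed_Cb_module_TF: "normed_Cb_module TF nrm (scal E)"
proof
  show "subspace TF" unfolding subspace_def using TF_zero TF_add TF_scaleR by blast
  show "0 \<le> nrm v" if "v \<in> TF" for v by (rule nrm_nonneg[OF TF_LinfTX[OF that]])
  show "nrm v = 0 \<longleftrightarrow> v = 0" if v: "v \<in> TF" for v
  proof
    assume "nrm v = 0"
    then have "AE x in m. pnorm E v x = 0"
      using nrm_AE[OF TF_LinfTX[OF v]] L0.pnorm_nonneg[of v] by (auto elim: eventually_elim2)
    then show "v = 0" by (rule L0.pnorm_definite)
  next
    assume "v = 0"
    then have "AE x in m. pnorm E v x \<le> 0" using pnorm_E_zero by (auto elim: eventually_mono)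
    then show "nrm v = 0" using nrm_leI[OF TF_LinfTX[OF v]] nrm_nonneg[OF TF_LinfTX[OF v]] by fastforce
  qed
  show "nrm (v + w) \<le> nrm v + nrm w" if v: "v \<in> TF" and w: "w \<in> TF" for v w
  proof (rule nrm_leI[OF TF_LinfTX[OF TF_add[OF w v]]])
    show "AE x in m. pnorm E (v + w) x \<le> nrm v + nrm w"
      using nrm_AE[OF TF_LinfTX[OF v]] nrm_AE[OF TF_LinfTX[OF w]] L0.pnorm_triangle[of v w]
      by eventually_elim linarith
  qed
  have scale_le: "nrm (c *\<^sub>R v) \<le> \<bar>c\<bar> * nrm v" if v: "v \<in> TF" for c v
  proof (rule nrm_leI[OF TF_LinfTX[OF TF_scaleR[OF v]]])
    show "AE x in m. pnorm E (c *\<^sub>R v) x \<le> \<bar>c\<bar> * nrm v"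
      using L0.pnorm_scal[OF borel_measurable_const, of c v] nrm_AE[OF TF_LinfTX[OF v]] unfolding L0.scal_const
      by eventually_elim (simp add: mult_left_mono)
  qed
  show "nrm (c *\<^sub>R v) = \<bar>c\<bar> * nrm v" if v: "v \<in> TF" for c v
  proof (rule antisym[OF scale_le[OF v]])
    show "\<bar>c\<bar> * nrm v \<le> nrm (c *\<^sub>R v)"
    proof (cases "c = 0")
      case True
      then show ?thesis using nrm_nonneg[OF TF_LinfTX[OF TF_zero]] by simp
    next
      case False
      then have "nrm v \<le> \<bar>1 / c\<bar> * nrm (c *\<^sub>R v)" using scale_le[OF TF_scaleR[OF v, of c], of "1 / c"] by simp
      then show ?thesis using False by (simp add: field_simps)
    qed
  qed
  show "scal E f v \<in> TF" if "f \<in> bcontfun" "v \<in> TF" for f v using TF_scal that by blast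
  show "scal E f (v + w) = scal E f v + scal E f w" if "f \<in> bcontfun" "v \<in> TF" "w \<in> TF" for f v w
    using that by (intro L0.scal_add_right bcontfun_measurable_m)
  show "scal E (\<lambda>x. f x + g x) v = scal E f v + scal E g v" if "f \<in> bcontfun" "g \<in> bcontfun" "v \<in> TF" for f g v
    using that by (intro L0.scal_add_left bcontfun_measurable_m)
  show "scal E (\<lambda>x. f x * g x) v = scal E f (scal E g v)" if "f \<in> bcontfun" "g \<in> bcontfun" "v \<in> TF" for f g v
    using that by (intro L0.scal_mult bcontfun_measurable_m)
  show "scal E (\<lambda>_. c) v = c *\<^sub>R v" if "v \<in> TF" for c v by (rule L0.scal_const)
  fix I :: "nat set" and f :: "nat \<Rightarrow> 'a \<Rightarrow> real" and v :: "nat \<Rightarrow> 'w"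
  assume I: "finite I" "I \<noteq> {}" and f: "\<And>i. i \<in> I \<Longrightarrow> f i \<in> bcontfun" and v: "\<And>i. i \<in> I \<Longrightarrow> v i \<in> TF"
    and disj: "disjoint_family_on (\<lambda>i. supp (f i)) I"
  define A where "A = Max ((\<lambda>i. supnorm (f i)) ` I)"
  define B where "B = Max ((\<lambda>i. nrm (v i)) ` I)"
  have A: "\<bar>f i x\<bar> \<le> A" if "i \<in> I" for i x
  proof -
    have "supnorm (f i) \<le> A" unfolding A_def using I that by (intro Max_ge) auto
    then show ?thesis using abs_le_supnorm[OF f[OF that], of x] by linarith
  qed
  have B: "nrm (v i) \<le> B" if "i \<in> I" for i unfolding B_def using I that by (intro Max_ge) auto
  obtain i0 where i0: "i0 \<in> I" using I by blast
  have A0: "0 \<le> A" using A[OF i0, of undefined] by simp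
  have B0: "0 \<le> B" using B[OF i0] nrm_nonneg[OF TF_LinfTX[OF v[OF i0]]] by simp
  have sumTF: "(\<Sum>i\<in>I. scal E (f i) (v i)) \<in> LinfTX m E"
  proof -
    have "finite J \<Longrightarrow> J \<subseteq> I \<Longrightarrow> (\<Sum>i\<in>J. scal E (f i) (v i)) \<in> TF" for J
      by (induction J rule: finite_induct) (auto intro: TF_zero TF_add TF_scal f v)
    then show ?thesis using I TF_LinfTX by blast
  qed
  have "AE x in m. \<forall>i\<in>I. pnorm E (scal E (f i) (v i)) x = \<bar>f i x\<bar> * pnorm E (v i) x"
    using I f by (intro AE_finite_allI L0.pnorm_scal bcontfun_measurable_m)
  moreover have "AE x in m. \<forall>i\<in>I. 0 \<le> pnorm E (v i) x \<and> pnorm E (v i) x \<le> B"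
  proof (rule AE_finite_allI[OF I(1)])
    fix i assume i: "i \<in> I"
    show "AE x in m. 0 \<le> pnorm E (v i) x \<and> pnorm E (v i) x \<le> B"
      using nrm_AE[OF TF_LinfTX[OF v[OF i]]] L0.pnorm_nonneg[of "v i"] by eventually_elim (use B[OF i] in auto)
  qed
  moreover have "AE x in m. pnorm E (\<Sum>i\<in>I. scal E (f i) (v i)) x \<le> (\<Sum>i\<in>I. pnorm E (scal E (f i) (v i)) x)"
    by (rule pnorm_E_sum[OF I(1)])
  ultimately have "AE x in m. pnorm E (\<Sum>i\<in>I. scal E (f i) (v i)) x \<le> A * B"
  proof eventually_elim
    case (elim x)
    have "(\<Sum>i\<in>I. pnorm E (scal E (f i) (v i)) x) = (\<Sum>i\<in>I. \<bar>f i x\<bar> * pnorm E (v i) x)"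
      using elim(1) by (intro sum.cong) auto
    also have "\<dots> \<le> A * B"
    proof (cases "\<exists>j\<in>I. f j x \<noteq> 0")
      case True
      then obtain j where j: "j \<in> I" "f j x \<noteq> 0" by blast
      \<comment> \<open>Disjoint supports leave a single nonzero coefficient at \<open>x\<close>, so
        the sum of pointwise norms reduces to one term and the maxima suffice.\<close>
      have "f i x = 0" if "i \<in> I - {j}" for i
      proof (rule ccontr)
        assume "f i x \<noteq> 0"
        then have "x \<in> supp (f i)" "x \<in> supp (f j)"
          using j closure_subset unfolding supp_def by (blast intro: subsetD[OF closure_subset])+
        then show False using disj that j unfolding disjoint_family_on_def by blast
      qed
      then have "(\<Sum>i\<in>I. \<bar>f i x\<bar> * pnorm E (v i) x) = \<bar>f j x\<bar> * pnorm E (v j) x"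
        using I(1) j(1) by (subst sum.remove[OF I(1) j(1)]) simp
      also have "\<dots> \<le> A * B" using A[OF j(1)] elim(2) j(1) A0 by (intro mult_mono) auto
      finally show ?thesis .
    next
      case False
      then show ?thesis using A0 B0 by simp
    qed
    finally show ?case using elim(3) by linarith
  qed
  then show "nrm (\<Sum>i\<in>I. scal E (f i) (v i)) \<le> Max ((\<lambda>i. supnorm (f i)) ` I) * Max ((\<lambda>i. nrm (v i)) ` I)"
    using nrm_leI[OF sumTF] unfolding A_def B_def by blast
qed

end

section \<open>The local vector measure of a functional\<close>

text \<open>Helly's theorem on the line: pairwise intersecting intervals around the centres
  \<open>c\<close> share the supremum of their left endpoints. It yields a limit that is independent
  of any approximating sequence and comes with its error estimate.\<close>

lemma ex1_common_point:
  fixes S :: "(real \<times> real) set"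
  assumes pair: "\<And>c r c' r'. (c, r) \<in> S \<Longrightarrow> (c', r') \<in> S \<Longrightarrow> \<bar>c - c'\<bar> \<le> r + r'"
    and small: "\<And>e. 0 < e \<Longrightarrow> \<exists>(c, r)\<in>S. r < e"
  shows "\<exists>!t. \<forall>(c, r)\<in>S. \<bar>t - c\<bar> \<le> r"
proof
  let ?L = "(\<lambda>(c, r). c - r) ` S"
  obtain c0 r0 where S0: "(c0, r0) \<in> S" using small[of 1] by auto
  have le: "l \<le> c + r" if "l \<in> ?L" "(c, r) \<in> S" for l c r
    using that pair by (fastforce simp: abs_le_iff)
  have bdd: "bdd_above ?L" using le S0 by (intro bdd_aboveI) blast
  show "\<forall>(c, r)\<in>S. \<bar>Sup ?L - c\<bar> \<le> r"
  proof safe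
    fix c r assume cr: "(c, r) \<in> S"
    have "Sup ?L \<le> c + r" using S0 le cr by (intro cSup_least) auto
    moreover have "c - r \<le> Sup ?L" using cr bdd by (intro cSup_upper) force
    ultimately show "\<bar>Sup ?L - c\<bar> \<le> r" by (simp add: abs_le_iff)
  qed
  fix t assume t: "\<forall>(c, r)\<in>S. \<bar>t - c\<bar> \<le> r"
  show "t = Sup ?L"
  proof (rule ccontr)
    assume "t \<noteq> Sup ?L"
    then have "0 < \<bar>t - Sup ?L\<bar> / 2" by simp
    from small[OF this] obtain c r where cr: "(c, r) \<in> S" "r < \<bar>t - Sup ?L\<bar> / 2" by blast
    have "\<bar>t - c\<bar> \<le> r" using t cr(1) by auto
    moreover have "\<bar>Sup ?L - c\<bar> \<le> r" using \<open>\<forall>(c, r)\<in>S. \<bar>Sup ?L - c\<bar> \<le> r\<close> cr(1) by auto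
    moreover have "\<bar>t - Sup ?L\<bar> \<le> \<bar>t - c\<bar> + \<bar>Sup ?L - c\<bar>"
      using abs_triangle_ineq4[of "t - c" "Sup ?L - c"] by simp
    ultimately show False using cr(2) by simp
  qed
qed

context divergence_functional
begin

lemma bcontfun_integrable:
  fixes s :: "'a \<Rightarrow> real"
  assumes s: "s \<in> bcontfun" shows "integrable dominating s"
proof -
  interpret finite_measure dominating by (rule finite_dominating)
  obtain b where "\<And>x. \<bar>s x\<bar> \<le> b" using s by (auto simp: bcontfun_real_iff)
  moreover have "s \<in> borel_measurable dominating"
    using s by (auto simp: bcontfun_real_iff measurable_cong_sets[OF sets_dominating refl] intro: borel_measurable_continuous_onI)
  ultimately show ?thesis by (intro integrable_const_bound[where B=b]) auto
qed

text \<open>The error is recorded as a continuous function rather than a number, because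
  \<open>F_le_integral\<close> can then be applied to differences and the quality of the
  approximation be measured by the integral of \<open>s\<close>.\<close>

definition near :: "'w \<Rightarrow> 'w \<Rightarrow> ('a \<Rightarrow> real) \<Rightarrow> bool" where
  "near w p s \<longleftrightarrow> p \<in> Ddiv \<and> s \<in> bcontfun \<and> (\<forall>x. 0 \<le> s x) \<and> (AE x in m. pnorm E (p - w) x \<le> s x)"

lemma near_refl: "p \<in> Ddiv \<Longrightarrow> near p p (\<lambda>_. 0)"
  using pnorm_E_zero by (auto simp: near_def elim: eventually_mono)

lemma near_add:
  assumes "near w p s" "near w' p' s'" shows "near (w + w') (p + p') (\<lambda>x. s x + s' x)"
proof -
  have "AE x in m. pnorm E ((p - w) + (p' - w')) x \<le> pnorm E (p - w) x + pnorm E (p' - w') x"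
    by (rule L0.pnorm_triangle)
  moreover have "(p - w) + (p' - w') = (p + p') - (w + w')" by simp
  ultimately have "AE x in m. pnorm E ((p + p') - (w + w')) x \<le> pnorm E (p - w) x + pnorm E (p' - w') x" by metis
  moreover have "AE x in m. pnorm E (p - w) x \<le> s x" "AE x in m. pnorm E (p' - w') x \<le> s' x"
    using assms by (auto simp: near_def)
  ultimately have "AE x in m. pnorm E ((p + p') - (w + w')) x \<le> s x + s' x" by eventually_elim linarith
  then show ?thesis using assms by (auto simp: near_def intro!: D_div_add bcontfun_add_real)
qed

lemma near_scaleR:
  assumes "near w p s" shows "near (c *\<^sub>R w) (c *\<^sub>R p) (\<lambda>x. \<bar>c\<bar> * s x)"
proof -
  have "AE x in m. pnorm E (scal E (\<lambda>_. c) (p - w)) x \<le> \<bar>c\<bar> * s x"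
    by (rule pnorm_scal_le[of _ _ s]) (use assms in \<open>auto simp: near_def\<close>)
  then have "AE x in m. pnorm E (c *\<^sub>R p - c *\<^sub>R w) x \<le> \<bar>c\<bar> * s x" by (simp add: L0.scal_const scaleR_right_diff_distrib)
  then show ?thesis using assms by (auto simp: near_def intro!: D_div_scaleR bcontfun_cmult_real)
qed

lemma near_F:
  assumes "near w p s" "near w p' s'"
  shows "\<bar>F p - F p'\<bar> \<le> (\<integral>x. s x \<partial>dominating) + (\<integral>x. s' x \<partial>dominating)"
proof -
  have "near (w + (-1) *\<^sub>R w) (p + (-1) *\<^sub>R p') (\<lambda>x. s x + \<bar>-1\<bar> * s' x)" by (intro near_add near_scaleR assms)
  then have n: "near 0 (p - p') (\<lambda>x. s x + s' x)" by simp
  then have "\<bar>F (p - p')\<bar> \<le> (\<integral>x. s x + s' x \<partial>dominating)" by (intro F_le_integral) (auto simp: near_def)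
  also have "\<dots> = (\<integral>x. s x \<partial>dominating) + (\<integral>x. s' x \<partial>dominating)"
    using assms by (intro Bochner_Integration.integral_add bcontfun_integrable) (auto simp: near_def)
  also have "F (p - p') = F p - F p'"
    using F_add[of p "(-1) *\<^sub>R p'"] F_scaleR[of p' "-1"] D_div_scaleR[of p' "-1"] assms by (simp add: near_def)
  finally show ?thesis .
qed

text \<open>The error of the approximation is measured against \<^const>\<open>dominating\<close>, because continuous functions
  are in general not uniform limits of Lipschitz ones.\<close>

lemma near_exists:
  assumes "w \<in> TF" "0 < e" shows "\<exists>p s. near w p s \<and> (\<integral>x. s x \<partial>dominating) < e"
  using assms
proof (induction arbitrary: e rule: TF_induct)
  case zero
  then show ?case using near_refl[OF D_div_zero] by (intro exI[of _ 0] exI[of _ "\<lambda>_. 0"]) auto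
next
  case (add w g v)
  obtain p s where p: "near w p s" "(\<integral>x. s x \<partial>dominating) < e/2" using add.IH[of "e/2"] add.prems by auto
  have vL: "v \<in> LinfTX m E" using add.hyps by (intro D_divD)
  define K where "K = nrm v"
  have K: "0 \<le> K" "AE x in m. pnorm E v x \<le> K" using nrm_nonneg[OF vL] nrm_AE[OF vL] by (auto simp: K_def)
  obtain h where h: "\<And>n. h n \<in> LIPb" "\<And>x. (\<lambda>n. h n x) \<longlonglongrightarrow> g x" "\<And>n x. \<bar>h n x\<bar> \<le> (SUP y. \<bar>g y\<bar>)"
    using bcontfun_Lipschitz_minorants[OF add.hyps(2)] by metis
  define r where "r n x = \<bar>h n x - g x\<bar> * K" for n x
  have rb: "r n \<in> bcontfun" for n
    unfolding r_def[abs_def] using LIPb_bcontfun[OF h(1)] add.hyps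
    by (intro bcontfun_mult_real bcontfun_abs_real bcontfun_diff_real bcontfun_const_real)
  have "(\<lambda>n. \<integral>x. r n x \<partial>dominating) \<longlonglongrightarrow> (\<integral>x. 0 \<partial>dominating)"
  proof (rule tendsto_integral_bounded[OF finite_dominating])
    show "r n \<in> borel_measurable dominating" for n using bcontfun_integrable[OF rb] by auto
    show "\<bar>r n x\<bar> \<le> (2 * (SUP y. \<bar>g y\<bar>)) * K" for n x
    proof -
      have "\<bar>g x\<bar> \<le> (SUP y. \<bar>g y\<bar>)" using abs_le_supnorm[OF add.hyps(2)] by (simp add: supnorm_def)
      then have "\<bar>h n x - g x\<bar> \<le> 2 * (SUP y. \<bar>g y\<bar>)" using h(3)[of n x] by linarith
      then show ?thesis using K(1) by (auto simp: r_def abs_mult intro!: mult_right_mono)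
    qed
    show "(\<lambda>n. r n x) \<longlonglongrightarrow> 0" for x
    proof -
      have "(\<lambda>n. \<bar>h n x - g x\<bar> * K) \<longlonglongrightarrow> \<bar>g x - g x\<bar> * K" by (intro tendsto_intros h)
      then show ?thesis by (simp add: r_def)
    qed
  qed simp
  then have "\<forall>\<^sub>F n in sequentially. (\<integral>x. r n x \<partial>dominating) < e/2"
    using add.prems by (intro order_tendstoD(2)) auto
  then obtain n where n: "(\<integral>x. r n x \<partial>dominating) < e/2" using eventually_happens'[OF sequentially_bot] by blast
  have "near (scal E g v) (scal E (h n) v) (r n)"
    unfolding near_def
  proof (intro conjI allI rb D_div_scal add.hyps h)
    show "0 \<le> r n x" for x using K(1) by (simp add: r_def)
    have hg: "h n \<in> borel_measurable m" "(\<lambda>x. h n x - g x) \<in> borel_measurable m" "g \<in> borel_measurable m"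
      using LIPb_measurable_m[OF h(1)] bcontfun_measurable_m[OF add.hyps(2)] by auto
    have "scal E (\<lambda>x. (h n x - g x) + g x) v = scal E (\<lambda>x. h n x - g x) v + scal E g v"
      using hg by (intro L0.scal_add_left)
    then have eq: "scal E (h n) v - scal E g v = scal E (\<lambda>x. h n x - g x) v" by simp
    show "AE x in m. pnorm E (scal E (h n) v - scal E g v) x \<le> r n x"
      unfolding eq using L0.pnorm_scal[OF hg(2), of v] K(2)
      by eventually_elim (auto simp: r_def intro!: mult_left_mono)
  qed
  from near_add[OF p(1) this] have "near (w + scal E g v) (p + scal E (h n) v) (\<lambda>x. s x + r n x)" .
  moreover have "(\<integral>x. s x + r n x \<partial>dominating) = (\<integral>x. s x \<partial>dominating) + (\<integral>x. r n x \<partial>dominating)"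
    using p by (intro Bochner_Integration.integral_add bcontfun_integrable rb) (auto simp: near_def)
  then have "(\<integral>x. s x + r n x \<partial>dominating) < e" using p(2) n by simp
  ultimately show ?case by blast
qed

text \<open>The intervals around the values \<open>F p\<close> overlap pairwise and get arbitrarily short, so that exactly
  one number lies in all of them; likewise for \<open>DF\<close> below.\<close>

definition Fext :: "'w \<Rightarrow> real" where
  "Fext w = (THE t. \<forall>(c, r)\<in>{(F p, \<integral>x. s x \<partial>dominating) | p s. near w p s}. \<bar>t - c\<bar> \<le> r)"

lemma Fext_near:
  assumes w: "w \<in> TF" and n: "near w p s" shows "\<bar>Fext w - F p\<bar> \<le> (\<integral>x. s x \<partial>dominating)"
proof -
  let ?S = "{(F p, \<integral>x. s x \<partial>dominating) | p s. near w p s}"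
  have "\<exists>!t. \<forall>(c, r)\<in>?S. \<bar>t - c\<bar> \<le> r"
  proof (rule ex1_common_point)
    show "\<bar>c - c'\<bar> \<le> r + r'" if "(c, r) \<in> ?S" "(c', r') \<in> ?S" for c r c' r' using that near_F by auto
    show "\<exists>(c, r)\<in>?S. r < e" if "0 < e" for e using near_exists[OF w that] by auto
  qed
  from theI'[OF this] show ?thesis unfolding Fext_def[symmetric] using n by auto
qed

lemma Fext_D: "p \<in> Ddiv \<Longrightarrow> Fext p = F p"
  using Fext_near[OF Ddiv_TF near_refl] by fastforce

lemma Fext_add:
  assumes w: "w \<in> TF" "w' \<in> TF" shows "Fext (w + w') = Fext w + Fext w'"
proof -
  have "\<bar>Fext (w + w') - (Fext w + Fext w')\<bar> \<le> 0 + e" if e: "0 < e" for e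
  proof -
    obtain p s where p: "near w p s" "(\<integral>x. s x \<partial>dominating) < e/4" using near_exists[OF w(1), of "e/4"] e by auto
    obtain p' s' where p': "near w' p' s'" "(\<integral>x. s' x \<partial>dominating) < e/4" using near_exists[OF w(2), of "e/4"] e by auto
    have "\<bar>Fext (w + w') - F (p + p')\<bar> \<le> (\<integral>x. s x + s' x \<partial>dominating)"
      by (rule Fext_near[OF TF_add[OF w(2,1)] near_add[OF p(1) p'(1)]])
    also have "\<dots> = (\<integral>x. s x \<partial>dominating) + (\<integral>x. s' x \<partial>dominating)"
      using p p' by (intro Bochner_Integration.integral_add bcontfun_integrable) (auto simp: near_def)
    also have "F (p + p') = F p + F p'" using F_add p p' by (auto simp: near_def)
    finally show ?thesis using Fext_near[OF w(1) p(1)] Fext_near[OF w(2) p'(1)] p(2) p'(2) e by linarith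
  qed
  then have "\<bar>Fext (w + w') - (Fext w + Fext w')\<bar> \<le> 0" by (rule field_le_epsilon)
  then show ?thesis by simp
qed

lemma Fext_scaleR:
  assumes w: "w \<in> TF" shows "Fext (c *\<^sub>R w) = c * Fext w"
proof -
  have "\<bar>Fext (c *\<^sub>R w) - c * Fext w\<bar> \<le> 0 + e" if e: "0 < e" for e
  proof -
    define k where "k = e / (2 * (\<bar>c\<bar> + 1))"
    have k: "0 < k" using e by (simp add: k_def add_nonneg_pos)
    obtain p s where p: "near w p s" "(\<integral>x. s x \<partial>dominating) < k" using near_exists[OF w k] by auto
    have "\<bar>Fext (c *\<^sub>R w) - F (c *\<^sub>R p)\<bar> \<le> (\<integral>x. \<bar>c\<bar> * s x \<partial>dominating)"
      by (rule Fext_near[OF TF_scaleR[OF w] near_scaleR[OF p(1)]])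
    also have "\<dots> = \<bar>c\<bar> * (\<integral>x. s x \<partial>dominating)" by simp
    also have "\<dots> \<le> \<bar>c\<bar> * k" using p(2) by (intro mult_left_mono) auto
    finally have 1: "\<bar>Fext (c *\<^sub>R w) - c * F p\<bar> \<le> \<bar>c\<bar> * k" using F_scaleR p by (simp add: near_def)
    have "\<bar>c * F p - c * Fext w\<bar> = \<bar>c\<bar> * \<bar>Fext w - F p\<bar>"
      by (simp only: abs_mult[symmetric] right_diff_distrib abs_minus_commute)
    also have "\<dots> \<le> \<bar>c\<bar> * k" using Fext_near[OF w p(1)] p(2) by (intro mult_left_mono) auto
    finally have "\<bar>Fext (c *\<^sub>R w) - c * Fext w\<bar> \<le> 2 * (\<bar>c\<bar> * k)" using 1 by linarith
    also have "\<dots> \<le> 2 * ((\<bar>c\<bar> + 1) * k)" using k by (intro mult_left_mono mult_right_mono) auto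
    also have "\<dots> = e"
    proof -
      have "2 * (b * (e / (2 * b))) = e" if "b \<noteq> 0" for b :: real using that by simp
      moreover have "\<bar>c\<bar> + 1 \<noteq> 0" using abs_ge_zero[of c] by linarith
      ultimately show ?thesis unfolding k_def by blast
    qed
    finally show ?thesis by simp
  qed
  then have "\<bar>Fext (c *\<^sub>R w) - c * Fext w\<bar> \<le> 0" by (rule field_le_epsilon)
  then show ?thesis by simp
qed

lemma Fext_zero: "Fext 0 = 0"
  using Fext_D[OF D_div_zero] F_zero by simp

lemma Fext_bound:
  assumes w: "w \<in> TF" and s: "s \<in> bcontfun" "\<And>x. 0 \<le> s x" "AE x in m. pnorm E w x \<le> s x"
  shows "\<bar>Fext w\<bar> \<le> (\<integral>x. s x \<partial>dominating)"
proof (rule field_le_epsilon)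
  fix e :: real assume e: "0 < e"
  obtain p r where p: "near w p r" "(\<integral>x. r x \<partial>dominating) < e/2" using near_exists[OF w, of "e/2"] e by auto
  have "AE x in m. pnorm E ((p - w) + w) x \<le> pnorm E (p - w) x + pnorm E w x" by (rule L0.pnorm_triangle)
  then have "AE x in m. pnorm E p x \<le> pnorm E (p - w) x + pnorm E w x" by simp
  moreover have "AE x in m. pnorm E (p - w) x \<le> r x" using p by (simp add: near_def)
  ultimately have "AE x in m. pnorm E p x \<le> s x + r x" using s(3) by eventually_elim linarith
  then have "\<bar>F p\<bar> \<le> (\<integral>x. s x + r x \<partial>dominating)"
    using p s by (intro F_le_integral bcontfun_add_real) (auto simp: near_def)
  also have "\<dots> = (\<integral>x. s x \<partial>dominating) + (\<integral>x. r x \<partial>dominating)"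
    using p s by (intro Bochner_Integration.integral_add bcontfun_integrable) (auto simp: near_def)
  finally show "\<bar>Fext w\<bar> \<le> (\<integral>x. s x \<partial>dominating) + e" using Fext_near[OF w p(1)] p(2) by linarith
qed

section \<open>Localisation of the extended functional to Borel sets\<close>

definition deviation :: "'a set \<Rightarrow> ('a \<Rightarrow> real) \<Rightarrow> real" where
  "deviation A h = (\<integral>x. \<bar>h x - indicator A x\<bar> \<partial>dominating)"

lemma deviation_integrable:
  assumes "A \<in> sets borel" "h \<in> LIPb"
  shows "integrable dominating (\<lambda>x. \<bar>h x - indicator A x\<bar>)"
proof -
  interpret finite_measure dominating by (rule finite_dominating)
  have "integrable dominating (indicator A :: 'a \<Rightarrow> real)" using assms by (simp add: emeasure_eq_measure sets_dominating)
  then show ?thesis using bcontfun_integrable[OF LIPb_bcontfun[OF assms(2)]] by simp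
qed

lemma deviation_nonneg: "0 \<le> deviation A h"
  unfolding deviation_def by simp

definition DF :: "'a set \<Rightarrow> 'w \<Rightarrow> real" where
  "DF A w = (THE t. \<forall>(c, r)\<in>{(Fext (scal E h w), nrm w * deviation A h) | h. h \<in> LIPb}. \<bar>t - c\<bar> \<le> r)"

lemma cutoff_sequence:
  assumes A: "A \<in> sets borel"
  obtains h where "\<And>n::nat. h n \<in> LIPb" "(\<lambda>n. deviation A (h n)) \<longlonglongrightarrow> 0"
proof -
  have "\<exists>h. h \<in> LIPb \<and> deviation A h < inverse (real (Suc n))" for n
    using Lipschitz_approx_indicator[OF sets_dominating finite_dominating A, of "inverse (real (Suc n))"]
    unfolding deviation_def by (metis inverse_positive_iff_positive of_nat_0_less_iff zero_less_Suc)
  then obtain h where h: "\<And>n. h n \<in> LIPb" "\<And>n. deviation A (h n) < inverse (real (Suc n))" by metis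
  have "\<forall>\<^sub>F n in sequentially. deviation A (h n) \<le> inverse (real (Suc n))"
    by (intro always_eventually allI less_imp_le h)
  then have "(\<lambda>n. deviation A (h n)) \<longlonglongrightarrow> 0"
    by (rule tendsto_sandwich[OF _ _ tendsto_const LIMSEQ_inverse_real_of_nat, rotated]) (simp add: deviation_nonneg)
  with h(1) show ?thesis by (rule that)
qed

text \<open>Values for two multipliers h and k differ by at most the norm of \<open>w\<close> times
  the integral of |h - k|. Comparing both with the indicator of \<open>A\<close> shows that the
  intervals overlap, and Lipschitz approximation of the indicator makes them short.\<close>

lemma DF_near:
  assumes A: "A \<in> sets borel" and w: "w \<in> TF" and h: "h \<in> LIPb"
  shows "\<bar>DF A w - Fext (scal E h w)\<bar> \<le> nrm w * deviation A h"
proof -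
  let ?S = "{(Fext (scal E h w), nrm w * deviation A h) | h. h \<in> LIPb}"
  note wL = TF_LinfTX[OF w]
  have pairwise: "\<bar>Fext (scal E h w) - Fext (scal E k w)\<bar> \<le> nrm w * deviation A h + nrm w * deviation A k"
    if h: "h \<in> LIPb" and k: "k \<in> LIPb" for h k
  proof -
    have hk: "(\<lambda>x. h x - k x) \<in> LIPb" using h k by auto
    have "scal E (\<lambda>x. (h x - k x) + k x) w = scal E (\<lambda>x. h x - k x) w + scal E k w" by (intro scal_E_add hk k)
    then have "Fext (scal E h w) = Fext (scal E (\<lambda>x. h x - k x) w) + Fext (scal E k w)"
      using Fext_add[OF TF_scal[OF w LIPb_bcontfun[OF hk]] TF_scal[OF w LIPb_bcontfun[OF k]]] by simp
    then have "\<bar>Fext (scal E h w) - Fext (scal E k w)\<bar> = \<bar>Fext (scal E (\<lambda>x. h x - k x) w)\<bar>" by simp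
    also have "\<dots> \<le> (\<integral>x. nrm w * \<bar>h x - k x\<bar> \<partial>dominating)"
    proof (rule Fext_bound[OF TF_scal[OF w LIPb_bcontfun[OF hk]]])
      show "(\<lambda>x. nrm w * \<bar>h x - k x\<bar>) \<in> bcontfun" by (intro LIPb_bcontfun LIPb_cmult LIPb_abs hk)
      show "AE x in m. pnorm E (scal E (\<lambda>x. h x - k x) w) x \<le> nrm w * \<bar>h x - k x\<bar>"
        by (rule pnorm_scal_le[OF hk nrm_AE[OF wL]]) simp
    qed (use nrm_nonneg[OF wL] in simp)
    also have "\<dots> = nrm w * (\<integral>x. \<bar>h x - k x\<bar> \<partial>dominating)" by simp
    also have "\<dots> \<le> nrm w * (deviation A h + deviation A k)"
    proof (intro mult_left_mono nrm_nonneg wL)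
      have "(\<integral>x. \<bar>h x - k x\<bar> \<partial>dominating) \<le> (\<integral>x. \<bar>h x - indicator A x\<bar> + \<bar>k x - indicator A x\<bar> \<partial>dominating)"
        using deviation_integrable[OF A h] deviation_integrable[OF A k] bcontfun_integrable[OF LIPb_bcontfun[OF LIPb_abs[OF hk]]]
        by (intro integral_mono) auto
      also have "\<dots> = deviation A h + deviation A k"
        using deviation_integrable[OF A h] deviation_integrable[OF A k] by (simp add: deviation_def)
      finally show "(\<integral>x. \<bar>h x - k x\<bar> \<partial>dominating) \<le> deviation A h + deviation A k" .
    qed
    finally show ?thesis by (simp add: distrib_left)
  qed
  have "\<exists>!t. \<forall>(c, r)\<in>?S. \<bar>t - c\<bar> \<le> r"
  proof (rule ex1_common_point)
    show "\<bar>c - c'\<bar> \<le> r + r'" if "(c, r) \<in> ?S" "(c', r') \<in> ?S" for c r c' r' using that pairwise by auto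
    show "\<exists>(c, r)\<in>?S. r < e" if e: "0 < e" for e
    proof -
      obtain g where g: "\<And>n::nat. g n \<in> LIPb" "(\<lambda>n. deviation A (g n)) \<longlonglongrightarrow> 0" using cutoff_sequence[OF A] by blast
      have "\<forall>\<^sub>F n in sequentially. nrm w * deviation A (g n) < e"
        using tendsto_mult_right_zero[OF g(2), of "nrm w"] e by (rule order_tendstoD(2))
      then obtain n where "nrm w * deviation A (g n) < e" using eventually_happens'[OF sequentially_bot] by blast
      then show ?thesis using g(1) by (intro bexI[of _ "(Fext (scal E (g n) w), nrm w * deviation A (g n))"]) auto
    qed
  qed
  from theI'[OF this] show ?thesis unfolding DF_def[symmetric] using h by auto
qed

lemma DF_limit:
  assumes A: "A \<in> sets borel" and h: "\<And>n. h n \<in> LIPb" "(\<lambda>n. deviation A (h n)) \<longlonglongrightarrow> 0" and w: "w \<in> TF"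
  shows "(\<lambda>n. Fext (scal E (h n) w)) \<longlonglongrightarrow> DF A w"
proof -
  have "(\<lambda>n. DF A w - Fext (scal E (h n) w)) \<longlonglongrightarrow> 0"
  proof (rule Lim_null_comparison)
    show "\<forall>\<^sub>F n in sequentially. norm (DF A w - Fext (scal E (h n) w)) \<le> nrm w * deviation A (h n)"
      using DF_near[OF A w h(1)] by simp
    show "(\<lambda>n. nrm w * deviation A (h n)) \<longlonglongrightarrow> 0" by (rule tendsto_mult_right_zero[OF h(2)])
  qed
  from tendsto_diff[OF tendsto_const[of "DF A w"] this] show ?thesis by simp
qed

lemma DF_add:
  assumes A: "A \<in> sets borel" and w: "w \<in> TF" "w' \<in> TF" shows "DF A (w + w') = DF A w + DF A w'"
proof -
  obtain h where h: "\<And>n::nat. h n \<in> LIPb" "(\<lambda>n. deviation A (h n)) \<longlonglongrightarrow> 0" using cutoff_sequence[OF A] by blast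
  have eq: "Fext (scal E (h n) (w + w')) = Fext (scal E (h n) w) + Fext (scal E (h n) w')" for n
    using Fext_add[OF TF_scal[OF w(1)] TF_scal[OF w(2)]] LIPb_bcontfun[OF h(1)[of n]]
      L0.scal_add_right[OF LIPb_measurable_m[OF h(1)], of n w w'] by simp
  show ?thesis
    using LIMSEQ_unique[OF DF_limit[OF A h TF_add[OF w(2,1)], unfolded eq] tendsto_add[OF DF_limit[OF A h w(1)] DF_limit[OF A h w(2)]]] .
qed

lemma DF_scaleR:
  assumes A: "A \<in> sets borel" and w: "w \<in> TF" shows "DF A (c *\<^sub>R w) = c * DF A w"
proof -
  obtain h where h: "\<And>n::nat. h n \<in> LIPb" "(\<lambda>n. deviation A (h n)) \<longlonglongrightarrow> 0" using cutoff_sequence[OF A] by blast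
  have eq: "Fext (scal E (h n) (c *\<^sub>R w)) = c * Fext (scal E (h n) w)" for n
  proof -
    have hm: "h n \<in> borel_measurable m" by (rule LIPb_measurable_m[OF h(1)])
    have "scal E (h n) (scal E (\<lambda>_. c) w) = scal E (\<lambda>x. h n x * c) w" using hm by (intro L0.scal_mult[symmetric]) auto
    also have "(\<lambda>x. h n x * c) = (\<lambda>x. c * h n x)" by (simp add: mult.commute)
    also have "scal E (\<lambda>x. c * h n x) w = scal E (\<lambda>_. c) (scal E (h n) w)" using hm by (intro L0.scal_mult) auto
    finally show ?thesis using Fext_scaleR[OF TF_scal[OF w LIPb_bcontfun[OF h(1)]]] by (simp add: L0.scal_const)
  qed
  show ?thesis
    using LIMSEQ_unique[OF DF_limit[OF A h TF_scaleR[OF w, of c], unfolded eq] tendsto_mult_left[OF DF_limit[OF A h w], of c]] .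
qed

lemma DF_UNIV:
  assumes w: "w \<in> TF" shows "DF UNIV w = Fext w"
  using DF_near[OF _ w LIPb_const, of UNIV 1] by (simp add: deviation_def L0.scal_const)

text \<open>For disjoint sets the indicators add up, so the sum of two approximating multipliers
  approximates the indicator of the union.\<close>

lemma DF_Un:
  assumes A: "A \<in> sets borel" and B: "B \<in> sets borel" and disj: "A \<inter> B = {}" and w: "w \<in> TF"
  shows "DF (A \<union> B) w = DF A w + DF B w"
proof -
  obtain h where h: "\<And>n::nat. h n \<in> LIPb" "(\<lambda>n. deviation A (h n)) \<longlonglongrightarrow> 0" using cutoff_sequence[OF A] by blast
  obtain k where k: "\<And>n::nat. k n \<in> LIPb" "(\<lambda>n. deviation B (k n)) \<longlonglongrightarrow> 0" using cutoff_sequence[OF B] by blast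
  have hk: "(\<lambda>x. h n x + k n x) \<in> LIPb" for n using h k by auto
  have AB: "A \<union> B \<in> sets borel" using A B by auto
  have dev: "deviation (A \<union> B) (\<lambda>x. h n x + k n x) \<le> deviation A (h n) + deviation B (k n)" for n
  proof -
    have ind: "indicator (A \<union> B) x = (indicator A x + indicator B x :: real)" for x using disj by (auto simp: indicator_def)
    have "deviation (A \<union> B) (\<lambda>x. h n x + k n x) \<le> (\<integral>x. \<bar>h n x - indicator A x\<bar> + \<bar>k n x - indicator B x\<bar> \<partial>dominating)"
      unfolding deviation_def using deviation_integrable[OF AB hk] deviation_integrable[OF A h(1)] deviation_integrable[OF B k(1)]
      by (intro integral_mono) (auto simp: ind)
    also have "\<dots> = deviation A (h n) + deviation B (k n)"
      using deviation_integrable[OF A h(1)] deviation_integrable[OF B k(1)] by (simp add: deviation_def)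
    finally show ?thesis .
  qed
  have "(\<lambda>n. deviation (A \<union> B) (\<lambda>x. h n x + k n x)) \<longlonglongrightarrow> 0"
  proof (rule tendsto_sandwich[OF _ _ tendsto_const])
    show "(\<lambda>n. deviation A (h n) + deviation B (k n)) \<longlonglongrightarrow> 0" using tendsto_add[OF h(2) k(2)] by simp
  qed (use dev deviation_nonneg in auto)
  then have lim: "(\<lambda>n. Fext (scal E (\<lambda>x. h n x + k n x) w)) \<longlonglongrightarrow> DF (A \<union> B) w"
    by (rule DF_limit[OF AB hk _ w])
  have eq: "Fext (scal E (\<lambda>x. h n x + k n x) w) = Fext (scal E (h n) w) + Fext (scal E (k n) w)" for n
    using Fext_add[OF TF_scal[OF w LIPb_bcontfun[OF h(1)]] TF_scal[OF w LIPb_bcontfun[OF k(1)]]]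
    by (simp add: scal_E_add h k)
  show ?thesis
    using LIMSEQ_unique[OF lim[unfolded eq] tendsto_add[OF DF_limit[OF A h w] DF_limit[OF B k w]]] .
qed

text \<open>Domination by a finite measure, uniform over the unit ball: both continuity in the field
  and sigma-additivity in the dual norm come from it.\<close>

lemma DF_bound:
  assumes A: "A \<in> sets borel" and w: "w \<in> TF" shows "\<bar>DF A w\<bar> \<le> nrm w * measure dominating A"
proof -
  interpret finite_measure dominating by (rule finite_dominating)
  obtain h where h: "\<And>n::nat. h n \<in> LIPb" "(\<lambda>n. deviation A (h n)) \<longlonglongrightarrow> 0" using cutoff_sequence[OF A] by blast
  note wL = TF_LinfTX[OF w]
  have "\<bar>Fext (scal E (h n) w)\<bar> \<le> nrm w * (measure dominating A + deviation A (h n))" for n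
  proof -
    have "\<bar>Fext (scal E (h n) w)\<bar> \<le> (\<integral>x. nrm w * \<bar>h n x\<bar> \<partial>dominating)"
    proof (rule Fext_bound[OF TF_scal[OF w LIPb_bcontfun[OF h(1)]]])
      show "(\<lambda>x. nrm w * \<bar>h n x\<bar>) \<in> bcontfun" by (intro LIPb_bcontfun LIPb_cmult LIPb_abs h)
      show "AE x in m. pnorm E (scal E (h n) w) x \<le> nrm w * \<bar>h n x\<bar>"
        by (rule pnorm_scal_le[OF h(1) nrm_AE[OF wL]]) simp
    qed (use nrm_nonneg[OF wL] in simp)
    also have "\<dots> = nrm w * (\<integral>x. \<bar>h n x\<bar> \<partial>dominating)" by simp
    also have "\<dots> \<le> nrm w * (measure dominating A + deviation A (h n))"
    proof (intro mult_left_mono nrm_nonneg wL)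
      have iA: "integrable dominating (indicator A :: 'a \<Rightarrow> real)" using A by (simp add: emeasure_eq_measure sets_dominating)
      have "(\<integral>x. \<bar>h n x\<bar> \<partial>dominating) \<le> (\<integral>x. indicator A x + \<bar>h n x - indicator A x\<bar> \<partial>dominating)"
      proof (rule integral_mono)
        show "integrable dominating (\<lambda>x. \<bar>h n x\<bar>)" by (rule bcontfun_integrable[OF LIPb_bcontfun[OF LIPb_abs[OF h(1)]]])
        show "integrable dominating (\<lambda>x. indicator A x + \<bar>h n x - indicator A x\<bar>)"
          by (intro Bochner_Integration.integrable_add iA deviation_integrable A h)
      qed (auto simp: indicator_def)
      also have "\<dots> = measure dominating A + deviation A (h n)"
        using iA deviation_integrable[OF A h(1)[of n]] by (simp add: deviation_def)
      finally show "(\<integral>x. \<bar>h n x\<bar> \<partial>dominating) \<le> measure dominating A + deviation A (h n)" .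
    qed
    finally show ?thesis .
  qed
  moreover have "(\<lambda>n. \<bar>Fext (scal E (h n) w)\<bar>) \<longlonglongrightarrow> \<bar>DF A w\<bar>" by (intro tendsto_rabs DF_limit A h w)
  moreover have "(\<lambda>n. nrm w * (measure dominating A + deviation A (h n))) \<longlonglongrightarrow> nrm w * (measure dominating A + 0)"
    by (intro tendsto_intros h)
  ultimately have "\<bar>DF A w\<bar> \<le> nrm w * (measure dominating A + 0)" by (blast intro: LIMSEQ_le)
  then show ?thesis by simp
qed

text \<open>The indicator of an open set is a bounded pointwise limit of Lipschitz cutoffs supported
  inside the set, and each of these annihilates \<open>w\<close>.\<close>

lemma DF_local:
  assumes A: "open A" and w: "w \<in> TF" and zero: "\<And>f. f \<in> bcontfun \<Longrightarrow> supp f \<subseteq> A \<Longrightarrow> supnorm f \<le> 1 \<Longrightarrow> scal E f w = 0"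
  shows "DF A w = 0"
proof -
  obtain h where h: "\<And>n::nat. h n \<in> LIPb" "\<And>n x. 0 \<le> h n x" "\<And>n x. h n x \<le> 1"
    "\<And>x. (\<lambda>n. h n x) \<longlonglongrightarrow> indicator A x" "\<And>n. closure {x. h n x \<noteq> 0} \<subseteq> A" using open_cutoffs[OF A] by metis
  have Ab: "A \<in> sets borel" using A by auto
  have "(\<lambda>n. deviation A (h n)) \<longlonglongrightarrow> (\<integral>x. 0 \<partial>dominating)"
    unfolding deviation_def
  proof (rule tendsto_integral_bounded[OF finite_dominating, where B=1])
    show "(\<lambda>x. \<bar>h n x - indicator A x\<bar>) \<in> borel_measurable dominating" for n
      using deviation_integrable[OF Ab h(1)] by auto
    show "\<bar>\<bar>h n x - indicator A x\<bar>\<bar> \<le> 1" for n x using h(2)[of n x] h(3)[of n x] by (auto simp: indicator_def)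
    show "(\<lambda>n. \<bar>h n x - indicator A x\<bar>) \<longlonglongrightarrow> 0" for x
      using tendsto_rabs[OF tendsto_diff[OF h(4)[of x] tendsto_const[of "indicator A x"]]] by simp
  qed simp
  then have "(\<lambda>n. Fext (scal E (h n) w)) \<longlonglongrightarrow> DF A w" using DF_limit[OF Ab h(1) _ w] by simp
  moreover have "Fext (scal E (h n) w) = 0" for n
  proof -
    have "supnorm (h n) \<le> 1" unfolding supnorm_def using h(2,3) by (intro cSUP_least) auto
    then show ?thesis using zero[OF LIPb_bcontfun[OF h(1)]] h(5) Fext_zero by (simp add: supp_def)
  qed
  ultimately have "(\<lambda>_. 0) \<longlonglongrightarrow> DF A w" by simp
  then show ?thesis by (rule LIMSEQ_unique[OF _ tendsto_const])
qed

definition Dvec :: "'a set \<Rightarrow> 'w \<Rightarrow> real" where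
  "Dvec = (\<lambda>A\<in>sets borel. \<lambda>w\<in>TF. DF A w)"

lemma Dvec_eq: "A \<in> sets borel \<Longrightarrow> w \<in> TF \<Longrightarrow> Dvec A w = DF A w"
  by (simp add: Dvec_def)

lemma local_vector_measure_Dvec: "local_vector_measure TF nrm (scal E) Dvec"
proof -
  interpret nm: normed_Cb_module TF nrm "scal E" by (rule normed_Cb_module_TF)
  interpret \<mu>: finite_measure dominating by (rule finite_dominating)
  show ?thesis
  proof
    show "Dvec \<in> sets borel \<rightarrow>\<^sub>E nm.dual_space"
    proof (rule PiE_I)
      fix A :: "'a set" assume A: "A \<in> sets borel"
      show "Dvec A \<in> nm.dual_space"
        unfolding nm.dual_space_def
      proof (intro CollectI conjI ballI allI exI[of _ "measure dominating A"])
        show "Dvec A \<in> extensional TF" using A by (simp add: Dvec_def)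
        show "Dvec A (v + w) = Dvec A v + Dvec A w" if "v \<in> TF" "w \<in> TF" for v w
          using that A TF_add[of w v] by (simp add: Dvec_eq DF_add)
        show "Dvec A (c *\<^sub>R v) = c * Dvec A v" if "v \<in> TF" for c v
          using that A TF_scaleR[of v c] by (simp add: Dvec_eq DF_scaleR)
        show "\<bar>Dvec A v\<bar> \<le> measure dominating A * nrm v" if "v \<in> TF" for v
          using that A DF_bound[OF A that] by (simp add: Dvec_eq mult.commute)
      qed
    qed (simp add: Dvec_def)
  next
    fix A :: "nat \<Rightarrow> 'a set" assume A: "\<And>i. A i \<in> sets borel" and disj: "disjoint_family A"
    \<comment> \<open>The error of a partial sum is minus the value on the tail \<open>R n\<close>,
      so its dual norm is at most the measure of a decreasing sequence of sets with empty
      intersection.\<close>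
    define R where "R n = (\<Union>i\<in>{n..}. A i)" for n
    have Rb: "R n \<in> sets borel" for n unfolding R_def using A by auto
    have Un: "(\<Union>i<n. A i) \<in> sets borel" for n using A by auto
    have fin: "(\<Sum>i<n. DF (A i) v) = DF (\<Union>i<n. A i) v" if v: "v \<in> TF" for n v
    proof (induction n)
      case 0
      have "\<bar>DF {} v\<bar> \<le> nrm v * measure dominating {}" by (rule DF_bound[OF _ v]) simp
      then show ?case by simp
    next
      case (Suc n)
      have "A i \<inter> A n = {}" if "i < n" for i using disj that by (simp add: disjoint_family_on_def)
      then have "(\<Union>i<n. A i) \<inter> A n = {}" by auto
      then have "DF ((\<Union>i<n. A i) \<union> A n) v = DF (\<Union>i<n. A i) v + DF (A n) v" using DF_Un[OF Un A _ v] by blast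
      moreover have "(\<Union>i<Suc n. A i) = (\<Union>i<n. A i) \<union> A n" by (auto simp: less_Suc_eq)
      ultimately show ?case using Suc by simp
    qed
    have diff: "(\<Sum>i<n. Dvec (A i) v) - Dvec (\<Union>i. A i) v = - DF (R n) v" if v: "v \<in> TF" for n v
    proof -
      have "A i \<inter> A j = {}" if "i < n" "n \<le> j" for i j using disj that by (simp add: disjoint_family_on_def)
      then have "(\<Union>i<n. A i) \<inter> R n = {}" unfolding R_def by auto
      moreover have "(\<Union>i. A i) = (\<Union>i<n. A i) \<union> R n" unfolding R_def using not_le by auto
      ultimately have "DF (\<Union>i. A i) v = (\<Sum>i<n. DF (A i) v) + DF (R n) v" using DF_Un[OF Un Rb _ v] fin[OF v] by metis
      then show ?thesis using v A by (simp add: Dvec_eq)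
    qed
    have le: "\<bar>(\<Sum>i<n. Dvec (A i) v) - Dvec (\<Union>i. A i) v\<bar> \<le> measure dominating (R n)" if v: "v \<in> TF" "nrm v \<le> 1" for n v
    proof -
      have "\<bar>DF (R n) v\<bar> \<le> nrm v * measure dominating (R n)" by (rule DF_bound[OF Rb v(1)])
      also have "\<dots> \<le> 1 * measure dominating (R n)" using v(2) by (intro mult_right_mono) auto
      finally show ?thesis by (simp add: diff[OF v(1)])
    qed
    have z: "0 \<in> {v \<in> TF. nrm v \<le> 1}" using TF_zero nm.nrm_eq_0_iff[OF TF_zero] by simp
    have up: "nm.dual_norm (\<lambda>v. (\<Sum>i<n. Dvec (A i) v) - Dvec (\<Union>i. A i) v) \<le> measure dominating (R n)" for n
      unfolding nm.dual_norm_def using z le by (intro cSUP_least) blast+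
    have lo: "0 \<le> nm.dual_norm (\<lambda>v. (\<Sum>i<n. Dvec (A i) v) - Dvec (\<Union>i. A i) v)" for n
    proof -
      have "bdd_above ((\<lambda>v. \<bar>(\<Sum>i<n. Dvec (A i) v) - Dvec (\<Union>i. A i) v\<bar>) ` {v \<in> TF. nrm v \<le> 1})"
        using le by (intro bdd_aboveI2[where M="measure dominating (R n)"]) blast
      from cSUP_upper[OF z this] show ?thesis unfolding nm.dual_norm_def by (rule order_trans[OF abs_ge_zero])
    qed
    have "(\<lambda>n. measure dominating (R n)) \<longlonglongrightarrow> measure dominating (\<Inter>n. R n)"
    proof (rule \<mu>.finite_Lim_measure_decseq)
      show "decseq R" unfolding decseq_def R_def by (intro allI impI UN_mono) auto
    qed (use Rb in \<open>auto simp: sets_dominating\<close>)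
    moreover have "(\<Inter>n. R n) = {}"
    proof (rule ccontr)
      assume "(\<Inter>n. R n) \<noteq> {}"
      then obtain x where x: "\<And>n. x \<in> R n" by blast
      obtain i where i: "x \<in> A i" using x[of 0] by (auto simp: R_def)
      obtain j where j: "Suc i \<le> j" "x \<in> A j" using x[of "Suc i"] by (auto simp: R_def)
      have "i \<noteq> j" using j by simp
      then have "A i \<inter> A j = {}" using disj by (simp add: disjoint_family_on_def)
      then show False using i j by blast
    qed
    ultimately have "(\<lambda>n. measure dominating (R n)) \<longlonglongrightarrow> 0" by simp
    then show "(\<lambda>n. nm.dual_norm (\<lambda>v. (\<Sum>i<n. Dvec (A i) v) - Dvec (\<Union>i. A i) v)) \<longlonglongrightarrow> 0"
      by (rule tendsto_sandwich[OF _ _ tendsto_const, rotated 2]) (use up lo in auto)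
  next
    fix A :: "'a set" and v assume A: "open A" and v: "v \<in> TF" and z: "nm.local_norm A v = 0"
    have "scal E f v = 0" if f: "f \<in> bcontfun" "supp f \<subseteq> A" "supnorm f \<le> 1" for f
    proof -
      \<comment> \<open>Boundedness is what lets the vanishing supremum in \<open>local_norm\<close>
        control each single multiplier.\<close>
      have "bdd_above ((\<lambda>f. nrm (scal E f v)) ` {f \<in> bcontfun. supp f \<subseteq> A \<and> supnorm f \<le> 1})"
      proof (rule bdd_aboveI2)
        fix g assume "g \<in> {f \<in> bcontfun. supp f \<subseteq> A \<and> supnorm f \<le> 1}"
        then have g: "g \<in> bcontfun" "supnorm g \<le> 1" by auto
        show "nrm (scal E g v) \<le> nrm v"
        proof (rule nrm_leI[OF TF_LinfTX[OF TF_scal[OF v g(1)]]])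
          show "AE x in m. pnorm E (scal E g v) x \<le> nrm v"
            using L0.pnorm_scal[OF bcontfun_measurable_m[OF g(1)], of v] nrm_AE[OF TF_LinfTX[OF v]] L0.pnorm_nonneg[of v]
          proof eventually_elim
            case (elim x)
            have "\<bar>g x\<bar> \<le> 1" using abs_le_supnorm[OF g(1), of x] g(2) by linarith
            then have "\<bar>g x\<bar> * pnorm E v x \<le> 1 * pnorm E v x" using elim(3) by (intro mult_right_mono) auto
            then show ?case using elim by linarith
          qed
        qed
      qed
      then have "nrm (scal E f v) \<le> nm.local_norm A v"
        unfolding nm.local_norm_def using f by (intro cSUP_upper) auto
      then have "nrm (scal E f v) = 0" using z nrm_nonneg[OF TF_LinfTX[OF TF_scal[OF v f(1)]]] by simp
      then show ?thesis using nm.nrm_eq_0_iff[OF TF_scal[OF v f(1)]] by simp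
    qed
    then have "DF A v = 0" by (intro DF_local A v)
    then show "Dvec A v = 0" using A v by (simp add: Dvec_eq)
  qed
qed

lemma Dvec_UNIV: "v \<in> Ddiv \<Longrightarrow> Dvec UNIV v = F v"
  using Ddiv_TF[of v] by (simp add: Dvec_eq DF_UNIV Fext_D)

end

section \<open>Uniqueness\<close>

text \<open>The rough bound by \<open>K\<close> ensures that the supremum defining
  \<open>dual_norm\<close> runs over a bounded set; the sharp bound follows by normalising
  \<open>v\<close>.\<close>

lemma (in normed_Cb_module) abs_le_dual_norm:
  assumes scale: "\<And>c v. v \<in> V \<Longrightarrow> L (c *\<^sub>R v) = c * L v" and bound: "\<And>v. v \<in> V \<Longrightarrow> \<bar>L v\<bar> \<le> K * nrm v"
    and v: "v \<in> V"
  shows "\<bar>L v\<bar> \<le> dual_norm L * nrm v"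
proof (cases "nrm v = 0")
  case True
  then show ?thesis using bound[OF v] by simp
next
  case False
  then have pos: "0 < nrm v" using nrm_nonneg[OF v] by simp
  let ?u = "(1 / nrm v) *\<^sub>R v"
  have uV: "?u \<in> V" using subspace_V v by (rule subspace_scale)
  have "nrm ?u \<le> 1" using nrm_scaleR[OF v, of "1 / nrm v"] pos by simp
  moreover have "bdd_above ((\<lambda>v. \<bar>L v\<bar>) ` {v \<in> V. nrm v \<le> 1})"
  proof (rule bdd_aboveI2)
    fix w assume "w \<in> {v \<in> V. nrm v \<le> 1}"
    then have w: "w \<in> V" "nrm w \<le> 1" by auto
    have "\<bar>L w\<bar> \<le> K * nrm w" by (rule bound[OF w(1)])
    also have "\<dots> \<le> \<bar>K\<bar> * nrm w" using nrm_nonneg[OF w(1)] by (intro mult_right_mono) auto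
    also have "\<dots> \<le> \<bar>K\<bar>" using w by (intro mult_left_le) auto
    finally show "\<bar>L w\<bar> \<le> \<bar>K\<bar>" .
  qed
  ultimately have "\<bar>L ?u\<bar> \<le> dual_norm L" unfolding dual_norm_def using uV by (intro cSUP_upper) auto
  then show ?thesis using scale[OF v, of "1 / nrm v"] pos by (simp add: abs_mult pos_divide_le_eq)
qed

text \<open>The properties that the difference of two local vector measures inherits.
  Sigma-additivity is stated with one null sequence for all fields, and locality with multipliers
  vanishing on \<open>A\<close>, the forms in which cutoffs use them.\<close>

locale field_charge = tangent_L0 m C d E \<iota>
  for m :: "'a::polish_space measure" and C :: "('a, 'v::banach) module_ops"
    and d :: "('a \<Rightarrow> real) \<Rightarrow> 'v" and E :: "('a, 'w::real_vector) module_ops"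
    and \<iota> :: "('v \<Rightarrow> 'a \<Rightarrow> real) \<Rightarrow> 'w" +
  fixes P :: "'a set \<Rightarrow> 'w \<Rightarrow> real"
  assumes P_add: "\<And>A v w. A \<in> sets borel \<Longrightarrow> v \<in> TF \<Longrightarrow> w \<in> TF \<Longrightarrow> P A (v + w) = P A v + P A w"
    and P_bound: "\<And>A. A \<in> sets borel \<Longrightarrow> \<exists>K. \<forall>v\<in>TF. \<bar>P A v\<bar> \<le> K * nrm v"
    and P_sigma_additive: "\<And>A :: nat \<Rightarrow> 'a set. (\<And>i. A i \<in> sets borel) \<Longrightarrow> disjoint_family A \<Longrightarrow>
          \<exists>\<delta>. \<delta> \<longlonglongrightarrow> 0 \<and> (\<forall>n. \<forall>v\<in>TF. \<bar>(\<Sum>i<n. P (A i) v) - P (\<Union>i. A i) v\<bar> \<le> \<delta> n * nrm v)"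
    and P_local: "\<And>A h v. open A \<Longrightarrow> h \<in> bcontfun \<Longrightarrow> (\<And>x. x \<in> A \<Longrightarrow> h x = 0) \<Longrightarrow> v \<in> TF \<Longrightarrow> P A (scal E h v) = 0"
begin

lemma nrm_nonneg_TF: "v \<in> TF \<Longrightarrow> 0 \<le> nrm v"
  by (rule nrm_nonneg[OF TF_LinfTX])

lemma nrm_scal_le:
  assumes v: "v \<in> TF" and h: "h \<in> bcontfun" and c: "\<And>x. \<bar>h x\<bar> \<le> c"
  shows "nrm (scal E h v) \<le> c * nrm v"
proof (rule nrm_leI[OF TF_LinfTX[OF TF_scal[OF v h]]])
  have "0 \<le> c" using c[of undefined] by linarith
  show "AE x in m. pnorm E (scal E h v) x \<le> c * nrm v"
    using L0.pnorm_scal[OF bcontfun_measurable_m[OF h], of v] nrm_AE[OF TF_LinfTX[OF v]] L0.pnorm_nonneg[of v]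
  proof eventually_elim
    case (elim x)
    have "\<bar>h x\<bar> * pnorm E v x \<le> c * nrm v" using elim c[of x] \<open>0 \<le> c\<close> by (intro mult_mono) auto
    then show ?case using elim(1) by simp
  qed
qed

lemma P_sums:
  assumes A: "\<And>i::nat. A i \<in> sets borel" "disjoint_family A" and v: "v \<in> TF"
  shows "(\<lambda>i. P (A i) v) sums P (\<Union>i. A i) v"
proof -
  obtain \<delta> where \<delta>: "\<delta> \<longlonglongrightarrow> 0" "\<And>n v. v \<in> TF \<Longrightarrow> \<bar>(\<Sum>i<n. P (A i) v) - P (\<Union>i. A i) v\<bar> \<le> \<delta> n * nrm v"
    using P_sigma_additive[OF A] by blast
  have "(\<lambda>n. (\<Sum>i<n. P (A i) v) - P (\<Union>i. A i) v) \<longlonglongrightarrow> 0"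
  proof (rule Lim_null_comparison)
    show "\<forall>\<^sub>F n in sequentially. norm ((\<Sum>i<n. P (A i) v) - P (\<Union>i. A i) v) \<le> \<delta> n * nrm v" using \<delta>(2)[OF v] by simp
    show "(\<lambda>n. \<delta> n * nrm v) \<longlonglongrightarrow> 0" by (rule tendsto_mult_left_zero[OF \<delta>(1)])
  qed
  then show ?thesis unfolding sums_def by (simp add: LIM_zero_iff)
qed

lemma P_empty: "v \<in> TF \<Longrightarrow> P {} v = 0"
proof -
  assume v: "v \<in> TF"
  have "(\<lambda>_::nat. P {} v) sums P (\<Union>i::nat. {}) v" by (rule P_sums[OF _ _ v]) (auto simp: disjoint_family_on_def)
  then have "(\<lambda>_::nat. P {} v) \<longlonglongrightarrow> 0" by (intro summable_LIMSEQ_zero sums_summable)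
  then show ?thesis using LIMSEQ_unique[OF tendsto_const] by blast
qed

lemma P_Un:
  assumes A: "A \<in> sets borel" "B \<in> sets borel" "A \<inter> B = {}" and v: "v \<in> TF"
  shows "P (A \<union> B) v = P A v + P B v"
proof -
  define S where "S i = (if i = 0 then A else if i = 1 then B else {})" for i :: nat
  have "(\<lambda>i. P (S i) v) sums P (\<Union>i. S i) v"
    by (rule P_sums[OF _ _ v]) (use A in \<open>auto simp: S_def disjoint_family_on_def\<close>)
  moreover have "(\<Union>i. S i) = A \<union> B" by (auto simp: S_def split: if_splits)
  moreover have "(\<lambda>i. P (S i) v) sums (\<Sum>i\<in>{0,1}. P (S i) v)"
    by (rule sums_finite) (use P_empty[OF v] in \<open>auto simp: S_def\<close>)
  ultimately show ?thesis using sums_unique2 by (fastforce simp: S_def)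
qed

lemma P_Diff:
  assumes "A \<in> sets borel" "B \<in> sets borel" "B \<subseteq> A" "v \<in> TF"
  shows "P (A - B) v = P A v - P B v"
proof -
  have "P ((A - B) \<union> B) v = P (A - B) v + P B v" using assms by (intro P_Un) auto
  moreover have "(A - B) \<union> B = A" using assms by auto
  ultimately show ?thesis by simp
qed

text \<open>The error is uniform over fields of bounded norm. This is essential in
  \<open>P_term_zero\<close>, where the field varies together with the index of the set.\<close>

lemma P_incseq:
  assumes B: "\<And>i::nat. B i \<in> sets borel" "incseq B"
  obtains \<delta> where "\<delta> \<longlonglongrightarrow> 0" "\<And>n v. v \<in> TF \<Longrightarrow> \<bar>P (B n) v - P (\<Union>i. B i) v\<bar> \<le> \<delta> n * nrm v"
proof -
  have dB: "disjointed B i \<in> sets borel" for i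
    using sets.range_disjointed_sets[of B borel] B(1) by auto
  obtain \<delta> where \<delta>: "\<delta> \<longlonglongrightarrow> 0"
    "\<And>n v. v \<in> TF \<Longrightarrow> \<bar>(\<Sum>i<n. P (disjointed B i) v) - P (\<Union>i. disjointed B i) v\<bar> \<le> \<delta> n * nrm v"
    using P_sigma_additive[OF dB disjoint_family_disjointed] by blast
  have sum: "(\<Sum>i<Suc n. P (disjointed B i) v) = P (B n) v" if v: "v \<in> TF" for n v
  proof (induction n)
    case 0
    then show ?case by simp
  next
    case (Suc n)
    have "disjointed B (Suc n) = B (Suc n) - B n" using disjointed_mono[OF _] B(2) by (simp add: disjointed_mono incseq_def)
    then have "P (disjointed B (Suc n)) v = P (B (Suc n)) v - P (B n) v"
      using P_Diff[OF B(1) B(1) _ v] incseq_SucD[OF B(2)] by simp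
    then show ?case using Suc by simp
  qed
  show ?thesis
  proof (rule that[of "\<lambda>n. \<delta> (Suc n)"])
    show "(\<lambda>n. \<delta> (Suc n)) \<longlonglongrightarrow> 0" using \<delta>(1) by (rule LIMSEQ_Suc)
    show "\<bar>P (B n) v - P (\<Union>i. B i) v\<bar> \<le> \<delta> (Suc n) * nrm v" if "v \<in> TF" for n v
      using \<delta>(2)[OF that, of "Suc n"] by (simp only: sum[OF that] UN_disjointed_eq)
  qed
qed

lemma P_incseq_tendsto:
  assumes B: "\<And>i::nat. B i \<in> sets borel" "incseq B" and v: "v \<in> TF"
  shows "(\<lambda>n. P (B n) v) \<longlonglongrightarrow> P (\<Union>i. B i) v"
proof -
  obtain \<delta> where \<delta>: "\<delta> \<longlonglongrightarrow> 0" "\<And>n v. v \<in> TF \<Longrightarrow> \<bar>P (B n) v - P (\<Union>i. B i) v\<bar> \<le> \<delta> n * nrm v"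
    using P_incseq[OF B] by blast
  have "(\<lambda>n. P (B n) v - P (\<Union>i. B i) v) \<longlonglongrightarrow> 0"
  proof (rule Lim_null_comparison)
    show "\<forall>\<^sub>F n in sequentially. norm (P (B n) v - P (\<Union>i. B i) v) \<le> \<delta> n * nrm v" using \<delta>(2)[OF v] by simp
    show "(\<lambda>n. \<delta> n * nrm v) \<longlonglongrightarrow> 0" by (rule tendsto_mult_left_zero[OF \<delta>(1)])
  qed
  then show ?thesis by (simp add: LIM_zero_iff)
qed

lemma borel_induct_disjoint [consumes 1, case_names basic empty compl union]:
  assumes A: "A \<in> sets (borel :: 'a measure)"
    and "\<And>U. open U \<Longrightarrow> Q U" and "Q {}" and "\<And>B. B \<in> sets borel \<Longrightarrow> Q B \<Longrightarrow> Q (UNIV - B)"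
    and "\<And>B :: nat \<Rightarrow> 'a set. disjoint_family B \<Longrightarrow> (\<And>i. B i \<in> sets borel) \<Longrightarrow> (\<And>i. Q (B i)) \<Longrightarrow> Q (\<Union>i. B i)"
  shows "Q A"
proof -
  have sb: "sets (borel :: 'a measure) = sigma_sets UNIV {S. open S}" by (simp add: borel_def sets_measure_of)
  have "Int_stable {S :: 'a set. open S}" by (auto simp: Int_stable_def)
  then show ?thesis
  proof (rule sigma_sets_induct_disjoint[where A=A])
    show "A \<in> sigma_sets UNIV {S. open S}" using A sb by simp
    show "Q (\<Union> (range B))" if "disjoint_family B" "range B \<subseteq> sigma_sets UNIV {S. open S}" "\<And>i. Q (B i)" for B :: "nat \<Rightarrow> 'a set"
      using assms(5)[OF that(1) _ that(3)] that(2) sb by auto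
  qed (use assms sb in auto)
qed

text \<open>The sets \<open>B\<close> whose part inside \<open>A\<close> carries no mass of the
  field form a Dynkin system containing the open sets, which are stable under intersection.\<close>

lemma P_local_Borel:
  assumes A: "open A" and B: "B \<in> sets borel" "B \<subseteq> A" and h: "h \<in> bcontfun" "\<And>x. x \<in> A \<Longrightarrow> h x = 0" and v: "v \<in> TF"
  shows "P B (scal E h v) = 0"
proof -
  have hv: "scal E h v \<in> TF" by (rule TF_scal[OF v h(1)])
  have Ab: "A \<in> sets borel" using A by auto
  have "P (B \<inter> A) (scal E h v) = 0"
    using B(1)
  proof (induction rule: borel_induct_disjoint)
    case (basic U)
    then show ?case using A h v by (intro P_local) auto
  next
    case empty
    then show ?case using P_empty[OF hv] by simp
  next
    case (compl B)
    have "P (A - B \<inter> A) (scal E h v) = P A (scal E h v) - P (B \<inter> A) (scal E h v)"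
      using compl Ab by (intro P_Diff hv) auto
    moreover have "(UNIV - B) \<inter> A = A - B \<inter> A" by auto
    ultimately show ?case using compl P_local[OF A h v] by simp
  next
    case (union B)
    have "(\<lambda>i. P (B i \<inter> A) (scal E h v)) sums P (\<Union>i. B i \<inter> A) (scal E h v)"
      using union Ab by (intro P_sums hv) (auto simp: disjoint_family_on_def)
    then have "(\<lambda>i::nat. 0) sums P (\<Union>i. B i \<inter> A) (scal E h v)" using union(3) by simp
    then have "P (\<Union>i. B i \<inter> A) (scal E h v) = 0" using sums_unique2[OF _ sums_zero] by blast
    moreover have "(\<Union>i. B i \<inter> A) = (\<Union>i. B i) \<inter> A" by auto
    ultimately show ?case by simp
  qed
  moreover have "B \<inter> A = B" using B by auto
  ultimately show ?thesis by simp
qed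

text \<open>The cutoffs between \<open>{g \<le> 4\<^sup>-\<^sup>j}\<close> and \<open>{g \<ge> 2 \<cdot> 4\<^sup>-\<^sup>j}\<close> only leave an error on a shell; the shells are
  disjoint, so their contributions tend to zero.\<close>

lemma P_open_zero:
  assumes zero: "\<And>w. w \<in> Ddiv \<Longrightarrow> P UNIV w = 0" and U: "open U" and v: "v \<in> Ddiv"
  shows "P U v = 0"
proof -
  obtain g where g: "\<And>x. 0 \<le> g x" "\<And>x. g x \<le> 1" "\<And>x y. \<bar>g x - g y\<bar> \<le> dist x y" "U = {x. 0 < g x}"
    using open_gauge[OF U] by blast
  have gL: "g \<in> LIPb" by (rule gauge_LIPb[OF g(1-3)])
  have gc: "continuous_on UNIV g" by (rule LIPb_continuous[OF gL])
  have vT: "v \<in> TF" by (rule Ddiv_TF[OF v])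
  define V where "V j = {x. 2 < 4 ^ j * g x}" for j :: nat
  define W where "W j = {x. 4 ^ j * g x < 1}" for j :: nat
  \<comment> \<open>Consecutive levels differ by the factor 4, whereas a shell spans only the factor
    2; this gap makes the shells disjoint.\<close>
  define R where "R j = {x. 1 \<le> 4 ^ j * g x \<and> 4 ^ j * g x \<le> 2}" for j :: nat
  define h where "h j x = min (max (4 ^ j * g x - 1) 0) 1" for j :: nat and x
  have hL: "h j \<in> LIPb" for j unfolding h_def[abs_def] by (intro LIPb_min LIPb_max LIPb_diff LIPb_cmult gL LIPb_const)
  have h01: "0 \<le> h j x" "h j x \<le> 1" for j x by (auto simp: h_def)
  have hb: "h j \<in> bcontfun" for j by (rule LIPb_bcontfun[OF hL])
  have op: "open (V j)" "open (W j)" for j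
    unfolding V_def W_def by (intro open_Collect_less continuous_intros gc)+
  have "closed (R j)" for j
    unfolding R_def by (intro closed_Collect_conj closed_Collect_le continuous_intros gc)
  then have bor: "V j \<in> sets borel" "W j \<in> sets borel" "R j \<in> sets borel" for j using op by auto
  have disj: "disjoint_family R"
  proof -
    have "R i \<inter> R j = {}" if "i < j" for i j
    proof (rule ccontr)
      assume "R i \<inter> R j \<noteq> {}"
      then obtain x where x: "1 \<le> 4 ^ i * g x" "4 ^ j * g x \<le> 2" by (auto simp: R_def)
      have "4 * (4 ^ i * g x) = 4 ^ Suc i * g x" by simp
      also have "\<dots> \<le> 4 ^ j * g x" using that g(1)[of x] by (intro mult_right_mono power_increasing) auto
      finally show False using x by linarith
    qed
    then show ?thesis unfolding disjoint_family_on_def by (metis Int_commute linorder_neqE_nat)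
  qed
  obtain \<delta> where \<delta>: "\<delta> \<longlonglongrightarrow> 0" "\<And>n v. v \<in> TF \<Longrightarrow> \<bar>(\<Sum>i<n. P (R i) v) - P (\<Union>i. R i) v\<bar> \<le> \<delta> n * nrm v"
    using P_sigma_additive[OF bor(3) disj] by blast
  \<comment> \<open>A single term is the difference of two consecutive partial sums. The bound has
    to be uniform in \<open>w\<close>, because it is applied to a field that depends on
    \<open>j\<close>.\<close>
  have PR: "\<bar>P (R j) w\<bar> \<le> (\<bar>\<delta> (Suc j)\<bar> + \<bar>\<delta> j\<bar>) * nrm w" if w: "w \<in> TF" for j w
  proof -
    have "\<delta> k * nrm w \<le> \<bar>\<delta> k\<bar> * nrm w" for k using nrm_nonneg_TF[OF w] by (intro mult_right_mono) auto
    from \<delta>(2)[OF w, of "Suc j"] \<delta>(2)[OF w, of j] this[of "Suc j"] this[of j]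
    show ?thesis unfolding sum.lessThan_Suc distrib_right by linarith
  qed
  have VR: "\<bar>P (V j) v\<bar> \<le> (\<bar>\<delta> (Suc j)\<bar> + \<bar>\<delta> j\<bar>) * nrm v" for j
  proof -
    let ?w = "scal E (h j) v"
    have w: "?w \<in> Ddiv" "?w \<in> TF" using D_div_scal[OF v hL] Ddiv_TF by auto
    have un: "(V j \<union> W j) \<union> R j = UNIV" and dj: "(V j \<union> W j) \<inter> R j = {}"
      by (auto simp: V_def W_def R_def)
    \<comment> \<open>The cut-off field is again a divergence field, so its total value is 0.
      Nothing lies on \<open>W j\<close>, where \<open>h j\<close> vanishes, so the values on
      \<open>V j\<close> and on the shell cancel; on \<open>V j\<close> the multiplier is 1 and
      \<open>v\<close> itself may be inserted.\<close>
    have "P UNIV ?w = P (V j \<union> W j) ?w + P (R j) ?w"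
      using P_Un[OF sets.Un[OF bor(1,2)] bor(3) dj w(2)] unfolding un .
    also have "P (V j \<union> W j) ?w = P (V j) ?w + P (W j) ?w"
      using bor w by (intro P_Un) (auto simp: V_def W_def)
    also have "P (W j) ?w = 0" by (rule P_local[OF op(2) hb _ vT]) (auto simp: W_def h_def)
    finally have eq: "P (V j) ?w = - P (R j) ?w" using zero[OF w(1)] by simp
    have "scal E (\<lambda>x. (1 - h j x) + h j x) v = scal E (\<lambda>x. 1 - h j x) v + ?w"
      using LIPb_measurable_m[OF hL] by (intro L0.scal_add_left) auto
    then have "v = scal E (\<lambda>x. 1 - h j x) v + ?w" by (simp add: L0.scal_const)
    moreover have hb': "(\<lambda>x. 1 - h j x) \<in> bcontfun" by (intro bcontfun_diff_real hb bcontfun_const_real)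
    moreover have "P (V j) (scal E (\<lambda>x. 1 - h j x) v) = 0"
      by (rule P_local[OF op(1) hb' _ vT]) (auto simp: V_def h_def)
    ultimately have "P (V j) v = P (V j) ?w" using P_add[OF bor(1) TF_scal[OF vT hb'] w(2), of j] by simp
    then have "\<bar>P (V j) v\<bar> = \<bar>P (R j) ?w\<bar>" using eq by simp
    also have "\<dots> \<le> (\<bar>\<delta> (Suc j)\<bar> + \<bar>\<delta> j\<bar>) * nrm ?w" by (rule PR[OF w(2)])
    also have "\<dots> \<le> (\<bar>\<delta> (Suc j)\<bar> + \<bar>\<delta> j\<bar>) * (1 * nrm v)"
      using h01 by (intro mult_left_mono nrm_scal_le[OF vT hb]) auto
    finally show ?thesis by simp
  qed
  have "(\<lambda>j. (\<bar>\<delta> (Suc j)\<bar> + \<bar>\<delta> j\<bar>) * nrm v) \<longlonglongrightarrow> 0"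
    using tendsto_mult_right[OF tendsto_add[OF tendsto_rabs[OF LIMSEQ_Suc[OF \<delta>(1)]] tendsto_rabs[OF \<delta>(1)]], of "nrm v"] by simp
  from Lim_null_comparison[OF _ this, of "\<lambda>j. P (V j) v"] VR
  have "(\<lambda>j. P (V j) v) \<longlonglongrightarrow> 0" by simp
  moreover have "(\<lambda>j. P (V j) v) \<longlonglongrightarrow> P (\<Union>j. V j) v"
  proof (rule P_incseq_tendsto[OF bor(1) _ vT])
    show "incseq V"
    proof (rule incseq_SucI, rule subsetI)
      fix j x assume "x \<in> V j"
      moreover have "4 ^ j * g x \<le> 4 ^ Suc j * g x" using g(1)[of x] by (intro mult_right_mono power_increasing) auto
      ultimately show "x \<in> V (Suc j)" unfolding V_def mem_Collect_eq by linarith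
    qed
  qed
  moreover have "(\<Union>j. V j) = U"
  proof
    show "(\<Union>j. V j) \<subseteq> U"
    proof
      fix x assume "x \<in> (\<Union>j. V j)"
      then obtain j where "2 < 4 ^ j * g x" by (auto simp: V_def)
      then have "g x \<noteq> 0" by auto
      then show "x \<in> U" using g(1)[of x] g(4) by simp
    qed
    show "U \<subseteq> (\<Union>j. V j)"
    proof
      fix x assume "x \<in> U"
      then have pos: "0 < g x" using g(4) by simp
      obtain j where "2 / g x < 4 ^ j" using real_arch_pow[of 4 "2 / g x"] by auto
      then show "x \<in> (\<Union>j. V j)" using pos by (auto simp: V_def pos_divide_less_eq)
    qed
  qed
  ultimately show ?thesis using LIMSEQ_unique[of "\<lambda>j. P (V j) v" 0 "P (\<Union>j. V j) v"] by simp
qed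

lemma P_div_zero:
  assumes zero: "\<And>w. w \<in> Ddiv \<Longrightarrow> P UNIV w = 0" and A: "A \<in> sets borel" and v: "v \<in> Ddiv"
  shows "P A v = 0"
  using A
proof (induction rule: borel_induct_disjoint)
  case (basic U)
  show ?case by (rule P_open_zero[OF _ basic v]) (rule zero)
next
  case empty
  then show ?case by (rule P_empty[OF Ddiv_TF[OF v]])
next
  case (compl B)
  then show ?case using P_Diff[of UNIV B v] zero[OF v] Ddiv_TF[OF v] by simp
next
  case (union B)
  have "(\<lambda>i. P (B i) v) sums P (\<Union>i. B i) v" using union by (intro P_sums Ddiv_TF v)
  then have "(\<lambda>i::nat. 0) sums P (\<Union>i. B i) v" using union(3) by simp
  then show ?case using sums_unique2[OF _ sums_zero] by blast
qed

text \<open>The minorants \<open>h n\<close> converge to \<open>g\<close> pointwise only, so g - h n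
  is split into a part truncated at \<open>e\<close> and an excess. The excess vanishes on the open
  set \<open>U n\<close> where g - h n < e, hence locality kills it there; the term with
  \<open>h n\<close> is a divergence field; the truncated part has norm at most \<open>e\<close>
  times that of \<open>v\<close>. The sets \<open>A \<inter> U n\<close> increase to
  \<open>A\<close>, and \<open>P_incseq\<close> removes the restriction to
  \<open>U n\<close>.\<close>

lemma P_term_zero:
  assumes zero: "\<And>w. w \<in> Ddiv \<Longrightarrow> P UNIV w = 0" and A: "A \<in> sets borel" and v: "v \<in> Ddiv" and g: "g \<in> bcontfun"
  shows "P A (scal E g v) = 0"
proof -
  have vT: "v \<in> TF" by (rule Ddiv_TF[OF v])
  have gv: "scal E g v \<in> TF" by (rule TF_scal[OF vT g])
  obtain K where K: "\<And>w. w \<in> TF \<Longrightarrow> \<bar>P A w\<bar> \<le> K * nrm w" using P_bound[OF A] by blast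
  obtain h where h: "\<And>n. h n \<in> LIPb" "\<And>n x. h n x \<le> g x" "\<And>n x. h n x \<le> h (Suc n) x" "\<And>x. (\<lambda>n. h n x) \<longlonglongrightarrow> g x"
    using bcontfun_Lipschitz_minorants[OF g] by metis
  have bound: "\<bar>P A (scal E g v)\<bar> \<le> (\<bar>K\<bar> + 1) * (e * nrm v)" if e: "0 < e" for e
  proof -
    define U where "U n = {x. g x - h n x < e}" for n
    have gc: "continuous_on UNIV g" using g by (simp add: bcontfun_def)
    have Uo: "open (U n)" for n
      unfolding U_def by (intro open_Collect_less continuous_intros gc LIPb_continuous h)
    have Ub: "A \<inter> U n \<in> sets borel" for n using A Uo by auto
    have "incseq (\<lambda>n. A \<inter> U n)"
    proof (rule incseq_SucI, rule subsetI)
      fix n x assume "x \<in> A \<inter> U n"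
      then show "x \<in> A \<inter> U (Suc n)" using h(3)[of n x] unfolding U_def by auto
    qed
    then obtain \<delta> where \<delta>: "\<delta> \<longlonglongrightarrow> 0" "\<And>n w. w \<in> TF \<Longrightarrow> \<bar>P (A \<inter> U n) w - P (\<Union>i. A \<inter> U i) w\<bar> \<le> \<delta> n * nrm w"
      using P_incseq[of "\<lambda>n. A \<inter> U n"] Ub by blast
    have "(\<Union>i. A \<inter> U i) = A"
    proof -
      have "\<exists>n. x \<in> U n" for x
      proof -
        have "\<forall>\<^sub>F n in sequentially. g x - e < h n x" using e by (intro order_tendstoD(1)[OF h(4)]) auto
        then obtain n where "g x - e < h n x" using eventually_happens'[OF sequentially_bot] by blast
        then show ?thesis by (auto simp: U_def intro!: exI[of _ n])
      qed
      then show ?thesis by auto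
    qed
    then have \<delta>A: "\<bar>P (A \<inter> U n) w - P A w\<bar> \<le> \<delta> n * nrm w" if "w \<in> TF" for n w using \<delta>(2)[OF that, of n] by simp
    have small: "\<bar>P (A \<inter> U n) (scal E g v)\<bar> \<le> (K + \<delta> n) * nrm (scal E (\<lambda>x. min (g x - h n x) e) v)" for n
    proof -
      define c where "c x = min (g x - h n x) e" for x
      have hb: "h n \<in> bcontfun" by (rule LIPb_bcontfun[OF h(1)])
      have cb: "c \<in> bcontfun"
      proof -
        have "c = (\<lambda>x. (1/2) * ((g x - h n x) + e - \<bar>(g x - h n x) - e\<bar>))" by (auto simp: c_def fun_eq_iff min_def)
        then show ?thesis
          using g hb by (simp only: bcontfun_cmult_real bcontfun_add_real bcontfun_diff_real bcontfun_abs_real bcontfun_const_real)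
      qed
      define r where "r x = g x - h n x - c x" for x
      have rb: "r \<in> bcontfun" unfolding r_def[abs_def] by (intro bcontfun_diff_real g hb cb)
      have meas: "r \<in> borel_measurable m" "c \<in> borel_measurable m" "h n \<in> borel_measurable m"
        using rb cb hb by (auto intro: bcontfun_measurable_m)
      have "g = (\<lambda>x. (r x + c x) + h n x)" by (auto simp: r_def)
      then have "scal E g v = scal E (\<lambda>x. (r x + c x) + h n x) v" by simp
      also have "\<dots> = scal E r v + scal E c v + scal E (h n) v"
        using meas by (simp add: L0.scal_add_left)
      finally have "P (A \<inter> U n) (scal E g v)
          = P (A \<inter> U n) (scal E r v) + P (A \<inter> U n) (scal E c v) + P (A \<inter> U n) (scal E (h n) v)"
        using P_add[OF Ub] TF_add[OF TF_scal[OF vT cb] TF_scal[OF vT rb]] TF_scal[OF vT cb] TF_scal[OF vT rb] TF_scal[OF vT hb]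
        by simp
      moreover have "P (A \<inter> U n) (scal E (h n) v) = 0" by (rule P_div_zero[OF zero Ub D_div_scal[OF v h(1)]])
      moreover have "P (A \<inter> U n) (scal E r v) = 0"
        by (rule P_local_Borel[OF Uo Ub _ rb _ vT]) (auto simp: r_def c_def U_def)
      ultimately have "P (A \<inter> U n) (scal E g v) = P (A \<inter> U n) (scal E c v)" by simp
      moreover have "\<bar>P (A \<inter> U n) (scal E c v)\<bar> \<le> K * nrm (scal E c v) + \<delta> n * nrm (scal E c v)"
        using K[OF TF_scal[OF vT cb]] \<delta>A[OF TF_scal[OF vT cb], of n] by linarith
      ultimately show ?thesis by (simp add: c_def[abs_def] distrib_right)
    qed
    have ev: "\<forall>\<^sub>F n in sequentially. \<bar>P (A \<inter> U n) (scal E g v)\<bar> \<le> (\<bar>K\<bar> + 1) * (e * nrm v)"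
    proof -
      have "\<forall>\<^sub>F n in sequentially. \<delta> n < 1" using order_tendstoD(2)[OF \<delta>(1), of 1] by simp
      then show ?thesis
      proof eventually_elim
        case (elim n)
        define c where "c x = min (g x - h n x) e" for x
        have hb: "h n \<in> bcontfun" by (rule LIPb_bcontfun[OF h(1)])
        have "c = (\<lambda>x. (1/2) * ((g x - h n x) + e - \<bar>(g x - h n x) - e\<bar>))" by (auto simp: c_def fun_eq_iff min_def)
        then have cb: "c \<in> bcontfun"
          using g hb by (simp only: bcontfun_cmult_real bcontfun_add_real bcontfun_diff_real bcontfun_abs_real bcontfun_const_real)
        have "\<bar>c x\<bar> \<le> e" for x using h(2)[of n x] e by (auto simp: c_def)
        then have nc: "nrm (scal E c v) \<le> e * nrm v" by (rule nrm_scal_le[OF vT cb])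
        have "\<bar>P (A \<inter> U n) (scal E g v)\<bar> \<le> (K + \<delta> n) * nrm (scal E c v)" using small[of n] by (simp add: c_def[abs_def])
        also have "\<dots> \<le> (\<bar>K\<bar> + 1) * nrm (scal E c v)"
          using elim nrm_nonneg_TF[OF TF_scal[OF vT cb]] by (intro mult_right_mono) auto
        also have "\<dots> \<le> (\<bar>K\<bar> + 1) * (e * nrm v)" by (intro mult_left_mono nc) auto
        finally show ?case .
      qed
    qed
    have "(\<lambda>n. P (A \<inter> U n) (scal E g v) - P A (scal E g v)) \<longlonglongrightarrow> 0"
    proof (rule Lim_null_comparison)
      show "\<forall>\<^sub>F n in sequentially. norm (P (A \<inter> U n) (scal E g v) - P A (scal E g v)) \<le> \<delta> n * nrm (scal E g v)"
        using \<delta>A[OF gv] by simp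
      show "(\<lambda>n. \<delta> n * nrm (scal E g v)) \<longlonglongrightarrow> 0" by (rule tendsto_mult_left_zero[OF \<delta>(1)])
    qed
    then have "(\<lambda>n. P (A \<inter> U n) (scal E g v)) \<longlonglongrightarrow> P A (scal E g v)" by (simp add: LIM_zero_iff)
    then have "(\<lambda>n. \<bar>P (A \<inter> U n) (scal E g v)\<bar>) \<longlonglongrightarrow> \<bar>P A (scal E g v)\<bar>" by (rule tendsto_rabs)
    then show ?thesis using ev tendsto_upperbound sequentially_bot by blast
  qed
  have "\<bar>P A (scal E g v)\<bar> \<le> 0"
  proof (rule field_le_epsilon)
    fix e :: real assume e: "0 < e"
    define k where "k = (\<bar>K\<bar> + 1) * (nrm v + 1)"
    have nv: "0 \<le> nrm v" by (rule nrm_nonneg_TF[OF vT])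
    have k: "0 < k" unfolding k_def using nv by (intro mult_pos_pos) auto
    have "\<bar>P A (scal E g v)\<bar> \<le> (\<bar>K\<bar> + 1) * (e / k * nrm v)" using e k by (intro bound) auto
    also have "\<dots> \<le> (\<bar>K\<bar> + 1) * (e / k * (nrm v + 1))" using e k by (intro mult_left_mono) auto
    also have "\<dots> = e / k * k" by (simp add: k_def)
    also have "\<dots> = e" using k by simp
    finally show "\<bar>P A (scal E g v)\<bar> \<le> 0 + e" by simp
  qed
  then show ?thesis by simp
qed

lemma P_zero:
  assumes zero: "\<And>w. w \<in> Ddiv \<Longrightarrow> P UNIV w = 0" and A: "A \<in> sets borel" and w: "w \<in> TF"
  shows "P A w = 0"
  using w
proof (induction rule: TF_induct)
  case zero
  show ?case using P_add[OF A TF_zero TF_zero] by simp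
next
  case (add u g v)
  then show ?case using P_add[OF A add.hyps(1) TF_term] P_term_zero[OF zero A] by simp
qed

end

section \<open>Uniqueness of the local vector measure\<close>

context tangent_L0
begin

lemma local_vector_measure_charge:
  assumes N: "local_vector_measure TF nrm (scal E) N"
  shows "A \<in> sets borel \<Longrightarrow> v \<in> TF \<Longrightarrow> w \<in> TF \<Longrightarrow> N A (v + w) = N A v + N A w"
    and "A \<in> sets borel \<Longrightarrow> \<exists>K. \<forall>v\<in>TF. \<bar>N A v\<bar> \<le> K * nrm v"
    and "(\<And>i. B i \<in> sets borel) \<Longrightarrow> disjoint_family B \<Longrightarrow>
          \<exists>\<delta>. \<delta> \<longlonglongrightarrow> 0 \<and> (\<forall>n. \<forall>v\<in>TF. \<bar>(\<Sum>i<n. N (B i) v) - N (\<Union>i. B i) v\<bar> \<le> \<delta> n * nrm v)"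
    and "open A \<Longrightarrow> h \<in> bcontfun \<Longrightarrow> (\<And>x. x \<in> A \<Longrightarrow> h x = 0) \<Longrightarrow> v \<in> TF \<Longrightarrow> N A (scal E h v) = 0"
proof -
  interpret N: local_vector_measure TF nrm "scal E" N by (rule N)
  have dual: "N A \<in> N.dual_space" if "A \<in> sets borel" for A using N.in_dual that by auto
  show "N A (v + w) = N A v + N A w" if "A \<in> sets borel" "v \<in> TF" "w \<in> TF" for A v w
    using dual[OF that(1)] that by (simp add: N.dual_space_def)
  have bound: "\<exists>K. \<forall>v\<in>TF. \<bar>N A v\<bar> \<le> K * nrm v" if "A \<in> sets borel" for A
    using dual[OF that] by (simp add: N.dual_space_def)
  then show "A \<in> sets borel \<Longrightarrow> \<exists>K. \<forall>v\<in>TF. \<bar>N A v\<bar> \<le> K * nrm v" .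
  show "\<exists>\<delta>. \<delta> \<longlonglongrightarrow> 0 \<and> (\<forall>n. \<forall>v\<in>TF. \<bar>(\<Sum>i<n. N (B i) v) - N (\<Union>i. B i) v\<bar> \<le> \<delta> n * nrm v)"
    if B: "\<And>i. B i \<in> sets borel" "disjoint_family B" for B :: "nat \<Rightarrow> 'a set"
  proof (intro exI conjI allI ballI)
    show "(\<lambda>n. N.dual_norm (\<lambda>v. (\<Sum>i<n. N (B i) v) - N (\<Union>i. B i) v)) \<longlonglongrightarrow> 0"
      by (rule N.sigma_additive[OF B])
    fix n v assume v: "v \<in> TF"
    have UB: "(\<Union>i. B i) \<in> sets borel" using B by auto
    have scale: "N A (c *\<^sub>R v) = c * N A v" if "A \<in> sets borel" "v \<in> TF" for A c v
      using dual[OF that(1)] that by (simp add: N.dual_space_def)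
    have "\<forall>i. \<exists>K. \<forall>v\<in>TF. \<bar>N (B i) v\<bar> \<le> K * nrm v" using bound B(1) by blast
    then obtain K where K: "\<And>i v. v \<in> TF \<Longrightarrow> \<bar>N (B i) v\<bar> \<le> K i * nrm v" by metis
    obtain K' where K': "\<And>v. v \<in> TF \<Longrightarrow> \<bar>N (\<Union>i. B i) v\<bar> \<le> K' * nrm v" using bound[OF UB] by blast
    show "\<bar>(\<Sum>i<n. N (B i) v) - N (\<Union>i. B i) v\<bar> \<le> N.dual_norm (\<lambda>v. (\<Sum>i<n. N (B i) v) - N (\<Union>i. B i) v) * nrm v"
    proof (rule N.abs_le_dual_norm[OF _ _ v])
      show "(\<Sum>i<n. N (B i) (c *\<^sub>R v)) - N (\<Union>i. B i) (c *\<^sub>R v) = c * ((\<Sum>i<n. N (B i) v) - N (\<Union>i. B i) v)"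
        if "v \<in> TF" for c v
        by (simp add: scale[OF B(1) that] scale[OF UB that] sum_distrib_left right_diff_distrib)
      show "\<bar>(\<Sum>i<n. N (B i) v) - N (\<Union>i. B i) v\<bar> \<le> ((\<Sum>i<n. K i) + K') * nrm v" if v: "v \<in> TF" for v
      proof -
        have "\<bar>\<Sum>i<n. N (B i) v\<bar> \<le> (\<Sum>i<n. \<bar>N (B i) v\<bar>)" by (rule sum_abs)
        also have "\<dots> \<le> (\<Sum>i<n. K i * nrm v)" using K[OF v] by (intro sum_mono)
        finally show ?thesis using K'[OF v] unfolding distrib_right sum_distrib_right by linarith
      qed
    qed
  qed
  show "N A (scal E h v) = 0"
    if A: "open A" and h: "h \<in> bcontfun" "\<And>x. x \<in> A \<Longrightarrow> h x = 0" and v: "v \<in> TF" for A h v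
  proof (rule N.locality[OF A TF_scal[OF v h(1)]])
    have "nrm (scal E f (scal E h v)) = 0" if f: "f \<in> bcontfun" "supp f \<subseteq> A" for f
    proof -
      have "(\<lambda>x. f x * h x) = (\<lambda>_. 0)"
      proof
        fix x
        show "f x * h x = 0"
        proof (cases "f x = 0")
          case False
          then have "x \<in> supp f" unfolding supp_def by (intro subsetD[OF closure_subset]) simp
          then show ?thesis using f(2) h(2) by auto
        qed simp
      qed
      then have "scal E f (scal E h v) = 0"
        using L0.scal_mult[OF bcontfun_measurable_m[OF f(1)] bcontfun_measurable_m[OF h(1)], of v] by (simp add: L0.scal_const)
      then show ?thesis using N.nrm_eq_0_iff[OF TF_zero] by simp
    qed
    moreover have "{f \<in> bcontfun. supp f \<subseteq> A \<and> supnorm f \<le> 1} \<noteq> {}"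
    proof -
      have "(\<lambda>_. 0) \<in> {f \<in> bcontfun. supp f \<subseteq> A \<and> supnorm f \<le> 1}" by (simp add: supp_def supnorm_def)
      then show ?thesis by blast
    qed
    ultimately show "N.local_norm A (scal E h v) = 0" unfolding N.local_norm_def by simp
  qed
qed

lemma local_vector_measure_unique:
  assumes M: "local_vector_measure TF nrm (scal E) M" and N: "local_vector_measure TF nrm (scal E) N"
    and eq: "\<And>v. v \<in> Ddiv \<Longrightarrow> M UNIV v = N UNIV v"
  shows "M = N"
proof -
  note M' = local_vector_measure_charge[OF M] and N' = local_vector_measure_charge[OF N]
  interpret field_charge m C d E \<iota> "\<lambda>A v. M A v - N A v"
  proof
    show "M A (v + w) - N A (v + w) = M A v - N A v + (M A w - N A w)" if "A \<in> sets borel" "v \<in> TF" "w \<in> TF" for A v w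
      using M'(1)[OF that] N'(1)[OF that] by simp
    show "\<exists>K. \<forall>v\<in>TF. \<bar>M A v - N A v\<bar> \<le> K * nrm v" if A: "A \<in> sets borel" for A
    proof -
      obtain K L where "\<forall>v\<in>TF. \<bar>M A v\<bar> \<le> K * nrm v" "\<forall>v\<in>TF. \<bar>N A v\<bar> \<le> L * nrm v"
        using M'(2)[OF A] N'(2)[OF A] by blast
      then have "\<bar>M A v - N A v\<bar> \<le> (K + L) * nrm v" if "v \<in> TF" for v
        using that abs_triangle_ineq4[of "M A v" "N A v"] by (fastforce simp: distrib_right)
      then show ?thesis by blast
    qed
    show "\<exists>\<delta>. \<delta> \<longlonglongrightarrow> 0 \<and> (\<forall>n. \<forall>v\<in>TF. \<bar>(\<Sum>i<n. M (A i) v - N (A i) v) - (M (\<Union>i. A i) v - N (\<Union>i. A i) v)\<bar> \<le> \<delta> n * nrm v)"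
      if A: "\<And>i. A i \<in> sets borel" "disjoint_family A" for A :: "nat \<Rightarrow> 'a set"
    proof -
      obtain \<delta> \<epsilon> where \<delta>: "\<delta> \<longlonglongrightarrow> 0" "\<forall>n. \<forall>v\<in>TF. \<bar>(\<Sum>i<n. M (A i) v) - M (\<Union>i. A i) v\<bar> \<le> \<delta> n * nrm v"
        and \<epsilon>: "\<epsilon> \<longlonglongrightarrow> 0" "\<forall>n. \<forall>v\<in>TF. \<bar>(\<Sum>i<n. N (A i) v) - N (\<Union>i. A i) v\<bar> \<le> \<epsilon> n * nrm v"
        using M'(3)[OF A] N'(3)[OF A] by metis
      show ?thesis
      proof (intro exI[of _ "\<lambda>n. \<delta> n + \<epsilon> n"] conjI allI ballI)
        show "(\<lambda>n. \<delta> n + \<epsilon> n) \<longlonglongrightarrow> 0" using tendsto_add[OF \<delta>(1) \<epsilon>(1)] by simp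
        fix n v assume v: "v \<in> TF"
        have "(\<Sum>i<n. M (A i) v - N (A i) v) - (M (\<Union>i. A i) v - N (\<Union>i. A i) v)
            = ((\<Sum>i<n. M (A i) v) - M (\<Union>i. A i) v) - ((\<Sum>i<n. N (A i) v) - N (\<Union>i. A i) v)"
          by (simp add: sum_subtractf)
        then have "\<bar>(\<Sum>i<n. M (A i) v - N (A i) v) - (M (\<Union>i. A i) v - N (\<Union>i. A i) v)\<bar>
            \<le> \<bar>(\<Sum>i<n. M (A i) v) - M (\<Union>i. A i) v\<bar> + \<bar>(\<Sum>i<n. N (A i) v) - N (\<Union>i. A i) v\<bar>"
          by (simp only: abs_triangle_ineq4)
        also have "\<dots> \<le> \<delta> n * nrm v + \<epsilon> n * nrm v" using \<delta>(2) \<epsilon>(2) v by (intro add_mono) auto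
        finally show "\<bar>(\<Sum>i<n. M (A i) v - N (A i) v) - (M (\<Union>i. A i) v - N (\<Union>i. A i) v)\<bar> \<le> (\<delta> n + \<epsilon> n) * nrm v"
          by (simp add: distrib_right)
      qed
    qed
    show "M A (scal E h v) - N A (scal E h v) = 0"
      if "open A" "h \<in> bcontfun" "\<And>x. x \<in> A \<Longrightarrow> h x = 0" "v \<in> TF" for A h v
      using M'(4)[OF that] N'(4)[OF that] by simp
  qed
  interpret M: local_vector_measure TF nrm "scal E" M by (rule M)
  interpret N: local_vector_measure TF nrm "scal E" N by (rule N)
  have "M A = N A" if A: "A \<in> sets borel" for A
  proof (rule extensionalityI[of _ TF])
    show "M A \<in> extensional TF" "N A \<in> extensional TF"
      using M.in_dual N.in_dual A by (auto simp: M.dual_space_def)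
    show "M A v = N A v" if "v \<in> TF" for v using P_zero[OF _ A that] eq by simp
  qed
  then show ?thesis using M.in_dual N.in_dual by (intro PiE_ext[OF M.in_dual N.in_dual]) auto
qed

section \<open>The functional of a function of bounded variation\<close>

text \<open>\<open>\<theta> k v\<close> equals minus the integral of \<open>F k\<close> times the
  divergence, so it converges to the functional with an error controlled by the bound of the
  divergence alone. As an integral of a differential, \<open>\<theta> k\<close> is linear and
  bounded through the slope of \<open>F k\<close>, and these properties survive in the
  limit.\<close>

lemma BV_divergence_functional:
  assumes f: "f \<in> BV m"
  shows "\<exists>M. divergence_functional m C d E \<iota> (\<lambda>v. - (\<integral>x. f x * divergence m C d E \<iota> v x \<partial>m)) M"
proof -
  obtain F M where M: "0 \<le> M" and F: "\<And>k. F k \<in> LIPb" "\<And>k. bounded {x. F k x \<noteq> 0}" "\<And>k. integrable m (slope (F k))"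
    "\<And>k. (\<integral>x. slope (F k) x \<partial>m) \<le> M" "(\<lambda>k. \<integral>x. \<bar>F k x - f x\<bar> \<partial>m) \<longlonglongrightarrow> 0"
    by (rule BV_Lipschitz_approx[OF f]) (rule that)
  have fint: "integrable m f" using f by (simp add: BV_def)
  have W: "F k \<in> W12 m" and bs: "has_bounded_support m (F k)" and sl: "AE x in m. pnorm C (d (F k)) x \<le> slope (F k) x" for k
  proof -
    obtain r where r: "{x. F k x \<noteq> 0} \<subseteq> ball undefined r" using bounded_subset_ballD[OF F(2)] by blast
    then have z: "x \<notin> ball undefined r \<Longrightarrow> F k x = 0" for x by blast
    show "F k \<in> W12 m" by (rule LIPb_bounded_support_W12[OF F(1) z])
    show "has_bounded_support m (F k)" unfolding has_bounded_support_iff using F(2)[of k] by blast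
    show "AE x in m. pnorm C (d (F k)) x \<le> slope (F k) x" by (rule pnorm_d_LIPb_le[OF F(1) z])
  qed
  have Fint: "integrable m (F k)" for k by (rule L2_bounded_support_integrable[OF W12_L2[OF W] bs])
  define \<theta> where "\<theta> k v = (\<integral>x. pair (d (F k)) v x \<partial>m)" for k v
  define \<Phi> where "\<Phi> v = - (\<integral>x. f x * divergence m C d E \<iota> v x \<partial>m)" for v
  have close: "\<bar>\<theta> k v + (\<integral>x. f x * g x \<partial>m)\<bar> \<le> G * (\<integral>x. \<bar>F k x - f x\<bar> \<partial>m)"
    if g: "is_div m C d E \<iota> v g" "AE x in m. \<bar>g x\<bar> \<le> G" for k v g G
  proof -
    have gL: "g \<in> Linf m" using g by (simp add: is_div_iff)
    have i: "integrable m (\<lambda>x. F k x * g x)" "integrable m (\<lambda>x. f x * g x)"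
      using Linf_mult_integrable[OF gL Fint] Linf_mult_integrable[OF gL fint] by (simp_all add: mult.commute)
    have "\<theta> k v = - (\<integral>x. F k x * g x \<partial>m)" using g W bs by (simp add: \<theta>_def is_div_iff)
    then have "\<theta> k v + (\<integral>x. f x * g x \<partial>m) = (\<integral>x. f x * g x - F k x * g x \<partial>m)" using i by simp
    also have "\<bar>\<dots>\<bar> \<le> (\<integral>x. \<bar>f x * g x - F k x * g x\<bar> \<partial>m)" by (rule integral_abs_bound)
    also have "\<dots> \<le> (\<integral>x. G * \<bar>F k x - f x\<bar> \<partial>m)"
    proof (rule integral_mono_AE)
      show "AE x in m. \<bar>f x * g x - F k x * g x\<bar> \<le> G * \<bar>F k x - f x\<bar>"
        using g(2)
      proof eventually_elim
        case (elim x)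
        have "\<bar>f x * g x - F k x * g x\<bar> = \<bar>g x\<bar> * \<bar>F k x - f x\<bar>"
          by (simp only: left_diff_distrib[symmetric] abs_mult abs_minus_commute[of "f x"]) (rule mult.commute)
        also have "\<dots> \<le> G * \<bar>F k x - f x\<bar>" using elim by (intro mult_right_mono) auto
        finally show ?case .
      qed
    qed (use i Fint fint in auto)
    also have "\<dots> = G * (\<integral>x. \<bar>F k x - f x\<bar> \<partial>m)" by simp
    finally show ?thesis .
  qed
  have lim_g: "(\<lambda>k. \<theta> k v) \<longlonglongrightarrow> - (\<integral>x. f x * g x \<partial>m)" if g: "is_div m C d E \<iota> v g" for v g
  proof -
    obtain G where G: "AE x in m. \<bar>g x\<bar> \<le> G" using g by (auto simp: is_div_iff Linf_def)
    have "(\<lambda>k. \<theta> k v + (\<integral>x. f x * g x \<partial>m)) \<longlonglongrightarrow> 0"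
    proof (rule Lim_null_comparison)
      show "\<forall>\<^sub>F k in sequentially. norm (\<theta> k v + (\<integral>x. f x * g x \<partial>m)) \<le> G * (\<integral>x. \<bar>F k x - f x\<bar> \<partial>m)"
        using close[OF g G] by simp
      show "(\<lambda>k. G * (\<integral>x. \<bar>F k x - f x\<bar> \<partial>m)) \<longlonglongrightarrow> 0" by (rule tendsto_mult_right_zero[OF F(5)])
    qed
    from tendsto_diff[OF this tendsto_const[of "\<integral>x. f x * g x \<partial>m"]] show ?thesis by simp
  qed
  have lim: "(\<lambda>k. \<theta> k v) \<longlonglongrightarrow> \<Phi> v" if "v \<in> Ddiv" for v
    using lim_g[OF someI_ex[OF D_divD(2)[OF that]]] by (simp add: \<Phi>_def divergence_def)
  \<comment> \<open>\<open>divergence\<close> is one chosen representative; the common limit of the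
    \<open>\<theta> k v\<close> shows that any other gives the same value.\<close>
  have \<Phi>_eq: "\<Phi> v = - (\<integral>x. f x * g x \<partial>m)" if "v \<in> Ddiv" "is_div m C d E \<iota> v g" for v g
    by (rule LIMSEQ_unique[OF lim[OF that(1)] lim_g[OF that(2)]])
  have pint: "integrable m (pair (d (F k)) v)" if "v \<in> Ddiv" for k v
    by (rule pair_integrable[OF W bs D_divD(1)[OF that]])
  have "divergence_functional m C d E \<iota> \<Phi> M"
  proof
    show "\<Phi> (u + v) = \<Phi> u + \<Phi> v" if u: "u \<in> Ddiv" and v: "v \<in> Ddiv" for u v
    proof -
      have "\<theta> k (u + v) = \<theta> k u + \<theta> k v" for k
      proof -
        have "\<theta> k (u + v) = (\<integral>x. pair (d (F k)) u x + pair (d (F k)) v x \<partial>m)"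
          unfolding \<theta>_def by (rule integral_cong_AE) (use pairing_add_right in auto)
        then show ?thesis using pint[OF u] pint[OF v] by (simp add: \<theta>_def)
      qed
      then show ?thesis using LIMSEQ_unique[OF lim[OF D_div_add[OF u v]]] tendsto_add[OF lim[OF u] lim[OF v]] by simp
    qed
    show "\<Phi> (c *\<^sub>R v) = c * \<Phi> v" if v: "v \<in> Ddiv" for c v
    proof -
      have "\<theta> k (c *\<^sub>R v) = c * \<theta> k v" for k
      proof -
        have "AE x in m. pair (d (F k)) (c *\<^sub>R v) x = c * pair (d (F k)) v x"
          using pairing_scal_right[of "\<lambda>_. c" "d (F k)" v] by (simp add: L0.scal_const)
        then have "\<theta> k (c *\<^sub>R v) = (\<integral>x. c * pair (d (F k)) v x \<partial>m)"
          unfolding \<theta>_def by (intro integral_cong_AE) auto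
        then show ?thesis by (simp add: \<theta>_def)
      qed
      then show ?thesis using LIMSEQ_unique[OF lim[OF D_div_scaleR[OF v]]] tendsto_mult_left[OF lim[OF v], of c] by simp
    qed
    show "\<Phi> v \<le> M * c" if v: "v \<in> Ddiv" and c: "AE x in m. pnorm E v x \<le> c" "0 \<le> c" for c v
    proof (rule LIMSEQ_le_const2[OF lim[OF v]])
      have "\<theta> k v \<le> M * c" for k
      proof -
        have "\<theta> k v \<le> (\<integral>x. c * slope (F k) x \<partial>m)"
          unfolding \<theta>_def
        proof (rule integral_mono_AE[OF pint[OF v]])
          show "integrable m (\<lambda>x. c * slope (F k) x)" using F(3) by simp
          show "AE x in m. pair (d (F k)) v x \<le> c * slope (F k) x"
            using c(1) sl[of k] pairing_bound[of "d (F k)" v] pnorm_nonneg[of "d (F k)"]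
          proof eventually_elim
            case (elim x)
            have "pnorm E v x * pnorm C (d (F k)) x \<le> c * slope (F k) x" using elim c(2) by (intro mult_mono) auto
            then show ?case using elim(3) by (simp add: abs_le_iff)
          qed
        qed
        also have "\<dots> = c * (\<integral>x. slope (F k) x \<partial>m)" by simp
        also have "\<dots> \<le> c * M" by (intro mult_left_mono F c(2))
        finally show ?thesis by (simp add: mult.commute)
      qed
      then show "\<exists>N. \<forall>k\<ge>N. \<theta> k v \<le> M * c" by blast
    qed
    show "0 \<le> M" by (rule M)
    fix v and \<phi> :: "nat \<Rightarrow> 'a \<Rightarrow> real" and L :: real
    assume v: "v \<in> Ddiv" and \<phi>: "\<And>n. \<phi> n \<in> LIPb" "\<And>n x. \<bar>\<phi> n x\<bar> \<le> 1" and L: "0 \<le> L"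
      "\<And>n x y. \<bar>\<phi> n x - \<phi> n y\<bar> \<le> L * dist x y" and to0: "\<And>x. (\<lambda>n. \<phi> n x) \<longlonglongrightarrow> 0"
    have vL: "v \<in> LinfTX m E" by (rule D_divD[OF v])
    obtain g where g: "is_div m C d E \<iota> v g" using D_divD(2)[OF v] by blast
    obtain K where K: "AE x in m. pnorm E v x \<le> K" using vL by (auto simp: LinfTX_iff)
    obtain G where G: "AE x in m. \<bar>g x\<bar> \<le> G" using g by (auto simp: is_div_iff Linf_def)
    \<comment> \<open>A bound for the divergences of all the fields
      \<open>scal E (\<phi> n) v\<close>. The convergence of \<open>\<theta> k\<close> is thus
      uniform in \<open>n\<close>, so the limits in \<open>k\<close> and \<open>n\<close> may be
      exchanged; for fixed \<open>k\<close>, dominated convergence suffices.\<close>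
    define H where "H = 1 * G + L * K"
    have near: "\<bar>\<Phi> (scal E (\<phi> n) v) - \<theta> k (scal E (\<phi> n) v)\<bar> \<le> H * (\<integral>x. \<bar>F k x - f x\<bar> \<partial>m)" for n k
    proof -
      obtain g' where g': "is_div m C d E \<iota> (scal E (\<phi> n) v) g'" "AE x in m. \<bar>g' x\<bar> \<le> 1 * G + L * K"
        using is_div_mult[OF vL g K G \<phi>(1) L(2) L(1) \<phi>(2), of n] by blast
      show ?thesis
        using close[OF g', of k] \<Phi>_eq[OF D_div_scal[OF v \<phi>(1)] g'(1)] by (simp add: H_def abs_minus_commute)
    qed
    have \<theta>0: "(\<lambda>n. \<theta> k (scal E (\<phi> n) v)) \<longlonglongrightarrow> 0" for k
    proof -
      have [measurable]: "\<phi> n \<in> borel_measurable m" for n by (rule LIPb_measurable_m[OF \<phi>(1)])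
      have "(\<lambda>n. \<integral>x. \<phi> n x * pair (d (F k)) v x \<partial>m) \<longlonglongrightarrow> (\<integral>x. 0 \<partial>m)"
      proof (rule integral_dominated_convergence[where w="\<lambda>x. \<bar>pair (d (F k)) v x\<bar>"])
        show "AE x in m. (\<lambda>n. \<phi> n x * pair (d (F k)) v x) \<longlonglongrightarrow> 0" using to0 by (intro AE_I2 tendsto_mult_left_zero)
        show "AE x in m. norm (\<phi> n x * pair (d (F k)) v x) \<le> \<bar>pair (d (F k)) v x\<bar>" for n
          using \<phi>(2)[of n] by (intro AE_I2) (auto simp: abs_mult mult_left_le_one_le)
      qed (use pint[OF v] in auto)
      moreover have "\<theta> k (scal E (\<phi> n) v) = (\<integral>x. \<phi> n x * pair (d (F k)) v x \<partial>m)" for n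
        unfolding \<theta>_def
        by (intro integral_cong_AE pairing_scal_right bcontfun_Linf LIPb_bcontfun \<phi>) measurable
      ultimately show ?thesis by simp
    qed
    show "(\<lambda>n. \<Phi> (scal E (\<phi> n) v)) \<longlonglongrightarrow> 0"
    proof (rule LIMSEQ_I)
      fix e :: real assume e: "0 < e"
      have "\<forall>\<^sub>F k in sequentially. H * (\<integral>x. \<bar>F k x - f x\<bar> \<partial>m) < e/2"
        using order_tendstoD(2)[OF tendsto_mult_right_zero[OF F(5), of H], of "e/2"] e by simp
      then obtain k where k: "H * (\<integral>x. \<bar>F k x - f x\<bar> \<partial>m) < e/2" using eventually_happens'[OF sequentially_bot] by blast
      obtain N where N: "\<And>n. N \<le> n \<Longrightarrow> norm (\<theta> k (scal E (\<phi> n) v) - 0) < e/2" using LIMSEQ_D[OF \<theta>0[of k], of "e/2"] e by auto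
      have "norm (\<Phi> (scal E (\<phi> n) v) - 0) < e" if "N \<le> n" for n
      proof -
        have "\<bar>\<Phi> (scal E (\<phi> n) v)\<bar> \<le> \<bar>\<Phi> (scal E (\<phi> n) v) - \<theta> k (scal E (\<phi> n) v)\<bar> + \<bar>\<theta> k (scal E (\<phi> n) v)\<bar>"
          using abs_triangle_ineq[of "\<Phi> (scal E (\<phi> n) v) - \<theta> k (scal E (\<phi> n) v)" "\<theta> k (scal E (\<phi> n) v)"] by simp
        then show ?thesis using near[of n k] N[OF that] k by simp
      qed
      then show "\<exists>no. \<forall>n\<ge>no. norm (\<Phi> (scal E (\<phi> n) v) - 0) < e" by blast
    qed
  qed
  then show ?thesis unfolding \<Phi>_def[abs_def] by blast
qed

end

theorem theorem1p46:
  fixes m :: "'a::polish_space measure"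
    and C :: "('a, 'v::banach) module_ops"
    and d :: "('a \<Rightarrow> real) \<Rightarrow> 'v"
    and E :: "('a, 'w::real_vector) module_ops"
    and \<iota> :: "('v \<Rightarrow> 'a \<Rightarrow> real) \<Rightarrow> 'w"
    and f :: "'a \<Rightarrow> real"
  assumes "metric_measure_space m"
    and "cotangent_module m C d"
    and "tangent_L0 m C d E \<iota>"
    and "f \<in> BV m"
  shows "\<exists>!Df. local_vector_measure (test_fields m C d E \<iota>) (LinfTX_norm m E) (scal E) Df \<and>
           (\<forall>v\<in>D_div m C d E \<iota>. Df UNIV v = - (\<integral>x. f x * divergence m C d E \<iota> v x \<partial>m))"
proof -
  interpret tangent_L0 m C d E \<iota> by (rule assms(3))
  obtain M where "divergence_functional m C d E \<iota> (\<lambda>v. - (\<integral>x. f x * divergence m C d E \<iota> v x \<partial>m)) M"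
    using BV_divergence_functional[OF assms(4)] by blast
  then interpret F: divergence_functional m C d E \<iota> "\<lambda>v. - (\<integral>x. f x * divergence m C d E \<iota> v x \<partial>m)" M .
  show ?thesis
  proof (rule ex1I[of _ F.Dvec])
    show "local_vector_measure TF nrm (scal E) F.Dvec \<and>
        (\<forall>v\<in>Ddiv. F.Dvec UNIV v = - (\<integral>x. f x * divergence m C d E \<iota> v x \<partial>m))"
      using F.local_vector_measure_Dvec F.Dvec_UNIV by blast
    fix N
    assume N: "local_vector_measure TF nrm (scal E) N \<and>
        (\<forall>v\<in>Ddiv. N UNIV v = - (\<integral>x. f x * divergence m C d E \<iota> v x \<partial>m))"
    show "N = F.Dvec"
      by (rule local_vector_measure_unique) (use N F.local_vector_measure_Dvec F.Dvec_UNIV in auto)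
  qed
qed

end
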